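(* Let $d\ge 2$, let $k$ be an integer with $k\ge\frac{d+1}{2}$, let $\mathcal E_0=H^k(\mathbb R^d)$, let $c>0$, $\kappa>0$, $0\le\epsilon<1$, and fix $\alpha\in(0,c/2)$. Consider the semilinear system $$\mathbf v_t=\begin{pmatrix}1&0\\0&\epsilon\end{pmatrix}\Delta_{\mathbf x}\mathbf v+c\,\partial_z\mathbf v+\begin{pmatrix}0&e^{-\kappa}\\0&-\kappa e^{-\kappa}\end{pmatrix}\mathbf v+H(\mathbf v),\qquad H(\mathbf v)=\begin{pmatrix}1\\-\kappa\end{pmatrix}\bigl(g(v_1+1/\kappa)-g(1/\kappa)\bigr)v_2,$$ for $\mathbf v=(v_1,v_2):\mathbb R_+\times\mathbb R^d\to\mathbb R^2$. There exist constants $C>0$, $\nu>0$ and a small $\delta_0>0$ such that for each $0<\delta<\delta_0$ one can find $\eta$ with $0<\eta<\delta$ such that, if $\mathbf v^0\in\mathcal E^2$ and $\|\mathbf v^0\|_{\mathcal E}\le\eta$, then the following hold for the solution $\mathbf v(t)$ with $\mathbf v(0)=\mathbf v^0$, for all $t>0$: (1) $\mathbf v(t)$ is defined in $\mathcal E^2$; (2) $\|\mathbf v(t)\|_{\mathcal E}\le\delta$; (3) $\|\mathbf v(t)\|_\alpha\le Ce^{-\nu t}\|\mathbf v^0\|_\alpha$; (4) $\|v_1(t)\|_0\le C\|\mathbf v^0\|_{\mathcal E}$; (5) $\|v_2(t)\|_0\le Ce^{-\nu t}\|\mathbf v^0\|_{\mathcal E}$.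
   Context: Points of $\mathbb R^d$ are written $\mathbf x=(z,x_2,\dots,x_d)$. The function $g:\mathbb R\to\mathbb R$ is $g(s)=e^{-1/s}$ for $s>0$ and $g(s)=0$ for $s\le0$. (The system governs perturbations $\mathbf v$ of the constant steady state $\mathbf u_-=(1/\kappa,0)$ of $u_{1t}=\Delta u_1+c\partial_zu_1+u_2g(u_1)$, $u_{2t}=\epsilon\Delta u_2+c\partial_zu_2-\kappa u_2g(u_1)$.) Spaces: $\mathcal E_0=H^k(\mathbb R^d)$ with norm $\|\cdot\|_0$; $\gamma_\alpha(\mathbf x)=e^{\alpha z}$; $\mathcal E_\alpha=\{u:\gamma_\alpha u\in\mathcal E_0\}$ with $\|u\|_\alpha=\|\gamma_\alpha u\|_0$; $\mathcal E=\mathcal E_0\cap\mathcal E_\alpha$ with $\|u\|_{\mathcal E}=\max\{\|u\|_0,\|u\|_\alpha\}$. On $\mathcal E_0^2,\mathcal E_\alpha^2,\mathcal E^2$ the same symbols denote the product norms (e.g. the maximum of the norms of the components). Solution means mild solution in $\mathcal E^2$: a continuous function $\mathbf v:[0,t_{\max})\to\mathcal E^2$ with $\mathbf v(t)=e^{t\mathcal L_{\mathcal E}}\mathbf v^0+\int_0^te^{(t-s)\mathcal L_{\mathcal E}}H(\mathbf v(s))\,ds$, on its maximal interval of existence, where $e^{t\mathcal L_{\mathcal E}}$ is the strongly continuous semigroup on $\mathcal E^2$ generated by the linear constant-coefficient part of the system. *)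

theory Defs
  imports "HOL-Analysis.Analysis"
begin

section \<open>Sobolev spaces on Euclidean space\<close>

text \<open>
  Elements of the function spaces are represented by functions rather than by classes modulo
  null sets. All norms below are therefore seminorms, and two elements \<open>u\<close>, \<open>w\<close> of a space are
  identified when the norm of \<open>u - w\<close> is zero, i.e. when \<open>u = w\<close> almost everywhere.
\<close>

definition partial :: "'n::finite \<Rightarrow> (real^'n \<Rightarrow> real) \<Rightarrow> real^'n \<Rightarrow> real" where
  "partial i f x = frechet_derivative f (at x) (axis i 1)"

definition iter_partial :: "'n::finite list \<Rightarrow> (real^'n \<Rightarrow> real) \<Rightarrow> real^'n \<Rightarrow> real" where
  "iter_partial js f = foldr partial js f"

definition laplacian :: "(real^'n::finite \<Rightarrow> real) \<Rightarrow> real^'n \<Rightarrow> real" where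
  "laplacian f x = (\<Sum>i\<in>UNIV. partial i (partial i f) x)"

definition test_functions :: "(real^'n::finite \<Rightarrow> real) set" where
  "test_functions = {\<phi>. (\<forall>js x. iter_partial js \<phi> differentiable (at x)) \<and>
                         (\<exists>K. compact K \<and> (\<forall>x. x \<notin> K \<longrightarrow> \<phi> x = 0))}"

definition L2_space :: "(real^'n::finite \<Rightarrow> real) set" where
  "L2_space = {u. u \<in> borel_measurable lebesgue \<and> integrable lebesgue (\<lambda>x. (u x)\<^sup>2)}"

text \<open>
  \<open>\<beta> :: 'n \<Rightarrow> nat\<close> is a multi-index; the list \<open>js\<close> enumerates the directions of differentiation
  prescribed by \<open>\<beta>\<close>, in an order that is irrelevant for smooth \<open>\<phi>\<close>.
\<close>

definition is_weak_deriv ::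
    "('n::finite \<Rightarrow> nat) \<Rightarrow> (real^'n \<Rightarrow> real) \<Rightarrow> (real^'n \<Rightarrow> real) \<Rightarrow> bool" where
  "is_weak_deriv \<beta> u w \<longleftrightarrow>
     (\<forall>\<phi>\<in>test_functions. \<forall>js. (\<forall>i. count_list js i = \<beta> i) \<longrightarrow>
        (LINT x|lebesgue. u x * iter_partial js \<phi> x) =
        (-1) ^ (\<Sum>i\<in>UNIV. \<beta> i) * (LINT x|lebesgue. w x * \<phi> x))"

definition weak_deriv :: "('n::finite \<Rightarrow> nat) \<Rightarrow> (real^'n \<Rightarrow> real) \<Rightarrow> real^'n \<Rightarrow> real" where
  "weak_deriv \<beta> u = (SOME w. w \<in> L2_space \<and> is_weak_deriv \<beta> u w)"

definition Hspace :: "nat \<Rightarrow> (real^'n::finite \<Rightarrow> real) set" where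
  "Hspace k = {u \<in> L2_space.
     \<forall>\<beta>. (\<Sum>i\<in>UNIV. \<beta> i) \<le> k \<longrightarrow> (\<exists>w\<in>L2_space. is_weak_deriv \<beta> u w)}"

definition Hnorm :: "nat \<Rightarrow> (real^'n::finite \<Rightarrow> real) \<Rightarrow> real" where
  "Hnorm k u =
     sqrt (\<Sum>\<beta> | (\<Sum>i\<in>UNIV. \<beta> i) \<le> k. LINT x|lebesgue. (weak_deriv \<beta> u x)\<^sup>2)"

section \<open>Weighted and intersection spaces\<close>

text \<open>
  The index \<open>z :: 'n\<close> singles out the coordinate of the point \<open>x\<close> that carries the weight and
  the drift.
\<close>

definition weight :: "'n::finite \<Rightarrow> real \<Rightarrow> real^'n \<Rightarrow> real" where
  "weight z \<alpha> x = exp (\<alpha> * (x $ z))"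

definition Wspace :: "nat \<Rightarrow> 'n::finite \<Rightarrow> real \<Rightarrow> (real^'n \<Rightarrow> real) set" where
  "Wspace k z \<alpha> = {u. (\<lambda>x. weight z \<alpha> x * u x) \<in> Hspace k}"

definition Wnorm :: "nat \<Rightarrow> 'n::finite \<Rightarrow> real \<Rightarrow> (real^'n \<Rightarrow> real) \<Rightarrow> real" where
  "Wnorm k z \<alpha> u = Hnorm k (\<lambda>x. weight z \<alpha> x * u x)"

definition Espace :: "nat \<Rightarrow> 'n::finite \<Rightarrow> real \<Rightarrow> (real^'n \<Rightarrow> real) set" where
  "Espace k z \<alpha> = Hspace k \<inter> Wspace k z \<alpha>"

definition Enorm :: "nat \<Rightarrow> 'n::finite \<Rightarrow> real \<Rightarrow> (real^'n \<Rightarrow> real) \<Rightarrow> real" where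
  "Enorm k z \<alpha> u = max (Hnorm k u) (Wnorm k z \<alpha> u)"

text \<open>Squares of spaces: a vector field \<open>v\<close> has the components \<open>fst \<circ> v\<close> and \<open>snd \<circ> v\<close>.\<close>

definition sq_space :: "('x \<Rightarrow> real) set \<Rightarrow> ('x \<Rightarrow> real \<times> real) set" where
  "sq_space X = {v. fst \<circ> v \<in> X \<and> snd \<circ> v \<in> X}"

definition sq_norm :: "(('x \<Rightarrow> real) \<Rightarrow> real) \<Rightarrow> ('x \<Rightarrow> real \<times> real) \<Rightarrow> real" where
  "sq_norm N v = max (N (fst \<circ> v)) (N (snd \<circ> v))"

section \<open>Semigroups and integrals in seminormed function spaces\<close>

definition C0_semigroup ::
    "('x \<Rightarrow> 'b::real_vector) set \<Rightarrow> (('x \<Rightarrow> 'b) \<Rightarrow> real) \<Rightarrow>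
     (real \<Rightarrow> ('x \<Rightarrow> 'b) \<Rightarrow> 'x \<Rightarrow> 'b) \<Rightarrow> bool" where
  "C0_semigroup X N T \<longleftrightarrow>
     (\<forall>t\<ge>0. \<forall>u\<in>X. T t u \<in> X) \<and>
     (\<forall>t\<ge>0. \<forall>u\<in>X. \<forall>w\<in>X. \<forall>a b.
        N (\<lambda>x. T t (\<lambda>y. a *\<^sub>R u y + b *\<^sub>R w y) x - (a *\<^sub>R T t u x + b *\<^sub>R T t w x)) = 0) \<and>
     (\<forall>t\<ge>0. \<exists>M. \<forall>u\<in>X. N (T t u) \<le> M * N u) \<and>
     (\<forall>u\<in>X. N (\<lambda>x. T 0 u x - u x) = 0) \<and>
     (\<forall>s\<ge>0. \<forall>t\<ge>0. \<forall>u\<in>X. N (\<lambda>x. T (s + t) u x - T s (T t u) x) = 0) \<and>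
     (\<forall>u\<in>X. ((\<lambda>t. N (\<lambda>x. T t u x - u x)) \<longlongrightarrow> 0) (at_right 0))"

text \<open>The graph of the infinitesimal generator: \<open>u\<close> lies in its domain and is mapped to \<open>f\<close>.\<close>

definition generator_graph ::
    "('x \<Rightarrow> 'b::real_vector) set \<Rightarrow> (('x \<Rightarrow> 'b) \<Rightarrow> real) \<Rightarrow>
     (real \<Rightarrow> ('x \<Rightarrow> 'b) \<Rightarrow> 'x \<Rightarrow> 'b) \<Rightarrow> (('x \<Rightarrow> 'b) \<times> ('x \<Rightarrow> 'b)) set" where
  "generator_graph X N T = {(u, f). u \<in> X \<and> f \<in> X \<and>
     ((\<lambda>h. N (\<lambda>x. (1 / h) *\<^sub>R (T h u x - u x) - f x)) \<longlongrightarrow> 0) (at_right 0)}"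

text \<open>
  The Riemann integral over \<open>{a..b}\<close> of a function with values in the space \<open>X\<close>, as a limit
  with respect to \<open>N\<close> of Riemann sums.
\<close>

definition has_riemann_integral ::
    "('x \<Rightarrow> 'b::real_vector) set \<Rightarrow> (('x \<Rightarrow> 'b) \<Rightarrow> real) \<Rightarrow>
     (real \<Rightarrow> 'x \<Rightarrow> 'b) \<Rightarrow> ('x \<Rightarrow> 'b) \<Rightarrow> real \<Rightarrow> real \<Rightarrow> bool" where
  "has_riemann_integral X N F I a b \<longleftrightarrow>
     (\<forall>s\<in>{a..b}. F s \<in> X) \<and> I \<in> X \<and>
     (\<forall>e>0. \<exists>r>0. \<forall>p. p tagged_division_of {a..b} \<and> (\<lambda>s. ball s r) fine p \<longrightarrow>
        N (\<lambda>x. (\<Sum>(s, K)\<in>p. measure lborel K *\<^sub>R F s x) - I x) < e)"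

section \<open>The system\<close>

definition arrhenius :: "real \<Rightarrow> real" where
  "arrhenius s = (if s > 0 then exp (- 1 / s) else 0)"

definition nonlin :: "real \<Rightarrow> ('x \<Rightarrow> real \<times> real) \<Rightarrow> 'x \<Rightarrow> real \<times> real" where
  "nonlin \<kappa> v x =
     ((arrhenius (fst (v x) + 1 / \<kappa>) - arrhenius (1 / \<kappa>)) * snd (v x)) *\<^sub>R (1, - \<kappa>)"

text \<open>\<open>a \<Delta>u + c \<partial>\<^sub>z u = f\<close> in the sense of distributions.\<close>

definition weak_drift_diffusion ::
    "'n::finite \<Rightarrow> real \<Rightarrow> real \<Rightarrow> (real^'n \<Rightarrow> real) \<Rightarrow> (real^'n \<Rightarrow> real) \<Rightarrow> bool" where
  "weak_drift_diffusion z a c u f \<longleftrightarrow>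
     (\<forall>\<phi>\<in>test_functions.
        (LINT x|lebesgue. u x * (a * laplacian \<phi> x - c * partial z \<phi> x)) =
        (LINT x|lebesgue. f x * \<phi> x))"

text \<open>
  The linear part of the system with its maximal domain in \<open>E\<^sup>2\<close>, i.e. all \<open>u\<close> in \<open>E\<^sup>2\<close> for which
  the distribution obtained by applying the linear part to \<open>u\<close> belongs to \<open>E\<^sup>2\<close>. The zeroth order
  terms are moved to the side of \<open>f\<close>.
\<close>

definition linear_part_graph ::
    "nat \<Rightarrow> 'n::finite \<Rightarrow> real \<Rightarrow> real \<Rightarrow> real \<Rightarrow> real \<Rightarrow>
     ((real^'n \<Rightarrow> real \<times> real) \<times> (real^'n \<Rightarrow> real \<times> real)) set" where
  "linear_part_graph k z \<alpha> c \<epsilon> \<kappa> = {(u, f).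
     u \<in> sq_space (Espace k z \<alpha>) \<and> f \<in> sq_space (Espace k z \<alpha>) \<and>
     weak_drift_diffusion z 1 c (fst \<circ> u) (\<lambda>x. fst (f x) - exp (- \<kappa>) * snd (u x)) \<and>
     weak_drift_diffusion z \<epsilon> c (snd \<circ> u) (\<lambda>x. snd (f x) + \<kappa> * exp (- \<kappa>) * snd (u x))}"

text \<open>
  The semigroup \<open>exp (t L)\<close> on \<open>E\<^sup>2\<close>: a strongly continuous semigroup is determined, modulo null
  sets, by its generator. For the present linear part it is given by a Gaussian convolution
  (a translation in the second component if \<open>\<epsilon> = 0\<close>), so such a \<open>T\<close> exists.
\<close>

definition is_linear_semigroup ::
    "nat \<Rightarrow> 'n::finite \<Rightarrow> real \<Rightarrow> real \<Rightarrow> real \<Rightarrow> real \<Rightarrow>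
     (real \<Rightarrow> (real^'n \<Rightarrow> real \<times> real) \<Rightarrow> real^'n \<Rightarrow> real \<times> real) \<Rightarrow> bool" where
  "is_linear_semigroup k z \<alpha> c \<epsilon> \<kappa> T \<longleftrightarrow>
     C0_semigroup (sq_space (Espace k z \<alpha>)) (sq_norm (Enorm k z \<alpha>)) T \<and>
     generator_graph (sq_space (Espace k z \<alpha>)) (sq_norm (Enorm k z \<alpha>)) T =
       linear_part_graph k z \<alpha> c \<epsilon> \<kappa>"

definition mild_solution ::
    "('x \<Rightarrow> real \<times> real) set \<Rightarrow> (('x \<Rightarrow> real \<times> real) \<Rightarrow> real) \<Rightarrow>
     (real \<Rightarrow> ('x \<Rightarrow> real \<times> real) \<Rightarrow> 'x \<Rightarrow> real \<times> real) \<Rightarrow> real \<Rightarrow>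
     ('x \<Rightarrow> real \<times> real) \<Rightarrow> ereal \<Rightarrow> (real \<Rightarrow> 'x \<Rightarrow> real \<times> real) \<Rightarrow> bool" where
  "mild_solution X N T \<kappa> v0 tmax v \<longleftrightarrow>
     tmax > 0 \<and>
     (\<forall>t\<ge>0. ereal t < tmax \<longrightarrow>
        v t \<in> X \<and>
        ((\<lambda>s. N (\<lambda>x. v s x - v t x)) \<longlongrightarrow> 0) (at t within {s. 0 \<le> s \<and> ereal s < tmax}) \<and>
        (\<exists>I. has_riemann_integral X N (\<lambda>s. T (t - s) (nonlin \<kappa> (v s))) I 0 t \<and>
             N (\<lambda>x. v t x - (T t v0 x + I x)) = 0))"

text \<open>
  The mild solution on its maximal interval of existence \<open>[0, tmax)\<close>: every mild solution with
  the same initial value is a restriction of it.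
\<close>

definition maximal_mild_solution ::
    "('x \<Rightarrow> real \<times> real) set \<Rightarrow> (('x \<Rightarrow> real \<times> real) \<Rightarrow> real) \<Rightarrow>
     (real \<Rightarrow> ('x \<Rightarrow> real \<times> real) \<Rightarrow> 'x \<Rightarrow> real \<times> real) \<Rightarrow> real \<Rightarrow>
     ('x \<Rightarrow> real \<times> real) \<Rightarrow> ereal \<Rightarrow> (real \<Rightarrow> 'x \<Rightarrow> real \<times> real) \<Rightarrow> bool" where
  "maximal_mild_solution X N T \<kappa> v0 tmax v \<longleftrightarrow>
     mild_solution X N T \<kappa> v0 tmax v \<and>
     (\<forall>\<tau> w. mild_solution X N T \<kappa> v0 \<tau> w \<longrightarrow>
        \<tau> \<le> tmax \<and> (\<forall>t\<ge>0. ereal t < \<tau> \<longrightarrow> N (\<lambda>x. w t x - v t x) = 0))"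

end

(*
  The linear semigroup is only known through its generator, so its decay is obtained from resolvent
  estimates: if f = L y, then P y (1 + h s) <= P (y - h f) for a seminorm P forces
  P (exp (t L) y) <= exp (- s t) P y.  Such estimates hold in H^k since drift is skew-symmetric and
  diffusion is dissipative; conjugating with exp (alpha z) produces the rate c alpha - alpha^2 > 0.
  The seminorms |v1| + |v2| / kappa absorb the coupling term, and v2 has the additional damping
  kappa exp (- kappa).  The nonlinearity always contains the factor v2, which decays, so in the
  Duhamel formula it is integrable in time although v1 itself is not damped in H^k; a contraction
  argument then gives a small global solution.  That H^k is an algebra for 2 k >= d + 1 is proved
  by bounding functions by Riesz potentials of their derivatives.
*)
theory Submission
  imports Defs "HOL-Complex_Analysis.Cauchy_Integral_Formula" "HOL-Probability.Discrete_Topology"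
begin

text \<open>The weighted bound has to be proportional to the weighted norm of the data alone,
  although the nonlinearity involves the first component in the plain norm. This works because the
  weight times the nonlinearity is a function of \<open>v1\<close> times the weighted
  \<open>v2\<close>: the weight never meets \<open>v1\<close>, so the weighted part obeys a linear
  estimate whose coefficient is the small plain size of \<open>v1\<close>. The assumption \<epsilon>
  < 1 makes the weighted rate of the second equation at least that of the first.

  The reaction rate is expanded in its power series at 1/\<kappa>. This replaces a chain rule in
  H^k, but it confines the nonlinearity to small \<open>v1\<close>; since the claim concerns every
  maximal mild solution, uniqueness must cover a competitor that is not known to stay small.

  The spaces consist of functions with seminorms, and the semigroup is linear only up to null
  functions. The quotient is therefore embedded into a Banach space type by pairing with the unit
  ball of H^k, and semigroup theory is developed on a closed subspace of such a type.\<close>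

type_synonym 'n fn = "real^'n => real"

abbreviation leb_integral :: "('a::euclidean_space => real) => real" (binder "LEB " 10) where
 "leb_integral f \<equiv> integral\<^sup>L lebesgue f"

abbreviation nn_lborel :: "('a::euclidean_space => ennreal) => ennreal" (binder "NNINT " 10) where
 "nn_lborel f \<equiv> nn_integral lborel f"

abbreviation nn_leb :: "('a::euclidean_space => ennreal) => ennreal" (binder "NNLEB " 10) where
 "nn_leb f \<equiv> nn_integral lebesgue f"

section \<open>Smooth functions and test functions\<close>

abbreviation test_space ("\<D>") where "\<D> \<equiv> test_functions"

definition smooth :: "'n::finite fn => bool" where
 "smooth f \<longleftrightarrow> (\<forall>js x. iter_partial js f differentiable (at x))"

lemma iter_partial_simps [simp]:
 "iter_partial [] f = f"
 "iter_partial (j # js) f = partial j (iter_partial js f)"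
 by (simp_all add: iter_partial_def)

lemma iter_partial_append: "iter_partial (js @ ks) f = iter_partial js (iter_partial ks f)"
 by (simp add: iter_partial_def)

lemma smooth_differentiable: "smooth f ==> f differentiable (at x)"
 unfolding smooth_def by (metis iter_partial_simps(1))

lemma smooth_iter_partial: "smooth f ==> smooth (iter_partial ks f)"
 unfolding smooth_def by (metis iter_partial_append)

lemma smooth_partial: "smooth f ==> smooth (partial i f)"
 using smooth_iter_partial[of f "[i]"] by simp

text \<open>Smoothness quantifies over all iterated partial derivatives at once; a set of
  differentiable functions that is stable under \<open>partial\<close> contains them all. Closure
  proofs then only have to find such a set around the given function.\<close>

lemma smooth_coinduct:
 assumes "f \<in> S" and "\<And>f x. f \<in> S ==> f differentiable (at x)"
  and "\<And>f i. f \<in> S ==> partial i f \<in> S"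
 shows "smooth f"
proof -
 have "iter_partial js f \<in> S" for js
  by (induction js) (use assms in auto)
 thus ?thesis using assms(2) by (auto simp: smooth_def)
qed

lemma smoothI:
 assumes "\<And>x. f differentiable (at x)" and "\<And>i. smooth (partial i f)"
 shows "smooth f"
proof -
 have "iter_partial js f differentiable (at x)" for js x
 \<comment> \<open>The last entry of \<open>js\<close> is the derivative taken first, so it is the
   one that can be split off onto \<open>f\<close>.\<close>
 proof (cases js rule: rev_cases)
  case Nil thus ?thesis using assms(1) by simp
 next
  case (snoc ks i) thus ?thesis using assms(2)[of i]
   by (simp add: iter_partial_append smooth_def)
 qed
 thus ?thesis by (simp add: smooth_def)
qed

lemma partial_eqI: "(f has_derivative D) (at x) ==> partial i f x = D (axis i 1)"
 unfolding partial_def using frechet_derivative_at by metis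

lemma has_derivative_partial:
 assumes "f differentiable (at x)"
 shows "(f has_derivative (\<lambda>h. \<Sum>i\<in>UNIV. h $ i * partial i f x)) (at x)"
proof -
 let ?D = "frechet_derivative f (at x)"
 have D: "(f has_derivative ?D) (at x)"
  using assms by (simp add: frechet_derivative_works)
 hence lin: "linear ?D" by (rule has_derivative_linear)
 have "?D h = (\<Sum>i\<in>UNIV. h $ i * partial i f x)" for h
 proof -
  have "?D h = ?D (\<Sum>i\<in>UNIV. h $ i *s axis i 1)" by (simp add: basis_expansion)
  also have "\<dots> = (\<Sum>i\<in>UNIV. h $ i * partial i f x)"
   using lin by (simp add: linear_sum linear_scale partial_def scalar_mult_eq_scaleR)
  finally show ?thesis .
 qed
 hence "?D = (\<lambda>h. \<Sum>i\<in>UNIV. h $ i * partial i f x)" by blast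
 thus ?thesis using D by simp
qed

lemma sum_axis [simp]: "(\<Sum>j\<in>UNIV. axis (i::'n::finite) (1::real) $ j * g j) = g i"
proof -
 have "(\<Sum>j\<in>UNIV. axis i (1::real) $ j * g j) = (\<Sum>j\<in>UNIV. if j = i then g j else 0)"
  by (intro sum.cong) (auto simp: axis_def)
 thus ?thesis by simp
qed

lemma partial_add:
 assumes "f differentiable (at x)" "g differentiable (at x)"
 shows "partial i (\<lambda>x. f x + g x) x = partial i f x + partial i g x"
 by (subst partial_eqI[OF has_derivative_add[OF has_derivative_partial has_derivative_partial]])
  (simp_all add: assms)

lemma partial_mult:
 assumes "f differentiable (at x)" "g differentiable (at x)"
 shows "partial i (\<lambda>x. f x * g x) x = partial i f x * g x + f x * partial i g x"
 by (subst partial_eqI[OF has_derivative_mult[OF has_derivative_partial has_derivative_partial]])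
  (simp_all add: assms)

lemma partial_const [simp]: "partial i (\<lambda>x. c) = (\<lambda>x. 0)"
 by (rule ext, subst partial_eqI[OF has_derivative_const]) simp

lemma partial_coord: "partial i (\<lambda>x. x $ j) = (\<lambda>x. if i = j then 1 else 0)"
proof
 fix x :: "real^'a"
 have "((\<lambda>x. x $ j) has_derivative (\<lambda>h. h $ j)) (at x)"
  by (intro bounded_linear.has_derivative[OF bounded_linear_vec_nth] has_derivative_ident)
 from partial_eqI[OF this, of i] show "partial i (\<lambda>x. x $ j) x = (if i = j then 1 else 0)"
  by (auto simp: axis_def)
qed

lemma smooth_const: "smooth (\<lambda>x. c)"
 by (rule smooth_coinduct[of _ "range (\<lambda>c x. c)"]) auto

lemma smooth_add: "smooth f ==> smooth g ==> smooth (\<lambda>x. f x + g x)"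
proof (rule smooth_coinduct[of _ "{\<lambda>x. f x + g x | f g. smooth f \<and> smooth g}"])
 fix F :: "'a fn" and i assume "F \<in> {\<lambda>x. f x + g x | f g. smooth f \<and> smooth g}"
 then obtain f g where F: "F = (\<lambda>x. f x + g x)" "smooth f" "smooth g" by auto
 have "partial i F = (\<lambda>x. partial i f x + partial i g x)"
  using F by (auto simp: partial_add smooth_differentiable)
 thus "partial i F \<in> {\<lambda>x. f x + g x | f g. smooth f \<and> smooth g}"
  using F smooth_partial by blast
qed (auto intro!: derivative_intros intro: smooth_differentiable)

text \<open>A single product is not stable under \<open>partial\<close>, as the Leibniz rule
  produces two. Finite sums of products are, which makes this set fit for
  \<open>smooth_coinduct\<close>.\<close>

inductive_set prod_span :: "'n::finite fn set" where
 base: "smooth f ==> smooth g ==> (\<lambda>x. f x * g x) \<in> prod_span"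
| add: "F \<in> prod_span ==> G \<in> prod_span ==> (\<lambda>x. F x + G x) \<in> prod_span"

lemma smooth_mult: assumes "smooth f" "smooth g" shows "smooth (\<lambda>x. f x * g x)"
proof (rule smooth_coinduct[of _ prod_span])
 show "(\<lambda>x. f x * g x) \<in> prod_span" using assms by (rule prod_span.base)
 show diff: "F differentiable (at x)" if "F \<in> prod_span" for F x
  using that by induction (auto intro!: derivative_intros intro: smooth_differentiable)
 show "partial i F \<in> prod_span" if "F \<in> prod_span" for F i
  using that
 proof induction
  case (base f g)
  have "partial i (\<lambda>x. f x * g x) = (\<lambda>x. partial i f x * g x + f x * partial i g x)"
   using base by (auto simp: partial_mult smooth_differentiable)
  thus ?case using base by (auto intro!: prod_span.intros smooth_partial)
 next
  case (add F G)
  have "partial i (\<lambda>x. F x + G x) = (\<lambda>x. partial i F x + partial i G x)"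
   using add by (auto simp: partial_add diff)
  thus ?case using add by (auto intro!: prod_span.intros)
 qed
qed

lemma smooth_cmult: "smooth f ==> smooth (\<lambda>x. c * f x)"
 by (intro smooth_mult smooth_const)

lemma smooth_coord: "smooth (\<lambda>x. x $ j)"
proof (rule smoothI)
 show "(\<lambda>x. x $ j) differentiable (at x)" for x :: "real^'a"
  by (rule bounded_linear_imp_differentiable[OF bounded_linear_vec_nth])
 show "smooth (partial i (\<lambda>x. x $ j))" for i :: 'a
  unfolding partial_coord by (cases "i = j") (simp_all add: smooth_const)
qed

lemma smooth_sum: "finite I ==> (\<And>i. i \<in> I ==> smooth (f i)) ==> smooth (\<lambda>x. \<Sum>i\<in>I. f i x)"
 by (induction I rule: finite_induct) (auto intro: smooth_const smooth_add)

lemma partial_cmult: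
 assumes "f differentiable (at x)"
 shows "partial i (\<lambda>x. c * f x) x = c * partial i f x"
 using partial_mult[of "\<lambda>x. c" x f i] assms by simp

lemma iter_partial_cmult:
 "smooth f ==> iter_partial js (\<lambda>x. c * f x) = (\<lambda>x. c * iter_partial js f x)"
 by (induction js) (auto simp: partial_cmult smooth_differentiable smooth_iter_partial)

lemma iter_partial_add:
 "smooth f ==> smooth g ==>
  iter_partial js (\<lambda>x. f x + g x) = (\<lambda>x. iter_partial js f x + iter_partial js g x)"
 by (induction js) (auto simp: partial_add smooth_differentiable smooth_iter_partial)

lemma partial_weight: "partial i (weight z \<alpha>) = (\<lambda>x. (if i = z then \<alpha> else 0) * weight z \<alpha> x)"
proof
 fix x :: "real^'a"
 have "((\<lambda>x. exp (\<alpha> * x $ z)) has_derivative (\<lambda>h. exp (\<alpha> * x $ z) * (\<alpha> * h $ z))) (at x)"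
  by (auto intro!: derivative_eq_intros bounded_linear.has_derivative[OF bounded_linear_vec_nth])
 from partial_eqI[OF this, of i]
 show "partial i (weight z \<alpha>) x = (if i = z then \<alpha> else 0) * weight z \<alpha> x"
  by (auto simp: axis_def weight_def[abs_def])
qed

lemma smooth_weight: "smooth (weight z \<alpha>)"
proof (rule smooth_coinduct[of _ "{\<lambda>x. c * weight z \<alpha> x | c. True}"])
 have d: "weight z \<alpha> differentiable (at x)" for x
 proof -
  have "((\<lambda>x. exp (\<alpha> * x $ z)) has_derivative (\<lambda>h. exp (\<alpha> * x $ z) * (\<alpha> * h $ z))) (at x)"
   by (auto intro!: derivative_eq_intros bounded_linear.has_derivative[OF bounded_linear_vec_nth])
  thus ?thesis by (auto simp: weight_def[abs_def] differentiable_def)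
 qed
 show "weight z \<alpha> \<in> {\<lambda>x. c * weight z \<alpha> x | c. True}" by (auto intro!: exI[of _ 1])
 show "f differentiable (at x)" if "f \<in> {\<lambda>x. c * weight z \<alpha> x | c. True}" for f x
  using that by (auto intro!: derivative_intros d)
 show "partial i f \<in> {\<lambda>x. c * weight z \<alpha> x | c. True}" if f: "f \<in> {\<lambda>x. c * weight z \<alpha> x | c. True}" for f i
 proof -
  from f obtain c where "f = (\<lambda>x. c * weight z \<alpha> x)" by auto
  hence "partial i f = (\<lambda>x. (c * (if i = z then \<alpha> else 0)) * weight z \<alpha> x)"
   by (auto simp: partial_cmult d partial_weight)
  thus ?thesis by blast
 qed
qed

lemma partial_affine:
 assumes "f differentiable (at (a *\<^sub>R x + b))"
 shows "partial i (\<lambda>x. f (a *\<^sub>R x + b)) x = a * partial i f (a *\<^sub>R x + b)"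
proof -
 have "((\<lambda>x. a *\<^sub>R x + b) has_derivative (\<lambda>h. a *\<^sub>R h)) (at x)"
  by (auto intro!: derivative_eq_intros)
 from diff_chain_at[OF this has_derivative_partial[OF assms]]
 have "((\<lambda>x. f (a *\<^sub>R x + b)) has_derivative
   (\<lambda>h. \<Sum>i\<in>UNIV. (a *\<^sub>R h) $ i * partial i f (a *\<^sub>R x + b))) (at x)"
  by (simp add: o_def)
 from partial_eqI[OF this, of i] show ?thesis
  by (simp add: mult.assoc flip: sum_distrib_left)
qed

lemma differentiable_affine:
 assumes "f differentiable (at (a *\<^sub>R x + b))"
 shows "(\<lambda>x. f (a *\<^sub>R x + b)) differentiable (at x)"
 using assms differentiable_chain_at[of "\<lambda>x. a *\<^sub>R x + b" x f]
 by (auto simp: o_def intro!: derivative_intros)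

lemma smooth_affine: assumes "smooth f" shows "smooth (\<lambda>x. f (a *\<^sub>R x + b))"
proof (rule smooth_coinduct[of _ "{\<lambda>x. c * f (a *\<^sub>R x + b) | c f. smooth f}"])
 show "(\<lambda>x. f (a *\<^sub>R x + b)) \<in> {\<lambda>x. c * f (a *\<^sub>R x + b) | c f. smooth f}"
  using assms by (auto intro!: exI[of _ 1])
 show "g differentiable (at x)" if "g \<in> {\<lambda>x. c * f (a *\<^sub>R x + b) | c f. smooth f}" for g x
 proof -
  from that obtain c f where "g = (\<lambda>x. c * f (a *\<^sub>R x + b))" "smooth f" by auto
  thus ?thesis
   using differentiable_mult[OF differentiable_const differentiable_affine[OF smooth_differentiable[OF \<open>smooth f\<close>]]]
   by blast
 qed
 show "partial i g \<in> {\<lambda>x. c * f (a *\<^sub>R x + b) | c f. smooth f}"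
  if g: "g \<in> {\<lambda>x. c * f (a *\<^sub>R x + b) | c f. smooth f}" for g i
 proof -
  from g obtain c f where cf: "g = (\<lambda>x. c * f (a *\<^sub>R x + b))" "smooth f" by auto
  hence "partial i g = (\<lambda>x. (c * a) * partial i f (a *\<^sub>R x + b))"
   by (auto simp: partial_cmult differentiable_affine smooth_differentiable partial_affine)
  thus ?thesis using cf smooth_partial by blast
 qed
qed

lemma iter_partial_affine:
 assumes "smooth f"
 shows "iter_partial js (\<lambda>x. f (a *\<^sub>R x + b)) = (\<lambda>x. a ^ length js * iter_partial js f (a *\<^sub>R x + b))"
proof (induction js)
 case (Cons j js)
 have sm: "smooth (iter_partial js f)" using assms by (rule smooth_iter_partial)
 show ?case
  by (rule ext) (simp add: Cons partial_cmult partial_affine smooth_differentiable[OF sm]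
    differentiable_affine)
qed simp

section \<open>Derivatives along lines and symmetry of mixed partial derivatives\<close>

lemma DERIV_line:
 assumes "f differentiable (at (x + s *\<^sub>R v))"
 shows "((\<lambda>s. f (x + s *\<^sub>R v)) has_real_derivative (\<Sum>i\<in>UNIV. v $ i * partial i f (x + s *\<^sub>R v))) (at s)"
proof -
 have "((\<lambda>s. x + s *\<^sub>R v) has_derivative (\<lambda>h. h *\<^sub>R v)) (at s)"
  by (auto intro!: derivative_eq_intros)
 from diff_chain_at[OF this has_derivative_partial[OF assms]]
 have "((\<lambda>s. f (x + s *\<^sub>R v)) has_derivative
  (\<lambda>h. \<Sum>i\<in>UNIV. (h *\<^sub>R v) $ i * partial i f (x + s *\<^sub>R v))) (at s)"
  by (simp add: o_def)
 moreover have "(\<lambda>h. \<Sum>i\<in>UNIV. (h *\<^sub>R v) $ i * partial i f (x + s *\<^sub>R v)) =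
   (*) (\<Sum>i\<in>UNIV. v $ i * partial i f (x + s *\<^sub>R v))"
  by (auto simp: sum_distrib_left mult_ac)
 ultimately show ?thesis by (simp add: has_field_derivative_def)
qed

lemma DERIV_axis:
 assumes "f differentiable (at (x + s *\<^sub>R axis i 1))"
 shows "((\<lambda>s. f (x + s *\<^sub>R axis i 1)) has_real_derivative partial i f (x + s *\<^sub>R axis i 1)) (at s)"
 using DERIV_line[OF assms] by simp

lemma smooth_continuous: "smooth f ==> continuous_on S f"
 by (meson continuous_at_imp_continuous_on differentiable_imp_continuous_within smooth_differentiable)

text \<open>The second difference \<open>D i j h\<close> is symmetric in \<open>i\<close> and
  \<open>j\<close>, and two applications of the mean value theorem equate it with h^2 times a mixed
  partial derivative at a point within 2h of \<open>x\<close>. Letting h tend to 0, continuity of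
  both mixed derivatives identifies them at \<open>x\<close>.\<close>

lemma partial_commute:
 assumes f: "smooth f"
 shows "partial i (partial j f) = partial j (partial i f)"
proof
 fix x
 define D where "D i j h = f (x + h *\<^sub>R axis i 1 + h *\<^sub>R axis j 1) - f (x + h *\<^sub>R axis i 1)
  - f (x + h *\<^sub>R axis j 1) + f x" for i j and h :: real
 have key: "\<exists>y. norm (y - x) \<le> 2 * h \<and> D i j h = h\<^sup>2 * partial j (partial i f) y"
  if h: "h > 0" for i j h
 proof -
  let ?\<phi> = "\<lambda>s. f ((x + h *\<^sub>R axis j 1) + s *\<^sub>R axis i 1) - f (x + s *\<^sub>R axis i 1)"
  have "(?\<phi> has_real_derivative partial i f ((x + h *\<^sub>R axis j 1) + s *\<^sub>R axis i 1)
    - partial i f (x + s *\<^sub>R axis i 1)) (at s)" for s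
   by (intro DERIV_diff DERIV_axis smooth_differentiable[OF f])
  from MVT2[OF h this] obtain s where s: "0 < s" "s < h"
   "?\<phi> h - ?\<phi> 0 = (h - 0) * (partial i f ((x + h *\<^sub>R axis j 1) + s *\<^sub>R axis i 1)
    - partial i f (x + s *\<^sub>R axis i 1))" by blast
  let ?\<psi> = "\<lambda>r. partial i f ((x + s *\<^sub>R axis i 1) + r *\<^sub>R axis j 1)"
  have "(?\<psi> has_real_derivative partial j (partial i f) ((x + s *\<^sub>R axis i 1) + r *\<^sub>R axis j 1)) (at r)" for r
   by (intro DERIV_axis smooth_differentiable smooth_partial f)
  from MVT2[OF h this] obtain r where r: "0 < r" "r < h"
   "?\<psi> h - ?\<psi> 0 = (h - 0) * partial j (partial i f) ((x + s *\<^sub>R axis i 1) + r *\<^sub>R axis j 1)" by blast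
  have "norm (s *\<^sub>R axis i (1::real) + r *\<^sub>R axis j 1) \<le> 2 * h"
   by (rule order_trans[OF norm_triangle_ineq]) (use s r in simp)
  moreover have "D i j h = h\<^sup>2 * partial j (partial i f) ((x + s *\<^sub>R axis i 1) + r *\<^sub>R axis j 1)"
   using s(3) r(3) by (simp add: D_def algebra_simps power2_eq_square)
  ultimately show ?thesis
   by (intro exI[of _ "(x + s *\<^sub>R axis i 1) + r *\<^sub>R axis j 1"]) (simp add: algebra_simps)
 qed
 have "D i j h = D j i h" for h by (simp add: D_def algebra_simps)
 hence "\<exists>y w. norm (y - x) \<le> 2 * h \<and> norm (w - x) \<le> 2 * h \<and>
   partial j (partial i f) y = partial i (partial j f) w" if "h > 0" for h
 proof -
  from key[OF that, of i j] key[OF that, of j i] obtain y w where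
   "norm (y - x) \<le> 2 * h" "norm (w - x) \<le> 2 * h"
   "D i j h = h\<^sup>2 * partial j (partial i f) y" "D j i h = h\<^sup>2 * partial i (partial j f) w" by blast
  moreover from this have "partial j (partial i f) y = partial i (partial j f) w"
   using \<open>D i j h = D j i h\<close> that by simp
  ultimately show ?thesis by blast
 qed
 hence "\<exists>y w. norm (y - x) \<le> 2 * inverse (real (Suc n)) \<and> norm (w - x) \<le> 2 * inverse (real (Suc n)) \<and>
   partial j (partial i f) y = partial i (partial j f) w" for n
  by simp
 then obtain Y W where YW: "\<And>n. norm (Y n - x) \<le> 2 * inverse (real (Suc n))"
   "\<And>n. norm (W n - x) \<le> 2 * inverse (real (Suc n))"
   "\<And>n. partial j (partial i f) (Y n) = partial i (partial j f) (W n)" by metis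
 have lim0: "(\<lambda>n. 2 * inverse (real (Suc n))) \<longlonglongrightarrow> 0"
  using tendsto_mult_right_zero[OF LIMSEQ_inverse_real_of_nat] by blast
 have "Y \<longlonglongrightarrow> x" "W \<longlonglongrightarrow> x"
  by (rule LIM_zero_cancel, rule Lim_null_comparison[OF _ lim0], use YW in simp)+
 moreover have "isCont (partial j (partial i f)) x" "isCont (partial i (partial j f)) x"
  by (auto intro!: differentiable_imp_continuous_within smooth_differentiable smooth_partial f)
 ultimately have "(\<lambda>n. partial j (partial i f) (Y n)) \<longlonglongrightarrow> partial j (partial i f) x"
   "(\<lambda>n. partial i (partial j f) (W n)) \<longlonglongrightarrow> partial i (partial j f) x"
  by (auto intro: isCont_tendsto_compose)
 thus "partial i (partial j f) x = partial j (partial i f) x"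
  using YW(3) LIMSEQ_unique by (metis (no_types, lifting) ext)
qed

lemma iter_partial_partial:
 "smooth f ==> iter_partial ks (partial j f) = partial j (iter_partial ks f)"
 by (induction ks) (auto simp: partial_commute smooth_iter_partial)

text \<open>This is what lets lists of directions stand in for multi-indices: only the multiset of
  directions matters.\<close>

lemma iter_partial_perm:
 "smooth f ==> mset js = mset ks ==> iter_partial js f = iter_partial ks f"
proof (induction js arbitrary: ks)
 case (Cons j js)
 hence "j \<in> set ks" by (metis list.set_intros(1) mset_eq_setD)
 then obtain k1 k2 where ks: "ks = k1 @ j # k2" by (meson split_list)
 hence "iter_partial js f = iter_partial (k1 @ k2) f" using Cons by auto
 thus ?case using Cons.prems(1)
  by (simp add: ks iter_partial_append iter_partial_partial smooth_iter_partial)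
qed simp

section \<open>A smooth bump function\<close>

definition flat :: "nat => real => real" where
 "flat m s = (if s > 0 then exp (- 1 / s) / s ^ m else 0)"

lemma flat_tendsto_0: "(flat m \<longlongrightarrow> 0) (at 0)"
proof (rule filterlim_split_at)
 show "(flat m \<longlongrightarrow> 0) (at_left 0)"
  by (rule tendsto_eventually) (auto simp: flat_def eventually_at_filter)
 have "((\<lambda>s::real. (inverse s) ^ m / exp (inverse s)) \<longlongrightarrow> 0) (at_right 0)"
  by (rule filterlim_compose[OF tendsto_power_div_exp_0 filterlim_inverse_at_top_right])
 moreover have "\<forall>\<^sub>F s in at_right 0. (inverse s) ^ m / exp (inverse s) = flat m s"
  by (auto simp: flat_def eventually_at_filter exp_minus field_simps)
 ultimately show "(flat m \<longlongrightarrow> 0) (at_right 0)" by (rule Lim_transform_eventually)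
qed

text \<open>The family is closed under differentiation up to linear combinations. At s = 0 the
  difference quotient of \<open>flat m\<close> is \<open>flat (Suc m)\<close>, so the derivative
  there is the limit already found in \<open>flat_tendsto_0\<close>.\<close>

lemma DERIV_flat: "(flat m has_real_derivative (flat (m + 2) s - real m * flat (m + 1) s)) (at s)"
proof (cases s "0::real" rule: linorder_cases)
 case less
 have "((\<lambda>s. 0) has_real_derivative 0) (at s)" by simp
 hence "(flat m has_real_derivative 0) (at s)"
  by (rule has_field_derivative_transform_within[where d = "-s"]) (use less in \<open>auto simp: flat_def dist_real_def\<close>)
 thus ?thesis using less by (simp add: flat_def)
next
 case equal
 have "((\<lambda>h. flat m h / h) \<longlongrightarrow> 0) (at 0)"
  by (rule Lim_transform_eventually[OF flat_tendsto_0[of "Suc m"]])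
   (auto simp: flat_def eventually_at_filter mult_ac)
 thus ?thesis using equal by (simp add: DERIV_def flat_def)
next
 case greater
 have "((\<lambda>s. exp (- 1 / s) / s ^ m) has_real_derivative
   (flat (m + 2) s - real m * flat (m + 1) s)) (at s)"
  using greater
  by (auto intro!: derivative_eq_intros simp: flat_def field_simps power2_eq_square)
   (cases m; simp add: field_simps)
 thus ?thesis
  by (rule has_field_derivative_transform_within[where d = s]) (use greater in \<open>auto simp: flat_def dist_real_def\<close>)
qed

text \<open>Stable under \<open>partial\<close>: the inner derivative of 1 - |x|^2 contributes a
  factor -2 x_i, which is absorbed by the arbitrary smooth coefficient \<open>P\<close>.\<close>

inductive_set flat_span :: "'n::finite fn set" where
 base: "smooth P ==> (\<lambda>x. P x * flat m (1 - x \<bullet> x)) \<in> flat_span"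
| add: "F \<in> flat_span ==> G \<in> flat_span ==> (\<lambda>x. F x + G x) \<in> flat_span"

definition bump :: "'n::finite fn" where "bump x = flat 0 (1 - x \<bullet> x)"

lemma has_derivative_flat_norm:
 "((\<lambda>x::real^'n::finite. flat m (1 - x \<bullet> x)) has_derivative
  (\<lambda>h. (flat (m + 2) (1 - x \<bullet> x) - real m * flat (m + 1) (1 - x \<bullet> x)) * (- 2 * (x \<bullet> h)))) (at x)"
proof -
 have "((\<lambda>x::real^'n. 1 - x \<bullet> x) has_derivative (\<lambda>h. - 2 * (x \<bullet> h))) (at x)"
  by (auto intro!: derivative_eq_intros simp: inner_commute)
 from diff_chain_at[OF this DERIV_flat[unfolded has_field_derivative_def, of m]]
 show ?thesis by (simp add: o_def)
qed

lemma smooth_bump: "smooth bump"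
proof (rule smooth_coinduct[of _ flat_span])
 have "(\<lambda>x::real^'n. 1 * flat 0 (1 - x \<bullet> x)) \<in> flat_span"
  by (intro flat_span.base smooth_const)
 thus "(bump :: real^'n => real) \<in> flat_span" by (simp add: bump_def[abs_def])
 have d: "(\<lambda>x. flat m (1 - x \<bullet> x)) differentiable (at x)" for m and x :: "real^'n"
  using has_derivative_flat_norm differentiable_def by blast
 show diff: "F differentiable (at x)" if "F \<in> flat_span" for F and x :: "real^'n"
  using that by induction (auto intro!: derivative_intros d intro: smooth_differentiable)
 show "partial i F \<in> flat_span" if "F \<in> flat_span" for F and i :: "'n::finite"
  using that
 proof induction
  case (base P m)
  have p: "partial i (\<lambda>x::real^'n. flat m (1 - x \<bullet> x)) x =
   (flat (m + 2) (1 - x \<bullet> x) - real m * flat (m + 1) (1 - x \<bullet> x)) * (- 2 * x $ i)" for x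
   using partial_eqI[OF has_derivative_flat_norm] by (simp add: inner_axis)
  have "partial i (\<lambda>x. P x * flat m (1 - x \<bullet> x)) =
   (\<lambda>x. (partial i P x * flat m (1 - x \<bullet> x) + ((-2 * x $ i) * P x) * flat (m + 2) (1 - x \<bullet> x))
     + ((2 * real m * x $ i) * P x) * flat (m + 1) (1 - x \<bullet> x))"
   using base by (auto simp: partial_mult smooth_differentiable d p algebra_simps)
  moreover have "\<dots> \<in> flat_span" using base
   by (intro flat_span.intros smooth_partial smooth_mult smooth_const smooth_coord)
  ultimately show ?case by simp
 next
  case (add F G)
  have "partial i (\<lambda>x. F x + G x) = (\<lambda>x. partial i F x + partial i G x)"
   using add by (auto simp: partial_add diff)
  thus ?case using add by (auto intro!: flat_span.intros)
 qed
qed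

lemma bump_nonneg: "bump x \<ge> 0" by (simp add: bump_def flat_def)

lemma bump_eq_0: "norm x \<ge> 1 ==> bump x = 0"
 using abs_square_less_1[of "norm x"] by (auto simp: bump_def flat_def dot_square_norm)

lemma bump_pos: "norm x < 1 ==> bump x > 0"
 using abs_square_less_1[of "norm x"] by (auto simp: bump_def flat_def dot_square_norm)

section \<open>Closure properties of test functions\<close>

lemma test_functions_iff:
 "\<phi> \<in> \<D> \<longleftrightarrow> smooth \<phi> \<and> (\<exists>R. \<forall>x. norm x > R --> \<phi> x = 0)"
proof safe
 assume "\<phi> \<in> \<D>"
 then obtain K where K: "smooth \<phi>" "compact K" "\<forall>x. x \<notin> K --> \<phi> x = 0"
  by (auto simp: test_functions_def smooth_def)
 thus "smooth \<phi>" "\<exists>R. \<forall>x. norm x > R --> \<phi> x = 0"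
  using compact_imp_bounded[OF K(2)] unfolding bounded_iff by (auto, meson leD)
next
 fix R assume "smooth \<phi>" "\<forall>x. norm x > R --> \<phi> x = 0"
 thus "\<phi> \<in> \<D>"
  unfolding test_functions_def smooth_def
  by (auto intro!: exI[of _ "cball 0 R"])
qed

lemma test_smooth: "\<phi> \<in> \<D> ==> smooth \<phi>" by (simp add: test_functions_iff)

lemma test_bump: "bump \<in> \<D>"
 unfolding test_functions_iff using smooth_bump bump_eq_0 by (meson less_imp_le)

lemma test_partial: assumes "\<phi> \<in> \<D>" shows "partial i \<phi> \<in> \<D>"
proof -
 from assms obtain R where R: "smooth \<phi>" "\<And>x. norm x > R ==> \<phi> x = 0"
  by (auto simp: test_functions_iff)
 have "partial i \<phi> x = 0" if "norm x > R" for x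
 proof -
  have "(\<phi> has_derivative (\<lambda>h. 0)) (at x)"
   by (rule has_derivative_transform_within_open[where f = "\<lambda>x. 0" and s = "{x. norm x > R}"])
    (use R that in \<open>auto intro!: open_Collect_less continuous_intros\<close>)
  from partial_eqI[OF this] show ?thesis by simp
 qed
 thus ?thesis using R smooth_partial by (auto simp: test_functions_iff)
qed

lemma test_iter_partial: "\<phi> \<in> \<D> ==> iter_partial js \<phi> \<in> \<D>"
 by (induction js) (auto intro: test_partial)

lemma test_mult: "\<phi> \<in> \<D> ==> smooth f ==> (\<lambda>x. f x * \<phi> x) \<in> \<D>"
 unfolding test_functions_iff by (auto intro!: smooth_mult)

lemma test_cmult: "\<phi> \<in> \<D> ==> (\<lambda>x. c * \<phi> x) \<in> \<D>"
 by (intro test_mult smooth_const)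

lemma test_add: assumes "\<phi> \<in> \<D>" "\<psi> \<in> \<D>"
 shows "(\<lambda>x. \<phi> x + \<psi> x) \<in> \<D>"
proof -
 from assms obtain R S where "\<forall>x. norm x > R --> \<phi> x = 0" "\<forall>x. norm x > S --> \<psi> x = 0"
  by (auto simp: test_functions_iff)
 hence "\<forall>x. norm x > max R S --> \<phi> x + \<psi> x = 0" by auto
 thus ?thesis using assms unfolding test_functions_iff by (blast intro: smooth_add)
qed

lemma test_sum: "finite I ==> (\<And>i. i \<in> I ==> \<phi> i \<in> \<D>) ==>
 (\<lambda>x. \<Sum>i\<in>I. \<phi> i x) \<in> \<D>"
proof (induction I rule: finite_induct)
 case empty
 thus ?case by (auto simp: test_functions_iff smooth_const)
qed (auto intro: test_add)

lemma test_affine: assumes "\<phi> \<in> \<D>" "a \<noteq> 0"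
 shows "(\<lambda>x. \<phi> (a *\<^sub>R x + b)) \<in> \<D>"
proof -
 from assms obtain R where R: "\<And>x. norm x > R ==> \<phi> x = 0" "smooth \<phi>"
  by (auto simp: test_functions_iff)
 have "\<phi> (a *\<^sub>R x + b) = 0" if "norm x > (R + norm b) / \<bar>a\<bar>" for x
 proof (rule R)
  have "R + norm b < \<bar>a\<bar> * norm x" using that assms by (simp add: field_simps)
  moreover have "norm (a *\<^sub>R x) \<le> norm (a *\<^sub>R x + b) + norm b"
   using norm_triangle_ineq4[of "a *\<^sub>R x + b" b] by simp
  ultimately show "R < norm (a *\<^sub>R x + b)" by simp
 qed
 thus ?thesis using smooth_affine[OF R(2)] by (auto simp: test_functions_iff)
qed

definition L2norm :: "'n::finite fn => real" where
 "L2norm u = sqrt (LEB x. (u x)\<^sup>2)"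

section \<open>The space $L^2$\<close>

lemma L2_measurable: "u \<in> L2_space ==> u \<in> borel_measurable lebesgue"
 by (simp add: L2_space_def)

lemma L2_integrable_sq: "u \<in> L2_space ==> integrable lebesgue (\<lambda>x. (u x)\<^sup>2)"
 by (simp add: L2_space_def)

lemma L2_spaceI: "u \<in> borel_measurable lebesgue ==> integrable lebesgue (\<lambda>x. (u x)\<^sup>2) ==> u \<in> L2_space"
 by (simp add: L2_space_def)

lemma L2_mult_integrable:
 assumes "u \<in> L2_space" "w \<in> L2_space"
 shows "integrable lebesgue (\<lambda>x. u x * w x)"
proof (rule Bochner_Integration.integrable_bound)
 show "integrable lebesgue (\<lambda>x. (u x)\<^sup>2 + (w x)\<^sup>2)"
  using assms by (intro Bochner_Integration.integrable_add L2_integrable_sq)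
 show "(\<lambda>x. u x * w x) \<in> borel_measurable lebesgue"
  using assms by (intro borel_measurable_times L2_measurable)
 have "\<bar>a * b\<bar> \<le> a\<^sup>2 + b\<^sup>2" for a b :: real
 proof -
  have "2 * (\<bar>a\<bar> * \<bar>b\<bar>) \<le> a\<^sup>2 + b\<^sup>2"
   using sum_squares_bound[of "\<bar>a\<bar>" "\<bar>b\<bar>"] by (simp add: mult.assoc)
  moreover have "0 \<le> \<bar>a\<bar> * \<bar>b\<bar>" by simp
  ultimately show ?thesis unfolding abs_mult by linarith
 qed
 thus "AE x in lebesgue. norm (u x * w x) \<le> norm ((u x)\<^sup>2 + (w x)\<^sup>2)"
  by (auto intro: order_trans[OF _ abs_ge_self])
qed

lemma L2_add: assumes "u \<in> L2_space" "w \<in> L2_space" shows "(\<lambda>x. u x + w x) \<in> L2_space"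
proof (rule L2_spaceI)
 show "(\<lambda>x. u x + w x) \<in> borel_measurable lebesgue"
  using assms by (intro borel_measurable_add L2_measurable)
 have "integrable lebesgue (\<lambda>x. (u x)\<^sup>2 + (w x)\<^sup>2 + 2 * (u x * w x))"
  using assms by (intro Bochner_Integration.integrable_add L2_integrable_sq
    integrable_mult_right L2_mult_integrable)
 thus "integrable lebesgue (\<lambda>x. (u x + w x)\<^sup>2)" by (simp add: power2_sum mult.assoc)
qed

lemma L2_cmult: assumes "u \<in> L2_space" shows "(\<lambda>x. c * u x) \<in> L2_space"
 using assms by (intro L2_spaceI) (auto simp: power_mult_distrib dest: L2_measurable L2_integrable_sq)

lemma L2_diff: "u \<in> L2_space ==> w \<in> L2_space ==> (\<lambda>x. u x - w x) \<in> L2_space"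
 using L2_add[of u "\<lambda>x. (-1) * w x"] L2_cmult[of w "-1"] by simp

lemma L2_lincomb: "u \<in> L2_space ==> w \<in> L2_space ==> (\<lambda>x. a * u x + b * w x) \<in> L2_space"
 by (intro L2_add L2_cmult)

lemma L2_zero: "(\<lambda>x. 0) \<in> L2_space" by (simp add: L2_space_def)

text \<open>Completeness of Lebesgue measure: preimages under \<open>u\<close> and \<open>w\<close>
  differ only inside a null set, all of whose subsets are measurable.\<close>

lemma lebesgue_measurable_cong:
 fixes u w :: "'a::euclidean_space => real"
 assumes u: "u \<in> borel_measurable lebesgue" and ae: "AE x in lebesgue. u x = w x"
 shows "w \<in> borel_measurable lebesgue"
proof (rule measurableI)
 fix A :: "real set" assume A: "A \<in> sets borel"
 from ae obtain N where N: "N \<in> null_sets lebesgue" "{x. u x \<noteq> w x} \<subseteq> N"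
  by (auto simp: eventually_ae_filter)
 have "w -` A = (u -` A - N) \<union> (w -` A \<inter> N)" using N(2) by (auto simp: subset_iff) metis+
 moreover have "u -` A \<in> sets lebesgue" using measurable_sets[OF u A] by simp
 moreover have "w -` A \<inter> N \<in> null_sets lebesgue"
  using N(1) null_sets_completion_subset by (metis inf_le2)
 ultimately have "w -` A \<in> sets lebesgue"
  using N(1) by (metis null_setsD2 sets.Diff sets.Un)
 thus "w -` A \<inter> space lebesgue \<in> sets lebesgue" by simp
qed simp

lemma L2_cong_AE: assumes "u \<in> L2_space" "AE x in lebesgue. u x = w x" shows "w \<in> L2_space"
proof (rule L2_spaceI)
 show w: "w \<in> borel_measurable lebesgue"
  using lebesgue_measurable_cong[OF L2_measurable[OF assms(1)] assms(2)] .
 have "AE x in lebesgue. (u x)\<^sup>2 = (w x)\<^sup>2" using assms(2) by eventually_elim simp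
 thus "integrable lebesgue (\<lambda>x. (w x)\<^sup>2)"
  by (rule integrable_cong_AE_imp[OF L2_integrable_sq[OF assms(1)] borel_measurable_power[OF w]])
qed

text \<open>If \<open>u\<close> is not measurable then neither is \<open>w\<close>, and both
  integrals take the default value 0; so the rewriting carries no measurability side
  condition.\<close>

lemma integral_cong_lebesgue:
 fixes u w :: "'a::euclidean_space => real"
 assumes "AE x in lebesgue. u x = w x"
 shows "(LEB x. u x) = (LEB x. w x)"
proof (cases "u \<in> borel_measurable lebesgue")
 case True
 thus ?thesis using lebesgue_measurable_cong[OF True assms] assms by (intro integral_cong_AE)
next
 case False
 have "AE x in lebesgue. w x = u x" using assms by eventually_elim simp
 hence "w \<notin> borel_measurable lebesgue" using lebesgue_measurable_cong[of w u] False by blast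
 thus ?thesis using False by (metis borel_measurable_integrable not_integrable_integral_eq)
qed

lemma L2norm_cong_AE: assumes "AE x in lebesgue. u x = w x" shows "L2norm u = L2norm w"
proof -
 have "AE x in lebesgue. (u x)\<^sup>2 = (w x)\<^sup>2" using assms by eventually_elim simp
 thus ?thesis unfolding L2norm_def by (simp add: integral_cong_lebesgue)
qed

lemma L2norm_nonneg [simp]: "L2norm u \<ge> 0"
 by (simp add: L2norm_def)

lemma L2norm_sq: "(L2norm u)\<^sup>2 = (LEB x. (u x)\<^sup>2)"
 by (simp add: L2norm_def)

lemma L2norm_cmult: "L2norm (\<lambda>x. c * u x) = \<bar>c\<bar> * L2norm u"
 by (simp add: L2norm_def power_mult_distrib real_sqrt_mult)

lemma L2norm_eq_0: assumes "u \<in> L2_space" "L2norm u = 0" shows "AE x in lebesgue. u x = 0"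
proof -
 have "(LEB x. (u x)\<^sup>2) = 0" using assms(2) by (simp add: L2norm_def)
 hence "AE x in lebesgue. (u x)\<^sup>2 = 0"
  using integral_nonneg_eq_0_iff_AE[OF L2_integrable_sq[OF assms(1)]] by simp
 thus ?thesis by simp
qed

text \<open>The quadratic form \<open>ex\<close> is nonnegative; inserting (r, s) = (b, a) and (b,
  -a) leaves twice ab(ab + I) and twice ab(ab - I). If one of the norms vanishes, the integrand
  vanishes almost everywhere.\<close>

lemma L2_Cauchy_Schwarz:
 assumes u: "u \<in> L2_space" and w: "w \<in> L2_space"
 shows "\<bar>LEB x. u x * w x\<bar> \<le> L2norm u * L2norm w"
proof -
 define a b I where "a = L2norm u" "b = L2norm w" "I = (LEB x. u x * w x)"
 have ex: "(LEB x. (r * u x + s * w x)\<^sup>2) = r\<^sup>2 * a\<^sup>2 + s\<^sup>2 * b\<^sup>2 + 2 * r * s * I" for r s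
 proof -
  have "(LEB x. (r * u x + s * w x)\<^sup>2) =
   (LEB x. r\<^sup>2 * (u x)\<^sup>2 + s\<^sup>2 * (w x)\<^sup>2 + 2 * r * s * (u x * w x))"
   by (intro Bochner_Integration.integral_cong) (auto simp: power2_sum power_mult_distrib algebra_simps)
  also have "\<dots> = r\<^sup>2 * a\<^sup>2 + s\<^sup>2 * b\<^sup>2 + 2 * r * s * I"
   using u w by (simp add: a_b_I_def L2norm_sq L2_integrable_sq L2_mult_integrable)
  finally show ?thesis .
 qed
 have nn: "0 \<le> r\<^sup>2 * a\<^sup>2 + s\<^sup>2 * b\<^sup>2 + 2 * r * s * I" for r s
  unfolding ex[symmetric] by simp
 show ?thesis
 proof (cases "a = 0 \<or> b = 0")
  case True
  hence "(AE x in lebesgue. u x = 0) \<or> (AE x in lebesgue. w x = 0)"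
   using L2norm_eq_0[OF u] L2norm_eq_0[OF w] unfolding a_b_I_def by blast
  hence "AE x in lebesgue. u x * w x = 0" by (auto elim: eventually_mono)
  hence "(LEB x. u x * w x) = 0"
   using integral_cong_lebesgue[of "\<lambda>x. u x * w x" "\<lambda>x. 0"] by simp
  thus ?thesis by simp
 next
  case False
  hence pos: "a > 0" "b > 0" using L2norm_nonneg[of u] L2norm_nonneg[of w]
   unfolding a_b_I_def by linarith+
  have "0 \<le> (a * b) * (a * b + I)" "0 \<le> (a * b) * (a * b - I)"
   using nn[of b a] nn[of b "-a"] by (auto simp: algebra_simps power2_eq_square)
  moreover have "a * b > 0" using pos by simp
  ultimately have "0 \<le> a * b + I" "0 \<le> a * b - I"
   using zero_le_mult_iff linorder_not_less by blast+
  thus ?thesis unfolding a_b_I_def by linarith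
 qed
qed

lemma L2norm_triangle:
 assumes u: "u \<in> L2_space" and w: "w \<in> L2_space"
 shows "L2norm (\<lambda>x. u x + w x) \<le> L2norm u + L2norm w"
proof (rule power2_le_imp_le)
 have "(L2norm (\<lambda>x. u x + w x))\<^sup>2 = (LEB x. (u x)\<^sup>2 + (w x)\<^sup>2 + 2 * (u x * w x))"
  by (simp add: L2norm_sq power2_sum mult.assoc)
 also have "\<dots> = (L2norm u)\<^sup>2 + (L2norm w)\<^sup>2 + 2 * (LEB x. u x * w x)"
  using u w by (simp add: L2norm_sq L2_integrable_sq L2_mult_integrable)
 also have "\<dots> \<le> (L2norm u)\<^sup>2 + (L2norm w)\<^sup>2 + 2 * (L2norm u * L2norm w)"
  using L2_Cauchy_Schwarz[OF u w] by simp
 finally show "(L2norm (\<lambda>x. u x + w x))\<^sup>2 \<le> (L2norm u + L2norm w)\<^sup>2"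
  by (simp add: power2_sum mult.assoc)
qed simp

lemma L2norm_diff_triangle:
 assumes "u \<in> L2_space" "w \<in> L2_space" "v \<in> L2_space"
 shows "L2norm (\<lambda>x. u x - w x) \<le> L2norm (\<lambda>x. u x - v x) + L2norm (\<lambda>x. v x - w x)"
 using L2norm_triangle[OF L2_diff[OF assms(1,3)] L2_diff[OF assms(3,2)]] by simp

lemma L2norm_diff_commute: "L2norm (\<lambda>x. u x - w x) = L2norm (\<lambda>x. w x - u x)"
 unfolding L2norm_def by (simp add: power2_commute)

lemma L2norm_nn: assumes "u \<in> L2_space"
 shows "(NNLEB x. ennreal ((u x)\<^sup>2)) = ennreal ((L2norm u)\<^sup>2)"
 unfolding L2norm_sq using assms by (intro nn_integral_eq_integral L2_integrable_sq) auto

lemma L2_nnI: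
 assumes m: "u \<in> borel_measurable lebesgue"
  and le: "(NNLEB x. ennreal ((u x)\<^sup>2)) \<le> ennreal (C\<^sup>2)" and C: "0 \<le> C"
 shows "u \<in> L2_space" "L2norm u \<le> C"
proof -
 have "integrable lebesgue (\<lambda>x. (u x)\<^sup>2)"
 proof (rule integrableI_nonneg)
  show "(NNLEB x. ennreal ((u x)\<^sup>2)) < \<infinity>"
   using le by (rule order_le_less_trans) simp
 qed (use m in auto)
 thus *: "u \<in> L2_space" using m by (intro L2_spaceI)
 have "ennreal ((L2norm u)\<^sup>2) \<le> ennreal (C\<^sup>2)" using le by (simp add: L2norm_nn[OF *])
 hence "(L2norm u)\<^sup>2 \<le> C\<^sup>2" by (simp add: ennreal_le_iff)
 thus "L2norm u \<le> C" using C power2_le_imp_le by blast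
qed

section \<open>Limits and completeness in L^2\<close>

lemma L2_Fatou:
 assumes u: "\<And>n. u n \<in> L2_space" and C: "\<And>n. L2norm (u n) \<le> C"
  and lim: "AE x in lebesgue. (\<lambda>n. u n x) \<longlonglongrightarrow> w x" and w: "w \<in> borel_measurable lebesgue"
 shows "w \<in> L2_space" "L2norm w \<le> C"
proof -
 have C0: "0 \<le> C" using C[of 0] L2norm_nonneg[of "u 0"] by linarith
 have "(NNLEB x. ennreal ((w x)\<^sup>2)) = (NNLEB x. liminf (\<lambda>n. ennreal ((u n x)\<^sup>2)))"
 proof (rule nn_integral_cong_AE)
  show "AE x in lebesgue. ennreal ((w x)\<^sup>2) = liminf (\<lambda>n. ennreal ((u n x)\<^sup>2))"
   using lim
  proof eventually_elim
   case (elim x)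
   hence "(\<lambda>n. ennreal ((u n x)\<^sup>2)) \<longlonglongrightarrow> ennreal ((w x)\<^sup>2)"
    by (intro tendsto_ennrealI tendsto_power)
   thus ?case using lim_imp_Liminf[OF sequentially_bot] by metis
  qed
 qed
 also have "\<dots> \<le> liminf (\<lambda>n. NNLEB x. ennreal ((u n x)\<^sup>2))"
  by (rule nn_integral_liminf) (use L2_measurable[OF u] in auto)
 also have "\<dots> \<le> ennreal (C\<^sup>2)"
 proof (rule Liminf_le)
  show "\<forall>\<^sub>F n in sequentially. (NNLEB x. ennreal ((u n x)\<^sup>2)) \<le> ennreal (C\<^sup>2)"
   using C C0 by (auto simp: L2norm_nn[OF u] intro!: ennreal_leI power_mono)
 qed simp
 finally show "w \<in> L2_space" "L2norm w \<le> C"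
  using L2_nnI[OF w _ C0] by auto
qed

lemma L2_AE_subseq:
 assumes u: "\<And>n. u n \<in> L2_space" and w: "w \<in> L2_space"
  and lim: "(\<lambda>n. L2norm (\<lambda>x. u n x - w x)) \<longlonglongrightarrow> 0"
 shows "\<exists>r. strict_mono r \<and> (AE x in lebesgue. (\<lambda>n. u (r n) x) \<longlonglongrightarrow> w x)"
proof -
 have "(\<lambda>n. (L2norm (\<lambda>x. u n x - w x))\<^sup>2) \<longlonglongrightarrow> 0\<^sup>2" by (intro tendsto_power lim)
 hence "(\<lambda>n. LEB x. norm ((u n x - w x)\<^sup>2)) \<longlonglongrightarrow> 0" by (simp add: L2norm_sq)
 from tendsto_L1_AE_subseq[OF _ this] obtain r where r: "strict_mono r"
  "AE x in lebesgue. (\<lambda>n. (u (r n) x - w x)\<^sup>2) \<longlonglongrightarrow> 0"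
  using L2_integrable_sq[OF L2_diff[OF u w]] by auto
 have "AE x in lebesgue. (\<lambda>n. u (r n) x) \<longlonglongrightarrow> w x"
  using r(2)
 proof eventually_elim
  case (elim x)
  hence "(\<lambda>n. sqrt ((u (r n) x - w x)\<^sup>2)) \<longlonglongrightarrow> sqrt 0" by (intro tendsto_real_sqrt)
  hence "(\<lambda>n. u (r n) x - w x) \<longlonglongrightarrow> 0" by (simp add: tendsto_rabs_zero_iff)
  thus ?case by (rule LIM_zero_cancel)
 qed
 thus ?thesis using r(1) by blast
qed

text \<open>Riesz-Fischer. Along a subsequence whose increments \<open>d k\<close> have norm at most
  2^-k, the sum of 2^k (d k)^2 has a finite integral, hence is finite almost everywhere, and 2|d k|
  <= 2^-k + 2^k (d k)^2 turns that into pointwise convergence.\<close>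

lemma L2_complete:
 assumes u: "\<And>n. u n \<in> L2_space"
  and cau: "\<And>e. e > 0 ==> \<exists>M. \<forall>m\<ge>M. \<forall>n\<ge>M. L2norm (\<lambda>x. u m x - u n x) < e"
 shows "\<exists>w\<in>L2_space. (\<lambda>n. L2norm (\<lambda>x. u n x - w x)) \<longlonglongrightarrow> 0"
proof -
 have "\<exists>M. \<forall>m\<ge>M. \<forall>n\<ge>M. L2norm (\<lambda>x. u m x - u n x) < (1/2)^k" for k :: nat
  by (rule cau) simp
 then obtain M where M: "\<And>k m n. m \<ge> M k ==> n \<ge> M k ==> L2norm (\<lambda>x. u m x - u n x) < (1/2)^k"
  by metis
 \<comment> \<open>The running maximum keeps \<open>r\<close> monotone while \<open>r k\<close>
   stays above \<open>M k\<close>.\<close>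
 define r where "r k = Max (M ` {..k}) + k" for k
 have rM: "r k \<ge> M k" for k unfolding r_def by (intro trans_le_add1 Max_ge) auto
 have rSuc: "r (Suc k) \<ge> r k" for k unfolding r_def by (intro add_mono Max_mono) auto
 define d where "d k x = u (r (Suc k)) x - u (r k) x" for k x
 have d2: "d k \<in> L2_space" for k unfolding d_def[abs_def] by (intro L2_diff u)
 have dn: "L2norm (d k) \<le> (1/2)^k" for k
  unfolding d_def[abs_def] using M[of k "r (Suc k)" "r k"] rM rSuc
  by (meson le_trans less_imp_le)
 have [measurable]: "d k \<in> borel_measurable lebesgue" "u k \<in> borel_measurable lebesgue" for k
  using d2 u L2_measurable by auto
 have "AE x in lebesgue. (\<Sum>k. ennreal (2^k * (d k x)\<^sup>2)) \<noteq> \<infinity>"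
 proof (rule nn_integral_PInf_AE)
  have "(NNLEB x. (\<Sum>k. ennreal (2^k * (d k x)\<^sup>2))) = (\<Sum>k. NNLEB x. ennreal (2^k * (d k x)\<^sup>2))"
   by (intro nn_integral_suminf) measurable
  also have "\<dots> \<le> (\<Sum>k. ennreal ((1/2)^k))"
  proof (intro suminf_le summableI)
   fix k
   have "(NNLEB x. ennreal (2^k * (d k x)\<^sup>2)) = ennreal (2^k) * ennreal ((L2norm (d k))\<^sup>2)"
    unfolding L2norm_nn[OF d2, symmetric] by (simp add: ennreal_mult nn_integral_cmult)
   also have "\<dots> \<le> ennreal (2^k * ((1/2)^k)\<^sup>2)"
    using dn by (auto simp flip: ennreal_mult intro!: ennreal_leI mult_left_mono power_mono)
   also have "\<dots> = ennreal ((1/2)^k)" by (simp add: power2_eq_square power_divide)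
   finally show "(NNLEB x. ennreal (2^k * (d k x)\<^sup>2)) \<le> ennreal ((1/2)^k)" .
  qed
  also have "\<dots> = ennreal (\<Sum>k. (1/2)^k)"
   by (rule suminf_ennreal2) (auto intro: summable_geometric)
  finally show "(NNLEB x. (\<Sum>k. ennreal (2^k * (d k x)\<^sup>2))) \<noteq> \<infinity>"
   by (metis ennreal_neq_top infinity_ennreal_def top.extremum_uniqueI)
 qed measurable
 hence conv: "AE x in lebesgue. convergent (\<lambda>n. u (r n) x)"
 proof eventually_elim
  case (elim x)
  hence s1: "summable (\<lambda>k. 2^k * (d k x)\<^sup>2)"
   by (intro summable_suminf_not_top) (auto simp: top_ennreal_def)
  have "summable (\<lambda>k. d k x)"
  proof (rule summable_comparison_test)
   show "\<exists>N. \<forall>n\<ge>N. norm (d n x) \<le> (1/2)^n + 2^n * (d n x)\<^sup>2"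
   proof (intro exI allI impI)
    fix n :: nat
    let ?s = "sqrt (2^n)"
    have p: "?s > 0" "?s\<^sup>2 = 2^n" by auto
    have "2 * (1 / ?s) * (?s * \<bar>d n x\<bar>) \<le> (1 / ?s)\<^sup>2 + (?s * \<bar>d n x\<bar>)\<^sup>2"
     by (rule sum_squares_bound)
    also have "\<dots> = (1/2)^n + 2^n * (d n x)\<^sup>2"
     using p by (simp add: power_mult_distrib power_divide)
    finally have "2 * \<bar>d n x\<bar> \<le> (1/2)^n + 2^n * (d n x)\<^sup>2" using p(1) by simp
    thus "norm (d n x) \<le> (1/2)^n + 2^n * (d n x)\<^sup>2" by simp
   qed
   show "summable (\<lambda>n. (1/2)^n + 2^n * (d n x)\<^sup>2)" by (intro summable_add s1 summable_geometric) simp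
  qed
  hence "convergent (\<lambda>n. (\<Sum>k<n. d k x) + u (r 0) x)"
   by (intro convergent_add convergent_const) (simp add: summable_iff_convergent)
  moreover have "(\<Sum>k<n. d k x) + u (r 0) x = u (r n) x" for n
   by (induction n) (auto simp: d_def)
  ultimately show ?case by simp
 qed
 define w where "w x = lim (\<lambda>n. u (r n) x)" for x
 have w [measurable]: "w \<in> borel_measurable lebesgue" unfolding w_def[abs_def] by measurable
 have lim: "AE x in lebesgue. (\<lambda>n. u (r n) x) \<longlonglongrightarrow> w x"
  using conv by eventually_elim (simp add: w_def convergent_LIMSEQ_iff)
 \<comment> \<open>Fatou's lemma in one of the two indices turns the Cauchy bound into a bound for
   the distance to the limit, and shows at the same time that the difference from the limit is
   square integrable.\<close>
 have close: "(\<lambda>x. w x - u m x) \<in> L2_space \<and> L2norm (\<lambda>x. w x - u m x) \<le> (1/2)^k" if "m \<ge> M k" for m k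
 proof -
  have *: "L2norm (\<lambda>x. u (r (n + k)) x - u m x) \<le> (1/2)^k" for n
  proof -
   have "r k \<le> r (n + k)" by (induction n) (auto intro: le_trans[OF _ rSuc])
   thus ?thesis using M[of k "r (n + k)" m] rM[of k] that by (meson le_trans less_imp_le)
  qed
  have "AE x in lebesgue. (\<lambda>n. u (r (n + k)) x - u m x) \<longlonglongrightarrow> w x - u m x"
   using lim by eventually_elim (intro tendsto_intros LIMSEQ_ignore_initial_segment)
  from L2_Fatou[OF L2_diff[OF u u] * this] show ?thesis by simp
 qed
 have "(\<lambda>x. (w x - u (M 0) x) + u (M 0) x) \<in> L2_space" by (intro L2_add u) (use close[of 0] in simp)
 hence "w \<in> L2_space" by simp
 moreover have "(\<lambda>n. L2norm (\<lambda>x. u n x - w x)) \<longlonglongrightarrow> 0"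
 proof (rule LIMSEQ_I)
  fix e :: real assume "e > 0"
  then obtain k :: nat where "(1/2)^k < e" using real_arch_pow_inv[of e "1/2"] by auto
  thus "\<exists>N. \<forall>n\<ge>N. norm (L2norm (\<lambda>x. u n x - w x) - 0) < e"
   using close[of k] by (intro exI[of _ "M k"]) (subst L2norm_diff_commute, force)
 qed
 ultimately show ?thesis by blast
qed

lemma L2_inner_tendsto:
 assumes u: "\<And>n. u n \<in> L2_space" and w: "w \<in> L2_space" and v: "v \<in> L2_space"
  and lim: "(\<lambda>n. L2norm (\<lambda>x. u n x - w x)) \<longlonglongrightarrow> 0"
 shows "(\<lambda>n. LEB x. u n x * v x) \<longlonglongrightarrow> (LEB x. w x * v x)"
proof (rule LIM_zero_cancel, rule Lim_null_comparison)
 show "(\<lambda>n. L2norm (\<lambda>x. u n x - w x) * L2norm v) \<longlonglongrightarrow> 0"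
  using tendsto_mult_left_zero[OF lim] .
 have "(LEB x. u n x * v x) - (LEB x. w x * v x) = (LEB x. (u n x - w x) * v x)" for n
  using u w v by (simp add: left_diff_distrib L2_mult_integrable)
 thus "\<forall>\<^sub>F n in sequentially. norm ((LEB x. u n x * v x) - (LEB x. w x * v x))
   \<le> L2norm (\<lambda>x. u n x - w x) * L2norm v"
  using L2_Cauchy_Schwarz[OF L2_diff[OF u w] v] by simp
qed

text \<open>Tonelli and substitution are applied over \<open>lborel\<close> to Borel functions; this
  supplies a Borel representative in each class.\<close>

lemma L2_borel_rep:
 assumes "u \<in> L2_space"
 shows "\<exists>u'\<in>borel_measurable borel. u' \<in> L2_space \<and> (AE x in lebesgue. u x = u' x)"
proof -
 obtain u' where u': "u' \<in> borel_measurable lborel" "AE x in lborel. u x = u' x"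
  using completion_ex_borel_measurable_real[OF L2_measurable[OF assms]] by blast
 hence "u' \<in> borel_measurable borel" by simp
 have "AE x in lebesgue. u x = u' x" using AE_completion[OF u'(2)] .
 thus ?thesis using \<open>u' \<in> borel_measurable borel\<close> L2_cong_AE[OF assms] by blast
qed

section \<open>Convolution and mollification\<close>

definition conv :: "'n::finite fn => 'n fn => 'n fn" where
 "conv u \<phi> x = (LEB y. u y * \<phi> (x - y))"

lemma cpt_integrable:
 fixes f :: "'n::finite fn"
 assumes "continuous_on UNIV f" "\<And>x. norm x > R ==> f x = 0"
 shows "integrable lebesgue f"
proof -
 have "integrable lborel (\<lambda>x. indicator (cball 0 R) x *\<^sub>R f x)"
  by (intro borel_integrable_compact compact_cball continuous_on_subset[OF assms(1)]) auto
 also have "(\<lambda>x. indicator (cball 0 R) x *\<^sub>R f x) = f"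
  using assms(2) by (auto simp: indicator_def fun_eq_iff)
 finally have "integrable lborel f" .
 moreover have "f \<in> borel_measurable lborel" using assms(1) by (simp add: borel_measurable_continuous_onI)
 ultimately show ?thesis by (simp add: integrable_completion)
qed

lemma cpt_L2:
 fixes f :: "'n::finite fn"
 assumes "continuous_on UNIV f" "\<And>x. norm x > R ==> f x = 0"
 shows "f \<in> L2_space"
proof (rule L2_spaceI)
 show "f \<in> borel_measurable lebesgue"
  using borel_measurable_integrable[OF cpt_integrable[OF assms]] .
 show "integrable lebesgue (\<lambda>x. (f x)\<^sup>2)"
  by (rule cpt_integrable[of _ R]) (auto intro!: continuous_intros assms)
qed

lemma test_continuous: "\<phi> \<in> \<D> ==> continuous_on S \<phi>"
 by (intro smooth_continuous test_smooth)

lemma test_L2: "\<phi> \<in> \<D> ==> \<phi> \<in> L2_space"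
 using cpt_L2 test_continuous unfolding test_functions_iff by metis

lemma test_integrable: "\<phi> \<in> \<D> ==> integrable lebesgue \<phi>"
 using cpt_integrable test_continuous unfolding test_functions_iff by metis

lemma test_shift: assumes "\<phi> \<in> \<D>" shows "(\<lambda>y. \<phi> (x - y)) \<in> \<D>"
 using test_affine[OF assms, of "-1" x] by simp

lemma iter_partial_shift:
 assumes "\<phi> \<in> \<D>"
 shows "iter_partial js (\<lambda>y. \<phi> (x - y)) = (\<lambda>y. (-1) ^ length js * iter_partial js \<phi> (x - y))"
 using iter_partial_affine[OF test_smooth[OF assms], of js "-1" x] by simp

text \<open>Heine-Cantor on the ball of radius R + 1. The margin 1 handles the remaining pairs: if
  one of two points closer than 1 lies outside that ball, both lie outside radius R, where
  \<open>f\<close> is 0.\<close>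

lemma cpt_uniform:
 fixes f :: "'n::finite fn"
 assumes f: "continuous_on UNIV f" "\<And>x. norm x > R ==> f x = 0" and e: "e > 0"
 shows "\<exists>d>0. \<forall>y y'. norm (y - y') < d --> \<bar>f y - f y'\<bar> < e"
proof -
 have "uniformly_continuous_on (cball 0 (R + 1)) f"
  by (intro compact_uniformly_continuous continuous_on_subset[OF f(1)]) auto
 then obtain d where d: "d > 0" "\<And>y y'. y \<in> cball 0 (R+1) ==> y' \<in> cball 0 (R+1) ==> dist y' y < d ==> dist (f y') (f y) < e"
  using e unfolding uniformly_continuous_on_def by metis
 have "\<bar>f y - f y'\<bar> < e" if "norm (y - y') < min d 1" for y y'
 proof (cases "norm y \<le> R + 1 \<and> norm y' \<le> R + 1")
  case True
  thus ?thesis using d(2)[of y' y] that by (auto simp: dist_norm dist_real_def)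
 next
  case False
  have "norm y \<le> norm y' + norm (y - y')" "norm y' \<le> norm y + norm (y - y')"
   using norm_triangle_sub[of y y'] norm_triangle_sub[of y' y] by (auto simp: norm_minus_commute)
  hence "norm y > R" "norm y' > R" using False that by auto
  thus ?thesis using f(2) e by simp
 qed
 thus ?thesis using d(1) by (intro exI[of _ "min d 1"]) auto
qed

text \<open>The mean value theorem along the segment, combined with uniform continuity of the
  partial derivatives, makes the first-order remainder small uniformly in the base point. That
  uniformity allows differentiation under the convolution integral.\<close>

lemma test_unif_diff:
 fixes \<phi> :: "'n::finite fn"
 assumes \<phi>: "\<phi> \<in> \<D>" and e: "e > 0"
 shows "\<exists>d>0. \<forall>y h. norm h < d --> \<bar>\<phi> (y + h) - \<phi> y - (\<Sum>i\<in>UNIV. h $ i * partial i \<phi> y)\<bar> \<le> e * norm h"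
proof -
 define e' where "e' = e / CARD('n)"
 have e': "e' > 0" using e by (simp add: e'_def)
 have "\<exists>d>0. \<forall>y y'. norm (y - y') < d --> \<bar>partial i \<phi> y - partial i \<phi> y'\<bar> < e'" for i
 proof -
  have t: "partial i \<phi> \<in> \<D>" using \<phi> by (rule test_partial)
  then obtain R where "\<And>x. norm x > R ==> partial i \<phi> x = 0" by (auto simp: test_functions_iff)
  from cpt_uniform[OF test_continuous[OF t] this e'] show ?thesis by blast
 qed
 then obtain d where d: "\<And>i. d i > 0" "\<And>i y y'. norm (y - y') < d i ==> \<bar>partial i \<phi> y - partial i \<phi> y'\<bar> < e'"
  by metis
 define D where "D = Min (range d)"
 have D: "D > 0" "\<And>i. D \<le> d i" using d(1) by (auto simp: D_def)
 show ?thesis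
 proof (intro exI conjI allI impI)
  fix y h :: "real^'n" assume h: "norm h < D"
  have "((\<lambda>s. \<phi> (y + s *\<^sub>R h)) has_real_derivative (\<Sum>i\<in>UNIV. h $ i * partial i \<phi> (y + s *\<^sub>R h))) (at s)" for s
   by (intro DERIV_line smooth_differentiable test_smooth \<phi>)
  from MVT2[of 0 1, OF _ this] obtain s where s: "0 < s" "s < 1"
   "\<phi> (y + h) - \<phi> y = (\<Sum>i\<in>UNIV. h $ i * partial i \<phi> (y + s *\<^sub>R h))" by auto
  have "\<bar>\<phi> (y + h) - \<phi> y - (\<Sum>i\<in>UNIV. h $ i * partial i \<phi> y)\<bar> =
    \<bar>\<Sum>i\<in>UNIV. h $ i * (partial i \<phi> (y + s *\<^sub>R h) - partial i \<phi> y)\<bar>"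
   by (simp add: s(3) right_diff_distrib sum_subtractf)
  also have "\<dots> \<le> (\<Sum>i\<in>(UNIV::'n set). norm h * e')"
  proof (rule order_trans[OF sum_abs sum_mono])
   fix i
   have "norm (s *\<^sub>R h) \<le> norm h" using s by (simp add: mult_left_le_one_le)
   hence "\<bar>partial i \<phi> (y + s *\<^sub>R h) - partial i \<phi> y\<bar> < e'"
    using h D(2)[of i] by (intro d(2)) simp
   thus "\<bar>h $ i * (partial i \<phi> (y + s *\<^sub>R h) - partial i \<phi> y)\<bar> \<le> norm h * e'"
    unfolding abs_mult by (intro mult_mono component_le_norm_cart) auto
  qed
  also have "\<dots> = e * norm h" by (simp add: e'_def)
  finally show "\<bar>\<phi> (y + h) - \<phi> y - (\<Sum>i\<in>UNIV. h $ i * partial i \<phi> y)\<bar> \<le> e * norm h" .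
 qed (use D in auto)
qed

lemma conv_integrable:
 assumes "u \<in> L2_space" "\<phi> \<in> \<D>"
 shows "integrable lebesgue (\<lambda>y. u y * \<phi> (x - y))"
 by (intro L2_mult_integrable assms test_L2 test_shift)

lemma indicator_L2: "indicator (cball a r) \<in> L2_space"
proof (rule L2_spaceI)
 show "integrable lebesgue (\<lambda>x. (indicator (cball a r) x)\<^sup>2 :: real)"
 proof -
  have "integrable lebesgue (indicator (cball a r) :: _ => real)"
   by (rule integrable_real_indicator) (use emeasure_lborel_cball_finite[of a r] in \<open>auto simp: less_top\<close>)
  moreover have "(\<lambda>x. (indicator (cball a r) x)\<^sup>2 :: real) = indicator (cball a r)"
   by (auto simp: indicator_def fun_eq_iff)
  ultimately show ?thesis by simp
 qed
qed (simp add: borel_measurable_indicator)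

lemma L2_loc_integrable:
 assumes "u \<in> L2_space" shows "integrable lebesgue (\<lambda>y. \<bar>u y\<bar> * indicator (cball a r) y)"
 using integrable_abs[OF L2_mult_integrable[OF assms indicator_L2[of a r]]] by (simp add: abs_mult)

lemma conv_has_derivative:
 fixes u :: "'n::finite fn"
 assumes u: "u \<in> L2_space" and \<phi>: "\<phi> \<in> \<D>"
 shows "(conv u \<phi> has_derivative (\<lambda>h. \<Sum>i\<in>UNIV. h $ i * conv u (partial i \<phi>) x)) (at x)"
 unfolding has_derivative_at_alt
proof (intro conjI allI impI)
 show "bounded_linear (\<lambda>h::real^'n. \<Sum>i\<in>UNIV. h $ i * conv u (partial i \<phi>) x)"
  by (intro bounded_linear_sum bounded_linear_mult_const bounded_linear_vec_nth)
 fix e :: real assume e: "e > 0"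
 from \<phi> obtain R where R: "\<And>x. norm x > R ==> \<phi> x = 0" by (auto simp: test_functions_iff)
 have "\<exists>R'. \<forall>i x. norm x > R' --> partial i \<phi> x = 0"
 proof -
  have "\<exists>R'. \<forall>x. norm x > R' --> partial i \<phi> x = 0" for i
   using test_partial[OF \<phi>, of i] by (auto simp: test_functions_iff)
  then obtain r where r: "\<And>i x. norm x > r i ==> partial i \<phi> x = 0" by metis
  have "r i \<le> Max (range r)" for i by simp
  thus ?thesis using r by (meson le_less_trans)
 qed
 then obtain R' where R': "\<And>i x. norm x > R' ==> partial i \<phi> x = 0" by blast
 \<comment> \<open>For |h| < 1 and |w| > S the points w and w + h lie outside the supports of \<phi>
   and of its partial derivatives. So the remainder sees \<open>u\<close> only on one fixed ball,
   where it is integrable.\<close>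
 define S where "S = max R R' + 1"
 define K where "K = (LEB y. \<bar>u y\<bar> * indicator (cball x S) y)"
 have K: "K \<ge> 0" unfolding K_def by (intro integral_nonneg_AE) auto
 have "e / (K + 1) > 0" using e K by simp
 from test_unif_diff[OF \<phi> this] obtain d where d: "d > 0"
  "\<And>y h. norm h < d ==> \<bar>\<phi> (y + h) - \<phi> y - (\<Sum>i\<in>UNIV. h $ i * partial i \<phi> y)\<bar> \<le> e / (K + 1) * norm h" by blast
 show "\<exists>d>0. \<forall>y. norm (y - x) < d -->
  norm (conv u \<phi> y - conv u \<phi> x - (\<Sum>i\<in>UNIV. (y - x) $ i * conv u (partial i \<phi>) x)) \<le> e * norm (y - x)"
 proof (intro exI conjI allI impI)
  fix y assume y: "norm (y - x) < min d 1"
  define h where "h = y - x"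
  let ?g = "\<lambda>w. \<phi> (w + h) - \<phi> w - (\<Sum>i\<in>UNIV. h $ i * partial i \<phi> w)"
  have g0: "?g w = 0" if "norm w > S" for w
  proof -
   have "norm w \<le> norm (w + h) + norm h" using norm_triangle_ineq4[of "w + h" h] by simp
   moreover have "norm h < 1" using y by (simp add: h_def)
   ultimately have "norm (w + h) > R" using that unfolding S_def by linarith
   moreover have "norm w > R" "norm w > R'" using that by (auto simp: S_def)
   ultimately show ?thesis using R R' by simp
  qed
  have i1: "integrable lebesgue (\<lambda>v. u v * \<phi> (y - v))" "integrable lebesgue (\<lambda>v. u v * \<phi> (x - v))"
   "\<And>i. integrable lebesgue (\<lambda>v. u v * partial i \<phi> (x - v))"
   by (intro conv_integrable u \<phi> test_partial)+
  have "conv u \<phi> y - conv u \<phi> x - (\<Sum>i\<in>UNIV. h $ i * conv u (partial i \<phi>) x)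
    = (LEB v. u v * \<phi> (y - v) - u v * \<phi> (x - v) - (\<Sum>i\<in>UNIV. h $ i * (u v * partial i \<phi> (x - v))))"
   unfolding conv_def using i1 by simp
  also have "\<dots> = (LEB v. u v * ?g (x - v))"
   by (intro Bochner_Integration.integral_cong)
    (auto simp: h_def algebra_simps sum_distrib_left)
  finally have eq: "conv u \<phi> y - conv u \<phi> x - (\<Sum>i\<in>UNIV. h $ i * conv u (partial i \<phi>) x) = (LEB v. u v * ?g (x - v))" .
  have "integrable lebesgue (\<lambda>v. u v * \<phi> (y - v) - u v * \<phi> (x - v) - (\<Sum>i\<in>UNIV. h $ i * (u v * partial i \<phi> (x - v))))"
   using i1 by simp
  also have "(\<lambda>v. u v * \<phi> (y - v) - u v * \<phi> (x - v) - (\<Sum>i\<in>UNIV. h $ i * (u v * partial i \<phi> (x - v))))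
   = (\<lambda>v. u v * ?g (x - v))"
   by (auto simp: h_def algebra_simps sum_distrib_left)
  finally have ig: "integrable lebesgue (\<lambda>v. u v * ?g (x - v))" .
  have "\<bar>LEB v. u v * ?g (x - v)\<bar> \<le> (LEB v. \<bar>u v * ?g (x - v)\<bar>)"
   by (rule integral_abs_bound)
  also have "\<dots> \<le> (LEB v. (e / (K + 1) * norm h) * (\<bar>u v\<bar> * indicator (cball x S) v))"
  proof (rule integral_mono)
   show "integrable lebesgue (\<lambda>v. \<bar>u v * ?g (x - v)\<bar>)" using ig by simp
   show "integrable lebesgue (\<lambda>v. (e / (K + 1) * norm h) * (\<bar>u v\<bar> * indicator (cball x S) v))"
    by (intro integrable_mult_right L2_loc_integrable u)
   fix v
   show "\<bar>u v * ?g (x - v)\<bar> \<le> (e / (K + 1) * norm h) * (\<bar>u v\<bar> * indicator (cball x S) v)"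
   proof (cases "v \<in> cball x S")
    case True
    have "\<bar>?g (x - v)\<bar> \<le> e / (K + 1) * norm h" by (rule d(2)) (use y in \<open>simp add: h_def\<close>)
    hence "\<bar>u v\<bar> * \<bar>?g (x - v)\<bar> \<le> \<bar>u v\<bar> * (e / (K + 1) * norm h)" by (rule mult_left_mono) simp
    thus ?thesis using True by (simp add: abs_mult mult.commute)
   next
    case False
    hence "?g (x - v) = 0" by (intro g0) (simp add: dist_norm)
    thus ?thesis using False by simp
   qed
  qed
  also have "\<dots> = (e / (K + 1) * norm h) * K" by (simp add: K_def)
  also have "\<dots> \<le> e * norm h"
   using e K by (simp add: field_simps mult_left_mono)
  finally show "norm (conv u \<phi> y - conv u \<phi> x - (\<Sum>i\<in>UNIV. (y - x) $ i * conv u (partial i \<phi>) x)) \<le> e * norm (y - x)"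
   using eq by (simp add: h_def)
 qed (use d in auto)
qed

lemma partial_conv:
 assumes "u \<in> L2_space" "\<phi> \<in> \<D>"
 shows "partial i (conv u \<phi>) = conv u (partial i \<phi>)"
 using partial_eqI[OF conv_has_derivative[OF assms]] by (auto simp: fun_eq_iff)

lemma iter_partial_conv:
 assumes "u \<in> L2_space" "\<phi> \<in> \<D>"
 shows "iter_partial js (conv u \<phi>) = conv u (iter_partial js \<phi>)"
 by (induction js) (auto simp: partial_conv test_iter_partial assms)

lemma smooth_conv:
 assumes "u \<in> L2_space" "\<phi> \<in> \<D>" shows "smooth (conv u \<phi>)"
proof (rule smooth_coinduct[of _ "conv u ` \<D>"])
 show "f differentiable at x" if "f \<in> conv u ` \<D>" for f x
  using that conv_has_derivative[OF assms(1)] by (auto simp: differentiable_def)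
 show "partial i f \<in> conv u ` \<D>" if "f \<in> conv u ` \<D>" for f i
  using that by (auto simp: partial_conv[OF assms(1)] intro!: imageI test_partial)
qed (use assms in auto)

lemma conv_cong: "AE x in lebesgue. u x = w x ==> conv u \<phi> = conv w \<phi>"
 unfolding conv_def fun_eq_iff by (auto intro!: integral_cong_lebesgue elim: eventually_mono)

lemma conv_diff:
 assumes "u \<in> L2_space" "w \<in> L2_space" "\<phi> \<in> \<D>"
 shows "conv (\<lambda>x. u x - w x) \<phi> x = conv u \<phi> x - conv w \<phi> x"
 using assms by (simp add: conv_def left_diff_distrib conv_integrable)

lemma lborel_reflect: "distr lborel borel (\<lambda>y. x - y) = (lborel :: 'a::euclidean_space measure)"
proof -
 have "lborel = density (distr lborel borel (\<lambda>y. x + (-1) *\<^sub>R y)) (\<lambda>_. \<bar>-1 :: real\<bar> ^ DIM('a))"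
  by (rule lborel_affine) simp
 thus ?thesis by (simp add: density_1)
qed

lemma nn_reflect:
 fixes f :: "'a::euclidean_space => ennreal"
 assumes [measurable]: "f \<in> borel_measurable borel"
 shows "(NNINT y. f (x - y)) = (NNINT y. f y)"
proof -
 have "(\<integral>\<^sup>+y. f y \<partial>distr lborel borel (\<lambda>y. x - y)) = (NNINT y. f (x - y))"
  by (rule nn_integral_distr) auto
 thus ?thesis by (simp add: lborel_reflect)
qed

lemma nn_translate:
 fixes f :: "'a::euclidean_space => ennreal"
 assumes [measurable]: "f \<in> borel_measurable borel"
 shows "(NNINT y. f (x + y)) = (NNINT y. f y)"
proof -
 have "(\<integral>\<^sup>+y. f y \<partial>distr lborel borel ((+) x)) = (NNINT y. f (x + y))"
  by (rule nn_integral_distr) auto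
 thus ?thesis by (simp add: lborel_distr_plus)
qed

lemma LINT_reflect:
 fixes f :: "'a::euclidean_space => real"
 assumes [measurable]: "f \<in> borel_measurable borel"
 shows "(LEB y. f (x - y)) = (LEB y. f y)"
proof -
 have "(LINT y|distr lborel borel (\<lambda>y. x - y). f y) = (LINT y|lborel. f (x - y))"
  by (rule integral_distr) auto
 thus ?thesis by (simp add: lborel_reflect integral_completion)
qed

lemma LINT_translate:
 fixes f :: "'a::euclidean_space => real"
 assumes [measurable]: "f \<in> borel_measurable borel"
 shows "(LEB y. f (y + x)) = (LEB y. f y)"
proof -
 have "(LINT y|distr lborel borel ((+) x). f y) = (LINT y|lborel. f (x + y))"
  by (rule integral_distr) auto
 thus ?thesis by (simp add: lborel_distr_plus integral_completion add.commute)
qed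

lemma continuous_lebesgue_measurable:
 fixes f :: "'a::euclidean_space => real"
 assumes "continuous_on UNIV f" shows "f \<in> borel_measurable lebesgue"
proof -
 have "f \<in> borel_measurable lborel" using assms by (simp add: borel_measurable_continuous_onI)
 thus ?thesis by (rule measurable_completion)
qed

text \<open>Young's inequality. With |\<phi>| written as a product of two square roots,
  Cauchy-Schwarz bounds the squared convolution pointwise by the L^1 norm of \<phi> times the
  convolution of u^2 with |\<phi>|, and Tonelli integrates the latter.\<close>

lemma conv_L2:
 fixes u :: "'n::finite fn"
 assumes u: "u \<in> L2_space" and \<phi>: "\<phi> \<in> \<D>"
 shows "conv u \<phi> \<in> L2_space" "L2norm (conv u \<phi>) \<le> L2norm u * (LEB x. \<bar>\<phi> x\<bar>)"
proof -
 obtain u' where u' [measurable]: "u' \<in> borel_measurable borel" and u'2: "u' \<in> L2_space"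
  and ae: "AE x in lebesgue. u x = u' x" using L2_borel_rep[OF u] by blast
 have [measurable]: "\<phi> \<in> borel_measurable borel"
  by (intro borel_measurable_continuous_onI test_continuous \<phi>)
 define K where "K = (LEB x. \<bar>\<phi> x\<bar>)"
 have K0: "K \<ge> 0" unfolding K_def by (intro integral_nonneg_AE) auto
 have Kn: "(NNINT x. ennreal \<bar>\<phi> x\<bar>) = ennreal K"
 proof -
  have "(NNLEB x. ennreal \<bar>\<phi> x\<bar>) = ennreal K"
   unfolding K_def by (intro nn_integral_eq_integral integrable_abs test_integrable \<phi>) auto
  thus ?thesis by (simp add: nn_integral_completion)
 qed
 have pt: "ennreal ((conv u' \<phi> x)\<^sup>2) \<le> ennreal K * (NNINT y. ennreal ((u' y)\<^sup>2) * ennreal \<bar>\<phi> (x - y)\<bar>)" for x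
 proof -
  have "ennreal \<bar>conv u' \<phi> x\<bar> \<le> (NNLEB y. ennreal \<bar>u' y * \<phi> (x - y)\<bar>)"
   unfolding conv_def using integral_norm_bound_ennreal[OF conv_integrable[OF u'2 \<phi>, of x]] by simp
  also have "\<dots> = (NNINT y. ennreal (\<bar>u' y\<bar> * sqrt \<bar>\<phi> (x - y)\<bar>) * ennreal (sqrt \<bar>\<phi> (x - y)\<bar>))"
   unfolding nn_integral_completion
   by (intro nn_integral_cong) (simp add: abs_mult mult.assoc flip: ennreal_mult)
  finally have "(ennreal \<bar>conv u' \<phi> x\<bar>)\<^sup>2 \<le> (NNINT y. ennreal (\<bar>u' y\<bar> * sqrt \<bar>\<phi> (x - y)\<bar>) * ennreal (sqrt \<bar>\<phi> (x - y)\<bar>))\<^sup>2"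
   by (rule power_mono) simp
  also have "\<dots> \<le> (NNINT y. (ennreal (\<bar>u' y\<bar> * sqrt \<bar>\<phi> (x - y)\<bar>))\<^sup>2) * (NNINT y. (ennreal (sqrt \<bar>\<phi> (x - y)\<bar>))\<^sup>2)"
   by (rule Cauchy_Schwarz_nn_integral) measurable
  also have "(NNINT y. (ennreal (\<bar>u' y\<bar> * sqrt \<bar>\<phi> (x - y)\<bar>))\<^sup>2) = (NNINT y. ennreal ((u' y)\<^sup>2) * ennreal \<bar>\<phi> (x - y)\<bar>)"
   by (intro nn_integral_cong) (simp add: ennreal_power power_mult_distrib flip: ennreal_mult)
  also have "(NNINT y. (ennreal (sqrt \<bar>\<phi> (x - y)\<bar>))\<^sup>2) = (NNINT y. ennreal \<bar>\<phi> (x - y)\<bar>)"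
   by (intro nn_integral_cong) (simp add: ennreal_power)
  also have "\<dots> = ennreal K" using nn_reflect[of "\<lambda>y. ennreal \<bar>\<phi> y\<bar>" x] Kn by simp
  finally show ?thesis by (simp add: ennreal_power mult.commute)
 qed
 have "(NNLEB x. ennreal ((conv u' \<phi> x)\<^sup>2)) \<le>
   (NNINT x. ennreal K * (NNINT y. ennreal ((u' y)\<^sup>2) * ennreal \<bar>\<phi> (x - y)\<bar>))"
  unfolding nn_integral_completion by (intro nn_integral_mono pt)
 also have "\<dots> = ennreal K * (NNINT x. (NNINT y. ennreal ((u' y)\<^sup>2) * ennreal \<bar>\<phi> (x - y)\<bar>))"
  by (rule nn_integral_cmult) measurable
 also have "(NNINT x. (NNINT y. ennreal ((u' y)\<^sup>2) * ennreal \<bar>\<phi> (x - y)\<bar>)) =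
   (NNINT y. (NNINT x. ennreal ((u' y)\<^sup>2) * ennreal \<bar>\<phi> (x - y)\<bar>))"
  by (rule lborel_pair.Fubini') measurable
 also have "\<dots> = (NNINT y. ennreal ((u' y)\<^sup>2) * ennreal K)"
 proof (intro nn_integral_cong)
  fix y
  have "(NNINT x. ennreal ((u' y)\<^sup>2) * ennreal \<bar>\<phi> (x - y)\<bar>) = ennreal ((u' y)\<^sup>2) * (NNINT x. ennreal \<bar>\<phi> (x - y)\<bar>)"
   by (rule nn_integral_cmult) measurable
  also have "(NNINT x. ennreal \<bar>\<phi> (x - y)\<bar>) = ennreal K"
   using nn_translate[of "\<lambda>x. ennreal \<bar>\<phi> x\<bar>" "-y"] Kn by simp
  finally show "(NNINT x. ennreal ((u' y)\<^sup>2) * ennreal \<bar>\<phi> (x - y)\<bar>) = ennreal ((u' y)\<^sup>2) * ennreal K" .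
 qed
 also have "\<dots> = ennreal ((L2norm u')\<^sup>2) * ennreal K"
  unfolding L2norm_nn[OF u'2, symmetric] nn_integral_completion by (rule nn_integral_multc) measurable
 also have "ennreal K * (ennreal ((L2norm u')\<^sup>2) * ennreal K) = ennreal ((L2norm u' * K)\<^sup>2)"
  using K0 by (simp add: power2_eq_square mult_ac flip: ennreal_mult)
 finally have le: "(NNLEB x. ennreal ((conv u' \<phi> x)\<^sup>2)) \<le> ennreal ((L2norm u' * K)\<^sup>2)" .
 have m: "conv u' \<phi> \<in> borel_measurable lebesgue"
  by (intro continuous_lebesgue_measurable smooth_continuous smooth_conv u'2 \<phi>)
 have "0 \<le> L2norm u' * K" using K0 by simp
 from L2_nnI[OF m le this] conv_cong[OF ae, of \<phi>] L2norm_cong_AE[OF ae]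
 show "conv u \<phi> \<in> L2_space" "L2norm (conv u \<phi>) \<le> L2norm u * (LEB x. \<bar>\<phi> x\<bar>)"
  by (simp_all add: K_def)
qed

section \<open>Mollifiers and approximation in L^2\<close>

definition moll :: "nat => 'n::finite fn" where
 "moll n x = inverse (LEB y. bump (real (Suc n) *\<^sub>R y :: real^'n)) * bump (real (Suc n) *\<^sub>R x)"

lemma test_bump_scaled: "(\<lambda>y. bump (real (Suc n) *\<^sub>R y)) \<in> \<D>"
 using test_affine[OF test_bump, of "real (Suc n)" 0] by simp

lemma bump_integral_pos: "(LEB y. bump (real (Suc n) *\<^sub>R y :: real^'n::finite)) > 0"
proof (rule ccontr)
 assume "\<not> ?thesis"
 moreover have "(LEB y. bump (real (Suc n) *\<^sub>R y :: real^'n)) \<ge> 0"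
  by (intro integral_nonneg_AE) (simp add: bump_nonneg)
 ultimately have "(LEB y. bump (real (Suc n) *\<^sub>R y :: real^'n)) = 0" by linarith
 hence "AE y in lebesgue. bump (real (Suc n) *\<^sub>R y :: real^'n) = 0"
  using integral_nonneg_eq_0_iff_AE[OF test_integrable[OF test_bump_scaled[where 'a='n and n=n]]] by (simp add: bump_nonneg)
 then obtain N where N: "N \<in> null_sets lebesgue" "{y. bump (real (Suc n) *\<^sub>R y :: real^'n) \<noteq> 0} \<subseteq> N"
  by (auto simp: eventually_ae_filter)
 have "ball 0 (1 / real (Suc n)) \<subseteq> N"
 proof
  fix y :: "real^'n" assume "y \<in> ball 0 (1 / real (Suc n))"
  hence "norm y < 1 / real (Suc n)" by simp
  hence "real (Suc n) * norm y < 1" by (subst (asm) pos_less_divide_eq) (auto simp: mult.commute)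
  hence "norm (real (Suc n) *\<^sub>R y) < 1" by (simp only: norm_scaleR abs_of_nat)
  from bump_pos[OF this] show "y \<in> N" using N(2) by force
 qed
 hence "negligible (ball (0::real^'n) (1 / real (Suc n)))"
  using N(1) null_sets_completion_subset by (auto simp: negligible_iff_null_sets)
 moreover have "ball (0::real^'n) (1 / real (Suc n)) \<noteq> {}" by simp
 ultimately show False using open_not_negligible[OF open_ball] by metis
qed

lemma test_moll: "moll n \<in> \<D>"
 unfolding moll_def[abs_def] by (intro test_cmult test_bump_scaled)

lemma moll_nonneg: "moll n x \<ge> 0"
 unfolding moll_def using bump_integral_pos[where 'n='a, of n] bump_nonneg
 by (intro mult_nonneg_nonneg) (auto intro: less_imp_le)

lemma moll_integral: "(LEB x. moll n x) = 1"
 unfolding moll_def using bump_integral_pos[where 'n='a, of n] by simp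

lemma moll_abs_integral: "(LEB x. \<bar>moll n x\<bar>) = 1"
 by (simp add: abs_of_nonneg moll_nonneg moll_integral)

lemma moll_eq_0: "norm x \<ge> 1 / real (Suc n) ==> moll n x = 0"
proof -
 assume "norm x \<ge> 1 / real (Suc n)"
 hence "real (Suc n) * norm x \<ge> 1" by (subst (asm) pos_divide_le_eq) (auto simp: mult.commute)
 hence "norm (real (Suc n) *\<^sub>R x) \<ge> 1" by (simp only: norm_scaleR abs_of_nat)
 thus ?thesis unfolding moll_def by (simp only: bump_eq_0 mult_zero_right)
qed

lemma moll_reflect_integral: "(LEB y. moll n (x - y)) = 1"
 by (subst LINT_reflect) (auto intro!: borel_measurable_continuous_onI test_continuous test_moll simp: moll_integral)

lemma conv_moll_le: "u \<in> L2_space ==> L2norm (conv u (moll n)) \<le> L2norm u"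
 using conv_L2(2)[OF _ test_moll, of u n] by (simp add: moll_abs_integral)

lemma L2norm_bounded_cpt:
 fixes f :: "'n::finite fn"
 assumes f: "f \<in> L2_space" and b: "\<And>x. \<bar>f x\<bar> \<le> e" and z: "\<And>x. norm x > R ==> f x = 0"
 shows "L2norm f \<le> e * L2norm (indicator (cball (0::real^'n) R))"
proof -
 have e: "e \<ge> 0" using b[of 0] by linarith
 have "(L2norm f)\<^sup>2 \<le> (LEB x. (e * indicator (cball (0::real^'n) R) x)\<^sup>2)"
  unfolding L2norm_sq
 proof (rule integral_mono)
  show "integrable lebesgue (\<lambda>x. (f x)\<^sup>2)" using f by (rule L2_integrable_sq)
  show "integrable lebesgue (\<lambda>x. (e * indicator (cball (0::real^'n) R) x)\<^sup>2)"
   by (rule L2_integrable_sq[OF L2_cmult[OF indicator_L2]])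
  fix x show "(f x)\<^sup>2 \<le> (e * indicator (cball 0 R) x)\<^sup>2"
   using b[of x] z[of x] e by (cases "norm x \<le> R") (auto simp: abs_le_square_iff[symmetric])
 qed
 also have "\<dots> = (e * L2norm (indicator (cball (0::real^'n) R)))\<^sup>2"
  by (simp add: power_mult_distrib L2norm_sq)
 finally show ?thesis by (rule power2_le_imp_le) (simp add: e)
qed

text \<open>Mollification averages \<open>g\<close> over a ball of radius 1/(n+1), so the error is
  uniformly small by uniform continuity; it is supported in the ball of radius R + 1, which converts
  the uniform bound into an L^2 bound.\<close>

lemma conv_moll_tendsto_cpt:
 fixes g :: "'n::finite fn"
 assumes g: "continuous_on UNIV g" "\<And>x. norm x > R ==> g x = 0"
 shows "(\<lambda>n. L2norm (\<lambda>x. conv g (moll n) x - g x)) \<longlonglongrightarrow> 0"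
proof (rule LIMSEQ_I)
 fix e :: real assume e: "e > 0"
 have g2: "g \<in> L2_space" using g by (rule cpt_L2)
 define V where "V = L2norm (indicator (cball (0::real^'n) (R + 1)))"
 define e' where "e' = e / (V + 1)"
 have V: "V \<ge> 0" by (simp add: V_def)
 hence e': "e' > 0" using e by (simp add: e'_def)
 from cpt_uniform[OF g e'] obtain d where d: "d > 0"
  "\<And>y y'. norm (y - y') < d ==> \<bar>g y - g y'\<bar> < e'" by blast
 obtain N where N: "1 / real (Suc N) < d" using d(1) nat_approx_posE by blast
 have "L2norm (\<lambda>x. conv g (moll n) x - g x) < e" if n: "n \<ge> N" for n
 proof -
  have r: "1 / real (Suc n) \<le> 1 / real (Suc N)" using n by (simp add: frac_le)
  have ig: "integrable lebesgue (\<lambda>y. moll n (x - y))" for x :: "real^'n"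
   by (intro test_integrable test_shift test_moll)
  have eq: "conv g (moll n) x - g x = (LEB y. (g y - g x) * moll n (x - y))" for x
  proof -
   have "g x = (LEB y. g x * moll n (x - y))" by (simp add: moll_reflect_integral)
   hence "conv g (moll n) x - g x = (LEB y. g y * moll n (x - y)) - (LEB y. g x * moll n (x - y))"
    by (simp add: conv_def)
   also have "\<dots> = (LEB y. (g y - g x) * moll n (x - y))"
    using conv_integrable[OF g2 test_moll] ig by (simp add: left_diff_distrib)
   finally show ?thesis .
  qed
  have b: "\<bar>conv g (moll n) x - g x\<bar> \<le> e'" for x
  proof -
   have i: "integrable lebesgue (\<lambda>y. (g y - g x) * moll n (x - y))"
    using conv_integrable[OF g2 test_moll] ig by (simp add: left_diff_distrib)
   have "\<bar>conv g (moll n) x - g x\<bar> \<le> (LEB y. \<bar>(g y - g x) * moll n (x - y)\<bar>)"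
    unfolding eq by (rule integral_abs_bound)
   also have "\<dots> \<le> (LEB y. e' * moll n (x - y))"
   proof (rule integral_mono)
    fix y
    show "\<bar>(g y - g x) * moll n (x - y)\<bar> \<le> e' * moll n (x - y)"
    proof (cases "norm (y - x) < d")
     case True
     thus ?thesis using d(2)[of y x] moll_nonneg[of n "x - y"]
      by (auto simp: abs_mult intro!: mult_right_mono)
    next
     case False
     hence "moll n (x - y) = 0" using N r by (intro moll_eq_0) (simp add: norm_minus_commute)
     thus ?thesis by simp
    qed
   qed (use i ig in auto)
   also have "\<dots> = e'" by (simp add: moll_reflect_integral)
   finally show ?thesis .
  qed
  have z: "conv g (moll n) x - g x = 0" if "norm x > R + 1" for x
  proof -
   have "(\<lambda>y. (g y - g x) * moll n (x - y)) = (\<lambda>y. 0)"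
   proof
    fix y
    show "(g y - g x) * moll n (x - y) = 0"
    proof (cases "norm y > R")
     case True
     thus ?thesis using g(2)[of y] g(2)[of x] that by simp
    next
     case False
     have "norm x \<le> norm y + norm (x - y)" using norm_triangle_sub by blast
     hence "1 \<le> norm (x - y)" using False that by linarith
     thus ?thesis by (subst moll_eq_0) (auto intro: order_trans[of _ 1])
    qed
   qed
   thus ?thesis unfolding eq by simp
  qed
  have "L2norm (\<lambda>x. conv g (moll n) x - g x) \<le> e' * V"
   unfolding V_def by (rule L2norm_bounded_cpt[OF L2_diff[OF conv_L2(1)[OF g2 test_moll] g2] b z])
  also have "\<dots> < e" using V e by (simp add: e'_def field_simps)
  finally show ?thesis .
 qed
 thus "\<exists>N. \<forall>n\<ge>N. norm (L2norm (\<lambda>x. conv g (moll n) x - g x) - 0) < e" by auto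
qed

lemma L2_dominated_tendsto:
 fixes f :: "nat => 'n::finite fn"
 assumes f: "\<And>n. f n \<in> borel_measurable lebesgue" and g: "g \<in> L2_space"
  and b: "\<And>n x. \<bar>f n x\<bar> \<le> g x" and lim: "AE x in lebesgue. (\<lambda>n. f n x) \<longlonglongrightarrow> 0"
 shows "(\<lambda>n. L2norm (f n)) \<longlonglongrightarrow> 0" "f n \<in> L2_space"
proof -
 have pw: "(f n x)\<^sup>2 \<le> (g x)\<^sup>2" for n x
  using abs_le_square_iff[THEN iffD1, OF order_trans[OF b abs_ge_self]] .
 have "(\<lambda>n. LEB x. (f n x)\<^sup>2) \<longlonglongrightarrow> (LINT x|(lebesgue :: (real^'n) measure). 0::real)"
 proof (rule integral_dominated_convergence)
  show "integrable lebesgue (\<lambda>x. (g x)\<^sup>2)" using g by (rule L2_integrable_sq)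
  show "AE x in lebesgue. (\<lambda>n. (f n x)\<^sup>2) \<longlonglongrightarrow> 0"
   using lim by eventually_elim (use tendsto_power[of _ 0 _ 2] in fastforce)
  show "AE x in lebesgue. norm ((f n x)\<^sup>2) \<le> (g x)\<^sup>2" for n
   using pw by simp
 qed (use f in auto)
 hence "(\<lambda>n. sqrt (LEB x. (f n x)\<^sup>2)) \<longlonglongrightarrow> sqrt 0" by (intro tendsto_real_sqrt) simp
 thus "(\<lambda>n. L2norm (f n)) \<longlonglongrightarrow> 0" by (simp add: L2norm_def)
 show "f n \<in> L2_space"
 proof (rule L2_spaceI[OF f])
  show "integrable lebesgue (\<lambda>x. (f n x)\<^sup>2)"
   by (rule Bochner_Integration.integrable_bound[OF L2_integrable_sq[OF g] borel_measurable_power[OF f]])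
    (simp add: pw)
 qed
qed

text \<open>\<open>u\<close> is first cut off in height and in space to \<open>t n\<close>.
  Continuous functions converging to \<open>t n\<close> almost everywhere are then clamped to height
  n and multiplied by the cutoff \<open>\<theta>\<close>, which provides the common bound for
  dominated convergence without disturbing the limit.\<close>

lemma L2_approx_continuous:
 fixes u :: "'n::finite fn"
 assumes u: "u \<in> L2_space" and e: "e > 0"
 shows "\<exists>g R. continuous_on UNIV g \<and> (\<forall>x. norm x > R --> g x = 0) \<and> L2norm (\<lambda>x. u x - g x) < e"
proof -
 define cl where "cl n s = max (- real n) (min (real n) s)" for n and s :: real
 have cl: "\<bar>cl n s\<bar> \<le> real n" "\<bar>s\<bar> \<le> real n ==> cl n s = s" "\<bar>s - cl n s\<bar> \<le> \<bar>s\<bar>" "cl n 0 = 0" for n s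
  by (auto simp: cl_def)
 define t where "t n x = cl n (u x) * indicator (ball 0 (real n)) x" for n x
 have tm: "t n \<in> borel_measurable lebesgue" for n
  unfolding t_def[abs_def] cl_def using L2_measurable[OF u]
  by (intro borel_measurable_times borel_measurable_max borel_measurable_min borel_measurable_const
    borel_measurable_indicator) auto
 have "(\<lambda>n. L2norm (\<lambda>x. u x - t n x)) \<longlonglongrightarrow> 0"
 proof (rule L2_dominated_tendsto(1)[of _ "\<lambda>x. \<bar>u x\<bar>"])
  show "(\<lambda>x. \<bar>u x\<bar>) \<in> L2_space" using u by (auto simp: L2_space_def)
  show "\<bar>u x - t n x\<bar> \<le> \<bar>u x\<bar>" for n x using cl(3) by (auto simp: t_def indicator_def)
  have "(\<lambda>n. u x - t n x) \<longlonglongrightarrow> 0" for x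
  proof (rule tendsto_eventually)
   obtain N :: nat where N: "max \<bar>u x\<bar> (norm x) < real N" using reals_Archimedean2 by blast
   show "\<forall>\<^sub>F n in sequentially. u x - t n x = 0"
    using eventually_ge_at_top[of N]
   proof eventually_elim
    case (elim n)
    hence "\<bar>u x\<bar> \<le> real n" "norm x < real n" using N by linarith+
    thus ?case using cl(2) by (simp add: t_def)
   qed
  qed
  thus "AE x in lebesgue. (\<lambda>n. u x - t n x) \<longlonglongrightarrow> 0" by simp
 qed (use tm L2_measurable[OF u] in auto)
 then obtain n where n: "L2norm (\<lambda>x. u x - t n x) < e / 2"
  using order_tendstoD(2)[of _ 0 sequentially "e/2"] e
  by (metis (no_types, lifting) eventually_sequentially half_gt_zero order_refl)
 have "t n measurable_on UNIV"
  using tm[of n] by (simp add: measurable_on_iff_borel_measurable lebesgue_on_UNIV_eq)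
 then obtain N g where N: "negligible N" and g: "\<And>m. continuous_on UNIV (g m)"
  "\<And>x. x \<notin> N ==> (\<lambda>m. g m x) \<longlonglongrightarrow> t n x"
  unfolding measurable_on_def by auto
 define \<theta> where "\<theta> x = max 0 (min 1 (real n + 1 - norm x))" for x :: "real^'n"
 have \<theta>: "0 \<le> \<theta> x" "\<theta> x \<le> 1" "norm x \<le> real n ==> \<theta> x = 1" "norm x \<ge> real n + 1 ==> \<theta> x = 0" for x
  by (auto simp: \<theta>_def)
 define G where "G m x = cl n (g m x) * \<theta> x" for m x
 have Gc: "continuous_on UNIV (G m)" for m
  unfolding G_def cl_def \<theta>_def by (intro continuous_intros g)
 have Gz: "G m x = 0" if "norm x > real n + 1" for m x using that \<theta>(4) by (simp add: G_def)
 have "(\<lambda>m. L2norm (\<lambda>x. t n x - G m x)) \<longlonglongrightarrow> 0"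
 proof (rule L2_dominated_tendsto(1)[of _ "\<lambda>x. (2 * real n) * indicator (cball 0 (real n + 1)) x"])
  show "(\<lambda>x. (2 * real n) * indicator (cball 0 (real n + 1)) x) \<in> L2_space"
   by (intro L2_cmult indicator_L2)
  show "\<bar>t n x - G m x\<bar> \<le> (2 * real n) * indicator (cball 0 (real n + 1)) x" for m x
  proof (cases "norm x \<le> real n + 1")
   case True
   have "\<bar>t n x\<bar> \<le> real n" using cl(1) by (auto simp: t_def indicator_def)
   moreover have "\<bar>G m x\<bar> \<le> real n * 1" unfolding G_def abs_mult
    using cl(1) \<theta> by (intro mult_mono) auto
   ultimately show ?thesis using True by simp
  next
   case False
   thus ?thesis using Gz[of x m] by (simp add: t_def)
  qed
  show "AE x in lebesgue. (\<lambda>m. t n x - G m x) \<longlonglongrightarrow> 0"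
  proof (rule AE_I')
   show "N \<in> null_sets lebesgue" using N by (simp add: negligible_iff_null_sets)
   have "(\<lambda>m. t n x - G m x) \<longlonglongrightarrow> 0" if "x \<notin> N" for x
   proof -
    have "(\<lambda>m. t n x - G m x) \<longlonglongrightarrow> t n x - cl n (t n x) * \<theta> x"
     unfolding G_def cl_def by (intro tendsto_intros g(2)[OF that])
    moreover have "cl n (t n x) * \<theta> x = t n x"
    proof (cases "norm x < real n")
     case True
     have "\<bar>t n x\<bar> \<le> real n" using cl(1) by (auto simp: t_def indicator_def)
     thus ?thesis using True cl(2) \<theta>(3)[of x] by simp
    next
     case False
     thus ?thesis using cl(4) by (simp add: t_def)
    qed
    ultimately show ?thesis by simp
   qed
   thus "{x \<in> space lebesgue. \<not> (\<lambda>m. t n x - G m x) \<longlonglongrightarrow> 0} \<subseteq> N" by blast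
  qed
 qed (use tm continuous_lebesgue_measurable[OF Gc] in auto)
 then obtain m where m: "L2norm (\<lambda>x. t n x - G m x) < e / 2"
  using order_tendstoD(2)[of _ 0 sequentially "e/2"] e
  by (metis (no_types, lifting) eventually_sequentially half_gt_zero order_refl)
 have "(\<lambda>x. u x - t n x) \<in> L2_space"
 \<comment> \<open>The sequence is 0 except at index n, so it trivially tends to 0, and the
   membership statement at index n is the one wanted.\<close>
 proof (rule L2_dominated_tendsto(2)[of "\<lambda>k x. if k = n then u x - t n x else 0" "\<lambda>x. \<bar>u x\<bar>" n, simplified])
  show "(\<lambda>x. \<bar>u x\<bar>) \<in> L2_space" using u by (auto simp: L2_space_def)
  show "\<bar>if k = n then u x - t n x else 0\<bar> \<le> \<bar>u x\<bar>" for k x using cl(3) by (auto simp: t_def indicator_def)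
  show "AE x in lebesgue. (\<lambda>k. if k = n then u x - t n x else 0) \<longlonglongrightarrow> 0"
  proof (intro AE_I2 tendsto_eventually)
   show "\<forall>\<^sub>F k in sequentially. (if k = n then u x - t n x else 0) = 0" for x
    using eventually_gt_at_top[of n] by eventually_elim auto
  qed
 qed (use tm L2_measurable[OF u] in auto)
 from L2_diff[OF u this] have t2: "t n \<in> L2_space" by simp
 have "L2norm (\<lambda>x. u x - G m x) < e"
  proof -
  have "G m \<in> L2_space" by (rule cpt_L2[OF Gc, of "real n + 1"]) (rule Gz)
  from L2norm_diff_triangle[OF u this t2] n m show ?thesis by linarith
 qed
 thus ?thesis using Gc Gz by blast
qed

lemma conv_moll_tendsto:
 assumes u: "u \<in> L2_space"
 shows "(\<lambda>n. L2norm (\<lambda>x. conv u (moll n) x - u x)) \<longlonglongrightarrow> 0"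
proof (rule LIMSEQ_I)
 fix e :: real assume e: "e > 0"
 hence "e / 3 > 0" by simp
 from L2_approx_continuous[OF u this] obtain g R where g: "continuous_on UNIV g"
  "\<And>x. norm x > R ==> g x = 0" "L2norm (\<lambda>x. u x - g x) < e / 3" by blast
 have g2: "g \<in> L2_space" using g cpt_L2 by blast
 from LIMSEQ_D[OF conv_moll_tendsto_cpt[OF g(1,2)] \<open>e / 3 > 0\<close>] obtain N where
  N: "\<And>n. n \<ge> N ==> L2norm (\<lambda>x. conv g (moll n) x - g x) < e / 3" by auto
 have "L2norm (\<lambda>x. conv u (moll n) x - u x) < e" if "n \<ge> N" for n
 proof -
  have c: "conv u (moll n) \<in> L2_space" "conv g (moll n) \<in> L2_space"
   by (intro conv_L2 u g2 test_moll)+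
  have "L2norm (\<lambda>x. conv u (moll n) x - u x) \<le>
   L2norm (\<lambda>x. conv u (moll n) x - conv g (moll n) x) + L2norm (\<lambda>x. conv g (moll n) x - u x)"
   by (rule L2norm_diff_triangle) fact+
  also have "L2norm (\<lambda>x. conv g (moll n) x - u x) \<le>
   L2norm (\<lambda>x. conv g (moll n) x - g x) + L2norm (\<lambda>x. g x - u x)"
   by (rule L2norm_diff_triangle) fact+
  also have "L2norm (\<lambda>x. conv u (moll n) x - conv g (moll n) x) \<le> L2norm (\<lambda>x. u x - g x)"
  proof -
   have "conv (\<lambda>x. u x - g x) (moll n) = (\<lambda>x. conv u (moll n) x - conv g (moll n) x)"
    by (rule ext) (rule conv_diff[OF u g2 test_moll])
   thus ?thesis using conv_moll_le[OF L2_diff[OF u g2], of n] by simp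
  qed
  finally show ?thesis using g(3) N[OF that] by (simp add: L2norm_diff_commute[of g u])
 qed
 thus "\<exists>N. \<forall>n\<ge>N. norm (L2norm (\<lambda>x. conv u (moll n) x - u x) - 0) < e" by auto
qed

text \<open>The values of the mollifications of \<open>u\<close> are its pairings with reflected and
  translated test functions, hence 0, while the mollifications converge to \<open>u\<close>.\<close>

lemma fundamental_lemma:
 assumes u: "u \<in> L2_space" and z: "\<And>\<phi>. \<phi> \<in> \<D> ==> (LEB x. u x * \<phi> x) = 0"
 shows "AE x in lebesgue. u x = 0"
proof -
 have "conv u (moll n) x = 0" for n x
  unfolding conv_def by (intro z test_shift test_moll)
 hence "(\<lambda>n. L2norm (\<lambda>x. (-1) * u x)) \<longlonglongrightarrow> 0" using conv_moll_tendsto[OF u] by simp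
 hence "L2norm u = 0" unfolding L2norm_cmult by (simp add: LIMSEQ_const_iff)
 thus ?thesis by (rule L2norm_eq_0[OF u])
qed

text \<open>Translation invariance makes 0 the integral of F(x + e) - F(x), which is the integral
  over t in [0,1] of the partial derivative at x + te. Fubini and translation invariance once more
  turn this into the integral of the partial derivative. Integrability thus takes the place of
  vanishing boundary terms.\<close>

lemma integral_partial_eq_0:
 fixes F :: "'n::finite fn"
 assumes F: "\<And>x. F differentiable (at x)" and c: "continuous_on UNIV (partial i F)"
  and iF: "integrable lebesgue F" and iD: "integrable lebesgue (partial i F)"
 shows "(LEB x. partial i F x) = 0"
proof -
 let ?e = "axis i 1 :: real^'n" and ?D = "partial i F"
 have Fc: "continuous_on UNIV F"
  by (meson F continuous_at_imp_continuous_on differentiable_imp_continuous_within)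
 have [measurable]: "F \<in> borel_measurable borel" "?D \<in> borel_measurable borel"
  using c Fc by (auto intro: borel_measurable_continuous_onI)
 have iF': "integrable lborel F" and iD': "integrable lborel ?D"
  using iF iD by (simp_all add: integrable_completion)
 define h where "h x t = indicator {0..1} t * ?D (x + t *\<^sub>R ?e)" for x and t :: real
 have [measurable]: "(\<lambda>(x, t). h x t) \<in> borel_measurable (borel \<Otimes>\<^sub>M borel)"
  unfolding h_def by measurable
 have ftc: "(LINT t|lborel. h x t) = F (x + ?e) - F x" for x
 proof -
  have "(LINT t|lborel. indicator {0..1} t *\<^sub>R ?D (x + t *\<^sub>R ?e)) = F (x + 1 *\<^sub>R ?e) - F (x + 0 *\<^sub>R ?e)"
  proof (rule integral_FTC_Icc[where F = "\<lambda>t. F (x + t *\<^sub>R ?e)"])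
   show "((\<lambda>t. F (x + t *\<^sub>R ?e)) has_vector_derivative ?D (x + t *\<^sub>R ?e)) (at t within {0..1})" for t
    using DERIV_axis[where f = F and x = x and s = t and i = i, OF F]
    unfolding has_real_derivative_iff_has_vector_derivative by (rule has_vector_derivative_at_within)
   show "continuous_on {0..1} (\<lambda>t. ?D (x + t *\<^sub>R ?e))"
    by (rule continuous_on_compose2[OF c]) (auto intro!: continuous_intros)
  qed simp
  thus ?thesis by (simp add: h_def)
 qed
 have tr: "integrable lborel (\<lambda>x. f (x + a))" "(LINT x|lborel. f (x + a)) = (LINT x|lborel. f x)"
  if f [measurable]: "f \<in> borel_measurable borel" and "integrable lborel f" for f :: "'n fn" and a
 proof -
  have "integrable (distr lborel borel ((+) a)) f = integrable lborel (\<lambda>x. f (a + x))"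
   by (rule integrable_distr_eq) auto
  thus "integrable lborel (\<lambda>x. f (x + a))" using that by (simp add: lborel_distr_plus add.commute)
  show "(LINT x|lborel. f (x + a)) = (LINT x|lborel. f x)"
   using LINT_translate[OF f, of a] by (simp add: integral_completion)
 qed
 have abs: "(NNINT x. NNINT t. ennreal (norm (h x t))) < \<infinity>"
 proof -
  have "(NNINT x. NNINT t. ennreal (norm (h x t))) =
    (NNINT t. NNINT x. ennreal (norm (h x t)))"
   by (rule lborel_pair.Fubini'[symmetric]) measurable
  also have "\<dots> = (NNINT t. indicator {0..1::real} t * (NNINT x. ennreal \<bar>?D x\<bar>))"
  proof (intro nn_integral_cong)
   fix t :: real
   have "(NNINT x. ennreal (norm (h x t))) = (NNINT x. indicator {0..1} t * ennreal \<bar>?D (t *\<^sub>R ?e + x)\<bar>)"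
    by (intro nn_integral_cong) (auto simp: h_def indicator_def add.commute)
   also have "\<dots> = indicator {0..1} t * (NNINT x. ennreal \<bar>?D (t *\<^sub>R ?e + x)\<bar>)"
    by (rule nn_integral_cmult) measurable
   also have "(NNINT x. ennreal \<bar>?D (t *\<^sub>R ?e + x)\<bar>) = (NNINT x. ennreal \<bar>?D x\<bar>)"
    by (rule nn_translate[of "\<lambda>x. ennreal \<bar>?D x\<bar>"]) measurable
   finally show "(NNINT x. ennreal (norm (h x t))) = indicator {0..1::real} t * (NNINT x. ennreal \<bar>?D x\<bar>)" .
  qed
  also have "\<dots> = (NNINT x. ennreal \<bar>?D x\<bar>)"
   by (simp add: nn_integral_multc)
  also have "\<dots> < \<infinity>" using iD' by (simp add: integrable_iff_bounded)
  finally show ?thesis .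
 qed
 have int2: "integrable (lborel \<Otimes>\<^sub>M lborel) (\<lambda>(x, t). h x t)"
 proof (rule integrableI_bounded)
  have "(\<integral>\<^sup>+p. ennreal (norm (case p of (x, t) => h x t)) \<partial>(lborel \<Otimes>\<^sub>M lborel)) =
   (NNINT x. NNINT t. ennreal (norm (h x t)))"
   by (subst lborel.nn_integral_fst[symmetric]) (auto simp: split_beta)
  thus "(\<integral>\<^sup>+p. ennreal (norm (case p of (x, t) => h x t)) \<partial>(lborel \<Otimes>\<^sub>M lborel)) < \<infinity>" using abs by simp
 qed measurable
 have "0 = (LINT x|lborel. F (x + ?e)) - (LINT x|lborel. F x)" using tr(2)[OF _ iF'] by simp
 also have "\<dots> = (LINT x|lborel. (LINT t|lborel. h x t))" using tr(1)[OF _ iF'] iF' by (simp add: ftc)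
 also have "\<dots> = (LINT t|lborel. (LINT x|lborel. h x t))"
  using lborel_pair.Fubini_integral[OF int2] by simp
 also have "\<dots> = (LINT t|lborel. indicator {0..1::real} t * (LINT x|lborel. ?D x))"
  unfolding h_def using tr(2)[OF _ iD'] by simp
 also have "\<dots> = (LINT x|lborel. ?D x)" by simp
 finally show ?thesis by (simp add: integral_completion)
qed

section \<open>Product estimates by Riesz potentials\<close>

text \<open>A pointwise density of the squared H^i norm. Running over lists instead of multi-indices
  repeats mixed derivatives; this changes only constants and spares the combinatorics in
  \<open>line_deriv\<close>.\<close>

definition Sq :: "nat => 'n::finite fn => 'n fn" where
 "Sq i a x = (\<Sum>js | length js \<le> i. (iter_partial js a x)\<^sup>2)"

text \<open>The l-th derivative in s of \<open>a\<close> along the line through x in direction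
  h.\<close>

definition line_deriv :: "'n::finite fn => real^'n => real^'n => nat => real => real" where
 "line_deriv a x h l s = (\<Sum>js | length js = l. prod_list (map (\<lambda>j. h $ j) js) * iter_partial js a (x + s *\<^sub>R h))"

lemma finite_lists_le: "finite {js :: 'n::finite list. length js \<le> i}"
 using finite_lists_length_le[of "UNIV :: 'n set" i] by simp

lemma Sq_nonneg: "Sq i a x \<ge> 0" by (auto simp: Sq_def intro: sum_nonneg)

lemma Sq_continuous: "smooth a ==> continuous_on S (Sq i a)"
 unfolding Sq_def by (intro continuous_intros smooth_continuous smooth_iter_partial)

lemma Sq_ge: "(a x)\<^sup>2 \<le> Sq i a x"
proof -
 have "(iter_partial [] a x)\<^sup>2 \<le> Sq i a x"
  unfolding Sq_def by (rule member_le_sum) (auto simp: finite_lists_le)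
 thus ?thesis by simp
qed

lemma DERIV_line_deriv:
 assumes a: "smooth a"
 shows "(line_deriv a x h l has_real_derivative line_deriv a x h (Suc l) s) (at s)"
proof -
 have "(line_deriv a x h l has_real_derivative
  (\<Sum>js | length js = l. prod_list (map (\<lambda>j. h $ j) js) *
    (\<Sum>i\<in>UNIV. h $ i * partial i (iter_partial js a) (x + s *\<^sub>R h)))) (at s)"
  unfolding line_deriv_def[abs_def]
  by (intro DERIV_sum DERIV_cmult DERIV_line smooth_differentiable smooth_iter_partial a)
 also have "(\<Sum>js | length js = l. prod_list (map (\<lambda>j. h $ j) js) *
    (\<Sum>i\<in>UNIV. h $ i * partial i (iter_partial js a) (x + s *\<^sub>R h))) =
   (\<Sum>(js, i)\<in>{js. length js = l} \<times> UNIV. prod_list (map (\<lambda>j. h $ j) (i # js)) * iter_partial (i # js) a (x + s *\<^sub>R h))"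
  by (simp add: sum.cartesian_product[symmetric] sum_distrib_left mult_ac)
 also have "\<dots> = line_deriv a x h (Suc l) s"
  unfolding line_deriv_def
  by (rule sum.reindex_bij_witness[where i = "\<lambda>js. (tl js, hd js)" and j = "\<lambda>(js, i). i # js"])
   (auto simp: length_Suc_conv)
 finally show ?thesis .
qed

text \<open>Taylor's formula based at the far end: \<open>W m s\<close> is the Taylor polynomial at
  the point x + sh, evaluated at x. Its s-derivative telescopes to \<open>W'\<close>,
  \<open>W m 0\<close> is a(x), and \<open>W m 1\<close> contains only values at x + h. The factor
  s^m in the remainder counteracts the concentration at x when h is averaged later.\<close>

lemma taylor_line:
 assumes a: "smooth a"
 shows "ennreal \<bar>a x\<bar> \<le> ennreal (\<Sum>l\<le>m. \<bar>line_deriv a x h l 1\<bar>) +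
  (NNINT s. (if 0 < s \<and> s \<le> 1 then ennreal (s ^ m * \<bar>line_deriv a x h (Suc m) s\<bar>) else 0))"
proof -
 let ?D = "line_deriv a x h"
 define W where "W m s = (\<Sum>l\<le>m. (- s) ^ l / fact l * ?D l s)" for m s
 define W' where "W' m s = (- s) ^ m / fact m * ?D (Suc m) s" for m s
 have W: "(W m has_real_derivative W' m s) (at s)" for s
 proof (induction m)
  case 0
  show ?case unfolding W_def[abs_def] W'_def using DERIV_line_deriv[OF a] by simp
 next
  case (Suc m)
  have "((\<lambda>s. (- s) ^ Suc m / fact (Suc m)) has_real_derivative - ((- s) ^ m / fact m)) (at s)"
  proof -
   have "((\<lambda>s. (- s) ^ Suc m) has_real_derivative - (real (Suc m) * (- s) ^ m)) (at s)"
    by (rule DERIV_cong, rule DERIV_power_Suc[OF DERIV_minus[OF DERIV_ident]]) simp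
   from DERIV_cdivide[OF this, of "fact (Suc m)"] show ?thesis by simp
  qed
  from DERIV_add[OF Suc DERIV_mult[OF this DERIV_line_deriv[OF a, of x h "Suc m" s]]]
  moreover have "(\<lambda>s. W m s + (- s) ^ Suc m / fact (Suc m) * ?D (Suc m) s) = W (Suc m)"
   by (simp add: W_def fun_eq_iff del: power_Suc fact_Suc)
  moreover have "W' m s + (- ((- s) ^ m / fact m) * ?D (Suc m) s + ?D (Suc (Suc m)) s * ((- s) ^ Suc m / fact (Suc m))) = W' (Suc m) s"
   by (simp add: W'_def del: power_Suc fact_Suc)
  ultimately show ?case by simp
 qed
 have Dc: "continuous_on {0..1} (?D l)" for l
  by (meson DERIV_line_deriv[OF a] DERIV_isCont continuous_at_imp_continuous_on)
 have cW': "continuous_on {0..1} (W' m)"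
  unfolding W'_def[abs_def] by (intro continuous_intros Dc) auto
 have i: "(LINT s|lborel. indicator {0..1} s *\<^sub>R W' m s) = W m 1 - W m 0"
  by (rule integral_FTC_Icc)
   (use W cW' in \<open>auto intro: has_vector_derivative_at_within simp: has_real_derivative_iff_has_vector_derivative\<close>)
 have ii: "integrable lborel (\<lambda>s. indicator {0..1} s *\<^sub>R W' m s)"
  by (intro borel_integrable_compact cW') auto
 have "{..m} = insert 0 {1..m}" by auto
 hence "W m 0 = ?D 0 0" by (simp add: W_def power_0_left sum.delta)
 also have "?D 0 0 = a x" by (simp add: line_deriv_def)
 finally have W0: "W m 0 = a x" .
 have W1: "\<bar>W m 1\<bar> \<le> (\<Sum>l\<le>m. \<bar>?D l 1\<bar>)"
  unfolding W_def
 proof (rule order_trans[OF sum_abs sum_mono])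
  fix l
  have "\<bar>(- 1) ^ l / fact l * ?D l 1\<bar> = (1 / fact l) * \<bar>?D l 1\<bar>" by (simp add: abs_mult power_abs)
  also have "\<dots> \<le> 1 * \<bar>?D l 1\<bar>" by (intro mult_right_mono) (auto simp: field_simps)
  finally show "\<bar>(- 1) ^ l / fact l * ?D l 1\<bar> \<le> \<bar>?D l 1\<bar>" by simp
 qed
 have "\<bar>a x\<bar> \<le> \<bar>W m 1\<bar> + \<bar>LINT s|lborel. indicator {0..1} s *\<^sub>R W' m s\<bar>"
  unfolding i using W0 by linarith
 hence "ennreal \<bar>a x\<bar> \<le> ennreal \<bar>W m 1\<bar> + ennreal \<bar>LINT s|lborel. indicator {0..1} s *\<^sub>R W' m s\<bar>"
  by (simp flip: ennreal_plus add: ennreal_leI)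
 also have "\<dots> \<le> ennreal (\<Sum>l\<le>m. \<bar>?D l 1\<bar>) +
  (NNINT s. (if 0 < s \<and> s \<le> 1 then ennreal (s ^ m * \<bar>?D (Suc m) s\<bar>) else 0))"
 proof (rule add_mono)
  show "ennreal \<bar>W m 1\<bar> \<le> ennreal (\<Sum>l\<le>m. \<bar>?D l 1\<bar>)" using W1 by (rule ennreal_leI)
  have "ennreal \<bar>LINT s|lborel. indicator {0..1} s *\<^sub>R W' m s\<bar> \<le> (NNINT s. ennreal (norm (indicator {0..1} s *\<^sub>R W' m s)))"
   using integral_norm_bound_ennreal[OF ii] by simp
  also have "\<dots> \<le> (NNINT s. (if 0 < s \<and> s \<le> 1 then ennreal (s ^ m * \<bar>?D (Suc m) s\<bar>) else 0))"
  proof (rule nn_integral_mono_AE)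
   have "AE s in lborel. s \<noteq> (0::real)" by (rule AE_lborel_singleton)
   thus "AE s in lborel. ennreal (norm (indicator {0..1} s *\<^sub>R W' m s)) \<le>
     (if 0 < s \<and> s \<le> 1 then ennreal (s ^ m * \<bar>?D (Suc m) s\<bar>) else 0)"
   proof eventually_elim
    case (elim s)
    show ?case
    proof (cases "0 < s \<and> s \<le> 1")
     case True
     hence "\<bar>W' m s\<bar> = (1 / fact m) * (s ^ m * \<bar>?D (Suc m) s\<bar>)"
      by (simp add: W'_def abs_mult power_abs)
     also have "\<dots> \<le> 1 * (s ^ m * \<bar>?D (Suc m) s\<bar>)"
      using True by (intro mult_right_mono) (auto simp: field_simps)
     finally show ?thesis using True by (simp add: ennreal_leI)
    next
     case False
     thus ?thesis using elim by (auto simp: indicator_def)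
    qed
   qed
  qed
  finally show "ennreal \<bar>LINT s|lborel. indicator {0..1} s *\<^sub>R W' m s\<bar> \<le>
   (NNINT s. (if 0 < s \<and> s \<le> 1 then ennreal (s ^ m * \<bar>?D (Suc m) s\<bar>) else 0))" .
 qed
 finally show ?thesis .
qed

lemma line_deriv_sq_le:
 fixes a :: "'n::finite fn"
 assumes h: "norm h \<le> 1" and l: "l \<le> i"
 shows "(line_deriv a x h l s)\<^sup>2 \<le> real (card {js::'n list. length js \<le> i}) * Sq i a (x + s *\<^sub>R h)"
proof -
 let ?L = "{js::'n list. length js = l}"
 have p: "\<bar>prod_list (map (\<lambda>j. h $ j) js)\<bar> \<le> 1" for js
 proof (induction js)
  case (Cons j js)
  have "\<bar>h $ j\<bar> \<le> 1" using h component_le_norm_cart order_trans by blast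
  hence "\<bar>h $ j\<bar> * \<bar>prod_list (map (\<lambda>j. h $ j) js)\<bar> \<le> 1 * 1" using Cons by (intro mult_mono) auto
  thus ?case by (simp add: abs_mult)
 qed simp
 have "(line_deriv a x h l s)\<^sup>2 \<le> (\<Sum>js\<in>?L. (prod_list (map (\<lambda>j. h $ j) js) * iter_partial js a (x + s *\<^sub>R h))\<^sup>2) * card ?L"
  unfolding line_deriv_def by (rule sum_squared_le_sum_of_squares)
 also have "\<dots> \<le> Sq i a (x + s *\<^sub>R h) * card {js::'n list. length js \<le> i}"
 proof (rule mult_mono)
  have "(\<Sum>js\<in>?L. (prod_list (map (\<lambda>j. h $ j) js) * iter_partial js a (x + s *\<^sub>R h))\<^sup>2) \<le>
    (\<Sum>js\<in>?L. (iter_partial js a (x + s *\<^sub>R h))\<^sup>2)"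
  proof (rule sum_mono)
   fix js
   have "(prod_list (map (\<lambda>j. h $ j) js))\<^sup>2 \<le> 1" using p[of js] abs_square_le_1 by blast
   thus "(prod_list (map (\<lambda>j. h $ j) js) * iter_partial js a (x + s *\<^sub>R h))\<^sup>2 \<le> (iter_partial js a (x + s *\<^sub>R h))\<^sup>2"
    unfolding power_mult_distrib by (intro mult_left_le_one_le) auto
  qed
  also have "\<dots> \<le> Sq i a (x + s *\<^sub>R h)"
   unfolding Sq_def using l by (intro sum_mono2 finite_lists_le) auto
  finally show "(\<Sum>js\<in>?L. (prod_list (map (\<lambda>j. h $ j) js) * iter_partial js a (x + s *\<^sub>R h))\<^sup>2) \<le> Sq i a (x + s *\<^sub>R h)" .
  show "real (card ?L) \<le> real (card {js::'n list. length js \<le> i})"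
   using l by (intro of_nat_mono card_mono finite_lists_le) auto
 qed (auto simp: Sq_nonneg)
 finally show ?thesis by (simp add: mult.commute)
qed

section \<open>Riesz kernels and potentials\<close>

lemma nn_powr:
 assumes "a > -1" "c \<ge> 0"
 shows "(NNINT s. (if 0 < s \<and> s \<le> c then ennreal (s powr a) else 0)) = ennreal (c powr (a + 1) / (a + 1))"
proof -
 have "(NNINT s. indicator {0..c} s * ennreal (s powr a)) = ennreal (c powr (a + 1) / (a + 1))"
 proof -
  have "indicator {0..c} s * ennreal (s powr a) = ennreal (indicator {0..c} s * s powr a)" for s
   by (auto simp: indicator_def)
  thus ?thesis
   using nn_integral_has_integral_lebesgue[OF _ has_integral_powr_from_0[OF assms]] by simp
 qed
 moreover have "indicator {0..c} s * ennreal (s powr a) = (if 0 < s \<and> s \<le> c then ennreal (s powr a) else 0)" for s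
  by (auto simp: indicator_def)
 ultimately show ?thesis by simp
qed

lemma nn_scale:
 fixes f :: "'a::euclidean_space => ennreal"
 assumes [measurable]: "f \<in> borel_measurable borel" and c: "c > 0"
 shows "(NNINT y. f (c *\<^sub>R y)) = ennreal (c powr (- real DIM('a))) * (NNINT y. f y)"
proof -
 have eq: "lborel = density (distr lborel borel (\<lambda>x. 0 + c *\<^sub>R x)) (\<lambda>_::'a. ennreal (\<bar>c\<bar> ^ DIM('a)))"
  using c by (intro lborel_affine) simp
 have "(NNINT y. f y) = (\<integral>\<^sup>+y. ennreal (c ^ DIM('a)) * f y \<partial>distr lborel borel (\<lambda>x. c *\<^sub>R x))"
  by (subst eq) (use c in \<open>simp add: nn_integral_density\<close>)
 also have "\<dots> = ennreal (c ^ DIM('a)) * (NNINT y. f (c *\<^sub>R y))"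
  by (simp add: nn_integral_distr nn_integral_cmult)
 finally have "ennreal (c powr (- real DIM('a))) * (NNINT y. f y) =
   (ennreal (c powr (- real DIM('a))) * ennreal (c ^ DIM('a))) * (NNINT y. f (c *\<^sub>R y))"
  by (simp add: mult.assoc)
 also have "ennreal (c powr (- real DIM('a))) * ennreal (c ^ DIM('a)) = 1"
  using c by (simp add: powr_minus powr_realpow flip: ennreal_mult)
 finally show ?thesis by simp
qed

text \<open>The Riesz kernel cut off to the unit ball. As 0 to any real power under
  \<open>powr\<close> is 0, its value at the origin is 0 and not infinite; estimates that need a
  lower bound therefore exclude the origin as a null set.\<close>

definition ker :: "real => real^'n::finite => ennreal" where
 "ker p y = (if norm y \<le> 1 then ennreal (norm y powr (- p)) else 0)"

lemma ker_measurable [measurable]: "ker p \<in> borel_measurable borel"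
 unfolding ker_def[abs_def] by measurable

text \<open>A layer-cake argument in place of polar coordinates: |y|^-r is at most a constant times
  the integral of s^(-r-1) over s between |y| and 2|y|. Exchanging the integrals leaves the volume
  s^d V of a ball and the integral of s^(d-r-1) over (0,2].\<close>

lemma ker_finite:
 assumes r: "r < real CARD('n)" "0 \<le> r"
 shows "(NNINT y. ker r (y::real^'n::finite)) < \<infinity>"
proof -
 let ?d = "real CARD('n)"
 define V where "V = (NNINT y. (if norm (y::real^'n) \<le> 1 then 1 else 0))"
 have V: "V < \<infinity>"
 proof -
  have "V = (NNINT y. indicator (cball 0 1) (y::real^'n))"
   unfolding V_def by (intro nn_integral_cong) (auto simp: indicator_def)
  also have "\<dots> = emeasure lborel (cball (0::real^'n) 1)" by simp
  also have "\<dots> < \<infinity>" by (rule emeasure_lborel_cball_finite)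
  finally show ?thesis .
 qed
 have vol: "(NNINT y. (if norm (y::real^'n) \<le> s then 1 else 0)) = ennreal (s powr ?d) * V" if s: "s > 0" for s
 proof -
  have "(NNINT y. (if norm (inverse s *\<^sub>R (y::real^'n)) \<le> 1 then 1 else 0)) =
    ennreal (inverse s powr (- ?d)) * V"
   unfolding V_def using s by (subst nn_scale[of "\<lambda>y. if norm y \<le> 1 then 1 else 0"]) auto
  moreover have "inverse s powr (- ?d) = s powr ?d" using s by (simp add: powr_minus inverse_powr)
  moreover have "norm (inverse s *\<^sub>R y) \<le> 1 \<longleftrightarrow> norm y \<le> s" for y :: "real^'n"
   using s by (simp add: field_simps)
  ultimately show ?thesis by simp
 qed
 define q where "q y s = (if 0 < s \<and> s \<le> 2 then (if norm y \<le> s then ennreal (2 powr (r + 1) * s powr (- r - 1)) else 0) else 0)"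
  for y :: "real^'n" and s :: real
 have [measurable]: "(\<lambda>(y, s). q y s) \<in> borel_measurable (borel \<Otimes>\<^sub>M borel)"
  unfolding q_def by measurable
 have pt: "ker r y \<le> (NNINT s. q y s)" if y: "y \<noteq> 0" for y :: "real^'n"
 proof (cases "norm y \<le> 1")
  case True
  let ?t = "norm y"
  have t: "?t > 0" using y by simp
  have "ker r y = ennreal (?t powr (- r - 1)) * ennreal ?t"
   using True t by (simp add: ker_def powr_diff flip: ennreal_mult)
  also have "\<dots> = (NNINT s. ennreal (?t powr (- r - 1)) * indicator {?t..2 * ?t} s)"
   by (simp add: nn_integral_cmult)
  also have "\<dots> \<le> (NNINT s. q y s)"
  proof (rule nn_integral_mono)
   fix s
   show "ennreal (?t powr (- r - 1)) * indicator {?t..2 * ?t} s \<le> q y s"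
   proof (cases "s \<in> {?t..2 * ?t}")
    case True
    hence s1: "?t \<le> s" "s \<le> 2 * ?t" by auto
    hence s: "0 < s" "s \<le> 2" "?t \<le> s" "s \<le> 2 * ?t" using t \<open>norm y \<le> 1\<close> by linarith+
    have "(2 * ?t) powr (- r - 1) \<le> s powr (- r - 1)"
     using s r by (intro powr_mono2') auto
    hence "2 powr (r + 1) * (2 powr (- r - 1) * ?t powr (- r - 1)) \<le> 2 powr (r + 1) * s powr (- r - 1)"
     by (intro mult_left_mono) (simp_all add: powr_mult)
    moreover have "2 powr (r + 1) * (2 powr (- r - 1)) = (1::real)"
     by (simp flip: powr_add)
    ultimately have "?t powr (- r - 1) \<le> 2 powr (r + 1) * s powr (- r - 1)"
     by (simp add: mult.assoc[symmetric])
    thus ?thesis using s True by (simp add: q_def ennreal_leI)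
   qed simp
  qed
  finally show ?thesis .
 qed (simp add: ker_def)
 have "(NNINT y. ker r (y::real^'n)) \<le> (NNINT y. NNINT s. q y s)"
 proof (rule nn_integral_mono_AE)
  have "AE y in lborel. y \<noteq> (0::real^'n)" by (rule AE_lborel_singleton)
  thus "AE y in lborel. ker r (y::real^'n) \<le> (NNINT s. q y s)"
   by eventually_elim (rule pt)
 qed
 also have "\<dots> = (NNINT s. NNINT y. q y s)"
  by (rule lborel_pair.Fubini'[symmetric]) measurable
 also have "\<dots> = (NNINT s. (if 0 < s \<and> s \<le> 2 then ennreal (s powr (?d - r - 1)) else 0) * (ennreal (2 powr (r + 1)) * V))"
 proof (rule nn_integral_cong)
  fix s :: real
  show "(NNINT y. q y s) = (if 0 < s \<and> s \<le> 2 then ennreal (s powr (?d - r - 1)) else 0) * (ennreal (2 powr (r + 1)) * V)"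
  proof (cases "0 < s \<and> s \<le> 2")
   case True
   hence "(NNINT y. q y s) = (NNINT y. ennreal (2 powr (r + 1) * s powr (- r - 1)) * (if norm (y::real^'n) \<le> s then 1 else 0))"
    by (intro nn_integral_cong) (auto simp: q_def)
   also have "\<dots> = ennreal (2 powr (r + 1) * s powr (- r - 1)) * (ennreal (s powr ?d) * V)"
    using True by (simp add: nn_integral_cmult vol)
   also have "\<dots> = ennreal (s powr (?d + (- r - 1))) * (ennreal (2 powr (r + 1)) * V)"
    by (simp add: ennreal_mult powr_add mult_ac)
   finally show ?thesis using True by (simp add: algebra_simps)
  qed (auto simp: q_def)
 qed
 also have "\<dots> = ennreal (2 powr (?d - r) / (?d - r)) * (ennreal (2 powr (r + 1)) * V)"
  using nn_powr[of "?d - r - 1" 2] r by (simp add: nn_integral_multc)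
 also have "\<dots> < \<infinity>" using V by (simp add: ennreal_mult_less_top)
 finally show ?thesis .
qed

lemma ennreal_add_sq_le: "((x::ennreal) + y)\<^sup>2 \<le> 2 * x\<^sup>2 + 2 * y\<^sup>2"
proof (cases "x = top \<or> y = top")
 case True
 hence "2 * x\<^sup>2 + 2 * y\<^sup>2 = top"
  by (auto simp: power2_eq_square ennreal_mult_eq_top_iff)
 thus ?thesis by (metis top_greatest)
next
 case False
 then obtain a b where ab: "x = ennreal a" "y = ennreal b" "a \<ge> 0" "b \<ge> 0"
  by (metis ennreal_cases)
 have "(a + b)\<^sup>2 \<le> 2 * a\<^sup>2 + 2 * b\<^sup>2"
  using sum_squares_bound[of a b] by (simp add: power2_sum)
 hence "ennreal ((a + b)\<^sup>2) \<le> ennreal (2 * a\<^sup>2 + 2 * b\<^sup>2)" by (rule ennreal_leI)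
 moreover have "ennreal (2 * a\<^sup>2 + 2 * b\<^sup>2) = 2 * x\<^sup>2 + 2 * y\<^sup>2"
  using ab by (simp add: ennreal_mult ennreal_power)
 moreover have "(x + y)\<^sup>2 = ennreal ((a + b)\<^sup>2)"
  using ab by (simp add: ennreal_power flip: ennreal_plus)
 ultimately show ?thesis by simp
qed

text \<open>In the Taylor remainder s^m is split as s^((\<tau>-1)/2) times s^(m+(1-\<tau>)/2). The
  square of the first factor has integral 1/\<tau>, so Cauchy-Schwarz gives a bound that is linear
  in \<open>Sq\<close>, at the price of \<tau> in the exponent.\<close>

lemma pointwise_bound_line:
 fixes a :: "'n::finite fn" and m :: nat
 assumes a: "smooth a" and h: "norm h \<le> 1" and \<tau>: "\<tau> > 0"
 defines "c \<equiv> real (card {js::'n list. length js \<le> Suc m})"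
 shows "ennreal ((a x)\<^sup>2) \<le> ennreal (2 * (real (Suc m))\<^sup>2 * c) * ennreal (Sq (Suc m) a (x + h)) +
  ennreal (2 * c / \<tau>) * (NNINT s. (if 0 < s \<and> s \<le> 1 then ennreal (s powr (2 * real m + 1 - \<tau>)) * ennreal (Sq (Suc m) a (x + s *\<^sub>R h)) else 0))"
proof -
 let ?D = "line_deriv a x h" and ?A = "Sq (Suc m) a"
 define J where "J = (NNINT s. (if 0 < s \<and> s \<le> 1 then ennreal (s ^ m * \<bar>?D (Suc m) s\<bar>) else 0))"
 define S where "S = (\<Sum>l\<le>m. \<bar>?D l 1\<bar>)"
 have c: "c \<ge> 0" by (simp add: c_def)
 have Dc: "continuous_on UNIV (?D l)" for l
  by (meson DERIV_line_deriv[OF a] DERIV_isCont continuous_at_imp_continuous_on)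
 have [measurable]: "?D l \<in> borel_measurable borel" for l
  using Dc by (rule borel_measurable_continuous_onI)
 have Ac: "continuous_on UNIV (\<lambda>s. ?A (x + s *\<^sub>R h))"
  by (rule continuous_on_compose2[OF Sq_continuous[OF a, of UNIV]]) (auto intro!: continuous_intros)
 have [measurable]: "(\<lambda>s. ?A (x + s *\<^sub>R h)) \<in> borel_measurable borel"
  using Ac by (rule borel_measurable_continuous_onI)
 have "S\<^sup>2 \<le> (\<Sum>l\<le>m. \<bar>?D l 1\<bar>\<^sup>2) * card {..m}"
  unfolding S_def by (rule sum_squared_le_sum_of_squares)
 also have "\<dots> \<le> (\<Sum>l\<le>m. c * ?A (x + h)) * card {..m}"
  using line_deriv_sq_le[OF h, of _ "Suc m" a x 1]
  by (intro mult_right_mono sum_mono) (auto simp: c_def)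
 also have "\<dots> = (real (Suc m))\<^sup>2 * c * ?A (x + h)" by (simp add: power2_eq_square)
 finally have S: "S\<^sup>2 \<le> (real (Suc m))\<^sup>2 * c * ?A (x + h)" .
 define I where "I = (NNINT s. (if 0 < s \<and> s \<le> 1 then ennreal (s powr (2 * real m + 1 - \<tau>)) * ennreal (?A (x + s *\<^sub>R h)) else 0))"
 define f where "f s = (if 0 < s \<and> s \<le> 1 then ennreal (s powr ((\<tau> - 1) / 2)) else 0)" for s
 define g where "g s = (if 0 < s \<and> s \<le> 1 then ennreal (s powr (real m + (1 - \<tau>) / 2) * \<bar>?D (Suc m) s\<bar>) else 0)" for s
 have "J = (NNINT s. f s * g s)"
  unfolding J_def
 proof (rule nn_integral_cong)
  fix s :: real
  show "(if 0 < s \<and> s \<le> 1 then ennreal (s ^ m * \<bar>?D (Suc m) s\<bar>) else 0) = f s * g s"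
  proof (cases "0 < s \<and> s \<le> 1")
   case True
   have "s powr ((\<tau> - 1) / 2) * s powr (real m + (1 - \<tau>) / 2) = s powr (real m)"
    by (simp add: diff_divide_distrib flip: powr_add)
   also have "\<dots> = s ^ m" using True by (simp add: powr_realpow)
   finally show ?thesis using True
    by (simp add: f_def g_def mult.assoc[symmetric] flip: ennreal_mult)
  qed (auto simp: f_def)
 qed
 also have "(\<dots>)\<^sup>2 \<le> (NNINT s. (f s)\<^sup>2) * (NNINT s. (g s)\<^sup>2)"
  unfolding f_def g_def by (rule Cauchy_Schwarz_nn_integral) measurable
 also have "(NNINT s. (f s)\<^sup>2) = (NNINT s. (if 0 < s \<and> s \<le> 1 then ennreal (s powr (\<tau> - 1)) else 0))"
  by (intro nn_integral_cong) (auto simp: f_def ennreal_power power2_eq_square simp flip: powr_add ennreal_mult)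
 also have "\<dots> = ennreal (1 / \<tau>)" using nn_powr[of "\<tau> - 1" 1] \<tau> by simp
 also have "(NNINT s. (g s)\<^sup>2) \<le> (NNINT s. ennreal c * (if 0 < s \<and> s \<le> 1 then ennreal (s powr (2 * real m + 1 - \<tau>)) * ennreal (?A (x + s *\<^sub>R h)) else 0))"
 proof (rule nn_integral_mono)
  fix s :: real
  show "(g s)\<^sup>2 \<le> ennreal c * (if 0 < s \<and> s \<le> 1 then ennreal (s powr (2 * real m + 1 - \<tau>)) * ennreal (?A (x + s *\<^sub>R h)) else 0)"
  proof (cases "0 < s \<and> s \<le> 1")
   case True
   have "(s powr (real m + (1 - \<tau>) / 2) * \<bar>?D (Suc m) s\<bar>)\<^sup>2 = s powr (2 * real m + 1 - \<tau>) * (?D (Suc m) s)\<^sup>2"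
   proof -
    have q: "(real m + (1 - \<tau>) / 2) + (real m + (1 - \<tau>) / 2) = 2 * real m + 1 - \<tau>"
     by (simp add: field_simps)
    have "(s powr (real m + (1 - \<tau>) / 2))\<^sup>2 = s powr (2 * real m + 1 - \<tau>)"
     unfolding q[symmetric] power2_eq_square by (rule powr_add[symmetric])
    thus ?thesis by (simp add: power_mult_distrib)
   qed
   also have "\<dots> \<le> s powr (2 * real m + 1 - \<tau>) * (c * ?A (x + s *\<^sub>R h))"
    using line_deriv_sq_le[OF h, of "Suc m" "Suc m" a x s] by (intro mult_left_mono) (auto simp: c_def)
   finally have "ennreal ((s powr (real m + (1 - \<tau>) / 2) * \<bar>?D (Suc m) s\<bar>)\<^sup>2) \<le>
     ennreal (c * (s powr (2 * real m + 1 - \<tau>) * ?A (x + s *\<^sub>R h)))"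
    by (intro ennreal_leI) (simp add: mult_ac)
   moreover have "(g s)\<^sup>2 = ennreal ((s powr (real m + (1 - \<tau>) / 2) * \<bar>?D (Suc m) s\<bar>)\<^sup>2)"
    using True by (simp only: g_def) (simp add: ennreal_power del: power_mult_distrib)
   moreover have "ennreal (c * (s powr (2 * real m + 1 - \<tau>) * ?A (x + s *\<^sub>R h))) =
     ennreal c * (ennreal (s powr (2 * real m + 1 - \<tau>)) * ennreal (?A (x + s *\<^sub>R h)))"
    using c by (simp add: ennreal_mult Sq_nonneg)
   ultimately show ?thesis using True by simp
  qed (auto simp: g_def)
 qed
 also have "\<dots> = ennreal c * I" unfolding I_def by (rule nn_integral_cmult) measurable
 finally have J: "J\<^sup>2 \<le> ennreal (1 / \<tau>) * (ennreal c * I)"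
  by (simp add: mult_left_mono)
 have "ennreal ((a x)\<^sup>2) = (ennreal \<bar>a x\<bar>)\<^sup>2" by (simp add: ennreal_power)
 also have "\<dots> \<le> (ennreal S + J)\<^sup>2"
  unfolding S_def J_def by (intro power_mono taylor_line a) simp
 also have "\<dots> \<le> 2 * (ennreal S)\<^sup>2 + 2 * J\<^sup>2" by (rule ennreal_add_sq_le)
 also have "\<dots> \<le> 2 * ennreal ((real (Suc m))\<^sup>2 * c * ?A (x + h)) + 2 * (ennreal (1 / \<tau>) * (ennreal c * I))"
 proof (intro add_mono mult_left_mono J)
  have "0 \<le> S" unfolding S_def by (intro sum_nonneg) auto
  thus "(ennreal S)\<^sup>2 \<le> ennreal ((real (Suc m))\<^sup>2 * c * ?A (x + h))"
   using S by (simp add: ennreal_power ennreal_leI)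
 qed auto
 also have "2 * ennreal ((real (Suc m))\<^sup>2 * c * ?A (x + h)) = ennreal (2 * (real (Suc m))\<^sup>2 * c) * ennreal (?A (x + h))"
  using c by (simp add: ennreal_mult Sq_nonneg mult_ac)
 also have "2 * (ennreal (1 / \<tau>) * (ennreal c * I)) = ennreal (2 * c / \<tau>) * I"
 proof -
  have "2 * (ennreal (1 / \<tau>) * (ennreal c * I)) = (ennreal 2 * ennreal (1 / \<tau>) * ennreal c) * I"
   by (simp add: mult_ac)
  also have "ennreal 2 * ennreal (1 / \<tau>) * ennreal c = ennreal (2 * (1 / \<tau>) * c)"
  proof -
   have "ennreal 2 * ennreal (1 / \<tau>) = ennreal (2 * (1 / \<tau>))"
    using \<tau> by (intro ennreal_mult[symmetric]) auto
   moreover have "\<dots> * ennreal c = ennreal (2 * (1 / \<tau>) * c)"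
    using \<tau> c by (intro ennreal_mult[symmetric]) auto
   ultimately show ?thesis by simp
  qed
  finally show ?thesis by (simp add: field_simps)
 qed
 finally show ?thesis unfolding I_def .
qed

text \<open>The bound along lines is averaged over h in the unit ball and y = sh is substituted,
  with Jacobian s^-d; this leaves s^(2m+1-\<tau>-d) on |y| <= s <= 1. The condition on p makes this
  at most s^-p s^(\<tau>-1). Then s^-p <= |y|^-p, and the remaining s-integral is at most 1/\<tau>.
  Up to 2\<tau>, p is the critical exponent d - 2(m+1).\<close>

lemma pointwise_bound:
 fixes p \<tau> :: real
 assumes \<tau>: "\<tau> > 0" and p: "p \<ge> 0" "p \<ge> real CARD('n) - 2 * real (Suc m) + 2 * \<tau>"
 shows "\<exists>C. \<forall>a::'n::finite fn. smooth a -->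
  (\<forall>x. ennreal ((a x)\<^sup>2) \<le> ennreal C * (NNINT y. ker p y * ennreal (Sq (Suc m) a (x + y))))"
proof -
 let ?d = "real CARD('n)" and ?e = "2 * real m + 1 - \<tau>"
 define c where "c = real (card {js::'n list. length js \<le> Suc m})"
 define C1 where "C1 = 2 * (real (Suc m))\<^sup>2 * c"
 define C2 where "C2 = 2 * c / \<tau>"
 have C: "C1 \<ge> 0" "C2 \<ge> 0" using \<tau> by (auto simp: C1_def C2_def c_def)
 define v where "v = measure lborel (cball (0::real^'n) 1)"
 have v: "v > 0" unfolding v_def by (rule content_cball_pos) simp
 have emv: "emeasure lborel (cball (0::real^'n) 1) = ennreal v"
  unfolding v_def by (rule emeasure_eq_ennreal_measure) (use emeasure_lborel_cball_finite[of "0::real^'n" 1] in \<open>auto simp: less_top\<close>)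
 have "ennreal ((a x)\<^sup>2) \<le> ennreal ((C1 + C2 * (1 / \<tau>)) / v) * (NNINT y. ker p y * ennreal (Sq (Suc m) a (x + y)))"
  if a: "smooth a" for a :: "'n fn" and x
 proof -
  define A where "A y = ennreal (Sq (Suc m) a (x + y))" for y
  have "continuous_on UNIV (\<lambda>y. Sq (Suc m) a (x + y))"
   by (rule continuous_on_compose2[OF Sq_continuous[OF a, of UNIV]]) (auto intro!: continuous_intros)
  hence [measurable]: "(\<lambda>y. Sq (Suc m) a (x + y)) \<in> borel_measurable borel"
   by (rule borel_measurable_continuous_onI)
  have [measurable]: "A \<in> borel_measurable borel" unfolding A_def[abs_def] by measurable
  define K where "K = (NNINT y. ker p y * A y)"
  let ?B = "\<lambda>h :: real^'n. (if norm h \<le> 1 then 1 else 0) :: ennreal"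
  have B: "(NNINT h. ?B h) = ennreal v"
  proof -
   have "(NNINT h. ?B h) = (NNINT h. indicator (cball (0::real^'n) 1) h)"
    by (intro nn_integral_cong) (auto simp: indicator_def)
   thus ?thesis by (simp add: emv)
  qed
  define R where "R h s = (if 0 < s \<and> s \<le> 1 then ennreal (s powr ?e) * A (s *\<^sub>R h) else 0)" for h s
  have [measurable]: "(\<lambda>(h, s). ?B h * R h s) \<in> borel_measurable (borel \<Otimes>\<^sub>M borel)"
   unfolding R_def by measurable
  have [measurable]: "(\<lambda>h. NNINT s. R h s) \<in> borel_measurable borel"
   unfolding R_def by measurable
  have line: "?B h * ennreal ((a x)\<^sup>2) \<le> ennreal C1 * (?B h * A h) + ennreal C2 * (?B h * (NNINT s. R h s))" for h
  proof (cases "norm h \<le> 1")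
   case True
   from pointwise_bound_line[OF a True \<tau>, of x m] True show ?thesis
    by (simp only: if_True mult_1_left C1_def C2_def c_def R_def A_def)
  qed simp
  have "ennreal v * ennreal ((a x)\<^sup>2) = (NNINT h. ?B h * ennreal ((a x)\<^sup>2))"
   by (subst nn_integral_multc) (simp_all only: B, measurable)
  also have "\<dots> \<le> (NNINT h. ennreal C1 * (?B h * A h) + ennreal C2 * (?B h * (NNINT s. R h s)))"
   by (intro nn_integral_mono line)
  also have "\<dots> = ennreal C1 * (NNINT h. ?B h * A h) + ennreal C2 * (NNINT h. ?B h * (NNINT s. R h s))"
   by (subst nn_integral_add) (simp_all add: nn_integral_cmult)
  also have "\<dots> \<le> ennreal C1 * K + ennreal C2 * (ennreal (1 / \<tau>) * K)"
  proof (intro add_mono mult_left_mono)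
   show "(NNINT h. ?B h * A h) \<le> K"
    unfolding K_def
   proof (rule nn_integral_mono_AE)
    have "AE h in lborel. h \<noteq> (0::real^'n)" by (rule AE_lborel_singleton)
    thus "AE h in lborel. ?B h * A h \<le> ker p h * A h"
    proof eventually_elim
     case (elim h)
     show ?case
     proof (cases "norm h \<le> 1")
      case True
      have "1 \<le> norm h powr (- p)"
       using powr_mono2'[of "-p" "norm h" 1] elim True p by simp
      hence "1 \<le> ennreal (norm h powr (- p))" by (simp flip: ennreal_1 add: ennreal_leI del: ennreal_1)
      thus ?thesis using True by (intro mult_right_mono) (auto simp: ker_def)
     next
      case False
      thus ?thesis by simp
     qed
    qed
   qed
   define Q where "Q y s = (if 0 < s \<and> s \<le> 1 then (if norm y \<le> s then ennreal (s powr (?e - ?d)) * A y else 0) else 0)"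
    for y :: "real^'n" and s :: real
   have [measurable]: "(\<lambda>(y, s). Q y s) \<in> borel_measurable (borel \<Otimes>\<^sub>M borel)"
    unfolding Q_def by measurable
   have "(NNINT h. ?B h * (NNINT s. R h s)) = (NNINT h. NNINT s. ?B h * R h s)"
    unfolding R_def by (intro nn_integral_cong nn_integral_cmult[symmetric]) measurable
   also have "\<dots> = (NNINT s. NNINT h. ?B h * R h s)"
    by (rule lborel_pair.Fubini'[symmetric]) measurable
   also have "\<dots> = (NNINT s. NNINT y. Q y s)"
   proof (rule nn_integral_cong)
    fix s :: real
    show "(NNINT h. ?B h * R h s) = (NNINT y. Q y s)"
    proof (cases "0 < s \<and> s \<le> 1")
     case True
     define F where "F y = (if norm y \<le> s then ennreal (s powr ?e) * A y else 0)" for y :: "real^'n"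
     have [measurable]: "F \<in> borel_measurable borel" unfolding F_def[abs_def] by measurable
     have "?B h * R h s = F (s *\<^sub>R h)" for h
      using True by (auto simp: R_def F_def indicator_def)
     hence "(NNINT h. ?B h * R h s) = ennreal (s powr (- ?d)) * (NNINT y. F y)"
      using True nn_scale[of F s] by simp
     also have "\<dots> = (NNINT y. ennreal (s powr (- ?d)) * F y)"
      by (rule nn_integral_cmult[symmetric]) measurable
     also have "\<dots> = (NNINT y. Q y s)"
     proof (rule nn_integral_cong)
      fix y
      have "ennreal (s powr (- ?d)) * ennreal (s powr ?e) = ennreal (s powr (?e - ?d))"
       by (simp add: powr_diff powr_minus divide_inverse mult.commute flip: ennreal_mult)
      thus "ennreal (s powr (- ?d)) * F y = Q y s"
       using True by (auto simp: F_def Q_def mult.assoc[symmetric])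
     qed
     finally show ?thesis .
    qed (auto simp: R_def Q_def)
   qed
   also have "\<dots> = (NNINT y. NNINT s. Q y s)"
    by (rule lborel_pair.Fubini') measurable
   also have "\<dots> \<le> (NNINT y. ennreal (1 / \<tau>) * (ker p y * A y))"
   proof (rule nn_integral_mono_AE)
    have "AE h in lborel. h \<noteq> (0::real^'n)" by (rule AE_lborel_singleton)
    thus "AE y in lborel. (NNINT s. Q y s) \<le> ennreal (1 / \<tau>) * (ker p y * A y)"
    proof eventually_elim
     case (elim y)
     have "(NNINT s. Q y s) \<le> (NNINT s. (if 0 < s \<and> s \<le> 1 then ennreal (s powr (\<tau> - 1)) else 0) * (ker p y * A y))"
     proof (rule nn_integral_mono)
      fix s :: real
      show "Q y s \<le> (if 0 < s \<and> s \<le> 1 then ennreal (s powr (\<tau> - 1)) else 0) * (ker p y * A y)"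
      proof (cases "0 < s \<and> s \<le> 1 \<and> norm y \<le> s")
       case True
       have "s powr (?e - ?d) \<le> s powr (- p + (\<tau> - 1))"
        using True p(2) by (intro powr_mono') auto
       also have "\<dots> = s powr (- p) * s powr (\<tau> - 1)" by (rule powr_add)
       also have "\<dots> \<le> norm y powr (- p) * s powr (\<tau> - 1)"
        using True elim p by (intro mult_right_mono powr_mono2') auto
       finally have "ennreal (s powr (?e - ?d)) \<le> ennreal (s powr (\<tau> - 1)) * ennreal (norm y powr (- p))"
        by (subst ennreal_mult[symmetric]) (auto intro: ennreal_leI simp: mult.commute)
       hence "ennreal (s powr (?e - ?d)) * A y \<le> ennreal (s powr (\<tau> - 1)) * ennreal (norm y powr (- p)) * A y"
        by (rule mult_right_mono) simp
       moreover have "norm y \<le> 1" using True by linarith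
       ultimately show ?thesis using True by (simp add: Q_def ker_def mult.assoc)
      qed (auto simp: Q_def)
     qed
     also have "\<dots> = ennreal (1 / \<tau>) * (ker p y * A y)"
      using nn_powr[of "\<tau> - 1" 1] \<tau> by (simp add: nn_integral_multc)
     finally show ?case .
    qed
   qed
   also have "\<dots> = ennreal (1 / \<tau>) * K" unfolding K_def by (rule nn_integral_cmult) measurable
   finally show "(NNINT h. ?B h * (NNINT s. R h s)) \<le> ennreal (1 / \<tau>) * K" .
  qed auto
  also have "\<dots> = ennreal (C1 + C2 * (1 / \<tau>)) * K"
  proof -
   have e1: "ennreal (C2 * (1 / \<tau>)) = ennreal C2 * ennreal (1 / \<tau>)"
    using C \<tau> by (intro ennreal_mult) auto
   have e2: "ennreal (C1 + C2 * (1 / \<tau>)) = ennreal C1 + ennreal (C2 * (1 / \<tau>))"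
    using C \<tau> by (intro ennreal_plus) auto
   show ?thesis by (simp only: e1 e2 distrib_right mult.assoc)
  qed
  finally have "ennreal (1 / v) * (ennreal v * ennreal ((a x)\<^sup>2)) \<le> ennreal (1 / v) * (ennreal (C1 + C2 * (1 / \<tau>)) * K)"
   by (rule mult_left_mono) simp
  moreover have "ennreal (1 / v) * ennreal v = 1" using v by (simp flip: ennreal_mult)
  moreover have "ennreal (1 / v) * ennreal (C1 + C2 * (1 / \<tau>)) = ennreal ((C1 + C2 * (1 / \<tau>)) / v)"
   using v C \<tau> by (subst ennreal_mult[symmetric]) auto
  ultimately show ?thesis by (simp add: mult.assoc[symmetric] K_def A_def)
 qed
 thus ?thesis by blast
qed

section \<open>Products of Riesz potentials and of smooth functions\<close>

lemma nn_ker_conv: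
 fixes A :: "real^'n::finite => ennreal"
 assumes [measurable]: "A \<in> borel_measurable borel"
 shows "(NNINT x. NNINT y. ker r y * A (x + y)) = (NNINT y. ker r (y::real^'n)) * (NNINT x. A x)"
proof -
 have "(NNINT x. NNINT y. ker r y * A (x + y)) = (NNINT y. NNINT x. ker r y * A (x + y))"
  by (rule lborel_pair.Fubini'[symmetric]) measurable
 also have "\<dots> = (NNINT (y::real^'n). ker r y * (NNINT x. A x))"
 proof (rule nn_integral_cong)
  fix y
  have "(NNINT x. ker r y * A (x + y)) = ker r y * (NNINT x. A (x + y))"
   by (rule nn_integral_cmult) measurable
  also have "(NNINT x. A (x + y)) = (NNINT x. A x)"
   using nn_translate[of A y] by (simp add: add.commute)
  finally show "(NNINT x. ker r y * A (x + y)) = ker r y * (NNINT x. A x)" .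
 qed
 also have "\<dots> = (NNINT y. ker r (y::real^'n)) * (NNINT x. A x)"
  by (rule nn_integral_multc) measurable
 finally show ?thesis .
qed

text \<open>The smaller of |y| and |w| can carry the whole exponent p + q.\<close>

lemma ker_prod_le: assumes "p \<ge> 0" "q \<ge> 0" shows "ker p y * ker q w \<le> ker (p + q) y + ker (p + q) w"
proof (cases "norm y \<le> 1 \<and> norm w \<le> 1 \<and> y \<noteq> 0 \<and> w \<noteq> 0")
 case True
 have *: "s powr (- p) * t powr (- q) \<le> s powr (- (p + q)) + t powr (- (p + q))" if st: "0 < s" "0 < t" for s t :: real
 proof (cases "s \<le> t")
  case True
  have "s powr (- p) * t powr (- q) \<le> s powr (- p) * s powr (- q)"
   using True st assms by (intro mult_left_mono powr_mono2') auto
  also have "\<dots> = s powr (- (p + q))" by (simp flip: powr_add)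
  finally show ?thesis by (simp add: add_increasing2)
 next
  case False
  have "s powr (- p) * t powr (- q) \<le> t powr (- p) * t powr (- q)"
   using False st assms by (intro mult_right_mono powr_mono2') auto
  also have "\<dots> = t powr (- (p + q))" by (simp flip: powr_add)
  finally show ?thesis by (simp add: add_increasing)
 qed
 have "ennreal (norm y powr (- p) * norm w powr (- q)) \<le> ennreal (norm y powr (- (p + q)) + norm w powr (- (p + q)))"
  using True by (intro ennreal_leI *) auto
 thus ?thesis using True unfolding ker_def by (simp add: ennreal_mult)
qed (auto simp: ker_def)

text \<open>After \<open>ker_prod_le\<close> each summand has a kernel in only one of the two
  variables, so the other function is integrated over all translates and splits off. What remains is
  a single convolution with the kernel of order p + q, which is integrable for p + q < d.\<close>

lemma nn_ker_product:
 fixes A B :: "real^'n::finite => ennreal"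
 assumes [measurable]: "A \<in> borel_measurable borel" "B \<in> borel_measurable borel" and pq: "p \<ge> 0" "q \<ge> 0"
 shows "(NNINT x. (NNINT y. ker p y * A (x + y)) * (NNINT y. ker q y * B (x + y)))
  \<le> 2 * (NNINT y. ker (p + q) (y::real^'n)) * ((NNINT x. A x) * (NNINT x. B x))"
proof -
 let ?k = "ker (p + q) :: real^'n => ennreal"
 have pt: "(NNINT y. ker p y * A (x + y)) * (NNINT y. ker q y * B (x + y))
   \<le> (NNINT y. ?k y * A (x + y)) * (NNINT x. B x) + (NNINT x. A x) * (NNINT y. ?k y * B (x + y))" for x
 proof -
  have "(NNINT y. ker p y * A (x + y)) * (NNINT y. ker q y * B (x + y)) =
    (NNINT y. (ker p y * A (x + y)) * (NNINT w. ker q w * B (x + w)))"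
   by (rule nn_integral_multc[symmetric]) measurable
  also have "\<dots> = (NNINT y. NNINT w. (ker p y * A (x + y)) * (ker q w * B (x + w)))"
   by (intro nn_integral_cong nn_integral_cmult[symmetric]) measurable
  also have "\<dots> \<le> (NNINT y. NNINT w. (?k y * A (x + y)) * B (x + w) + A (x + y) * (?k w * B (x + w)))"
  proof (intro nn_integral_mono)
   fix y w
   have "(ker p y * A (x + y)) * (ker q w * B (x + w)) = (ker p y * ker q w) * (A (x + y) * B (x + w))"
    by (simp add: mult_ac)
   also have "\<dots> \<le> (?k y + ?k w) * (A (x + y) * B (x + w))"
    by (intro mult_right_mono ker_prod_le pq) simp
   finally show "(ker p y * A (x + y)) * (ker q w * B (x + w)) \<le> (?k y * A (x + y)) * B (x + w) + A (x + y) * (?k w * B (x + w))"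
    by (simp add: algebra_simps)
  qed
  also have "\<dots> = (NNINT y. (?k y * A (x + y)) * (NNINT w. B (x + w)) + A (x + y) * (NNINT w. ?k w * B (x + w)))"
   by (intro nn_integral_cong) (subst nn_integral_add; simp add: nn_integral_cmult)
  also have "\<dots> = (NNINT y. ?k y * A (x + y)) * (NNINT w. B (x + w)) + (NNINT y. A (x + y)) * (NNINT w. ?k w * B (x + w))"
   by (subst nn_integral_add) (simp_all add: nn_integral_multc)
  finally show ?thesis by (simp add: nn_translate)
 qed
 have "(NNINT x. (NNINT y. ker p y * A (x + y)) * (NNINT y. ker q y * B (x + y))) \<le>
  (NNINT x. (NNINT y. ?k y * A (x + y)) * (NNINT x. B x) + (NNINT x. A x) * (NNINT y. ?k y * B (x + y)))"
  by (intro nn_integral_mono pt)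
 also have "\<dots> = (NNINT x. NNINT y. ?k y * A (x + y)) * (NNINT x. B x) +
  (NNINT x. A x) * (NNINT x. NNINT y. ?k y * B (x + y))"
  by (subst nn_integral_add) (simp_all add: nn_integral_multc nn_integral_cmult)
 also have "\<dots> = 2 * (NNINT y. ?k y) * ((NNINT x. A x) * (NNINT x. B x))"
  by (simp only: nn_ker_conv[OF assms(1)] nn_ker_conv[OF assms(2)]) (simp add: mult_ac flip: mult_2)
 finally show ?thesis .
qed

text \<open>The excess of 2(m+1) over d makes p = 0 admissible in \<open>pointwise_bound\<close>,
  with \<tau> = 1/4, and a kernel of order 0 is at most 1.\<close>

lemma sup_bound_smooth:
 assumes m: "2 * real (Suc m) \<ge> real CARD('n) + 1"
 shows "\<exists>C. \<forall>a::'n::finite fn. smooth a -->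
  (\<forall>x. ennreal ((a x)\<^sup>2) \<le> ennreal C * (NNINT y. ennreal (Sq (Suc m) a y)))"
proof -
 have "\<exists>C. \<forall>a::'n fn. smooth a -->
  (\<forall>x. ennreal ((a x)\<^sup>2) \<le> ennreal C * (NNINT y. ker 0 y * ennreal (Sq (Suc m) a (x + y))))"
  by (rule pointwise_bound[of "1/4"]) (use m in auto)
 then obtain C where C: "\<And>(a::'n fn) x. smooth a ==>
  ennreal ((a x)\<^sup>2) \<le> ennreal C * (NNINT y. ker 0 y * ennreal (Sq (Suc m) a (x + y)))" by blast
 have "ennreal ((a x)\<^sup>2) \<le> ennreal C * (NNINT y. ennreal (Sq (Suc m) a y))"
  if a: "smooth a" for a :: "'n fn" and x
 proof -
  have [measurable]: "Sq (Suc m) a \<in> borel_measurable borel"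
   by (intro borel_measurable_continuous_onI Sq_continuous a)
  note C[OF a, of x]
  also have "(NNINT y. ker 0 y * ennreal (Sq (Suc m) a (x + y))) \<le> (NNINT y. ennreal (Sq (Suc m) a (x + y)))"
   by (intro nn_integral_mono) (auto simp: ker_def)
  also have "\<dots> = (NNINT y. ennreal (Sq (Suc m) a y))"
   by (rule nn_translate[of "\<lambda>y. ennreal (Sq (Suc m) a y)"]) measurable
  finally show ?thesis by (simp add: mult_left_mono)
 qed
 thus ?thesis by blast
qed

lemma product_estimate_0:
 assumes k: "2 * real j \<ge> real CARD('n) + 1"
 shows "\<exists>C. \<forall>a b::'n::finite fn. smooth a --> smooth b -->
  (NNINT x. ennreal ((a x * b x)\<^sup>2)) \<le>
   ennreal C * ((NNINT x. ennreal (Sq i a x)) * (NNINT x. ennreal (Sq j b x)))"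
proof -
 obtain m where m: "j = Suc m" using k by (cases j) auto
 obtain C where C: "\<And>(a::'n fn) x. smooth a ==>
  ennreal ((a x)\<^sup>2) \<le> ennreal C * (NNINT y. ennreal (Sq j a y))"
  using sup_bound_smooth k m by blast
 have "(NNINT x. ennreal ((a x * b x)\<^sup>2)) \<le>
   ennreal C * ((NNINT x. ennreal (Sq i a x)) * (NNINT x. ennreal (Sq j b x)))"
  if a: "smooth a" and b: "smooth b" for a b :: "'n fn"
 proof -
  have [measurable]: "Sq i a \<in> borel_measurable borel"
   by (intro borel_measurable_continuous_onI Sq_continuous a)
  have "(NNINT x. ennreal ((a x * b x)\<^sup>2)) \<le>
   (NNINT x. ennreal (Sq i a x) * (ennreal C * (NNINT x. ennreal (Sq j b x))))"
  proof (intro nn_integral_mono)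
   fix x
   show "ennreal ((a x * b x)\<^sup>2) \<le> ennreal (Sq i a x) * (ennreal C * (NNINT x. ennreal (Sq j b x)))"
    unfolding power_mult_distrib by (subst ennreal_mult) (auto intro!: mult_mono C[OF b] ennreal_leI Sq_ge)
  qed
  also have "\<dots> = (NNINT x. ennreal (Sq i a x)) * (ennreal C * (NNINT x. ennreal (Sq j b x)))"
   by (rule nn_integral_multc) measurable
  finally show ?thesis by (simp add: mult_ac)
 qed
 thus ?thesis by blast
qed

text \<open>The derivatives are shared between the factors: each factor alone may be unbounded, but
  the orders p and q of their Riesz potentials have a sum below d. If one factor has no derivatives
  at its disposal, the other one has at least k and is bounded.\<close>

lemma product_estimate_smooth:
 assumes k: "2 * real k \<ge> real CARD('n) + 1" and ij: "i + j \<ge> k"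
 shows "\<exists>C\<ge>0. \<forall>a b::'n::finite fn. smooth a --> smooth b -->
  (NNINT x. ennreal ((a x * b x)\<^sup>2)) \<le>
   ennreal C * ((NNINT x. ennreal (Sq i a x)) * (NNINT x. ennreal (Sq j b x)))"
proof -
 have "\<exists>C. \<forall>a b::'n fn. smooth a --> smooth b -->
  (NNINT x. ennreal ((a x * b x)\<^sup>2)) \<le>
   ennreal C * ((NNINT x. ennreal (Sq i a x)) * (NNINT x. ennreal (Sq j b x)))" (is "\<exists>C. ?P C")
 proof (cases "i = 0 \<or> j = 0")
  case True
  thus ?thesis
  proof
   assume "i = 0"
   hence "2 * real j \<ge> real CARD('n) + 1" using ij k by (simp add: order_trans)
   thus ?thesis by (rule product_estimate_0)
  next
   assume "j = 0"
   hence "2 * real i \<ge> real CARD('n) + 1" using ij k by (simp add: order_trans)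
   then obtain C where C: "\<And>a b::'n fn. smooth a ==> smooth b ==>
    (NNINT x. ennreal ((a x * b x)\<^sup>2)) \<le>
    ennreal C * ((NNINT x. ennreal (Sq j a x)) * (NNINT x. ennreal (Sq i b x)))"
    using product_estimate_0 by blast
   have "?P C"
   proof (intro allI impI)
    fix a b :: "'n fn" assume "smooth a" "smooth b"
    from C[OF this(2) this(1)] show "(NNINT x. ennreal ((a x * b x)\<^sup>2)) \<le>
     ennreal C * ((NNINT x. ennreal (Sq i a x)) * (NNINT x. ennreal (Sq j b x)))"
     by (simp only: mult.commute[of "b _"] mult.commute[of "NNINT x. ennreal (Sq i a x)"])
   qed
   thus ?thesis ..
  qed
 next
  case False
  then obtain m l where ml: "i = Suc m" "j = Suc l" by (metis not0_implies_Suc)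
  \<comment> \<open>These are the least admissible orders for \<tau> = 1/8. When both are positive
    their sum is 2d - 2(i+j) + 1/2, at most d - 1/2 by the hypothesis on k; when one is 0 the other
    is below d because i and j are at least 1.\<close>
  define p where "p = max 0 (real CARD('n) - 2 * real i + 1/4)"
  define q where "q = max 0 (real CARD('n) - 2 * real j + 1/4)"
  have pq: "p \<ge> 0" "q \<ge> 0" by (auto simp: p_def q_def)
  have "real i + real j \<ge> real k" using ij by (metis of_nat_add of_nat_le_iff)
  moreover have "real i \<ge> 1" "real j \<ge> 1" using ml by auto
  moreover have "real CARD('n) \<ge> 1" by (metis One_nat_def Suc_leI of_nat_1 of_nat_le_iff zero_less_card_finite)
  ultimately have pqd: "p + q < real CARD('n)" using k by (auto simp: p_def q_def max_def)
  obtain C1 where C1: "\<And>(a::'n fn) x. smooth a ==>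
   ennreal ((a x)\<^sup>2) \<le> ennreal C1 * (NNINT y. ker p y * ennreal (Sq i a (x + y)))"
   using pointwise_bound[where 'n='n, of "1/8" p m] pq ml by (auto simp: p_def)
  obtain C2 where C2: "\<And>(a::'n fn) x. smooth a ==>
   ennreal ((a x)\<^sup>2) \<le> ennreal C2 * (NNINT y. ker q y * ennreal (Sq j a (x + y)))"
   using pointwise_bound[where 'n='n, of "1/8" q l] pq ml by (auto simp: q_def)
  obtain K where K: "(NNINT y. ker (p + q) (y::real^'n)) = ennreal K" "K \<ge> 0"
   using ker_finite[OF pqd] pq by (metis add_nonneg_nonneg ennreal_cases infinity_ennreal_def less_irrefl)
  have "(NNINT x. ennreal ((a x * b x)\<^sup>2)) \<le>
   ennreal (max 0 C1 * max 0 C2 * (2 * K)) * ((NNINT x. ennreal (Sq i a x)) * (NNINT x. ennreal (Sq j b x)))"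
   if a: "smooth a" and b: "smooth b" for a b :: "'n fn"
  proof -
   have [measurable]: "Sq i a \<in> borel_measurable borel" "Sq j b \<in> borel_measurable borel"
    by (intro borel_measurable_continuous_onI Sq_continuous a b)+
   have "(NNINT x. ennreal ((a x * b x)\<^sup>2)) \<le>
    (NNINT x. (ennreal C1 * ennreal C2) * ((NNINT y. ker p y * ennreal (Sq i a (x + y))) * (NNINT y. ker q y * ennreal (Sq j b (x + y)))))"
   proof (intro nn_integral_mono)
    fix x
    have "ennreal ((a x * b x)\<^sup>2) = ennreal ((a x)\<^sup>2) * ennreal ((b x)\<^sup>2)"
     by (simp add: power_mult_distrib ennreal_mult)
    also have "\<dots> \<le> (ennreal C1 * (NNINT y. ker p y * ennreal (Sq i a (x + y)))) * (ennreal C2 * (NNINT y. ker q y * ennreal (Sq j b (x + y))))"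
     by (intro mult_mono C1 C2 a b) auto
    finally show "ennreal ((a x * b x)\<^sup>2) \<le> (ennreal C1 * ennreal C2) * ((NNINT y. ker p y * ennreal (Sq i a (x + y))) * (NNINT y. ker q y * ennreal (Sq j b (x + y))))"
     by (simp add: mult_ac)
   qed
   also have "\<dots> = (ennreal C1 * ennreal C2) * (NNINT x. (NNINT y. ker p y * ennreal (Sq i a (x + y))) * (NNINT y. ker q y * ennreal (Sq j b (x + y))))"
    by (rule nn_integral_cmult) measurable
   also have "\<dots> \<le> (ennreal C1 * ennreal C2) * (2 * ennreal K * ((NNINT x. ennreal (Sq i a x)) * (NNINT x. ennreal (Sq j b x))))"
    unfolding K(1)[symmetric] by (intro mult_left_mono nn_ker_product pq) simp_all
   also have "\<dots> = ennreal (max 0 C1 * max 0 C2 * (2 * K)) * ((NNINT x. ennreal (Sq i a x)) * (NNINT x. ennreal (Sq j b x)))"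
   proof -
    have "ennreal (max 0 C1 * max 0 C2 * (2 * K)) = ennreal C1 * ennreal C2 * (2 * ennreal K)"
     using K(2) by (simp add: ennreal_mult max_def ennreal_neg)
    thus ?thesis by (simp add: mult_ac)
   qed
   finally show ?thesis .
  qed
  thus ?thesis by blast
 qed
 then obtain C where "?P C" by blast
 moreover have "ennreal (max 0 C) = ennreal C" by (simp add: max_def ennreal_neg)
 ultimately have "?P (max 0 C)" by simp
 thus ?thesis by (intro exI[of _ "max 0 C"]) auto
qed

section \<open>Weak derivatives and Sobolev spaces\<close>

text \<open>Indexed by lists of directions, so that composition of weak derivatives is
  concatenation; \<open>is_weak_deriv_iff\<close> translates to multi-indices.\<close>

definition wd :: "'n::finite list => 'n fn => 'n fn => bool" where
 "wd js u w \<longleftrightarrow> (\<forall>\<phi>\<in>\<D>. (LEB x. u x * iter_partial js \<phi> x) =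
   (-1) ^ length js * (LEB x. w x * \<phi> x))"

lemma deg_count_list: "(\<Sum>i\<in>UNIV. count_list js (i::'n::finite)) = length js"
 by (rule sum_count_set) auto

lemma ex_count_list: "\<exists>js. count_list js = (\<beta> :: 'n::finite => nat)"
proof (induction "\<Sum>i\<in>UNIV. \<beta> i" arbitrary: \<beta>)
 case 0
 hence "count_list [] = \<beta>" by (auto simp: fun_eq_iff)
 thus ?case by blast
next
 case (Suc n)
 then obtain i where i: "\<beta> i \<noteq> 0" by (metis nat.distinct(1) sum.neutral)
 let ?\<beta> = "\<beta>(i := \<beta> i - 1)"
 have "(\<Sum>j\<in>UNIV. \<beta> j) = Suc (\<Sum>j\<in>UNIV. ?\<beta> j)"
  using i by (subst (1 2) sum.remove[of _ i]) auto
 then obtain js where "count_list js = ?\<beta>" using Suc by fastforce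
 hence "count_list (i # js) = \<beta>" using i by (auto simp: fun_eq_iff)
 thus ?case by blast
qed

lemma is_weak_deriv_iff:
 fixes u :: "'n::finite fn"
 shows "is_weak_deriv (count_list js) u w \<longleftrightarrow> wd js u w"
proof -
 have "iter_partial ks \<phi> = iter_partial js \<phi>" "length ks = length js"
  if "\<forall>i. count_list ks i = count_list js i" "\<phi> \<in> \<D>" for ks and \<phi> :: "'n fn"
 proof -
  have m: "mset ks = mset js" using that(1) by (intro multiset_eqI) (simp add: count_mset)
  thus "iter_partial ks \<phi> = iter_partial js \<phi>"
   using iter_partial_perm[OF test_smooth[OF that(2)]] by blast
  show "length ks = length js" using m by (rule mset_eq_length)
 qed
 note eq = this
 show ?thesis
 proof
  assume "is_weak_deriv (count_list js) u w"
  thus "wd js u w" unfolding is_weak_deriv_def wd_def deg_count_list by blast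
 next
  assume w: "wd js u w"
  show "is_weak_deriv (count_list js) u w"
   unfolding is_weak_deriv_def deg_count_list
  proof (intro ballI allI impI)
   fix \<phi> :: "'n fn" and ks assume \<phi>: "\<phi> \<in> \<D>" and ks: "\<forall>i. count_list ks i = count_list js i"
   show "(LEB x. u x * iter_partial ks \<phi> x) = (-1) ^ length js * (LEB x. w x * \<phi> x)"
    unfolding eq(1)[OF ks \<phi>] using w \<phi> unfolding wd_def by blast
  qed
 qed
qed

lemma wd_unique:
 assumes "wd js u w" "wd js u w'" "w \<in> L2_space" "w' \<in> L2_space"
 shows "AE x in lebesgue. w x = w' x"
proof -
 have "AE x in lebesgue. w x - w' x = 0"
 proof (rule fundamental_lemma[OF L2_diff[OF assms(3,4)]])
  fix \<phi> :: "'a fn" assume \<phi>: "\<phi> \<in> \<D>"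
  have "(-1) ^ length js * (LEB x. w x * \<phi> x) = (-1) ^ length js * (LEB x. w' x * \<phi> x)"
   using bspec[OF assms(1)[unfolded wd_def] \<phi>] bspec[OF assms(2)[unfolded wd_def] \<phi>] by simp
  thus "(LEB x. (w x - w' x) * \<phi> x) = 0"
   using L2_mult_integrable[OF assms(3) test_L2[OF \<phi>]] L2_mult_integrable[OF assms(4) test_L2[OF \<phi>]]
   by (simp add: left_diff_distrib)
 qed
 thus ?thesis by eventually_elim simp
qed

lemma wd_Nil: "wd [] u u" by (simp add: wd_def)

lemma wd_cong:
 assumes "wd js u w" "AE x in lebesgue. u x = u' x" "AE x in lebesgue. w x = w' x"
 shows "wd js u' w'"
proof -
 have "(LEB x. u' x * f x) = (LEB x. u x * f x)"
   "(LEB x. w' x * f x) = (LEB x. w x * f x)" for f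
  by (rule integral_cong_lebesgue, use assms(2,3) in \<open>eventually_elim, simp\<close>)+
 thus ?thesis using assms(1) by (simp add: wd_def)
qed

lemma wd_lincomb:
 assumes "wd js u w" "wd js u' w'" "u \<in> L2_space" "w \<in> L2_space" "u' \<in> L2_space" "w' \<in> L2_space"
 shows "wd js (\<lambda>x. a * u x + b * u' x) (\<lambda>x. a * w x + b * w' x)"
 unfolding wd_def
proof
 fix \<phi> :: "'a fn" assume \<phi>: "\<phi> \<in> \<D>"
 have lin: "(LEB x. (a * f x + b * g x) * h x) = a * (LEB x. f x * h x) + b * (LEB x. g x * h x)"
  if "f \<in> L2_space" "g \<in> L2_space" "h \<in> L2_space" for f g h :: "'a fn"
  using L2_mult_integrable[OF that(1,3)] L2_mult_integrable[OF that(2,3)]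
  by (simp add: distrib_right mult.assoc)
 show "(LEB x. (a * u x + b * u' x) * iter_partial js \<phi> x) =
  (-1) ^ length js * (LEB x. (a * w x + b * w' x) * \<phi> x)"
 proof -
  have "(LEB x. u x * iter_partial js \<phi> x) = (-1) ^ length js * (LEB x. w x * \<phi> x)"
   "(LEB x. u' x * iter_partial js \<phi> x) = (-1) ^ length js * (LEB x. w' x * \<phi> x)"
   using assms(1,2) \<phi> unfolding wd_def by auto
  thus ?thesis using assms(3-6) test_L2[OF \<phi>] test_L2[OF test_iter_partial[OF \<phi>]]
   by (simp only: lin) (simp add: distrib_left mult.left_commute)
 qed
qed

lemma wd_append: "wd js u w ==> wd ks w v ==> wd (js @ ks) u v"
 unfolding wd_def iter_partial_append by (auto simp: test_iter_partial power_add)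

text \<open>Serves to recognise derivatives of a first weak derivative as higher derivatives of
  \<open>u\<close>.\<close>

lemma wd_append_cancel: assumes "wd (js @ ks) u v" "wd js u w" shows "wd ks w v"
 unfolding wd_def
proof
 fix \<phi> :: "'a fn" assume \<phi>: "\<phi> \<in> \<D>"
 have "(-1) ^ length js * (LEB x. w x * iter_partial ks \<phi> x) =
   (-1) ^ length js * ((-1) ^ length ks * (LEB x. v x * \<phi> x))"
 proof -
  have "(LEB x. u x * iter_partial js (iter_partial ks \<phi>) x) =
    (-1) ^ length (js @ ks) * (LEB x. v x * \<phi> x)"
   using assms(1) \<phi> unfolding wd_def iter_partial_append by blast
  moreover have "(LEB x. u x * iter_partial js (iter_partial ks \<phi>) x) =
    (-1) ^ length js * (LEB x. w x * iter_partial ks \<phi> x)"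
   using assms(2) test_iter_partial[OF \<phi>] unfolding wd_def by blast
  ultimately show ?thesis by (simp add: power_add)
 qed
 thus "(LEB x. w x * iter_partial ks \<phi> x) = (-1) ^ length ks * (LEB x. v x * \<phi> x)"
  by simp
qed

lemma wd_limit:
 assumes wd: "\<And>n. wd js (u n) (w n)"
  and u: "\<And>n. u n \<in> L2_space" "u' \<in> L2_space" and w: "\<And>n. w n \<in> L2_space" "w' \<in> L2_space"
  and "(\<lambda>n. L2norm (\<lambda>x. u n x - u' x)) \<longlonglongrightarrow> 0" "(\<lambda>n. L2norm (\<lambda>x. w n x - w' x)) \<longlonglongrightarrow> 0"
 shows "wd js u' w'"
 unfolding wd_def
proof
 fix \<phi> :: "'a fn" assume \<phi>: "\<phi> \<in> \<D>"
 have "(\<lambda>n. LEB x. u n x * iter_partial js \<phi> x) \<longlonglongrightarrow> (LEB x. u' x * iter_partial js \<phi> x)"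
  by (rule L2_inner_tendsto[OF u(1) u(2) test_L2[OF test_iter_partial[OF \<phi>]] assms(6)])
 moreover have "(\<lambda>n. (-1) ^ length js * (LEB x. w n x * \<phi> x)) \<longlonglongrightarrow> (-1) ^ length js * (LEB x. w' x * \<phi> x)"
  by (intro tendsto_mult_left L2_inner_tendsto[OF w(1) w(2) test_L2[OF \<phi>] assms(7)])
 ultimately show "(LEB x. u' x * iter_partial js \<phi> x) = (-1) ^ length js * (LEB x. w' x * \<phi> x)"
  using wd \<phi> unfolding wd_def by (simp add: LIMSEQ_unique)
qed

abbreviation wder :: "'n::finite list => 'n fn => 'n fn" where
 "wder js u \<equiv> weak_deriv (count_list js) u"

text \<open>\<open>weak_deriv\<close> is a choice. A square integrable weak derivative makes that
  choice meaningful and agrees with it almost everywhere, by the fundamental lemma.\<close>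

lemma wder_props:
 assumes "w \<in> L2_space" "wd js u w"
 shows "wder js u \<in> L2_space" "wd js u (wder js u)" "AE x in lebesgue. wder js u x = w x"
proof -
 have "\<exists>w. w \<in> L2_space \<and> is_weak_deriv (count_list js) u w"
  using assms by (auto simp: is_weak_deriv_iff)
 from someI_ex[OF this] show *: "wder js u \<in> L2_space" "wd js u (wder js u)"
  unfolding weak_deriv_def by (simp_all add: is_weak_deriv_iff)
 show "AE x in lebesgue. wder js u x = w x" using wd_unique[OF *(2) assms(2) *(1) assms(1)] .
qed

lemma Hspace_iff:
 "u \<in> Hspace k \<longleftrightarrow> u \<in> L2_space \<and> (\<forall>js. length js \<le> k --> (\<exists>w\<in>L2_space. wd js u w))"
proof -
 have "(\<forall>\<beta>. (\<Sum>i\<in>UNIV. \<beta> i) \<le> k --> (\<exists>w\<in>L2_space. is_weak_deriv \<beta> u w)) \<longleftrightarrow>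
  (\<forall>js. length js \<le> k --> (\<exists>w\<in>L2_space. wd js u w))" (is "?l = ?r")
 proof
  assume ?l thus ?r by (metis is_weak_deriv_iff deg_count_list)
 next
  assume ?r thus ?l by (metis is_weak_deriv_iff deg_count_list ex_count_list)
 qed
 thus ?thesis by (simp add: Hspace_def)
qed

lemma Hspace_L2: "u \<in> Hspace k ==> u \<in> L2_space" by (simp add: Hspace_iff)

lemma Hspace_wder:
 assumes "u \<in> Hspace k" "length js \<le> k"
 shows "wder js u \<in> L2_space" "wd js u (wder js u)"
proof -
 obtain w where w: "w \<in> L2_space" "wd js u w" using assms unfolding Hspace_iff by blast
 from wder_props[OF w] show "wder js u \<in> L2_space" "wd js u (wder js u)" by auto
qed

section \<open>The Sobolev norm and completeness of H^k\<close>

abbreviation mdeg :: "('n::finite => nat) => nat" where "mdeg \<beta> \<equiv> \<Sum>i\<in>UNIV. \<beta> i"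

lemma multiindex_image:
 "{\<beta> :: 'n::finite => nat. mdeg \<beta> \<le> k} = count_list ` {js. length js \<le> k}"
proof (intro equalityI subsetI)
 fix \<beta> :: "'n => nat" assume \<beta>: "\<beta> \<in> {\<beta>. mdeg \<beta> \<le> k}"
 obtain js where js: "count_list js = \<beta>" using ex_count_list by blast
 have "(\<Sum>i\<in>UNIV. count_list js i) \<le> k" using \<beta> unfolding js by simp
 hence "length js \<le> k" unfolding deg_count_list .
 thus "\<beta> \<in> count_list ` {js. length js \<le> k}" using js by blast
qed (auto simp: deg_count_list)

lemma multiindex_cases:
 fixes \<beta> :: "'n::finite => nat"
 assumes "mdeg \<beta> \<le> k" obtains js where "\<beta> = count_list js" "length js \<le> k"
 using assms multiindex_image[where 'n='n, of k] by blast

lemma finite_multiindex: "finite {\<beta> :: 'n::finite => nat. mdeg \<beta> \<le> k}"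
 unfolding multiindex_image by (intro finite_imageI finite_lists_le)

lemma Hnorm_L2_set: "Hnorm k u = L2_set (\<lambda>\<beta>. L2norm (weak_deriv \<beta> u)) {\<beta>. mdeg \<beta> \<le> k}"
 unfolding Hnorm_def L2_set_def L2norm_sq ..

lemma Hnorm_nonneg [simp]: "Hnorm k u \<ge> 0"
 unfolding Hnorm_L2_set by (rule L2_set_nonneg)

lemma wder_le_Hnorm: assumes "length js \<le> k" shows "L2norm (wder js u) \<le> Hnorm k u"
proof -
 have "count_list js \<in> {\<beta>. mdeg \<beta> \<le> k}" using assms by (simp add: deg_count_list)
 thus ?thesis unfolding Hnorm_L2_set
  by (intro member_le_L2_set[OF finite_multiindex]) auto
qed

lemma Hnorm_le_sum: "Hnorm k u \<le> (\<Sum>js | length js \<le> k. L2norm (wder js u))"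
proof -
 have "Hnorm k u \<le> (\<Sum>\<beta> | mdeg \<beta> \<le> k. L2norm (weak_deriv \<beta> u))"
  unfolding Hnorm_L2_set by (rule L2_set_le_sum) simp
 also have "\<dots> \<le> (\<Sum>\<beta>\<in>count_list ` {js. length js \<le> k}. L2norm (weak_deriv \<beta> u))"
  unfolding multiindex_image by simp
 also have "\<dots> \<le> (\<Sum>js | length js \<le> k. L2norm (wder js u))"
  using sum_image_le[OF finite_lists_le, of k "\<lambda>\<beta>. L2norm (weak_deriv \<beta> u)" count_list]
  by (simp add: o_def)
 finally show ?thesis .
qed

lemma wder_cong_AE:
 assumes u: "u \<in> Hspace k" and ae: "AE x in lebesgue. u x = w x" and js: "length js \<le> k"
 shows "AE x in lebesgue. wder js w x = wder js u x"
proof -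
 have "wd js w (wder js u)"
  by (rule wd_cong[OF Hspace_wder(2)[OF u js] ae]) simp
 from wder_props(3)[OF Hspace_wder(1)[OF u js] this] show ?thesis .
qed

lemma Hspace_cong_AE:
 assumes u: "u \<in> Hspace k" and ae: "AE x in lebesgue. u x = w x"
 shows "w \<in> Hspace k"
 unfolding Hspace_iff
proof (intro conjI allI impI)
 show "w \<in> L2_space" using L2_cong_AE[OF Hspace_L2[OF u] ae] .
 fix js :: "'a list" assume js: "length js \<le> k"
 have "wd js w (wder js u)" by (rule wd_cong[OF Hspace_wder(2)[OF u js] ae]) simp
 thus "\<exists>v\<in>L2_space. wd js w v" using Hspace_wder(1)[OF u js] by blast
qed

lemma Hnorm_cong_AE:
 assumes u: "u \<in> Hspace k" and ae: "AE x in lebesgue. u x = w x"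
 shows "Hnorm k w = Hnorm k u"
 unfolding Hnorm_L2_set
proof (rule L2_set_cong[OF refl])
 fix \<beta> :: "'a => nat" assume "\<beta> \<in> {\<beta>. mdeg \<beta> \<le> k}"
 then obtain js where "\<beta> = count_list js" "length js \<le> k" using multiindex_cases by blast
 thus "L2norm (weak_deriv \<beta> w) = L2norm (weak_deriv \<beta> u)"
  using wder_cong_AE[OF u ae] by (auto intro: L2norm_cong_AE)
qed

lemma wder_lincomb:
 assumes u: "u \<in> Hspace k" and w: "w \<in> Hspace k" and js: "length js \<le> k"
 shows "AE x in lebesgue. wder js (\<lambda>x. a * u x + b * w x) x = a * wder js u x + b * wder js w x"
 by (rule wder_props(3)[OF L2_lincomb wd_lincomb])
  (use Hspace_wder[OF u js] Hspace_wder[OF w js] Hspace_L2[OF u] Hspace_L2[OF w] in auto)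

lemma Hspace_lincomb:
 assumes u: "u \<in> Hspace k" and w: "w \<in> Hspace k"
 shows "(\<lambda>x. a * u x + b * w x) \<in> Hspace k"
 unfolding Hspace_iff
proof (intro conjI allI impI)
 show "(\<lambda>x. a * u x + b * w x) \<in> L2_space" using u w by (intro L2_lincomb Hspace_L2)
 fix js :: "'a list" assume js: "length js \<le> k"
 have "wd js (\<lambda>x. a * u x + b * w x) (\<lambda>x. a * wder js u x + b * wder js w x)"
  by (rule wd_lincomb) (use Hspace_wder[OF u js] Hspace_wder[OF w js] Hspace_L2[OF u] Hspace_L2[OF w] in auto)
 thus "\<exists>v\<in>L2_space. wd js (\<lambda>x. a * u x + b * w x) v"
  using L2_lincomb[OF Hspace_wder(1)[OF u js] Hspace_wder(1)[OF w js]] by blast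
qed

lemma Hspace_cmult: "u \<in> Hspace k ==> (\<lambda>x. a * u x) \<in> Hspace k"
 using Hspace_lincomb[of u k u a 0] by simp

lemma Hspace_add: "u \<in> Hspace k ==> w \<in> Hspace k ==> (\<lambda>x. u x + w x) \<in> Hspace k"
 using Hspace_lincomb[of u k w 1 1] by simp

lemma Hspace_diff: "u \<in> Hspace k ==> w \<in> Hspace k ==> (\<lambda>x. u x - w x) \<in> Hspace k"
 using Hspace_lincomb[of u k w 1 "-1"] by simp

lemma Hspace_zero: "(\<lambda>x. 0) \<in> Hspace k"
 unfolding Hspace_iff by (auto simp: wd_def intro!: L2_zero bexI[of _ "\<lambda>x. 0"])

lemma Hnorm_cmult: assumes u: "u \<in> Hspace k" shows "Hnorm k (\<lambda>x. a * u x) = \<bar>a\<bar> * Hnorm k u"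
proof -
 have "Hnorm k (\<lambda>x. a * u x) = L2_set (\<lambda>\<beta>. \<bar>a\<bar> * L2norm (weak_deriv \<beta> u)) {\<beta>. mdeg \<beta> \<le> k}"
  unfolding Hnorm_L2_set
 proof (rule L2_set_cong[OF refl])
  fix \<beta> :: "'a => nat" assume "\<beta> \<in> {\<beta>. mdeg \<beta> \<le> k}"
  then obtain js where js: "\<beta> = count_list js" "length js \<le> k" using multiindex_cases by blast
  have "AE x in lebesgue. wder js (\<lambda>x. a * u x) x = a * wder js u x"
   using wder_lincomb[OF u u js(2), of a 0] by simp
  thus "L2norm (weak_deriv \<beta> (\<lambda>x. a * u x)) = \<bar>a\<bar> * L2norm (weak_deriv \<beta> u)"
   unfolding js(1) L2norm_cmult[symmetric] by (rule L2norm_cong_AE)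
 qed
 also have "\<dots> = \<bar>a\<bar> * Hnorm k u" unfolding Hnorm_L2_set by (rule L2_set_right_distrib[symmetric]) simp
 finally show ?thesis .
qed

lemma Hnorm_triangle:
 assumes u: "u \<in> Hspace k" and w: "w \<in> Hspace k"
 shows "Hnorm k (\<lambda>x. u x + w x) \<le> Hnorm k u + Hnorm k w"
proof -
 have "Hnorm k (\<lambda>x. u x + w x) \<le>
  L2_set (\<lambda>\<beta>. L2norm (weak_deriv \<beta> u) + L2norm (weak_deriv \<beta> w)) {\<beta>. mdeg \<beta> \<le> k}"
  unfolding Hnorm_L2_set
 proof (rule L2_set_mono)
  fix \<beta> :: "'a => nat" assume "\<beta> \<in> {\<beta>. mdeg \<beta> \<le> k}"
  then obtain js where js: "\<beta> = count_list js" "length js \<le> k" using multiindex_cases by blast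
  have "AE x in lebesgue. wder js (\<lambda>x. u x + w x) x = wder js u x + wder js w x"
   using wder_lincomb[OF u w js(2), of 1 1] by simp
  from L2norm_cong_AE[OF this] L2norm_triangle[OF Hspace_wder(1)[OF u js(2)] Hspace_wder(1)[OF w js(2)]]
  show "L2norm (weak_deriv \<beta> (\<lambda>x. u x + w x)) \<le> L2norm (weak_deriv \<beta> u) + L2norm (weak_deriv \<beta> w)"
   using js(1) by simp
 qed simp
 also have "\<dots> \<le> Hnorm k u + Hnorm k w" unfolding Hnorm_L2_set by (rule L2_set_triangle_ineq)
 finally show ?thesis .
qed

lemma L2norm_le_Hnorm: assumes "u \<in> Hspace k" shows "L2norm u \<le> Hnorm k u"
proof -
 have "AE x in lebesgue. wder [] u x = u x"
  by (rule wder_props(3)[OF Hspace_L2[OF assms] wd_Nil])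
 from L2norm_cong_AE[OF this] wder_le_Hnorm[of "[]" k u] show ?thesis by simp
qed

lemma Hnorm_eq_0: assumes "u \<in> Hspace k" shows "Hnorm k u = 0 \<longleftrightarrow> (AE x in lebesgue. u x = 0)"
proof
 assume "Hnorm k u = 0"
 hence "L2norm u = 0" using L2norm_le_Hnorm[OF assms] L2norm_nonneg[of u] by linarith
 thus "AE x in lebesgue. u x = 0" by (rule L2norm_eq_0[OF Hspace_L2[OF assms]])
next
 assume "AE x in lebesgue. u x = 0"
 hence "AE x in lebesgue. u x = 0 * u x" by simp
 hence "Hnorm k (\<lambda>x. 0 * u x) = Hnorm k u" by (rule Hnorm_cong_AE[OF assms])
 thus "Hnorm k u = 0" using Hnorm_cmult[OF assms, of 0] by simp
qed

text \<open>Each derivative converges in L^2, and weak derivatives pass to L^2 limits, so the limit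
  of the zeroth derivative has the other limits as its derivatives.\<close>

lemma Hspace_complete:
 assumes u: "\<And>n. u n \<in> Hspace k"
  and cau: "\<And>e. e > 0 ==> \<exists>M. \<forall>m\<ge>M. \<forall>n\<ge>M. Hnorm k (\<lambda>x. u m x - u n x) < e"
 shows "\<exists>w\<in>Hspace k. (\<lambda>n. Hnorm k (\<lambda>x. u n x - w x)) \<longlonglongrightarrow> 0"
proof -
 have wdiff: "AE x in lebesgue. wder js (\<lambda>x. v x - w x) x = wder js v x - wder js w x"
  if "v \<in> Hspace k" "w \<in> Hspace k" "length js \<le> k" for v w and js :: "'a list"
  using wder_lincomb[OF that, of 1 "-1"] by simp
 have "\<exists>w\<in>L2_space. (\<lambda>n. L2norm (\<lambda>x. wder js (u n) x - w x)) \<longlonglongrightarrow> 0" if js: "length js \<le> k" for js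
 proof (rule L2_complete)
  show "wder js (u n) \<in> L2_space" for n using Hspace_wder(1)[OF u js] .
  fix e :: real assume "e > 0"
  from cau[OF this] obtain M where M: "\<And>m n. m \<ge> M ==> n \<ge> M ==> Hnorm k (\<lambda>x. u m x - u n x) < e" by blast
  have "L2norm (\<lambda>x. wder js (u m) x - wder js (u n) x) \<le> Hnorm k (\<lambda>x. u m x - u n x)" for m n
   using wder_le_Hnorm[OF js, of "\<lambda>x. u m x - u n x"] L2norm_cong_AE[OF wdiff[OF u[of m] u[of n] js]] by simp
  thus "\<exists>M. \<forall>m\<ge>M. \<forall>n\<ge>M. L2norm (\<lambda>x. wder js (u m) x - wder js (u n) x) < e"
   using M by (meson le_less_trans)
 qed
 hence "\<forall>js\<in>{js. length js \<le> k}. \<exists>w. w \<in> L2_space \<and> (\<lambda>n. L2norm (\<lambda>x. wder js (u n) x - w x)) \<longlonglongrightarrow> 0"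
  by blast
 from bchoice[OF this] obtain W where "\<forall>js\<in>{js. length js \<le> k}. W js \<in> L2_space \<and> (\<lambda>n. L2norm (\<lambda>x. wder js (u n) x - W js x)) \<longlonglongrightarrow> 0" ..
 hence W: "\<And>js. length js \<le> k ==> W js \<in> L2_space"
  "\<And>js. length js \<le> k ==> (\<lambda>n. L2norm (\<lambda>x. wder js (u n) x - W js x)) \<longlonglongrightarrow> 0" by auto
 define w where "w = W []"
 have w2: "w \<in> L2_space" using W(1)[of "[]"] by (simp add: w_def)
 have ae0: "AE x in lebesgue. wder [] (u n) x = u n x" for n
  by (rule wder_props(3)[OF Hspace_L2[OF u] wd_Nil])
 have lim0: "(\<lambda>n. L2norm (\<lambda>x. u n x - w x)) \<longlonglongrightarrow> 0"
 proof -
  have "L2norm (\<lambda>x. wder [] (u n) x - w x) = L2norm (\<lambda>x. u n x - w x)" for n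
   by (rule L2norm_cong_AE) (use ae0[of n] in \<open>eventually_elim, simp\<close>)
  thus ?thesis using W(2)[of "[]"] by (simp add: w_def)
 qed
 have wdW: "wd js w (W js)" if js: "length js \<le> k" for js
  by (rule wd_limit[OF Hspace_wder(2)[OF u js] Hspace_L2[OF u] w2 Hspace_wder(1)[OF u js] W(1)[OF js] lim0 W(2)[OF js]])
 have w: "w \<in> Hspace k" unfolding Hspace_iff using w2 wdW W(1) by blast
 moreover have "(\<lambda>n. Hnorm k (\<lambda>x. u n x - w x)) \<longlonglongrightarrow> 0"
 proof (rule Lim_null_comparison)
  show "\<forall>\<^sub>F n in sequentially. norm (Hnorm k (\<lambda>x. u n x - w x)) \<le>
    (\<Sum>js | length js \<le> k. L2norm (\<lambda>x. wder js (u n) x - W js x))"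
  proof (intro always_eventually allI)
   fix n
   have "L2norm (wder js (\<lambda>x. u n x - w x)) = L2norm (\<lambda>x. wder js (u n) x - W js x)" if js: "length js \<le> k" for js
   proof (rule L2norm_cong_AE)
    show "AE x in lebesgue. wder js (\<lambda>x. u n x - w x) x = wder js (u n) x - W js x"
     using wdiff[OF u[of n] w js] wder_props(3)[OF W(1)[OF js] wdW[OF js]] by eventually_elim simp
   qed
   hence "(\<Sum>js | length js \<le> k. L2norm (wder js (\<lambda>x. u n x - w x))) = (\<Sum>js | length js \<le> k. L2norm (\<lambda>x. wder js (u n) x - W js x))"
    by (intro sum.cong) auto
   thus "norm (Hnorm k (\<lambda>x. u n x - w x)) \<le> (\<Sum>js | length js \<le> k. L2norm (\<lambda>x. wder js (u n) x - W js x))"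
    using Hnorm_le_sum[of k "\<lambda>x. u n x - w x"] by simp
  qed
  show "(\<lambda>n. \<Sum>js | length js \<le> k. L2norm (\<lambda>x. wder js (u n) x - W js x)) \<longlonglongrightarrow> 0"
   by (intro tendsto_null_sum W(2)) auto
 qed
 ultimately show ?thesis by blast
qed

lemma Hspace_Suc_deriv:
 assumes u: "u \<in> Hspace (Suc k)"
 shows "wder [l] u \<in> Hspace k"
  "Hnorm k (wder [l] u) \<le> real (card {js::'n::finite list. length js \<le> k}) * Hnorm (Suc k) (u :: 'n fn)"
proof -
 have l: "wder [l] u \<in> L2_space" "wd [l] u (wder [l] u)" using Hspace_wder[OF u, of "[l]"] by auto
 have c: "wd js (wder [l] u) (wder (l # js) u)" if "length js \<le> k" for js
  using wd_append_cancel[of "[l]" js, OF _ l(2)] Hspace_wder(2)[OF u, of "l # js"] that by simp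
 show w: "wder [l] u \<in> Hspace k"
  unfolding Hspace_iff
 proof (intro conjI l allI impI)
  fix js :: "'n list" assume js: "length js \<le> k"
  hence "wder (l # js) u \<in> L2_space" by (intro Hspace_wder(1)[OF u]) simp
  thus "\<exists>v\<in>L2_space. wd js (wder [l] u) v" using c[OF js] by blast
 qed
 have "L2norm (wder js (wder [l] u)) \<le> Hnorm (Suc k) u" if js: "length js \<le> k" for js
 proof -
  have "AE x in lebesgue. wder js (wder [l] u) x = wder (l # js) u x"
   by (rule wder_props(3)[OF _ c[OF js]]) (use Hspace_wder(1)[OF u, of "l # js"] js in simp)
  from L2norm_cong_AE[OF this] wder_le_Hnorm[of "l # js" "Suc k" u] js show ?thesis by simp
 qed
 hence "(\<Sum>js | length js \<le> k. L2norm (wder js (wder [l] u))) \<le> (\<Sum>js\<in>{js::'n list. length js \<le> k}. Hnorm (Suc k) u)"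
  by (intro sum_mono) auto
 thus "Hnorm k (wder [l] u) \<le> real (card {js::'n list. length js \<le> k}) * Hnorm (Suc k) u"
  using Hnorm_le_sum[of k "wder [l] u"] by simp
qed

text \<open>With \<open>Hspace_Suc_deriv\<close> this describes H^(k+1) through first derivatives in
  H^k, the form in which products are treated by induction on the order.\<close>

lemma Hspace_SucI:
 fixes u :: "'n::finite fn"
 assumes u: "u \<in> L2_space" and w: "\<And>l. w l \<in> Hspace k" and wd: "\<And>l. wd [l] u (w l)"
 shows "u \<in> Hspace (Suc k)"
  "Hnorm (Suc k) u \<le> real (card {js::'n list. length js \<le> Suc k}) * (L2norm u + (\<Sum>l\<in>UNIV. Hnorm k (w l)))"
proof -
 have c: "wd (l # js) u (wder js (w l))" if "length js \<le> k" for l js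
  using wd_append[OF wd Hspace_wder(2)[OF w that]] by simp
 have ex: "\<exists>v\<in>L2_space. wd js u v" if "length js \<le> Suc k" for js
 proof (cases js)
  case Nil
  thus ?thesis using u wd_Nil by blast
 next
  case (Cons l ks)
  hence "length ks \<le> k" using that by simp
  thus ?thesis unfolding Cons using c Hspace_wder(1)[OF w] by blast
 qed
 thus "u \<in> Hspace (Suc k)" using u by (simp add: Hspace_iff)
 have "L2norm (wder js u) \<le> L2norm u + (\<Sum>l\<in>UNIV. Hnorm k (w l))" if js: "length js \<le> Suc k" for js
 proof (cases js)
  case Nil
  have "L2norm (wder js u) = L2norm u"
   unfolding Nil by (rule L2norm_cong_AE[OF wder_props(3)[OF u wd_Nil]])
  thus ?thesis by (simp add: sum_nonneg)
 next
  case (Cons l ks)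
  hence ks: "length ks \<le> k" using js by simp
  have "L2norm (wder js u) = L2norm (wder ks (w l))"
   unfolding Cons by (rule L2norm_cong_AE[OF wder_props(3)[OF Hspace_wder(1)[OF w ks] c[OF ks]]])
  also have "\<dots> \<le> Hnorm k (w l)" using ks by (rule wder_le_Hnorm)
  also have "\<dots> \<le> (\<Sum>l\<in>UNIV. Hnorm k (w l))" by (rule member_le_sum) auto
  finally show ?thesis by (simp add: add_increasing)
 qed
 hence "(\<Sum>js | length js \<le> Suc k. L2norm (wder js u)) \<le> (\<Sum>js\<in>{js::'n list. length js \<le> Suc k}. L2norm u + (\<Sum>l\<in>UNIV. Hnorm k (w l)))"
  by (intro sum_mono) auto
 thus "Hnorm (Suc k) u \<le> real (card {js::'n list. length js \<le> Suc k}) * (L2norm u + (\<Sum>l\<in>UNIV. Hnorm k (w l)))"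
  using Hnorm_le_sum[of "Suc k" u] by simp
qed

section \<open>From smooth functions to Sobolev functions by mollification\<close>

lemma wd_conv:
 assumes "wd js u w" "\<phi> \<in> \<D>"
 shows "conv u (iter_partial js \<phi>) = conv w \<phi>"
proof
 fix x
 have "(LEB y. u y * ((-1) ^ length js * iter_partial js \<phi> (x - y))) = (-1) ^ length js * (LEB y. w y * \<phi> (x - y))"
  using bspec[OF assms(1)[unfolded wd_def] test_shift[OF assms(2), of x]]
  unfolding iter_partial_shift[OF assms(2)] .
 hence "(-1) ^ length js * conv u (iter_partial js \<phi>) x = (-1) ^ length js * conv w \<phi> x"
  unfolding conv_def by (simp only: mult.left_commute[of "u _"] integral_mult_right_zero)
 thus "conv u (iter_partial js \<phi>) x = conv w \<phi> x" by simp
qed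

lemma iter_partial_conv_wd:
 assumes "wd js u w" "u \<in> L2_space" "\<phi> \<in> \<D>"
 shows "iter_partial js (conv u \<phi>) = conv w \<phi>"
 using iter_partial_conv[OF assms(2,3)] wd_conv[OF assms(1,3)] by simp

lemma smooth_moll: "u \<in> L2_space ==> smooth (conv u (moll n))"
 by (intro smooth_conv test_moll)

text \<open>Mollification commutes with weak derivatives and does not increase L^2 norms; the factor
  counts the lists, each of which contributes at most the squared Sobolev norm.\<close>

lemma Sq_moll_bound:
 fixes u :: "'n::finite fn"
 assumes u: "u \<in> Hspace i"
 shows "(NNINT x. ennreal (Sq i (conv u (moll n)) x)) \<le> ennreal (real (card {js::'n list. length js \<le> i}) * (Hnorm i u)\<^sup>2)"
proof -
 have eq: "iter_partial js (conv u (moll n)) = conv (wder js u) (moll n)" if "length js \<le> i" for js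
  by (rule iter_partial_conv_wd[OF Hspace_wder(2)[OF u that] Hspace_L2[OF u] test_moll])
 have "(NNINT x. ennreal (Sq i (conv u (moll n)) x)) =
   (NNLEB x. (\<Sum>js | length js \<le> i. ennreal ((conv (wder js u) (moll n) x)\<^sup>2)))"
  unfolding nn_integral_completion Sq_def
  by (intro nn_integral_cong) (simp add: eq)
 also have "\<dots> = (\<Sum>js | length js \<le> i. (NNLEB x. ennreal ((conv (wder js u) (moll n) x)\<^sup>2)))"
 proof (rule nn_integral_sum)
  fix js :: "'n list" assume "js \<in> {js. length js \<le> i}"
  hence "conv (wder js u) (moll n) \<in> L2_space"
   by (intro conv_L2(1)[OF Hspace_wder(1)[OF u] test_moll]) simp
  from L2_measurable[OF this] show "(\<lambda>x. ennreal ((conv (wder js u) (moll n) x)\<^sup>2)) \<in> borel_measurable lebesgue"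
   by measurable
 qed
 also have "\<dots> \<le> (\<Sum>js\<in>{js::'n list. length js \<le> i}. ennreal ((Hnorm i u)\<^sup>2))"
 proof (rule sum_mono)
  fix js :: "'n list" assume "js \<in> {js. length js \<le> i}"
  hence js: "length js \<le> i" by simp
  have c: "conv (wder js u) (moll n) \<in> L2_space"
   by (rule conv_L2(1)[OF Hspace_wder(1)[OF u js] test_moll])
  have "L2norm (conv (wder js u) (moll n)) \<le> Hnorm i u"
   using conv_moll_le[OF Hspace_wder(1)[OF u js]] wder_le_Hnorm[OF js] order_trans by blast
  thus "(NNLEB x. ennreal ((conv (wder js u) (moll n) x)\<^sup>2)) \<le> ennreal ((Hnorm i u)\<^sup>2)"
   unfolding L2norm_nn[OF c] by (intro ennreal_leI power_mono) auto
 qed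
 also have "\<dots> = ennreal (real (card {js::'n list. length js \<le> i}) * (Hnorm i u)\<^sup>2)"
  by (simp add: ennreal_mult ennreal_of_nat_eq_real_of_nat)
 finally show ?thesis .
qed

lemma L2_moll_AE_subseq2:
 assumes u: "u \<in> L2_space" and w: "w \<in> L2_space"
 obtains r where "strict_mono r" "AE x in lebesgue. (\<lambda>n. conv u (moll (r n)) x) \<longlonglongrightarrow> u x"
  "AE x in lebesgue. (\<lambda>n. conv w (moll (r n)) x) \<longlonglongrightarrow> w x"
proof -
 obtain r where r: "strict_mono r" "AE x in lebesgue. (\<lambda>n. conv u (moll (r n)) x) \<longlonglongrightarrow> u x"
  using L2_AE_subseq[OF conv_L2(1)[OF u test_moll] u conv_moll_tendsto[OF u]] by blast
 have "(\<lambda>n. L2norm (\<lambda>x. conv w (moll (r n)) x - w x)) \<longlonglongrightarrow> 0"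
  using LIMSEQ_subseq_LIMSEQ[OF conv_moll_tendsto[OF w] r(1)] by (simp add: o_def)
 from L2_AE_subseq[OF conv_L2(1)[OF w test_moll] w this] obtain s where
  s: "strict_mono s" "AE x in lebesgue. (\<lambda>n. conv w (moll (r (s n))) x) \<longlonglongrightarrow> w x" by blast
 have "AE x in lebesgue. (\<lambda>n. conv u (moll (r (s n))) x) \<longlonglongrightarrow> u x"
  using r(2) by eventually_elim (use LIMSEQ_subseq_LIMSEQ[OF _ s(1)] in \<open>force simp: o_def\<close>)
 thus ?thesis using that[of "r \<circ> s"] s r(1) strict_mono_o by (auto simp: o_def)
qed

text \<open>The smooth estimate bounds the products of mollifications uniformly; along a common
  subsequence they converge almost everywhere to the product, and Fatou's lemma keeps the
  bound.\<close>

lemma product_estimate: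
 assumes k: "2 * real k \<ge> real CARD('n) + 1" and ij: "i + j \<ge> k"
 shows "\<exists>C\<ge>0. \<forall>a\<in>Hspace i. \<forall>b\<in>Hspace j. (\<lambda>x::real^'n::finite. a x * b x) \<in> L2_space \<and>
  L2norm (\<lambda>x. a x * b x) \<le> C * (Hnorm i a * Hnorm j b)"
proof -
 from product_estimate_smooth[OF k ij] obtain C where C0: "C \<ge> 0" and
  C: "\<And>a b::'n fn. smooth a ==> smooth b ==>
  (NNINT x. ennreal ((a x * b x)\<^sup>2)) \<le>
   ennreal C * ((NNINT x. ennreal (Sq i a x)) * (NNINT x. ennreal (Sq j b x)))" by blast
 define ci cj where "ci = real (card {js::'n list. length js \<le> i})" "cj = real (card {js::'n list. length js \<le> j})"
 define D where "D = sqrt (C * (ci * cj))"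
 have D0: "D \<ge> 0" and D2: "D\<^sup>2 = C * (ci * cj)" using C0 by (auto simp: D_def ci_cj_def)
 have main: "(\<lambda>x. a x * b x) \<in> L2_space \<and> L2norm (\<lambda>x. a x * b x) \<le> D * (Hnorm i a * Hnorm j b)"
  if a: "a \<in> Hspace i" and b: "b \<in> Hspace j" for a b :: "'n fn"
 proof -
  have a2: "a \<in> L2_space" and b2: "b \<in> L2_space" using a b Hspace_L2 by auto
  obtain r where r: "AE x in lebesgue. (\<lambda>n. conv a (moll (r n)) x) \<longlonglongrightarrow> a x"
   "AE x in lebesgue. (\<lambda>n. conv b (moll (r n)) x) \<longlonglongrightarrow> b x"
   using L2_moll_AE_subseq2[OF a2 b2] by blast
  define U where "U n x = conv a (moll (r n)) x * conv b (moll (r n)) x" for n x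
  have P0: "0 \<le> D * (Hnorm i a * Hnorm j b)" using D0 by simp
  have U: "U n \<in> L2_space" "L2norm (U n) \<le> D * (Hnorm i a * Hnorm j b)" for n
  proof -
   have m: "U n \<in> borel_measurable lebesgue"
    unfolding U_def[abs_def]
    by (intro borel_measurable_times L2_measurable conv_L2(1) a2 b2 test_moll)
   have "(NNLEB x. ennreal ((U n x)\<^sup>2)) \<le> ennreal C * ((NNINT x. ennreal (Sq i (conv a (moll (r n))) x)) * (NNINT x. ennreal (Sq j (conv b (moll (r n))) x)))"
    unfolding U_def nn_integral_completion by (intro C smooth_moll a2 b2)
   also have "\<dots> \<le> ennreal C * (ennreal (ci * (Hnorm i a)\<^sup>2) * ennreal (cj * (Hnorm j b)\<^sup>2))"
    unfolding ci_cj_def by (intro mult_left_mono mult_mono Sq_moll_bound a b) auto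
   also have "\<dots> = ennreal ((D * (Hnorm i a * Hnorm j b))\<^sup>2)"
    using C0 by (simp add: power_mult_distrib D2 mult_ac ci_cj_def flip: ennreal_mult)
   finally have le: "(NNLEB x. ennreal ((U n x)\<^sup>2)) \<le> ennreal ((D * (Hnorm i a * Hnorm j b))\<^sup>2)" .
   from L2_nnI[OF m le P0] show "U n \<in> L2_space" "L2norm (U n) \<le> D * (Hnorm i a * Hnorm j b)" by auto
  qed
  have lim: "AE x in lebesgue. (\<lambda>n. U n x) \<longlonglongrightarrow> a x * b x"
   using r unfolding U_def by eventually_elim (rule tendsto_mult)
  have m: "(\<lambda>x. a x * b x) \<in> borel_measurable lebesgue"
   by (intro borel_measurable_times L2_measurable a2 b2)
  show ?thesis using L2_Fatou[OF U lim m] by blast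
 qed
 thus ?thesis using D0 by blast
qed

lemma Hspace_sup_bound:
 assumes k: "2 * real k \<ge> real CARD('n) + 1"
 shows "\<exists>C\<ge>0. \<forall>u\<in>Hspace k. AE x::real^'n::finite in lebesgue. \<bar>u x\<bar> \<le> C * Hnorm k u"
proof -
 obtain m where m: "k = Suc m" using k by (cases k) auto
 obtain C where C: "\<And>(a::'n fn) x. smooth a ==>
  ennreal ((a x)\<^sup>2) \<le> ennreal C * (NNINT y. ennreal (Sq k a y))"
  using sup_bound_smooth k m by blast
 define c where "c = real (card {js::'n list. length js \<le> k})"
 define D where "D = sqrt (max 0 C * c)"
 have D0: "D \<ge> 0" and D2: "D\<^sup>2 = max 0 C * c" by (auto simp: D_def c_def)
 have "AE x in lebesgue. \<bar>u x\<bar> \<le> D * Hnorm k u" if u: "u \<in> Hspace k" for u :: "'n fn"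
 proof -
  have u2: "u \<in> L2_space" using u by (rule Hspace_L2)
  obtain r where r: "AE x in lebesgue. (\<lambda>n. conv u (moll (r n)) x) \<longlonglongrightarrow> u x"
   using L2_moll_AE_subseq2[OF u2 u2] by blast
  have b: "\<bar>conv u (moll n) x\<bar> \<le> D * Hnorm k u" for n x
  proof -
   have "ennreal ((conv u (moll n) x)\<^sup>2) \<le> ennreal C * (NNINT y. ennreal (Sq k (conv u (moll n)) y))"
    by (intro C smooth_moll u2)
   also have "\<dots> \<le> ennreal (max 0 C) * ennreal (c * (Hnorm k u)\<^sup>2)"
    unfolding c_def by (intro mult_mono Sq_moll_bound u ennreal_leI) auto
   also have "\<dots> = ennreal ((D * Hnorm k u)\<^sup>2)"
    by (simp add: power_mult_distrib D2 mult_ac c_def flip: ennreal_mult)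
   finally have "(conv u (moll n) x)\<^sup>2 \<le> (D * Hnorm k u)\<^sup>2" by (simp add: ennreal_le_iff)
   thus ?thesis using D0 by (simp add: abs_le_square_iff[symmetric] abs_of_nonneg)
  qed
  show ?thesis using r
  proof eventually_elim
   case (elim x)
   hence "(\<lambda>n. \<bar>conv u (moll (r n)) x\<bar>) \<longlonglongrightarrow> \<bar>u x\<bar>" by (rule tendsto_rabs)
   thus ?case by (rule LIMSEQ_le_const2) (use b in auto)
  qed
 qed
 thus ?thesis using D0 by blast
qed

text \<open>The product of two sequences converging in L^2 converges in L^1, which suffices after
  pairing with a bounded function. This is the passage to the limit in the Leibniz rule.\<close>

lemma triple_integral_tendsto:
 fixes f g :: "nat => 'n::finite fn"
 assumes f: "\<And>n. f n \<in> L2_space" "f' \<in> L2_space" "(\<lambda>n. L2norm (\<lambda>x. f n x - f' x)) \<longlonglongrightarrow> 0"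
  and g: "\<And>n. g n \<in> L2_space" "g' \<in> L2_space" "(\<lambda>n. L2norm (\<lambda>x. g n x - g' x)) \<longlonglongrightarrow> 0"
  and B: "\<And>n. L2norm (g n) \<le> B"
  and \<phi>: "\<phi> \<in> \<D>"
 shows "(\<lambda>n. LEB x. f n x * g n x * \<phi> x) \<longlonglongrightarrow> (LEB x. f' x * g' x * \<phi> x)"
  and "\<And>a b. a \<in> L2_space ==> b \<in> L2_space ==> integrable lebesgue (\<lambda>x. a x * b x * \<phi> x)"
proof -
 from \<phi> obtain R where R: "\<And>x. norm x > R ==> \<phi> x = 0" by (auto simp: test_functions_iff)
 have "bounded (\<phi> ` cball 0 R)"
  by (intro compact_imp_bounded compact_continuous_image test_continuous \<phi>) auto
 then obtain M0 where "\<forall>x\<in>cball 0 R. norm (\<phi> x) \<le> M0" unfolding bounded_iff by auto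
 hence M0: "\<And>x. norm x \<le> R ==> \<bar>\<phi> x\<bar> \<le> M0" by simp
 define M where "M = max M0 0"
 have M: "\<bar>\<phi> x\<bar> \<le> M" for x using M0[of x] R[of x] by (cases "norm x \<le> R") (auto simp: M_def)
 have M0: "M \<ge> 0" by (simp add: M_def)
 have \<phi>m: "\<phi> \<in> borel_measurable lebesgue" using test_L2[OF \<phi>] by (rule L2_measurable)
 have h: "(\<lambda>x. b x * \<phi> x) \<in> L2_space" "L2norm (\<lambda>x. b x * \<phi> x) \<le> M * L2norm b" if b: "b \<in> L2_space" for b
 proof -
  have m: "(\<lambda>x. b x * \<phi> x) \<in> borel_measurable lebesgue"
   using L2_measurable[OF b] \<phi>m by (rule borel_measurable_times)
  have "(NNLEB x. ennreal ((b x * \<phi> x)\<^sup>2)) \<le> (NNLEB x. ennreal (M\<^sup>2) * ennreal ((b x)\<^sup>2))"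
  proof (intro nn_integral_mono)
   fix x
   have "(b x * \<phi> x)\<^sup>2 \<le> M\<^sup>2 * (b x)\<^sup>2"
    using M[of x] M0 unfolding power_mult_distrib
    by (subst mult.commute) (intro mult_right_mono, auto simp: abs_le_square_iff[symmetric])
   thus "ennreal ((b x * \<phi> x)\<^sup>2) \<le> ennreal (M\<^sup>2) * ennreal ((b x)\<^sup>2)"
    by (simp add: ennreal_leI flip: ennreal_mult)
  qed
  also have "\<dots> = ennreal (M\<^sup>2) * ennreal ((L2norm b)\<^sup>2)"
   unfolding L2norm_nn[OF b, symmetric] by (rule nn_integral_cmult) (use L2_measurable[OF b] in measurable)
  also have "\<dots> = ennreal ((M * L2norm b)\<^sup>2)" by (simp add: power_mult_distrib flip: ennreal_mult)
  finally have le: "(NNLEB x. ennreal ((b x * \<phi> x)\<^sup>2)) \<le> ennreal ((M * L2norm b)\<^sup>2)" .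
  have "0 \<le> M * L2norm b" using M0 by simp
  from L2_nnI[OF m le this] show "(\<lambda>x. b x * \<phi> x) \<in> L2_space" "L2norm (\<lambda>x. b x * \<phi> x) \<le> M * L2norm b" by auto
 qed
 show int: "integrable lebesgue (\<lambda>x. a x * b x * \<phi> x)" if "a \<in> L2_space" "b \<in> L2_space" for a b
  using L2_mult_integrable[OF that(1) h(1)[OF that(2)]] by (simp add: mult.assoc)
 show "(\<lambda>n. LEB x. f n x * g n x * \<phi> x) \<longlonglongrightarrow> (LEB x. f' x * g' x * \<phi> x)"
 proof (rule LIM_zero_cancel, rule Lim_null_comparison)
  show "(\<lambda>n. L2norm (\<lambda>x. f n x - f' x) * (M * B) + L2norm f' * (M * L2norm (\<lambda>x. g n x - g' x))) \<longlonglongrightarrow> 0"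
   using tendsto_add[OF tendsto_mult_left_zero[OF f(3), of "M * B"]
     tendsto_mult_right_zero[OF tendsto_mult_right_zero[OF g(3), of M], of "L2norm f'"]] by simp
  show "\<forall>\<^sub>F n in sequentially. norm ((LEB x. f n x * g n x * \<phi> x) - (LEB x. f' x * g' x * \<phi> x)) \<le>
   L2norm (\<lambda>x. f n x - f' x) * (M * B) + L2norm f' * (M * L2norm (\<lambda>x. g n x - g' x))"
  proof (intro always_eventually allI)
   fix n
   have fd: "(\<lambda>x. f n x - f' x) \<in> L2_space" and gd: "(\<lambda>x. g n x - g' x) \<in> L2_space"
    using f g by (auto intro: L2_diff)
   have "(LEB x. f n x * g n x * \<phi> x) - (LEB x. f' x * g' x * \<phi> x) =
    (LEB x. f n x * g n x * \<phi> x - f' x * g' x * \<phi> x)"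
    using int[OF f(1) g(1)] int[OF f(2) g(2)] by simp
   also have "\<dots> = (LEB x. (f n x - f' x) * (g n x * \<phi> x) + f' x * ((g n x - g' x) * \<phi> x))"
    by (intro Bochner_Integration.integral_cong) (auto simp: algebra_simps)
   also have "\<dots> = (LEB x. (f n x - f' x) * (g n x * \<phi> x)) + (LEB x. f' x * ((g n x - g' x) * \<phi> x))"
    by (rule Bochner_Integration.integral_add)
     (rule L2_mult_integrable[OF fd h(1)[OF g(1)]], rule L2_mult_integrable[OF f(2) h(1)[OF gd]])
   finally have "norm ((LEB x. f n x * g n x * \<phi> x) - (LEB x. f' x * g' x * \<phi> x)) \<le>
    \<bar>LEB x. (f n x - f' x) * (g n x * \<phi> x)\<bar> + \<bar>LEB x. f' x * ((g n x - g' x) * \<phi> x)\<bar>"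
    by simp
   also have "\<dots> \<le> L2norm (\<lambda>x. f n x - f' x) * (M * B) + L2norm f' * (M * L2norm (\<lambda>x. g n x - g' x))"
   proof (rule add_mono)
    have "\<bar>LEB x. (f n x - f' x) * (g n x * \<phi> x)\<bar> \<le> L2norm (\<lambda>x. f n x - f' x) * L2norm (\<lambda>x. g n x * \<phi> x)"
     by (rule L2_Cauchy_Schwarz[OF fd h(1)[OF g(1)]])
    also have "\<dots> \<le> L2norm (\<lambda>x. f n x - f' x) * (M * B)"
     using mult_left_mono[OF B M0] h(2)[OF g(1)] by (intro mult_left_mono) (auto intro: order_trans)
    finally show "\<bar>LEB x. (f n x - f' x) * (g n x * \<phi> x)\<bar> \<le> L2norm (\<lambda>x. f n x - f' x) * (M * B)" .
    have "\<bar>LEB x. f' x * ((g n x - g' x) * \<phi> x)\<bar> \<le> L2norm f' * L2norm (\<lambda>x. (g n x - g' x) * \<phi> x)"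
     by (rule L2_Cauchy_Schwarz[OF f(2) h(1)[OF gd]])
    also have "\<dots> \<le> L2norm f' * (M * L2norm (\<lambda>x. g n x - g' x))"
     by (intro mult_left_mono h(2) gd) simp
    finally show "\<bar>LEB x. f' x * ((g n x - g' x) * \<phi> x)\<bar> \<le> L2norm f' * (M * L2norm (\<lambda>x. g n x - g' x))" .
   qed
   finally show "norm ((LEB x. f n x * g n x * \<phi> x) - (LEB x. f' x * g' x * \<phi> x)) \<le>
    L2norm (\<lambda>x. f n x - f' x) * (M * B) + L2norm f' * (M * L2norm (\<lambda>x. g n x - g' x))" .
  qed
 qed
qed

text \<open>For mollifications, the partial derivative of their product with \<phi> has integral 0,
  and the three terms of its Leibniz expansion converge to the weak identity. Square integrability
  of the product is a separate matter, supplied by \<open>product_estimate\<close>.\<close>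

lemma wd_product:
 fixes u v :: "'n::finite fn"
 assumes u: "u \<in> L2_space" "u' \<in> L2_space" "wd [l] u u'"
  and v: "v \<in> L2_space" "v' \<in> L2_space" "wd [l] v v'"
 shows "wd [l] (\<lambda>x. u x * v x) (\<lambda>x. u' x * v x + u x * v' x)"
 unfolding wd_def
proof
 fix \<phi> :: "'n fn" assume \<phi>: "\<phi> \<in> \<D>"
 define c where "c w n = conv w (moll n)" for w :: "'n fn" and n
 have c: "c w n \<in> L2_space" "(\<lambda>n. L2norm (\<lambda>x. c w n x - w x)) \<longlonglongrightarrow> 0" "L2norm (c w n) \<le> L2norm w" "smooth (c w n)"
  if "w \<in> L2_space" for w n
  unfolding c_def by (auto intro: conv_L2 conv_moll_tendsto conv_moll_le smooth_moll test_moll that)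
 have pu: "partial l (c u n) = c u' n" and pv: "partial l (c v n) = c v' n" for n
  unfolding c_def using iter_partial_conv_wd[OF u(3,1) test_moll] iter_partial_conv_wd[OF v(3,1) test_moll] by simp_all
 note lim = triple_integral_tendsto(1)[OF c(1) _ c(2) c(1) _ c(2) c(3)] and int = triple_integral_tendsto(2)[OF c(1)[OF u(1)] u(1) c(2)[OF u(1)] c(1)[OF v(1)] v(1) c(2)[OF v(1)] c(3)[OF v(1)]]
 have zero: "(LEB x. c u' n x * c v n x * \<phi> x) + (LEB x. c u n x * c v' n x * \<phi> x)
   + (LEB x. c u n x * c v n x * partial l \<phi> x) = 0" for n
 proof -
  define F where "F x = c u n x * (c v n x * \<phi> x)" for x
  have sF: "smooth F" unfolding F_def by (intro smooth_mult c u v test_smooth \<phi>)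
  have pF: "partial l F = (\<lambda>x. c u' n x * c v n x * \<phi> x + c u n x * c v' n x * \<phi> x + c u n x * c v n x * partial l \<phi> x)"
  proof
   fix x
   have d: "c u n differentiable (at x)" "c v n differentiable (at x)" "\<phi> differentiable (at x)"
    by (auto intro: smooth_differentiable c u v test_smooth \<phi>)
   have "partial l F x = c u' n x * (c v n x * \<phi> x) + c u n x * partial l (\<lambda>x. c v n x * \<phi> x) x"
    unfolding F_def using d by (subst partial_mult) (auto simp: pu intro: differentiable_mult)
   also have "partial l (\<lambda>x. c v n x * \<phi> x) x = c v' n x * \<phi> x + c v n x * partial l \<phi> x"
    using d by (subst partial_mult) (auto simp: pv)
   finally show "partial l F x = c u' n x * c v n x * \<phi> x + c u n x * c v' n x * \<phi> x + c u n x * c v n x * partial l \<phi> x"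
    by (simp add: algebra_simps)
  qed
  have i: "integrable lebesgue (\<lambda>x. c u' n x * c v n x * \<phi> x)" "integrable lebesgue (\<lambda>x. c u n x * c v' n x * \<phi> x)"
   "integrable lebesgue (\<lambda>x. c u n x * c v n x * partial l \<phi> x)" "integrable lebesgue (\<lambda>x. c u n x * c v n x * \<phi> x)"
   by (rule int[OF \<phi> c(1)[OF u(2)] c(1)[OF v(1)]], rule int[OF \<phi> c(1)[OF u(1)] c(1)[OF v(2)]],
     rule int[OF test_partial[OF \<phi>] c(1)[OF u(1)] c(1)[OF v(1)]], rule int[OF \<phi> c(1)[OF u(1)] c(1)[OF v(1)]])
  have "(LEB x. partial l F x) = 0"
  proof (rule integral_partial_eq_0)
   show "F differentiable at x" for x using sF by (rule smooth_differentiable)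
   show "continuous_on UNIV (partial l F)" by (intro smooth_continuous smooth_partial sF)
   show "integrable lebesgue F" using i(4) by (simp add: F_def[abs_def] mult.assoc)
   show "integrable lebesgue (partial l F)" unfolding pF using i by simp
  qed
  thus ?thesis unfolding pF using i by simp
 qed
 have "(\<lambda>n. (LEB x. c u' n x * c v n x * \<phi> x) + (LEB x. c u n x * c v' n x * \<phi> x)
   + (LEB x. c u n x * c v n x * partial l \<phi> x)) \<longlonglongrightarrow>
  (LEB x. u' x * v x * \<phi> x) + (LEB x. u x * v' x * \<phi> x) + (LEB x. u x * v x * partial l \<phi> x)"
  by (intro tendsto_add lim u v \<phi> test_partial)
 hence "(LEB x. u' x * v x * \<phi> x) + (LEB x. u x * v' x * \<phi> x) + (LEB x. u x * v x * partial l \<phi> x) = 0"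
  unfolding zero LIMSEQ_const_iff by (rule sym)
 moreover have "(LEB x. (u' x * v x + u x * v' x) * \<phi> x) = (LEB x. u' x * v x * \<phi> x) + (LEB x. u x * v' x * \<phi> x)"
  using int[OF \<phi> u(2) v(1)] int[OF \<phi> u(1) v(2)] by (simp add: distrib_right)
 ultimately show "(LEB x. u x * v x * iter_partial [l] \<phi> x) =
  (-1) ^ length [l] * (LEB x. (u' x * v x + u x * v' x) * \<phi> x)" by simp
qed

text \<open>Induction on the order m of the product. By the Leibniz rule a derivative of the product
  costs one order in one factor, lowering i + j and m together, so i + j >= k + m is preserved down
  to m = 0, where \<open>product_estimate\<close> applies. The case i = j = m = k is the algebra
  property.\<close>

lemma Hspace_product_aux:
 assumes k: "2 * real k \<ge> real CARD('n) + 1"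
 shows "i + j \<ge> k + m ==> m \<le> i ==> m \<le> j ==>
  \<exists>C\<ge>0. \<forall>a\<in>Hspace i. \<forall>b\<in>Hspace j. (\<lambda>x::real^'n::finite. a x * b x) \<in> Hspace m \<and>
  Hnorm m (\<lambda>x. a x * b x) \<le> C * (Hnorm i a * Hnorm j b)"
proof (induction m arbitrary: i j)
 case 0
 obtain C where C: "C \<ge> 0" "\<And>a b. a \<in> Hspace i ==> b \<in> Hspace j ==> (\<lambda>x::real^'n. a x * b x) \<in> L2_space \<and>
  L2norm (\<lambda>x. a x * b x) \<le> C * (Hnorm i a * Hnorm j b)"
  using product_estimate[OF k, of i j] 0 by auto
 have H0: "u \<in> Hspace 0" "Hnorm 0 u = L2norm u" if u: "u \<in> L2_space" for u :: "'n fn"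
 proof -
  show u0: "u \<in> Hspace 0" using u wd_Nil by (auto simp: Hspace_iff)
  have "Hnorm 0 u \<le> (\<Sum>js | length js \<le> 0. L2norm (wder js u))" by (rule Hnorm_le_sum)
  also have "{js::'n list. length js \<le> 0} = {[]}" by auto
  also have "(\<Sum>js\<in>{[]}. L2norm (wder js u)) = L2norm u"
   using L2norm_cong_AE[OF wder_props(3)[OF u wd_Nil]] by simp
  finally show "Hnorm 0 u = L2norm u" using L2norm_le_Hnorm[OF u0] by linarith
 qed
 show ?case using C H0 by (intro exI[of _ C]) auto
next
 case (Suc m)
 obtain i' j' where ij: "i = Suc i'" "j = Suc j'" using Suc.prems by (metis Suc_le_D)
 obtain C0 where C0: "C0 \<ge> 0" "\<And>a b. a \<in> Hspace i ==> b \<in> Hspace j ==> (\<lambda>x::real^'n. a x * b x) \<in> L2_space \<and>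
  L2norm (\<lambda>x. a x * b x) \<le> C0 * (Hnorm i a * Hnorm j b)"
  using product_estimate[OF k, of i j] Suc.prems by auto
 obtain C1 where C1: "C1 \<ge> 0" "\<And>a b. a \<in> Hspace i' ==> b \<in> Hspace j ==> (\<lambda>x::real^'n. a x * b x) \<in> Hspace m \<and>
  Hnorm m (\<lambda>x. a x * b x) \<le> C1 * (Hnorm i' a * Hnorm j b)"
  using Suc.IH[of i' j] Suc.prems ij by auto
 obtain C2 where C2: "C2 \<ge> 0" "\<And>a b. a \<in> Hspace i ==> b \<in> Hspace j' ==> (\<lambda>x::real^'n. a x * b x) \<in> Hspace m \<and>
  Hnorm m (\<lambda>x. a x * b x) \<le> C2 * (Hnorm i a * Hnorm j' b)"
  using Suc.IH[of i j'] Suc.prems ij by auto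
 define ci cj cm where "ci = real (card {js::'n list. length js \<le> i'})" "cj = real (card {js::'n list. length js \<le> j'})"
  "cm = real (card {js::'n list. length js \<le> Suc m})"
 have nn: "ci \<ge> 0" "cj \<ge> 0" "cm \<ge> 0" by (auto simp: ci_cj_cm_def)
 define D where "D = cm * (C0 + real CARD('n) * (C1 * ci + C2 * cj))"
 have main: "(\<lambda>x. a x * b x) \<in> Hspace (Suc m) \<and> Hnorm (Suc m) (\<lambda>x. a x * b x) \<le> D * (Hnorm i a * Hnorm j b)"
  if a: "a \<in> Hspace i" and b: "b \<in> Hspace j" for a b :: "'n fn"
 proof -
  define P where "P = Hnorm i a * Hnorm j b"
  define w where "w l x = wder [l] a x * b x + a x * wder [l] b x" for l x
  have da: "wder [l] a \<in> Hspace i'" "Hnorm i' (wder [l] a) \<le> ci * Hnorm i a" for l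
   using Hspace_Suc_deriv[of a i' l] a by (simp_all add: ij ci_cj_cm_def)
  have db: "wder [l] b \<in> Hspace j'" "Hnorm j' (wder [l] b) \<le> cj * Hnorm j b" for l
   using Hspace_Suc_deriv[of b j' l] b by (simp_all add: ij ci_cj_cm_def)
  have w: "w l \<in> Hspace m" for l
   unfolding w_def[abs_def] using C1(2)[OF da(1) b] C2(2)[OF a db(1)] by (intro Hspace_add) auto
  have wn: "Hnorm m (w l) \<le> (C1 * ci + C2 * cj) * P" for l
  proof -
   have "Hnorm m (w l) \<le> Hnorm m (\<lambda>x. wder [l] a x * b x) + Hnorm m (\<lambda>x. a x * wder [l] b x)"
    unfolding w_def[abs_def] using C1(2)[OF da(1) b] C2(2)[OF a db(1)] by (intro Hnorm_triangle) auto
   also have "\<dots> \<le> C1 * (Hnorm i' (wder [l] a) * Hnorm j b) + C2 * (Hnorm i a * Hnorm j' (wder [l] b))"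
    using C1(2)[OF da(1) b] C2(2)[OF a db(1)] by (intro add_mono) auto
   also have "\<dots> \<le> C1 * ((ci * Hnorm i a) * Hnorm j b) + C2 * (Hnorm i a * (cj * Hnorm j b))"
    by (intro add_mono mult_left_mono mult_right_mono da db C1 C2) auto
   finally show ?thesis by (simp add: P_def algebra_simps)
  qed
  have wdw: "wd [l] (\<lambda>x. a x * b x) (w l)" for l
  proof -
   have la: "wder [l] a \<in> L2_space" "wd [l] a (wder [l] a)" using Hspace_wder[OF a, of "[l]"] ij by auto
   have lb: "wder [l] b \<in> L2_space" "wd [l] b (wder [l] b)" using Hspace_wder[OF b, of "[l]"] ij by auto
   show ?thesis unfolding w_def[abs_def]
    by (rule wd_product[OF Hspace_L2[OF a] la Hspace_L2[OF b] lb])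
  qed
  have ab: "(\<lambda>x. a x * b x) \<in> L2_space" "L2norm (\<lambda>x. a x * b x) \<le> C0 * P"
   using C0(2)[OF a b] by (auto simp: P_def)
  have "Hnorm (Suc m) (\<lambda>x. a x * b x) \<le> cm * (L2norm (\<lambda>x. a x * b x) + (\<Sum>l\<in>UNIV. Hnorm m (w l)))"
   unfolding ci_cj_cm_def by (rule Hspace_SucI(2)[OF ab(1) w wdw])
  also have "\<dots> \<le> cm * (C0 * P + (\<Sum>l\<in>(UNIV::'n set). (C1 * ci + C2 * cj) * P))"
   by (intro mult_left_mono add_mono ab sum_mono wn nn)
  also have "\<dots> = D * P" by (simp add: D_def algebra_simps)
  finally show ?thesis using Hspace_SucI(1)[OF ab(1) w wdw] by (simp add: P_def)
 qed
 have "D \<ge> 0" unfolding D_def using nn C0 C1 C2 by simp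
 thus ?case using main by blast
qed

lemma Hspace_product:
 assumes k: "2 * real k \<ge> real CARD('n) + 1"
 shows "\<exists>C\<ge>0. \<forall>a\<in>Hspace k. \<forall>b\<in>Hspace k. (\<lambda>x::real^'n::finite. a x * b x) \<in> Hspace k \<and>
  Hnorm k (\<lambda>x. a x * b x) \<le> C * (Hnorm k a * Hnorm k b)"
 using Hspace_product_aux[OF k, of k k k] by simp

lemma Hspace_constant:
 assumes k: "2 * real k \<ge> real CARD('n) + 1"
 obtains K where "K \<ge> 1"
  "\<And>a b. a \<in> Hspace k ==> b \<in> Hspace k ==> (\<lambda>x::real^'n::finite. a x * b x) \<in> Hspace k"
  "\<And>a b :: 'n fn. a \<in> Hspace k ==> b \<in> Hspace k ==> Hnorm k (\<lambda>x. a x * b x) \<le> K * Hnorm k a * Hnorm k b"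
  "\<And>u. u \<in> Hspace k ==> AE x::real^'n in lebesgue. \<bar>u x\<bar> \<le> K * Hnorm k u"
proof -
 obtain C1 where C1: "C1 \<ge> 0" "\<And>a b. a \<in> Hspace k ==> b \<in> Hspace k ==> (\<lambda>x::real^'n. a x * b x) \<in> Hspace k \<and>
  Hnorm k (\<lambda>x. a x * b x) \<le> C1 * (Hnorm k a * Hnorm k b)" using Hspace_product[OF k] by blast
 obtain C2 where C2: "C2 \<ge> 0" "\<And>u. u \<in> Hspace k ==> AE x::real^'n in lebesgue. \<bar>u x\<bar> \<le> C2 * Hnorm k u"
  using Hspace_sup_bound[OF k] by blast
 define K where "K = 1 + C1 + C2"
 show ?thesis
 proof (rule that[of K])
  show "K \<ge> 1" using C1 C2 by (simp add: K_def)
  show "(\<lambda>x::real^'n. a x * b x) \<in> Hspace k" if "a \<in> Hspace k" "b \<in> Hspace k" for a b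
   using C1(2)[OF that] by blast
  show "Hnorm k (\<lambda>x. a x * b x) \<le> K * Hnorm k a * Hnorm k b" if "a \<in> Hspace k" "b \<in> Hspace k" for a b :: "'n fn"
  proof -
   have "C1 * (Hnorm k a * Hnorm k b) \<le> K * (Hnorm k a * Hnorm k b)"
    using C1 C2 by (intro mult_right_mono) (auto simp: K_def)
   thus ?thesis using C1(2)[OF that] by (simp add: mult.assoc)
  qed
  show "AE x::real^'n in lebesgue. \<bar>u x\<bar> \<le> K * Hnorm k u" if "u \<in> Hspace k" for u
   using C2(2)[OF that]
  proof eventually_elim
   case (elim x)
   have "C2 * Hnorm k u \<le> K * Hnorm k u" using C1 C2 by (intro mult_right_mono) (auto simp: K_def)
   with elim show ?case by linarith
  qed
 qed
qed

section \<open>Power series in H^k and the reaction rate\<close>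

lemma Hspace_sum:
 fixes f :: "'a => 'n::finite fn"
 assumes "finite I" "\<And>i. i \<in> I ==> f i \<in> Hspace k"
 shows "(\<lambda>x. \<Sum>i\<in>I. f i x) \<in> Hspace k" "Hnorm k (\<lambda>x. \<Sum>i\<in>I. f i x) \<le> (\<Sum>i\<in>I. Hnorm k (f i))"
proof -
 have "(\<lambda>x. \<Sum>i\<in>I. f i x) \<in> Hspace k \<and> Hnorm k (\<lambda>x. \<Sum>i\<in>I. f i x) \<le> (\<Sum>i\<in>I. Hnorm k (f i))"
  using assms
 proof (induction I rule: finite_induct)
  case empty
  have "Hnorm k (\<lambda>x::real^'n. 0) = 0" using Hnorm_eq_0[OF Hspace_zero] by simp
  thus ?case by (simp add: Hspace_zero)
 next
  case (insert i I)
  hence "(\<lambda>x. \<Sum>i\<in>I. f i x) \<in> Hspace k" "Hnorm k (\<lambda>x. \<Sum>i\<in>I. f i x) \<le> (\<Sum>i\<in>I. Hnorm k (f i))" "f i \<in> Hspace k"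
   by auto
  thus ?case using insert(1,2) Hspace_add[of "f i" k] Hnorm_triangle[of "f i" k "\<lambda>x. \<Sum>i\<in>I. f i x"] by auto
 qed
 thus "(\<lambda>x. \<Sum>i\<in>I. f i x) \<in> Hspace k" "Hnorm k (\<lambda>x. \<Sum>i\<in>I. f i x) \<le> (\<Sum>i\<in>I. Hnorm k (f i))" by auto
qed

text \<open>Composition with \<open>f\<close> is realised as a convergent series in the algebra H^k,
  so that no chain rule for higher weak derivatives enters. The radius r/K makes K times the norm at
  most r: powers then obey geometric bounds, and the same number bounds |u| almost everywhere, so
  the pointwise series converges as well.\<close>

lemma Hspace_series:
 fixes u w :: "'n::finite fn"
 assumes K: "K \<ge> 1"
  and alg: "\<And>a b. a \<in> Hspace k ==> b \<in> Hspace k ==> (\<lambda>x::real^'n. a x * b x) \<in> Hspace k"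
  "\<And>a b :: 'n fn. a \<in> Hspace k ==> b \<in> Hspace k ==> Hnorm k (\<lambda>x. a x * b x) \<le> K * Hnorm k a * Hnorm k b"
  and sup: "\<And>u. u \<in> Hspace k ==> AE x::real^'n in lebesgue. \<bar>u x\<bar> \<le> K * Hnorm k u"
  and r: "r > 0" and c: "summable (\<lambda>n. \<bar>c n\<bar> * real (Suc n) * r ^ n)"
  and f: "\<And>x. \<bar>x\<bar> \<le> r ==> (\<lambda>n. c n * x ^ Suc n) sums f x"
  and u: "u \<in> Hspace k" "Hnorm k u \<le> r / K" and w: "w \<in> Hspace k" "Hnorm k w \<le> r / K"
 shows "(\<lambda>x. f (u x) - f (w x)) \<in> Hspace k"
  "Hnorm k (\<lambda>x. f (u x) - f (w x)) \<le> (\<Sum>n. \<bar>c n\<bar> * real (Suc n) * r ^ n) * Hnorm k (\<lambda>x. u x - w x)"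
proof -
 define m where "m = r / K"
 have m: "m > 0" "K * m = r" using r K by (auto simp: m_def)
 define d where "d = Hnorm k (\<lambda>x. u x - w x)"
 have d: "d \<ge> 0" by (simp add: d_def)
 have duw: "(\<lambda>x. u x - w x) \<in> Hspace k" using u w by (intro Hspace_diff)
 have pw: "(\<lambda>x. v x ^ Suc n) \<in> Hspace k \<and> Hnorm k (\<lambda>x. v x ^ Suc n) \<le> r ^ n * m"
  if v: "v \<in> Hspace k" "Hnorm k v \<le> m" for v :: "'n fn" and n
 proof (induction n)
  case 0
  show ?case using v by simp
 next
  case (Suc n)
  have "Hnorm k (\<lambda>x. v x * v x ^ Suc n) \<le> K * Hnorm k v * Hnorm k (\<lambda>x. v x ^ Suc n)"
   by (rule alg(2)) (use Suc v in auto)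
  also have "\<dots> \<le> (K * m) * (r ^ n * m)"
   using Suc v K m r by (intro mult_mono) auto
  finally show ?case using alg(1)[OF v(1), of "\<lambda>x. v x ^ Suc n"] Suc m(2) by (simp add: mult.assoc)
 qed
 \<comment> \<open>Induction by u^(n+2) - w^(n+2) = u (u^(n+1) - w^(n+1)) + (u - w) w^(n+1), where
   both terms gain a factor r.\<close>
 have df: "(\<lambda>x. u x ^ Suc n - w x ^ Suc n) \<in> Hspace k \<and> Hnorm k (\<lambda>x. u x ^ Suc n - w x ^ Suc n) \<le> real (Suc n) * r ^ n * d" for n
 proof (induction n)
  case 0
  show ?case using duw by (simp add: d_def)
 next
  case (Suc n)
  let ?a = "\<lambda>x. u x * (u x ^ Suc n - w x ^ Suc n)" and ?b = "\<lambda>x. (u x - w x) * w x ^ Suc n"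
  have wn: "(\<lambda>x. w x ^ Suc n) \<in> Hspace k" "Hnorm k (\<lambda>x. w x ^ Suc n) \<le> r ^ n * m"
   using pw[of w n] w by (auto simp: m_def)
  have a: "?a \<in> Hspace k" by (rule alg(1)) (use Suc u in auto)
  have b: "?b \<in> Hspace k" by (rule alg(1)[OF duw wn(1)])
  have "Hnorm k ?a \<le> K * Hnorm k u * Hnorm k (\<lambda>x. u x ^ Suc n - w x ^ Suc n)" by (rule alg(2)) (use Suc u in auto)
  also have "\<dots> \<le> (K * m) * (real (Suc n) * r ^ n * d)"
   using Suc u K m r d by (intro mult_mono) (auto simp: m_def)
  finally have a': "Hnorm k ?a \<le> real (Suc n) * r ^ Suc n * d" using m(2) by (simp add: mult_ac)
  have "Hnorm k ?b \<le> K * d * Hnorm k (\<lambda>x. w x ^ Suc n)" unfolding d_def by (rule alg(2)[OF duw wn(1)])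
  also have "\<dots> \<le> K * d * (r ^ n * m)" using K d wn by (intro mult_left_mono) auto
  also have "\<dots> = r ^ Suc n * d" by (simp add: mult_ac flip: m(2))
  finally have b': "Hnorm k ?b \<le> r ^ Suc n * d" .
  have "(\<lambda>x. ?a x + ?b x) = (\<lambda>x. u x ^ Suc (Suc n) - w x ^ Suc (Suc n))" by (auto simp: algebra_simps)
  thus ?case using Hspace_add[OF a b] Hnorm_triangle[OF a b] a' b' by (simp add: algebra_simps)
 qed
 define g where "g n x = c n * (u x ^ Suc n - w x ^ Suc n)" for n x
 define e where "e n = \<bar>c n\<bar> * real (Suc n) * r ^ n" for n
 have g: "g n \<in> Hspace k" "Hnorm k (g n) \<le> e n * d" for n
 proof -
  show "g n \<in> Hspace k" unfolding g_def[abs_def] using df by (intro Hspace_cmult) auto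
  have "Hnorm k (g n) = \<bar>c n\<bar> * Hnorm k (\<lambda>x. u x ^ Suc n - w x ^ Suc n)"
   unfolding g_def[abs_def] using df by (intro Hnorm_cmult) auto
  also have "\<dots> \<le> \<bar>c n\<bar> * (real (Suc n) * r ^ n * d)" using df by (intro mult_left_mono) auto
  finally show "Hnorm k (g n) \<le> e n * d" by (simp add: e_def mult_ac)
 qed
 define S where "S N x = (\<Sum>n<N. g n x)" for N x
 have S: "S N \<in> Hspace k" for N unfolding S_def[abs_def] by (intro Hspace_sum g) simp
 have e0: "e n \<ge> 0" for n using r by (simp add: e_def)
 have se: "summable e" unfolding e_def[abs_def] by (rule c)
 have Sdiff: "Hnorm k (\<lambda>x. S M x - S N x) \<le> (\<Sum>n\<in>{N..<M}. e n) * d" if "N \<le> M" for M N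
 proof -
  have "{..<M} = {..<N} \<union> {N..<M}" using that by auto
  hence "S M x - S N x = (\<Sum>n\<in>{N..<M}. g n x)" for x
   unfolding S_def by (simp add: sum.union_disjoint ivl_disj_int)
  hence "Hnorm k (\<lambda>x. S M x - S N x) \<le> (\<Sum>n\<in>{N..<M}. Hnorm k (g n))"
   using Hspace_sum(2)[of "{N..<M}" g k] g by simp
  also have "\<dots> \<le> (\<Sum>n\<in>{N..<M}. e n * d)" by (intro sum_mono g)
  finally show ?thesis by (simp add: sum_distrib_right)
 qed
 have cau: "\<exists>M. \<forall>m\<ge>M. \<forall>n\<ge>M. Hnorm k (\<lambda>x. S m x - S n x) < \<epsilon>" if "\<epsilon> > 0" for \<epsilon>
 proof -
  have "\<epsilon> / (d + 1) > 0" using that d by simp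
  from summable_Cauchy[THEN iffD1, OF se, rule_format, OF this] obtain M where
   M: "\<And>m n. m \<ge> M ==> norm (sum e {m..<n}) < \<epsilon> / (d + 1)" by blast
  have *: "Hnorm k (\<lambda>x. S m x - S n x) < \<epsilon>" if "m \<ge> n" "n \<ge> M" for m n
  proof -
   have "Hnorm k (\<lambda>x. S m x - S n x) \<le> sum e {n..<m} * d" using that by (intro Sdiff)
   also have "\<dots> \<le> \<epsilon> / (d + 1) * d" using M[OF that(2), of m] d by (intro mult_right_mono) auto
   also have "\<dots> < \<epsilon>" using d \<open>\<epsilon> > 0\<close> by (simp add: field_simps)
   finally show ?thesis .
  qed
  have "Hnorm k (\<lambda>x. S m x - S n x) < \<epsilon>" if "m \<ge> M" "n \<ge> M" for m n
  proof (cases "m \<ge> n")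
   case False
   have "Hnorm k (\<lambda>x. S m x - S n x) = Hnorm k (\<lambda>x. (-1) * (S n x - S m x))" by simp
   also have "\<dots> = Hnorm k (\<lambda>x. S n x - S m x)" using Hnorm_cmult[OF Hspace_diff[OF S S], of "-1"] by simp
   finally show ?thesis using *[of m n] that False by simp
  qed (use * that in auto)
  thus ?thesis by blast
 qed
 from Hspace_complete[OF S cau] obtain G where G: "G \<in> Hspace k" "(\<lambda>N. Hnorm k (\<lambda>x. S N x - G x)) \<longlonglongrightarrow> 0" by blast
 have "(\<lambda>N. L2norm (\<lambda>x. S N x - G x)) \<longlonglongrightarrow> 0"
  by (rule Lim_null_comparison[OF _ G(2)]) (use L2norm_le_Hnorm[OF Hspace_diff[OF S G(1)]] in auto)
 from L2_AE_subseq[OF Hspace_L2[OF S] Hspace_L2[OF G(1)] this] obtain s where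
  s: "strict_mono s" "AE x in lebesgue. (\<lambda>N. S (s N) x) \<longlonglongrightarrow> G x" by blast
 \<comment> \<open>The limit in H^k and the pointwise sum of the series are compared along an almost
   everywhere convergent subsequence.\<close>
 have "AE x in lebesgue. G x = f (u x) - f (w x)"
  using s(2) sup[OF u(1)] sup[OF w(1)]
 proof eventually_elim
  case (elim x)
  have "K * Hnorm k u \<le> r" "K * Hnorm k w \<le> r"
   using u(2) w(2) K by (auto simp: field_simps)
  hence "\<bar>u x\<bar> \<le> r" "\<bar>w x\<bar> \<le> r" using elim by linarith+
  hence "(\<lambda>n. c n * u x ^ Suc n - c n * w x ^ Suc n) sums (f (u x) - f (w x))"
   by (intro sums_diff f)
  hence "(\<lambda>N. S N x) \<longlonglongrightarrow> f (u x) - f (w x)"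
   by (simp add: sums_def S_def g_def right_diff_distrib)
  from LIMSEQ_subseq_LIMSEQ[OF this s(1)] elim(1) show ?case
   by (simp add: o_def LIMSEQ_unique)
 qed
 note ae = this
 show "(\<lambda>x. f (u x) - f (w x)) \<in> Hspace k" using Hspace_cong_AE[OF G(1) ae] .
 have "Hnorm k (\<lambda>x. f (u x) - f (w x)) = Hnorm k G" using Hnorm_cong_AE[OF G(1) ae] .
 also have "\<dots> \<le> suminf e * d"
 proof (rule LIMSEQ_le_const[where X = "\<lambda>N. suminf e * d + Hnorm k (\<lambda>x. S N x - G x)"])
  show "(\<lambda>N. suminf e * d + Hnorm k (\<lambda>x. S N x - G x)) \<longlonglongrightarrow> suminf e * d"
   using tendsto_add[OF tendsto_const G(2), of "suminf e * d"] by simp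
  have "Hnorm k G \<le> suminf e * d + Hnorm k (\<lambda>x. S N x - G x)" for N
  proof -
   have "Hnorm k G = Hnorm k (\<lambda>x. S N x + (-1) * (S N x - G x))" by simp
   also have "\<dots> \<le> Hnorm k (S N) + Hnorm k (\<lambda>x. (-1) * (S N x - G x))"
    by (intro Hnorm_triangle S Hspace_cmult Hspace_diff G)
   also have "Hnorm k (\<lambda>x. (-1) * (S N x - G x)) = Hnorm k (\<lambda>x. S N x - G x)"
    using Hnorm_cmult[OF Hspace_diff[OF S G(1)], of "-1" N] by simp
   also have "Hnorm k (S N) \<le> (\<Sum>n<N. e n) * d"
    using Sdiff[of 0 N] by (simp add: S_def[of 0] atLeast0LessThan)
   also have "(\<Sum>n<N. e n) * d \<le> suminf e * d"
    using sum_le_suminf[OF se, of "{..<N}"] e0 d by (intro mult_right_mono) auto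
   finally show ?thesis by simp
  qed
  thus "\<exists>N. \<forall>n\<ge>N. Hnorm k G \<le> suminf e * d + Hnorm k (\<lambda>x. S n x - G x)" by blast
 qed
 finally show "Hnorm k (\<lambda>x. f (u x) - f (w x)) \<le> (\<Sum>n. \<bar>c n\<bar> * real (Suc n) * r ^ n) * Hnorm k (\<lambda>x. u x - w x)"
  by (simp add: d_def e_def[abs_def])
qed

text \<open>On positive arguments \<open>arrhenius\<close> is exp(-1/s), which extends
  holomorphically to the disc of radius 1/\<kappa> about 1/\<kappa>. The real parts of the Taylor
  coefficients serve on the real axis, and at half the radius even the term-by-term differentiated
  series converges absolutely.\<close>

lemma arrhenius_series:
 assumes \<kappa>: "\<kappa> > 0"
 obtains c where "summable (\<lambda>n. \<bar>c n\<bar> * real (Suc n) * (1 / (2 * \<kappa>)) ^ n)"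
  "\<And>x. \<bar>x\<bar> \<le> 1 / (2 * \<kappa>) ==> (\<lambda>n. c n * x ^ Suc n) sums (arrhenius (x + 1 / \<kappa>) - arrhenius (1 / \<kappa>))"
proof -
 define F where "F z = exp (- 1 / (complex_of_real (1 / \<kappa>) + z))" for z
 define C where "C n = (deriv ^^ n) F 0 / fact n" for n
 have nz: "complex_of_real (1 / \<kappa>) + z \<noteq> 0" if "z \<in> ball 0 (1 / \<kappa>)" for z
 proof
  assume "complex_of_real (1 / \<kappa>) + z = 0"
  hence "z = - complex_of_real (1 / \<kappa>)" by (simp add: eq_neg_iff_add_eq_0 add.commute)
  hence "norm z = 1 / \<kappa>" using \<kappa> by (simp only: norm_minus_cancel norm_of_real) simp
  thus False using that by simp
 qed
 have "F holomorphic_on ball 0 (1 / \<kappa>)"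
  unfolding F_def using nz by (intro holomorphic_intros) auto
 from holomorphic_power_series[OF this] have C: "(\<lambda>n. C n * z ^ n) sums F z" if "z \<in> ball 0 (1 / \<kappa>)" for z
  using that by (simp add: C_def)
 define b where "b n = Re (C n)" for n
 have b: "(\<lambda>n. b n * x ^ n) sums exp (- 1 / (1 / \<kappa> + x))" if x: "\<bar>x\<bar> < 1 / \<kappa>" for x
 proof -
  have "(\<lambda>n. Re (C n * complex_of_real x ^ n)) sums Re (F (complex_of_real x))"
   by (intro sums_Re C) (use x in simp)
  moreover have "Re (C n * complex_of_real x ^ n) = b n * x ^ n" for n
   by (simp add: b_def flip: of_real_power)
  moreover have "F (complex_of_real x) = complex_of_real (exp (- 1 / (1 / \<kappa> + x)))"
  proof -
   have "- 1 / (complex_of_real (1 / \<kappa>) + complex_of_real x) = complex_of_real (- 1 / (1 / \<kappa> + x))"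
    by (simp only: of_real_add of_real_divide of_real_minus of_real_1)
   thus ?thesis unfolding F_def by (simp only: exp_of_real)
  qed
  ultimately show ?thesis by (simp only: Re_complex_of_real)
 qed
 have "summable (\<lambda>n. diffs (\<lambda>n. \<bar>b n\<bar>) n * (1 / (2 * \<kappa>)) ^ n)"
 proof (rule termdiff_converges[where K = "1 / \<kappa>"])
  show "norm (1 / (2 * \<kappa>)) < 1 / \<kappa>" using \<kappa> by (simp add: field_simps)
  fix x :: real assume x: "norm x < 1 / \<kappa>"
  then obtain y where y: "\<bar>x\<bar> < y" "y < 1 / \<kappa>" using dense by auto
  hence "summable (\<lambda>n. b n * y ^ n)" by (intro sums_summable[OF b]) auto
  from powser_insidea[OF this, of x] y have "summable (\<lambda>n. norm (b n * x ^ n))" by simp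
  hence "summable (\<lambda>n. norm (\<bar>b n\<bar> * x ^ n))" by (simp add: abs_mult)
  thus "summable (\<lambda>n. \<bar>b n\<bar> * x ^ n)" by (rule summable_norm_cancel)
 qed
 hence s: "summable (\<lambda>n. \<bar>b (Suc n)\<bar> * real (Suc n) * (1 / (2 * \<kappa>)) ^ n)"
  by (simp add: diffs_def mult_ac)
 have "(\<lambda>n. b (Suc n) * x ^ Suc n) sums (arrhenius (x + 1 / \<kappa>) - arrhenius (1 / \<kappa>))"
  if x: "\<bar>x\<bar> \<le> 1 / (2 * \<kappa>)" for x
 proof -
  have "1 / (2 * \<kappa>) < 1 / \<kappa>" using \<kappa> by (simp add: field_simps)
  hence x': "\<bar>x\<bar> < 1 / \<kappa>" using x by linarith
  have "b 0 = exp (- 1 / (1 / \<kappa>))" using sums_unique2[OF powser_sums_zero[of b] b[of 0]] \<kappa> by simp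
  moreover have "(\<lambda>n. b (Suc n) * x ^ Suc n) sums (exp (- 1 / (1 / \<kappa> + x)) - b 0)"
   using b[OF x'] sums_Suc_iff[of "\<lambda>n. b n * x ^ n" "exp (- 1 / (1 / \<kappa> + x)) - b 0"] by simp
  moreover have "x + 1 / \<kappa> > 0" using x' by linarith
  ultimately show ?thesis using \<kappa> by (simp add: arrhenius_def add.commute)
 qed
 with s show ?thesis by (rule that)
qed

section \<open>Resolvent estimates for drift and diffusion\<close>

lemma smooth_dissipation:
 fixes U :: "'n::finite fn"
 assumes U: "smooth U" "U \<in> L2_space" "partial i U \<in> L2_space" "partial i (partial i U) \<in> L2_space"
 shows "(LEB x. U x * partial i U x) = 0" "(LEB x. U x * partial i (partial i U) x) \<le> 0"
proof -
 have sp: "smooth (partial i U)" using U(1) by (rule smooth_partial)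
 have p: "partial i (\<lambda>x. f x * g x) = (\<lambda>x. partial i f x * g x + f x * partial i g x)" if "smooth f" "smooth g" for f g :: "'n fn"
  using that by (auto simp: partial_mult smooth_differentiable)
 have z: "(LEB x. partial i (\<lambda>x. f x * g x) x) = 0"
  if "smooth f" "smooth g" "f \<in> L2_space" "g \<in> L2_space" "partial i f \<in> L2_space" "partial i g \<in> L2_space" for f g :: "'n fn"
 proof (rule integral_partial_eq_0)
  have s: "smooth (\<lambda>x. f x * g x)" using that by (intro smooth_mult)
  thus "(\<lambda>x. f x * g x) differentiable at x" for x by (rule smooth_differentiable)
  show "continuous_on UNIV (partial i (\<lambda>x. f x * g x))" using s by (intro smooth_continuous smooth_partial)
  show "integrable lebesgue (\<lambda>x. f x * g x)" using that by (intro L2_mult_integrable)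
  show "integrable lebesgue (partial i (\<lambda>x. f x * g x))" unfolding p[OF that(1,2)]
   using that by (intro Bochner_Integration.integrable_add L2_mult_integrable)
 qed
 show "(LEB x. U x * partial i U x) = 0"
  using z[OF U(1) U(1) U(2) U(2) U(3) U(3)] L2_mult_integrable[OF U(3) U(2)] L2_mult_integrable[OF U(2) U(3)]
  unfolding p[OF U(1) U(1)] by (simp add: mult.commute)
 have "(LEB x. partial i U x * partial i U x) + (LEB x. U x * partial i (partial i U) x) = 0"
  using z[OF U(1) sp U(2) U(3) U(3) U(4)] L2_mult_integrable[OF U(3) U(3)] L2_mult_integrable[OF U(2) U(4)]
  unfolding p[OF U(1) sp] by simp
 moreover have "(LEB x. partial i U x * partial i U x) \<ge> 0" by (intro integral_nonneg_AE) auto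
 ultimately show "(LEB x. U x * partial i (partial i U) x) \<le> 0" by linarith
qed

text \<open>The equation lu - a Laplace(u) - b du/dz = g in the sense of distributions.\<close>

definition res_eq :: "'n::finite => real => real => real => 'n fn => 'n fn => bool" where
 "res_eq z l a b u g \<longleftrightarrow> (\<forall>\<phi>\<in>\<D>.
  (LEB x. u x * (l * \<phi> x - a * laplacian \<phi> x + b * partial z \<phi> x)) = (LEB x. g x * \<phi> x))"

lemma test_laplacian: "\<phi> \<in> \<D> ==> laplacian \<phi> \<in> \<D>"
 unfolding laplacian_def[abs_def] by (intro test_sum test_partial) auto

text \<open>Testing with translated mollifiers turns the weak equation into a pointwise one for the
  smooth function \<open>U\<close>, which can be multiplied by \<open>U\<close> and integrated: the
  drift term vanishes and diffusion has a sign. The detour is due to \<open>u\<close> itself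
  possibly lacking the derivatives in the equation. The bound is uniform in the mollifier and passes
  to the limit.\<close>

lemma resolvent_L2:
 fixes u g :: "'n::finite fn"
 assumes u: "u \<in> L2_space" and g: "g \<in> L2_space" and eq: "res_eq z l a b u g" and a: "a \<ge> 0" and l: "l > 0"
 shows "l * L2norm u \<le> L2norm g"
proof -
 have main: "l * L2norm (conv u (moll n)) \<le> L2norm g" for n
 proof -
  define U where "U = conv u (moll n)"
  define G where "G = conv g (moll n)"
  let ?\<rho> = "moll n :: 'n fn"
  note \<rho> = test_moll[of n, where 'a='n]
  have U2: "iter_partial js U \<in> L2_space" for js
   unfolding U_def using iter_partial_conv[OF u \<rho>] conv_L2(1)[OF u test_iter_partial[OF \<rho>]] by simp
  have sU: "smooth U" unfolding U_def by (rule smooth_moll[OF u])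
  have G2: "G \<in> L2_space" unfolding G_def by (rule conv_L2(1)[OF g \<rho>])
  have GU: "G x = l * U x - a * (\<Sum>i\<in>UNIV. partial i (partial i U) x) - b * partial z U x" for x
  proof -
   have p1: "partial i (\<lambda>y. ?\<rho> (x - y)) = (\<lambda>y. - partial i ?\<rho> (x - y))" for i
    using iter_partial_shift[OF \<rho>, of "[i]" x] by simp
   have "partial i (partial i (\<lambda>y. ?\<rho> (x - y))) = (\<lambda>y. partial i (partial i ?\<rho>) (x - y))" for i
    using iter_partial_shift[OF \<rho>, of "[i, i]" x] by simp
   note p2 = this[unfolded p1]
   have i: "integrable lebesgue (\<lambda>y. u y * \<psi> (x - y))" if "\<psi> \<in> \<D>" for \<psi>
    by (rule conv_integrable[OF u that])
   have "G x = (LEB y. u y * (l * ?\<rho> (x - y) - a * laplacian (\<lambda>y. ?\<rho> (x - y)) y + b * partial z (\<lambda>y. ?\<rho> (x - y)) y))"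
    unfolding G_def conv_def using eq test_shift[OF \<rho>, of x] unfolding res_eq_def by simp
   also have "\<dots> = (LEB y. l * (u y * ?\<rho> (x - y)) - a * (\<Sum>i\<in>UNIV. u y * partial i (partial i ?\<rho>) (x - y)) - b * (u y * partial z ?\<rho> (x - y)))"
    unfolding laplacian_def p1 p2
    by (intro Bochner_Integration.integral_cong) (auto simp: algebra_simps sum_distrib_left)
   also have "\<dots> = l * conv u ?\<rho> x - a * (\<Sum>i\<in>UNIV. conv u (partial i (partial i ?\<rho>)) x) - b * conv u (partial z ?\<rho>) x"
    unfolding conv_def using i[OF \<rho>] i[OF test_partial[OF test_partial[OF \<rho>]]] i[OF test_partial[OF \<rho>]] by simp
   finally show ?thesis unfolding U_def by (simp add: partial_conv u \<rho> test_partial)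
  qed
  have U: "U \<in> L2_space" "partial i U \<in> L2_space" "partial i (partial i U) \<in> L2_space" for i
   using U2[of "[]"] U2[of "[i]"] U2[of "[i, i]"] by simp_all
  note dis = smooth_dissipation[OF sU U(1) U(2) U(3)]
  have "(LEB x. U x * G x) = (LEB x. l * (U x)\<^sup>2 - a * (\<Sum>i\<in>UNIV. U x * partial i (partial i U) x) - b * (U x * partial z U x))"
   unfolding GU by (intro Bochner_Integration.integral_cong) (auto simp: algebra_simps power2_eq_square sum_distrib_left)
  also have "\<dots> = l * (L2norm U)\<^sup>2 - a * (\<Sum>i\<in>UNIV. (LEB x. U x * partial i (partial i U) x)) - b * (LEB x. U x * partial z U x)"
   using L2_integrable_sq[OF U(1)] L2_mult_integrable[OF U(1) U(2)] L2_mult_integrable[OF U(1) U(3)] by (simp add: L2norm_sq)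
  also have "\<dots> \<ge> l * (L2norm U)\<^sup>2"
  proof -
   have "(\<Sum>i\<in>UNIV. (LEB x. U x * partial i (partial i U) x)) \<le> 0" using dis(2) by (intro sum_nonpos)
   thus ?thesis using a dis(1) by (simp add: mult_nonneg_nonpos)
  qed
  finally have "l * (L2norm U)\<^sup>2 \<le> (LEB x. U x * G x)" .
  also have "\<dots> \<le> L2norm U * L2norm G" using L2_Cauchy_Schwarz[OF U(1) G2] by linarith
  also have "\<dots> \<le> L2norm U * L2norm g" unfolding G_def by (intro mult_left_mono conv_moll_le g) simp
  finally have *: "L2norm U * (l * L2norm U) \<le> L2norm U * L2norm g" by (simp add: power2_eq_square mult_ac)
  have "l * L2norm U \<le> L2norm g"
  proof (cases "L2norm U = 0")
   case False
   hence "L2norm U > 0" using L2norm_nonneg[of U] by linarith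
   thus ?thesis using * mult_le_cancel_left_pos by blast
  qed simp
  thus ?thesis by (simp add: U_def)
 qed
 have "l * L2norm u \<le> L2norm g"
 proof (rule LIMSEQ_le_const[where X = "\<lambda>n. L2norm g + l * L2norm (\<lambda>x. conv u (moll n) x - u x)"])
  show "(\<lambda>n. L2norm g + l * L2norm (\<lambda>x. conv u (moll n) x - u x)) \<longlonglongrightarrow> L2norm g"
   using tendsto_add[OF tendsto_const tendsto_mult_right_zero[OF conv_moll_tendsto[OF u], of l], of "L2norm g"] by simp
  have "l * L2norm u \<le> L2norm g + l * L2norm (\<lambda>x. conv u (moll n) x - u x)" for n
  proof -
   have "L2norm u \<le> L2norm (conv u (moll n)) + L2norm (\<lambda>x. (-1) * (conv u (moll n) x - u x))"
    using L2norm_triangle[OF conv_L2(1)[OF u test_moll] L2_cmult[OF L2_diff[OF conv_L2(1)[OF u test_moll] u]], of n "-1" n] by simp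
   hence "L2norm u \<le> L2norm (conv u (moll n)) + L2norm (\<lambda>x. conv u (moll n) x - u x)"
    unfolding L2norm_cmult by simp
   hence "l * L2norm u \<le> l * (L2norm (conv u (moll n)) + L2norm (\<lambda>x. conv u (moll n) x - u x))"
    using l by (intro mult_left_mono) auto
   thus ?thesis using main[of n] by (simp add: distrib_left)
  qed
  thus "\<exists>N. \<forall>n\<ge>N. l * L2norm u \<le> L2norm g + l * L2norm (\<lambda>x. conv u (moll n) x - u x)" by blast
 qed
 thus ?thesis .
qed

text \<open>The coefficients are constant, so every weak derivative of \<open>u\<close> up to order
  k solves the same equation with the corresponding derivative of \<open>g\<close>.\<close>

lemma resolvent_H:
 fixes u g :: "'n::finite fn"
 assumes u: "u \<in> Hspace k" and g: "g \<in> Hspace k" and eq: "res_eq z l a b u g" and a: "a \<ge> 0" and l: "l > 0"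
 shows "l * Hnorm k u \<le> Hnorm k g"
proof -
 have main: "l * L2norm (wder js u) \<le> L2norm (wder js g)" if js: "length js \<le> k" for js
 proof (rule resolvent_L2[OF Hspace_wder(1)[OF u js] Hspace_wder(1)[OF g js] _ a l])
  show "res_eq z l a b (wder js u) (wder js g)"
   unfolding res_eq_def
  proof
   fix \<phi> :: "'n fn" assume \<phi>: "\<phi> \<in> \<D>"
   define \<psi> where "\<psi> x = l * \<phi> x + (- a) * laplacian \<phi> x + b * partial z \<phi> x" for x
   have \<psi>: "\<psi> \<in> \<D>" unfolding \<psi>_def[abs_def]
    by (intro test_add test_cmult test_laplacian test_partial \<phi>)
   have sm: "smooth \<phi>" using \<phi> by (rule test_smooth)
   have lap: "iter_partial js (laplacian \<phi>) = laplacian (iter_partial js \<phi>)"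
   proof -
    have "iter_partial js (\<lambda>x. \<Sum>i\<in>I. partial i (partial i \<phi>) x) = (\<lambda>x. \<Sum>i\<in>I. iter_partial js (partial i (partial i \<phi>)) x)" if "finite I" for I
     using that
    proof (induction I rule: finite_induct)
     case empty
     show ?case by (induction js) auto
    next
     case (insert i I)
     thus ?case
      by (simp add: iter_partial_add sm smooth_partial smooth_sum)
    qed
    thus ?thesis unfolding laplacian_def[abs_def]
     by (simp add: iter_partial_partial sm smooth_partial)
   qed
   have ps: "iter_partial js \<psi> x = l * iter_partial js \<phi> x - a * laplacian (iter_partial js \<phi>) x + b * partial z (iter_partial js \<phi>) x" for x
   proof -
    have sl: "smooth (laplacian \<phi>)" and sz: "smooth (partial z \<phi>)"
     using test_smooth[OF test_laplacian[OF \<phi>]] smooth_partial[OF sm] by auto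
    show ?thesis unfolding \<psi>_def[abs_def]
     by (simp only: iter_partial_add[OF smooth_add[OF smooth_cmult[OF sm] smooth_cmult[OF sl]] smooth_cmult[OF sz]]
       iter_partial_add[OF smooth_cmult[OF sm] smooth_cmult[OF sl]] iter_partial_cmult[OF sm]
       iter_partial_cmult[OF sl] iter_partial_cmult[OF sz] lap iter_partial_partial[OF sm])
   qed
   have "(-1) ^ length js * (LEB x. wder js u x * \<psi> x) = (LEB x. u x * iter_partial js \<psi> x)"
    using Hspace_wder(2)[OF u js] \<psi> unfolding wd_def by simp
   also have "\<dots> = (LEB x. g x * iter_partial js \<phi> x)"
    unfolding ps using eq test_iter_partial[OF \<phi>, of js] unfolding res_eq_def by simp
   also have "\<dots> = (-1) ^ length js * (LEB x. wder js g x * \<phi> x)"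
    using Hspace_wder(2)[OF g js] \<phi> unfolding wd_def by simp
   finally show "(LEB x. wder js u x * (l * \<phi> x - a * laplacian \<phi> x + b * partial z \<phi> x)) = (LEB x. wder js g x * \<phi> x)"
    by (simp add: \<psi>_def)
  qed
 qed
 have "l * Hnorm k u = L2_set (\<lambda>\<beta>. l * L2norm (weak_deriv \<beta> u)) {\<beta>. mdeg \<beta> \<le> k}"
  unfolding Hnorm_L2_set using l by (intro L2_set_right_distrib) simp
 also have "\<dots> \<le> Hnorm k g"
  unfolding Hnorm_L2_set
 proof (rule L2_set_mono)
  fix \<beta> :: "'n => nat" assume "\<beta> \<in> {\<beta>. mdeg \<beta> \<le> k}"
  then obtain js where "\<beta> = count_list js" "length js \<le> k" using multiindex_cases by blast
  thus "l * L2norm (weak_deriv \<beta> u) \<le> L2norm (weak_deriv \<beta> g)" using main by simp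
 qed (use l in simp)
 finally show ?thesis .
qed

lemma laplacian_weight:
 assumes \<phi>: "smooth \<phi>"
 shows "laplacian (\<lambda>x. weight z \<alpha> x * \<phi> x) x = weight z \<alpha> x * (laplacian \<phi> x + 2 * \<alpha> * partial z \<phi> x + \<alpha>\<^sup>2 * \<phi> x)"
  and partial_weight_mult: "partial z (\<lambda>x. weight z \<alpha> x * \<phi> x) x = weight z \<alpha> x * (partial z \<phi> x + \<alpha> * \<phi> x)"
proof -
 let ?k = "\<lambda>i. if i = z then \<alpha> else 0"
 have p: "partial i (\<lambda>x. weight z \<alpha> x * f x) = (\<lambda>x. weight z \<alpha> x * (?k i * f x + partial i f x))" if "smooth f" for i f
  using that by (auto simp: partial_mult smooth_differentiable smooth_weight partial_weight algebra_simps)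
 show "partial z (\<lambda>x. weight z \<alpha> x * \<phi> x) x = weight z \<alpha> x * (partial z \<phi> x + \<alpha> * \<phi> x)"
  by (simp add: p[OF \<phi>] add.commute)
 have "partial i (partial i (\<lambda>x. weight z \<alpha> x * \<phi> x)) x =
   weight z \<alpha> x * (partial i (partial i \<phi>) x + (if i = z then 2 * \<alpha> * partial z \<phi> x + \<alpha>\<^sup>2 * \<phi> x else 0))" for i
 proof -
  have s: "smooth (\<lambda>x. ?k i * \<phi> x + partial i \<phi> x)" by (intro smooth_add smooth_cmult \<phi> smooth_partial)
  have q: "partial i (\<lambda>x. ?k i * \<phi> x + partial i \<phi> x) x = ?k i * partial i \<phi> x + partial i (partial i \<phi>) x"
   using \<phi> by (subst partial_add) (auto simp: partial_cmult smooth_differentiable smooth_partial smooth_cmult)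
  show ?thesis unfolding p[OF \<phi>] p[OF s] q by (auto simp: algebra_simps power2_eq_square)
 qed
 thus "laplacian (\<lambda>x. weight z \<alpha> x * \<phi> x) x = weight z \<alpha> x * (laplacian \<phi> x + 2 * \<alpha> * partial z \<phi> x + \<alpha>\<^sup>2 * \<phi> x)"
  unfolding laplacian_def by (simp add: distrib_left sum.distrib flip: sum_distrib_left)
qed

text \<open>Testing with the weight times \<phi> conjugates the operator: a Laplace + c d/dz becomes
  a Laplace + (c - 2a\<alpha>) d/dz - (c\<alpha> - a\<alpha>^2). Together with the damping \<mu>,
  the zeroth-order terms of u - hf add up to the factor on the left, and the rest has the form
  covered by \<open>resolvent_H\<close>.\<close>

lemma drift_resolvent:
 fixes u f :: "'n::finite fn"
 assumes eq: "weak_drift_diffusion z a c u (\<lambda>x. f x + \<mu> * u x)"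
  and U: "(\<lambda>x. weight z \<alpha> x * u x) \<in> Hspace k" and F: "(\<lambda>x. weight z \<alpha> x * f x) \<in> Hspace k"
  and a: "a \<ge> 0" and h: "h \<ge> 0" and l: "1 + h * (c * \<alpha> - a * \<alpha>\<^sup>2 + \<mu>) > 0"
 shows "(1 + h * (c * \<alpha> - a * \<alpha>\<^sup>2 + \<mu>)) * Hnorm k (\<lambda>x. weight z \<alpha> x * u x)
  \<le> Hnorm k (\<lambda>x. weight z \<alpha> x * u x - h * (weight z \<alpha> x * f x))"
proof (rule resolvent_H[where z = z and a = "h * a" and b = "h * (c - 2 * a * \<alpha>)"])
 let ?W = "\<lambda>x. weight z \<alpha> x * u x" and ?F = "\<lambda>x. weight z \<alpha> x * f x"
 show "?W \<in> Hspace k" by (rule U)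
 show "(\<lambda>x. ?W x - h * ?F x) \<in> Hspace k" by (intro Hspace_diff Hspace_cmult U F)
 show "0 \<le> h * a" using a h by simp
 show "1 + h * (c * \<alpha> - a * \<alpha>\<^sup>2 + \<mu>) > 0" by (rule l)
 show "res_eq z (1 + h * (c * \<alpha> - a * \<alpha>\<^sup>2 + \<mu>)) (h * a) (h * (c - 2 * a * \<alpha>)) ?W (\<lambda>x. ?W x - h * ?F x)"
  unfolding res_eq_def
 proof
  fix \<phi> :: "'n fn" assume \<phi>: "\<phi> \<in> \<D>"
  have s: "smooth \<phi>" using \<phi> by (rule test_smooth)
  have i: "integrable lebesgue (\<lambda>x. ?W x * \<phi> x)" "integrable lebesgue (\<lambda>x. ?W x * laplacian \<phi> x)"
   "integrable lebesgue (\<lambda>x. ?W x * partial z \<phi> x)" "integrable lebesgue (\<lambda>x. ?F x * \<phi> x)"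
   by (intro L2_mult_integrable Hspace_L2[OF U] Hspace_L2[OF F] test_L2 test_laplacian test_partial \<phi>)+
  have "(LEB x. u x * (a * laplacian (\<lambda>x. weight z \<alpha> x * \<phi> x) x - c * partial z (\<lambda>x. weight z \<alpha> x * \<phi> x) x)) =
    (LEB x. (f x + \<mu> * u x) * (weight z \<alpha> x * \<phi> x))"
   using eq test_mult[OF \<phi> smooth_weight] unfolding weak_drift_diffusion_def by blast
  also have "(\<lambda>x. u x * (a * laplacian (\<lambda>x. weight z \<alpha> x * \<phi> x) x - c * partial z (\<lambda>x. weight z \<alpha> x * \<phi> x) x)) =
    (\<lambda>x. a * (?W x * laplacian \<phi> x) - (c - 2 * a * \<alpha>) * (?W x * partial z \<phi> x) - (c * \<alpha> - a * \<alpha>\<^sup>2) * (?W x * \<phi> x))"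
   by (rule ext, simp only: laplacian_weight[OF s] partial_weight_mult[OF s]) (simp add: algebra_simps)
  also have "(\<lambda>x. (f x + \<mu> * u x) * (weight z \<alpha> x * \<phi> x)) = (\<lambda>x. ?F x * \<phi> x + \<mu> * (?W x * \<phi> x))"
   by (auto simp: algebra_simps)
  finally have e: "a * (LEB x. ?W x * laplacian \<phi> x) - (c - 2 * a * \<alpha>) * (LEB x. ?W x * partial z \<phi> x)
    - (c * \<alpha> - a * \<alpha>\<^sup>2) * (LEB x. ?W x * \<phi> x) = (LEB x. ?F x * \<phi> x) + \<mu> * (LEB x. ?W x * \<phi> x)"
   using i by simp
  have "(LEB x. ?W x * ((1 + h * (c * \<alpha> - a * \<alpha>\<^sup>2 + \<mu>)) * \<phi> x - (h * a) * laplacian \<phi> x + (h * (c - 2 * a * \<alpha>)) * partial z \<phi> x))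
   = (LEB x. (1 + h * (c * \<alpha> - a * \<alpha>\<^sup>2 + \<mu>)) * (?W x * \<phi> x) - (h * a) * (?W x * laplacian \<phi> x) + (h * (c - 2 * a * \<alpha>)) * (?W x * partial z \<phi> x))"
   by (intro Bochner_Integration.integral_cong) (auto simp: algebra_simps)
  also have "\<dots> = (1 + h * (c * \<alpha> - a * \<alpha>\<^sup>2 + \<mu>)) * (LEB x. ?W x * \<phi> x) - (h * a) * (LEB x. ?W x * laplacian \<phi> x)
    + (h * (c - 2 * a * \<alpha>)) * (LEB x. ?W x * partial z \<phi> x)"
   using i by simp
  also have "\<dots> = (LEB x. ?W x * \<phi> x) - h * (a * (LEB x. ?W x * laplacian \<phi> x) - (c - 2 * a * \<alpha>) * (LEB x. ?W x * partial z \<phi> x)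
    - (c * \<alpha> - a * \<alpha>\<^sup>2) * (LEB x. ?W x * \<phi> x) - \<mu> * (LEB x. ?W x * \<phi> x))"
   by (simp add: algebra_simps)
  also have "\<dots> = (LEB x. ?W x * \<phi> x) - h * (LEB x. ?F x * \<phi> x)" unfolding e by simp
  also have "\<dots> = (LEB x. (?W x - h * ?F x) * \<phi> x)"
   using i by (simp add: left_diff_distrib mult.assoc)
  finally show "(LEB x. ?W x * ((1 + h * (c * \<alpha> - a * \<alpha>\<^sup>2 + \<mu>)) * \<phi> x - (h * a) * laplacian \<phi> x + (h * (c - 2 * a * \<alpha>)) * partial z \<phi> x))
   = (LEB x. (?W x - h * ?F x) * \<phi> x)" .
 qed
qed

section \<open>Strongly continuous semigroups on closed subspaces\<close>

text \<open>A gliding-hump proof of the uniform boundedness principle that stays inside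
  \<open>Y\<close>, where the maps are linear. If the operator norms \<open>L n\<close> on
  \<open>Y\<close> are unbounded, indices with L > 4^k and steps of length at most 3^-(k+1) build a
  convergent sequence whose limit has unbounded images.\<close>

lemma uniform_boundedness_seq:
 fixes Y :: "'b::banach set" and T :: "nat => 'b => 'b"
 assumes Y: "subspace Y" "closed Y"
  and add: "\<And>n x y. x \<in> Y ==> y \<in> Y ==> T n (x + y) = T n x + T n y"
  and scale: "\<And>n x a. x \<in> Y ==> T n (a *\<^sub>R x) = a *\<^sub>R T n x"
  and bdd: "\<And>n. \<exists>M. \<forall>y\<in>Y. norm (T n y) \<le> M * norm y"
  and pt: "\<And>y. y \<in> Y ==> \<exists>B. \<forall>n. norm (T n y) \<le> B"
 shows "\<exists>M. \<forall>n. \<forall>y\<in>Y. norm (T n y) \<le> M * norm y"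
proof (rule ccontr)
 assume neg: "\<not> ?thesis"
 have diff: "T n (x - y) = T n x - T n y" if "x \<in> Y" "y \<in> Y" for n x y
 proof -
  have "T n (x + (-1) *\<^sub>R y) = T n x + (-1) *\<^sub>R T n y"
   using add[OF that(1), of "(-1) *\<^sub>R y"] scale[OF that(2), of n "-1"] subspace_scale[OF Y(1) that(2), of "-1"] by simp
  thus ?thesis by simp
 qed
 define L where "L n = (SUP y\<in>{y\<in>Y. norm y \<le> 1}. norm (T n y))" for n
 have bd: "bdd_above ((\<lambda>y. norm (T n y)) ` {y\<in>Y. norm y \<le> 1})" for n
 proof -
  obtain M where M: "\<And>y. y \<in> Y ==> norm (T n y) \<le> M * norm y" using bdd by blast
  have "norm (T n y) \<le> \<bar>M\<bar>" if "y \<in> Y" "norm y \<le> 1" for y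
  proof -
   have "norm (T n y) \<le> M * norm y" using M that by blast
   also have "\<dots> \<le> \<bar>M\<bar> * 1" using that by (intro mult_mono) auto
   finally show ?thesis by simp
  qed
  thus ?thesis by (intro bdd_aboveI[of _ "\<bar>M\<bar>"]) auto
 qed
 have zero: "(0::'b) \<in> {y\<in>Y. norm y \<le> 1}" using subspace_0[OF Y(1)] by simp
 have L1: "norm (T n y) \<le> L n" if "y \<in> Y" "norm y \<le> 1" for n y
  unfolding L_def using that by (intro cSUP_upper bd) auto
 have Lb: "norm (T n y) \<le> L n * norm y" if y: "y \<in> Y" for n y
 proof (cases "y = 0")
  case True
  thus ?thesis using scale[OF y, of n 0] by simp
 next
  case False
  have "norm (T n (inverse (norm y) *\<^sub>R y)) \<le> L n"
   using False by (intro L1 subspace_scale[OF Y(1) y]) auto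
  thus ?thesis using False scale[OF y, of n "inverse (norm y)"] by (simp add: field_simps)
 qed
 have L0: "L n \<ge> 0" for n using order_trans[OF norm_ge_zero L1[OF subspace_0[OF Y(1)]]] by simp
 have "\<exists>n. L n > 4 ^ k" for k :: nat
 proof (rule ccontr)
  assume "\<not> ?thesis"
  hence "\<forall>n. L n \<le> 4 ^ k" by (simp add: not_less)
  hence "\<forall>n. \<forall>y\<in>Y. norm (T n y) \<le> 4 ^ k * norm y"
   using Lb by (meson mult_right_mono norm_ge_zero order_trans)
  thus False using neg by blast
 qed
 then obtain N where N: "\<And>k. L (N k) > 4 ^ k" by metis
 \<comment> \<open>The steps after the k-th add up to at most r k / 2. Of the lower bound 3/4 L(N k)
   r k at x(k+1), at least 1/4 L(N k) r k therefore survives at the limit, and 4^k r k tends to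
   infinity.\<close>
 define r where "r k = (1/3::real) ^ Suc k" for k
 have step: "\<exists>x'. x' \<in> Y \<and> norm (x' - x) \<le> r k \<and> norm (T (N k) x') \<ge> 3/4 * L (N k) * r k" if x: "x \<in> Y" for x k
 proof -
  have Lp: "L (N k) > 0" using N[of k] by (meson less_trans zero_less_numeral zero_less_power)
  hence "3/4 * L (N k) < L (N k)" by simp
  then obtain y where y: "y \<in> Y" "norm y \<le> 1" "3/4 * L (N k) < norm (T (N k) y)"
   unfolding L_def[of "N k"] using less_cSUP_iff[OF _ bd] zero by blast
  define \<xi> where "\<xi> = r k *\<^sub>R y"
  have rk: "r k > 0" by (simp add: r_def)
  have \<xi>: "\<xi> \<in> Y" "norm \<xi> \<le> r k" "T (N k) \<xi> = r k *\<^sub>R T (N k) y"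
   using y rk scale[OF y(1)] subspace_scale[OF Y(1) y(1)] by (auto simp: \<xi>_def mult_left_le)
  have big: "norm (T (N k) \<xi>) \<ge> 3/4 * L (N k) * r k" using \<xi>(3) y(3) rk by simp
  \<comment> \<open>The triangle inequality for this difference shows that the image of one of x +
    \<xi>, x - \<xi> is at least as large as that of \<xi>.\<close>
  have e: "T (N k) (x + \<xi>) - T (N k) (x - \<xi>) = 2 *\<^sub>R T (N k) \<xi>"
   using add[OF x \<xi>(1)] diff[OF x \<xi>(1)] by (simp add: scaleR_2)
  have "2 * norm (T (N k) \<xi>) \<le> norm (T (N k) (x + \<xi>)) + norm (T (N k) (x - \<xi>))"
   using norm_triangle_ineq4[of "T (N k) (x + \<xi>)" "T (N k) (x - \<xi>)"] unfolding e by simp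
  hence "norm (T (N k) (x + \<xi>)) \<ge> 3/4 * L (N k) * r k \<or> norm (T (N k) (x - \<xi>)) \<ge> 3/4 * L (N k) * r k"
   using big by linarith
  moreover have "x + \<xi> \<in> Y" "x - \<xi> \<in> Y" using x \<xi> Y(1) by (auto intro: subspace_add subspace_diff)
  ultimately show ?thesis using \<xi>(2) by (metis add_diff_cancel_left' diff_add_cancel minus_diff_eq norm_minus_cancel add.commute)
 qed
 define x where "x = rec_nat 0 (\<lambda>k x. SOME x'. x' \<in> Y \<and> norm (x' - x) \<le> r k \<and> norm (T (N k) x') \<ge> 3/4 * L (N k) * r k)"
 have xS: "x (Suc k) = (SOME x'. x' \<in> Y \<and> norm (x' - x k) \<le> r k \<and> norm (T (N k) x') \<ge> 3/4 * L (N k) * r k)" for k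
  by (simp add: x_def)
 have xY: "x k \<in> Y" for k
 proof (induction k)
  case 0 show ?case using subspace_0[OF Y(1)] by (simp add: x_def)
 next
  case (Suc k)
  from someI_ex[OF step[OF Suc, of k]] show ?case unfolding xS by blast
 qed
 have x: "norm (x (Suc k) - x k) \<le> r k" "norm (T (N k) (x (Suc k))) \<ge> 3/4 * L (N k) * r k" for k
  using someI_ex[OF step[OF xY, of k k]] unfolding xS by blast+
 have sm: "summable (\<lambda>k. x (Suc k) - x k)"
 proof (rule summable_comparison_test'[of r 0])
  show "summable r" unfolding r_def[abs_def] by (intro summable_Suc_iff[THEN iffD2] summable_geometric) simp
 qed (use x in auto)
 have tele: "(\<Sum>k<n. x (Suc k) - x k) = x n - x 0" for n by (rule sum_lessThan_telescope)
 from summable_LIMSEQ[OF sm] have "(\<lambda>n. x n - x 0) \<longlonglongrightarrow> (\<Sum>k. x (Suc k) - x k)" unfolding tele .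
 from tendsto_add[OF this tendsto_const[of "x 0"]] obtain X where X: "x \<longlonglongrightarrow> X" by auto
 have XY: "X \<in> Y" using Y(2) X xY closed_sequentially by blast
 have far: "norm (x (Suc k + m) - x (Suc k)) \<le> (r k - r (k + m)) / 2" for k m
 proof (induction m)
  case (Suc m)
  have "norm (x (Suc k + Suc m) - x (Suc k)) \<le> norm (x (Suc (Suc (k + m))) - x (Suc (k + m))) + norm (x (Suc k + m) - x (Suc k))"
   using norm_triangle_ineq[of "x (Suc (Suc (k + m))) - x (Suc (k + m))" "x (Suc k + m) - x (Suc k)"] by simp
  also have "\<dots> \<le> r (Suc (k + m)) + (r k - r (k + m)) / 2" using x(1) Suc by (intro add_mono) auto
  also have "\<dots> = (r k - r (k + Suc m)) / 2" by (simp add: r_def field_simps)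
  finally show ?case .
 qed simp
 have Xfar: "norm (X - x (Suc k)) \<le> r k / 2" for k
 proof (rule LIMSEQ_le_const2)
  show "(\<lambda>m. norm (x (m + Suc k) - x (Suc k))) \<longlonglongrightarrow> norm (X - x (Suc k))"
   by (intro tendsto_intros LIMSEQ_ignore_initial_segment X)
  have "norm (x (m + Suc k) - x (Suc k)) \<le> r k / 2" for m
  proof -
   have "norm (x (m + Suc k) - x (Suc k)) \<le> (r k - r (k + m)) / 2" using far[of k m] by (simp add: add_ac)
   also have "\<dots> \<le> r k / 2" by (simp add: r_def)
   finally show ?thesis .
  qed
  thus "\<exists>n. \<forall>m\<ge>n. norm (x (m + Suc k) - x (Suc k)) \<le> r k / 2" by blast
 qed
 obtain B where B: "\<And>n. norm (T n X) \<le> B" using pt[OF XY] by blast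
 have "(4/3) ^ k \<le> 12 * B" for k :: nat
 proof -
  have "T (N k) (x (Suc k)) = T (N k) X - T (N k) (X - x (Suc k))" using diff[OF XY xY] by simp
  hence "norm (T (N k) (x (Suc k))) \<le> norm (T (N k) X) + norm (T (N k) (X - x (Suc k)))"
   using norm_triangle_ineq4 by metis
  also have "norm (T (N k) (X - x (Suc k))) \<le> L (N k) * norm (X - x (Suc k))"
   by (intro Lb subspace_diff Y XY xY)
  also have "\<dots> \<le> L (N k) * (r k / 2)" by (intro mult_left_mono Xfar L0)
  finally have "3/4 * L (N k) * r k \<le> B + L (N k) * (r k / 2)" using x(2)[of k] B[of "N k"] by linarith
  hence "L (N k) * r k \<le> 4 * B" by (simp add: field_simps)
  moreover have "4 ^ k * r k \<le> L (N k) * r k" using N[of k] by (intro mult_right_mono) (auto simp: r_def)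
  moreover have "4 ^ k * r k = (4/3) ^ k / 3" by (simp add: r_def power_divide)
  ultimately show ?thesis by simp
 qed
 moreover obtain k :: nat where "12 * B < (4/3) ^ k" using real_arch_pow[of "4/3" "12 * B"] by auto
 ultimately show False by (meson not_less)
qed

text \<open>A continuous function whose upper right Dini derivatives are nonpositive does not
  increase. Allowing a slope e > 0, the supremum m of the times up to which \<phi> stays below the
  line must be T, since the one-sided estimate at m would carry the bound further.\<close>

lemma dini_nonincreasing:
 fixes \<phi> :: "real => real"
 assumes T: "0 \<le> T" and c: "continuous_on {0..T} \<phi>"
  and d: "\<And>t. 0 \<le> t ==> t < T ==> \<exists>r. (r \<longlongrightarrow> 0) (at_right 0) \<and> (\<forall>\<^sub>F h in at_right 0. \<phi> (t + h) \<le> \<phi> t + h * r h)"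
 shows "\<phi> T \<le> \<phi> 0"
proof (rule field_le_epsilon)
 fix e' :: real assume "e' > 0"
 define e where "e = e' / (T + 1)"
 have e: "e > 0" using \<open>e' > 0\<close> T by (simp add: e_def)
 define A where "A = {t\<in>{0..T}. \<phi> t \<le> \<phi> 0 + e * t}"
 have clA: "closed A" unfolding A_def
  by (rule continuous_on_closed_Collect_le[OF c]) (auto intro!: continuous_intros)
 define G where "G = {t\<in>{0..T}. {0..t} \<subseteq> A}"
 have G0: "0 \<in> G" using T by (auto simp: G_def A_def)
 have bG: "bdd_above G" by (rule bdd_aboveI[of _ T]) (auto simp: G_def)
 define m where "m = Sup G"
 have "0 \<le> m" unfolding m_def using G0 bG by (rule cSup_upper)
 moreover have "m \<le> T" unfolding m_def by (rule cSup_least) (use G0 in \<open>auto simp: G_def\<close>)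
 ultimately have m: "0 \<le> m" "m \<le> T" by auto
 have sub: "{0..<m} \<subseteq> A"
 proof
  fix t assume t: "t \<in> {0..<m}"
  then obtain g where "g \<in> G" "t < g" unfolding m_def using less_cSup_iff[OF _ bG] G0 by auto
  thus "t \<in> A" using t by (auto simp: G_def)
 qed
 have mA: "m \<in> A"
 proof (cases "m = 0")
  case True
  thus ?thesis using G0 by (auto simp: G_def)
 next
  case False
  hence "closure {0..<m} = {0..m}" using m by (intro closure_atLeastLessThan) auto
  thus ?thesis using closure_minimal[OF sub clA] m by auto
 qed
 have "m = T"
 proof (rule ccontr)
  assume "m \<noteq> T"
  hence mT: "m < T" using m by simp
  from d[OF m(1) this] obtain r where r: "(r \<longlongrightarrow> 0) (at_right 0)"
   "\<forall>\<^sub>F h in at_right 0. \<phi> (m + h) \<le> \<phi> m + h * r h" by blast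
  have "\<forall>\<^sub>F h in at_right 0. r h < e" using order_tendstoD(2)[OF r(1) e] .
  hence "\<forall>\<^sub>F h in at_right 0. \<phi> (m + h) \<le> \<phi> 0 + e * (m + h)"
   using r(2) eventually_at_right_less[of 0]
  proof eventually_elim
   case (elim h)
   have "h * r h \<le> h * e" using elim by (intro mult_left_mono) auto
   moreover have "\<phi> m \<le> \<phi> 0 + e * m" using mA by (simp add: A_def)
   ultimately have "\<phi> (m + h) \<le> \<phi> 0 + e * m + h * e" using elim by linarith
   thus ?case by (simp add: distrib_left mult.commute)
  qed
  then obtain b where b: "b > 0" "\<And>h. 0 < h ==> h < b ==> \<phi> (m + h) \<le> \<phi> 0 + e * (m + h)"
   unfolding eventually_at_right_field by auto
  define g where "g = m + min (b / 2) (T - m)"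
  have g: "m < g" "g \<le> T" "g - m < b" using b mT by (auto simp: g_def min_def)
  have "{0..g} \<subseteq> A"
  proof
   fix t assume t: "t \<in> {0..g}"
   show "t \<in> A"
   proof (cases "t \<le> m")
    case True
    thus ?thesis using sub mA t by (cases "t = m") auto
   next
    case False
    thus ?thesis using b(2)[of "t - m"] t g by (auto simp: A_def)
   qed
  qed
  hence "g \<in> G" using g m by (auto simp: G_def)
  hence "g \<le> m" unfolding m_def using bG by (rule cSup_upper)
  thus False using g by simp
 qed
 hence "\<phi> T \<le> \<phi> 0 + e * T" using mA by (simp add: A_def)
 also have "e * T \<le> e'" using \<open>e' > 0\<close> T by (simp add: e_def field_simps)
 finally show "\<phi> T \<le> \<phi> 0 + e'" by simp
qed

lemma integral_in_closed_subspace: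
 fixes f :: "real => 'b::banach"
 assumes Y: "subspace Y" "closed Y" and f: "f integrable_on {a..b}" "\<And>t. t \<in> {a..b} ==> f t \<in> Y"
 shows "integral {a..b} f \<in> Y"
proof -
 have "integral {a..b} f \<in> closure Y"
  unfolding closure_approachable
 proof (intro allI impI)
  fix e :: real assume e: "e > 0"
  from integrable_integral[OF f(1), unfolded has_integral_real, rule_format, OF e] obtain \<gamma> where
   g: "gauge \<gamma>" "\<And>p. p tagged_division_of {a..b} \<and> \<gamma> fine p ==> norm ((\<Sum>(x, K)\<in>p. measure lborel K *\<^sub>R f x) - integral {a..b} f) < e" by blast
  obtain p where p: "p tagged_division_of {a..b}" "\<gamma> fine p"
   using fine_division_exists_real[OF g(1)] by blast
  have "(\<Sum>(x, K)\<in>p. measure lborel K *\<^sub>R f x) \<in> Y"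
   using tag_in_interval[OF p(1)] f(2) by (intro subspace_sum Y) (auto intro: subspace_scale[OF Y(1)])
  moreover have "dist (\<Sum>(x, K)\<in>p. measure lborel K *\<^sub>R f x) (integral {a..b} f) < e"
   using g(2) p by (simp add: dist_norm)
  ultimately show "\<exists>y\<in>Y. dist y (integral {a..b} f) < e" by blast
 qed
 thus ?thesis using Y(2) by (simp add: closure_closed)
qed

text \<open>The function space will appear as a closed subspace of a Banach space type, and the
  operators are meaningful only there; hence all laws are relative to \<open>Y\<close>.\<close>

locale semigroup_on =
 fixes Y :: "'b::banach set" and S :: "real => 'b => 'b"
 assumes Y: "subspace Y" "closed Y"
  and S_in: "\<And>t y. t \<ge> 0 ==> y \<in> Y ==> S t y \<in> Y"
  and S_add: "\<And>t x y. t \<ge> 0 ==> x \<in> Y ==> y \<in> Y ==> S t (x + y) = S t x + S t y"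
  and S_scale: "\<And>t x a. t \<ge> 0 ==> x \<in> Y ==> S t (a *\<^sub>R x) = a *\<^sub>R S t x"
  and S_bdd: "\<And>t. t \<ge> 0 ==> \<exists>M. \<forall>y\<in>Y. norm (S t y) \<le> M * norm y"
  and S_0: "\<And>y. y \<in> Y ==> S 0 y = y"
  and S_plus: "\<And>s t y. s \<ge> 0 ==> t \<ge> 0 ==> y \<in> Y ==> S (s + t) y = S s (S t y)"
  and S_cont: "\<And>y. y \<in> Y ==> ((\<lambda>t. S t y) \<longlongrightarrow> y) (at_right 0)"
begin

lemma S_diff: "t \<ge> 0 ==> x \<in> Y ==> y \<in> Y ==> S t (x - y) = S t x - S t y"
 using S_add[of t x "(-1) *\<^sub>R y"] S_scale[of t y "-1"] subspace_scale[OF Y(1), of y "-1"] by simp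

lemma S_sum:
 assumes t: "t \<ge> 0" and "finite I" and "\<And>i. i \<in> I ==> f i \<in> Y"
 shows "S t (\<Sum>i\<in>I. f i) = (\<Sum>i\<in>I. S t (f i))"
 using assms(2,3)
proof (induction I rule: finite_induct)
 case empty
 show ?case using t S_scale[of t 0 0] subspace_0[OF Y(1)] by simp
next
 case (insert i I)
 thus ?case using t S_add[of t "f i" "\<Sum>i\<in>I. f i"] subspace_sum[OF Y(1), of I f] by simp
qed

text \<open>Otherwise there are times \<open>\<tau> n\<close> tending to 0 at which the operator
  norm exceeds n, although each orbit converges along these times and so is bounded. This
  contradicts \<open>uniform_boundedness_seq\<close>.\<close>

lemma S_bdd_near_0: "\<exists>\<delta>>0. \<exists>M. \<forall>t\<in>{0..\<delta>}. \<forall>y\<in>Y. norm (S t y) \<le> M * norm y"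
proof (rule ccontr)
 assume neg: "\<not> ?thesis"
 have "\<exists>t. t \<in> {0..1 / real (Suc n)} \<and> (\<exists>y\<in>Y. norm (S t y) > real n * norm y)" for n
 proof (rule ccontr)
  assume "\<not> ?thesis"
  hence "\<forall>t\<in>{0..1 / real (Suc n)}. \<forall>y\<in>Y. norm (S t y) \<le> real n * norm y" by (auto simp: not_less)
  moreover have "1 / real (Suc n) > 0" by simp
  ultimately show False using neg by blast
 qed
 then obtain \<tau> where \<tau>: "\<And>n. \<tau> n \<in> {0..1 / real (Suc n)}" "\<And>n. \<exists>y\<in>Y. norm (S (\<tau> n) y) > real n * norm y" by metis
 have \<tau>0: "\<tau> \<longlonglongrightarrow> 0"
  by (rule tendsto_sandwich[OF _ _ tendsto_const LIMSEQ_Suc[OF lim_1_over_n]]) (use \<tau>(1) in auto)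
 have "\<exists>M. \<forall>n. \<forall>y\<in>Y. norm (S (\<tau> n) y) \<le> M * norm y"
 proof (rule uniform_boundedness_seq[OF Y])
  show "\<exists>B. \<forall>n. norm (S (\<tau> n) y) \<le> B" if y: "y \<in> Y" for y
  proof -
   have "(\<lambda>n. S (\<tau> n) y) \<longlonglongrightarrow> y"
   proof (rule tendstoI)
    fix e :: real assume e: "e > 0"
    from tendstoD[OF S_cont[OF y] this] obtain b where b: "b > 0" "\<And>h. 0 < h ==> h < b ==> dist (S h y) y < e"
     unfolding eventually_at_right_field by auto
    show "\<forall>\<^sub>F n in sequentially. dist (S (\<tau> n) y) y < e"
     using order_tendstoD(2)[OF \<tau>0 b(1)]
    proof eventually_elim
     case (elim n)
     thus ?case using b(2)[of "\<tau> n"] \<tau>(1)[of n] S_0[OF y] e by (cases "\<tau> n = 0") auto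
    qed
   qed
   hence "Bseq (\<lambda>n. S (\<tau> n) y)" by (intro convergent_imp_Bseq convergentI)
   thus ?thesis unfolding Bseq_def by blast
  qed
 qed (use \<tau>(1) S_add S_scale S_bdd in auto)
 then obtain M where M: "\<And>n y. y \<in> Y ==> norm (S (\<tau> n) y) \<le> M * norm y" by blast
 obtain n where n: "M < real n" using reals_Archimedean2 by blast
 obtain y where "y \<in> Y" "norm (S (\<tau> n) y) > real n * norm y" using \<tau>(2) by blast
 hence "real n * norm y < M * norm y" using M[of y n] by simp
 thus False using n mult_right_mono[of M "real n" "norm y"] by simp
qed

lemma S_loc_bdd: "\<exists>M\<ge>1. \<forall>t\<in>{0..T}. \<forall>y\<in>Y. norm (S t y) \<le> M * norm y"
proof -
 obtain \<delta> M0 where \<delta>: "\<delta> > 0" and M0: "\<And>t y. t \<in> {0..\<delta>} ==> y \<in> Y ==> norm (S t y) \<le> M0 * norm y"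
  using S_bdd_near_0 by blast
 define M where "M = max 1 M0"
 have M: "norm (S t y) \<le> M * norm y" if "t \<in> {0..\<delta>}" "y \<in> Y" for t y
  by (rule order_trans[OF M0[OF that]]) (auto simp: M_def intro: mult_right_mono)
 have "\<forall>t\<in>{0..real n * \<delta>}. \<forall>y\<in>Y. norm (S t y) \<le> M ^ n * norm y" for n
 proof (induction n)
  case 0
  thus ?case using S_0 by auto
 next
  case (Suc n)
  show ?case
  proof (intro ballI)
   fix t y assume t: "t \<in> {0..real (Suc n) * \<delta>}" and y: "y \<in> Y"
   show "norm (S t y) \<le> M ^ Suc n * norm y"
   proof (cases "t \<le> \<delta>")
    case True
    have "M * norm y \<le> M ^ Suc n * norm y" using self_le_power[of M "Suc n"]
     by (intro mult_right_mono) (auto simp: M_def)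
    thus ?thesis using M[of t y] True t y by auto
   next
    case False
    have "S t y = S \<delta> (S (t - \<delta>) y)" using S_plus[of \<delta> "t - \<delta>" y] False \<delta> y by simp
    hence "norm (S t y) \<le> M * norm (S (t - \<delta>) y)" using M[of \<delta> "S (t - \<delta>) y"] \<delta> y False S_in by simp
    also have "norm (S (t - \<delta>) y) \<le> M ^ n * norm y" using Suc t False y by (auto simp: algebra_simps)
    finally show ?thesis by (simp add: M_def mult.assoc mult_left_mono)
   qed
  qed
 qed
 moreover obtain n :: nat where "T / \<delta> \<le> real n" using real_arch_simple by blast
 hence "T \<le> real n * \<delta>" using \<delta> by (simp add: field_simps)
 ultimately have "\<forall>t\<in>{0..T}. \<forall>y\<in>Y. norm (S t y) \<le> M ^ n * norm y" by auto
 moreover have "M ^ n \<ge> 1" by (simp add: M_def)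
 ultimately show ?thesis by blast
qed

lemma S_continuous: assumes y: "y \<in> Y" shows "continuous_on {0..} (\<lambda>t. S t y)"
 unfolding continuous_on_iff
proof (intro ballI allI impI)
 fix t e :: real assume t: "t \<in> {0..}" and e: "e > 0"
 obtain M where M: "M \<ge> 1" "\<And>s y. s \<in> {0..t + 1} ==> y \<in> Y ==> norm (S s y) \<le> M * norm y"
  using S_loc_bdd by blast
 have "e / M > 0" using e M by simp
 from tendstoD[OF S_cont[OF y] this] obtain b where b: "b > 0" "\<And>h. 0 < h ==> h < b ==> dist (S h y) y < e / M"
  unfolding eventually_at_right_field by auto
 show "\<exists>d>0. \<forall>s\<in>{0..}. dist s t < d --> dist (S s y) (S t y) < e"
 proof (intro exI conjI ballI impI)
  fix s assume s: "s \<in> {0..}" "dist s t < min b 1"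
  have *: "dist (S (p + h) y) (S p y) < e" if "p \<ge> 0" "p \<le> t + 1" "0 < h" "h < b" for p h
  proof -
   have "S (p + h) y - S p y = S p (S h y - y)" using that y by (simp add: S_plus S_diff S_in)
   hence "dist (S (p + h) y) (S p y) \<le> M * norm (S h y - y)"
    using M(2)[of p "S h y - y"] that y by (simp add: dist_norm S_in subspace_diff[OF Y(1)])
   also have "\<dots> < e" using b(2)[OF that(3,4)] M(1) by (simp add: dist_norm field_simps)
   finally show ?thesis .
  qed
  show "dist (S s y) (S t y) < e"
  proof (cases s t rule: linorder_cases)
   case less
   thus ?thesis using *[of s "t - s"] s t by (simp add: dist_real_def dist_commute)
  next
   case equal
   thus ?thesis using e by simp
  next
   case greater
   thus ?thesis using *[of t "s - t"] s t by (simp add: dist_real_def)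
  qed
 qed (use b in auto)
qed

text \<open>In the Duhamel integrand S (t - s) (F s) time and argument vary together; local
  boundedness of the operator norms upgrades separate to joint continuity.\<close>

lemma S_jointly_continuous: "continuous_on ({0..} \<times> Y) (\<lambda>p. S (fst p) (snd p))"
 unfolding continuous_on_iff
proof (intro ballI allI impI)
 fix p :: "real \<times> 'b" and e :: real assume p: "p \<in> {0..} \<times> Y" and e: "e > 0"
 define t y where "t = fst p" "y = snd p"
 have ty: "t \<ge> 0" "y \<in> Y" using p by (auto simp: t_y_def)
 obtain M where M: "M \<ge> 1" "\<And>s y. s \<in> {0..t + 1} ==> y \<in> Y ==> norm (S s y) \<le> M * norm y"
  using S_loc_bdd by blast
 have "e / 2 > 0" using e by simp
 with S_continuous[OF ty(2)] obtain d where d: "d > 0" "\<And>s. s \<ge> 0 ==> dist s t < d ==> dist (S s y) (S t y) < e / 2"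
  unfolding continuous_on_iff using ty(1) by (metis atLeast_iff)
 define d' where "d' = min (min d 1) (e / (2 * M))"
 show "\<exists>d>0. \<forall>q\<in>{0..} \<times> Y. dist q p < d --> dist (S (fst q) (snd q)) (S (fst p) (snd p)) < e"
 proof (intro exI conjI ballI impI)
  show "d' > 0" using d e M by (simp add: d'_def)
  fix q assume q: "q \<in> {0..} \<times> Y" "dist q p < d'"
  have q1: "dist (fst q) t < d'" "dist (snd q) y < d'"
   using q(2) dist_fst_le[of q p] dist_snd_le[of q p] by (auto simp: t_y_def)
  have qY: "fst q \<ge> 0" "snd q \<in> Y" using q(1) by auto
  have "fst q \<in> {0..t + 1}" using q1(1) qY by (auto simp: d'_def dist_real_def)
  hence "norm (S (fst q) (snd q - y)) \<le> M * norm (snd q - y)" using M qY ty subspace_diff[OF Y(1)] by blast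
  also have "\<dots> < e / 2" using q1(2) M(1) by (simp add: d'_def dist_norm field_simps)
  finally have "dist (S (fst q) (snd q)) (S (fst q) y) < e / 2" using qY ty by (simp add: S_diff dist_norm)
  moreover have "dist (S (fst q) y) (S t y) < e / 2" using d(2)[of "fst q"] qY q1(1) by (simp add: d'_def)
  ultimately show "dist (S (fst q) (snd q)) (S (fst p) (snd p)) < e"
   using dist_triangle[of "S (fst q) (snd q)" "S t y" "S (fst q) y"] by (simp add: t_y_def)
 qed
qed

lemma S_continuous_comp:
 assumes "continuous_on A f" "continuous_on A g" "\<And>x. x \<in> A ==> f x \<ge> 0" "\<And>x. x \<in> A ==> g x \<in> Y"
 shows "continuous_on A (\<lambda>x. S (f x) (g x))"
 using continuous_on_compose2[OF S_jointly_continuous continuous_on_Pair[OF assms(1,2)]] assms(3,4) by auto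

text \<open>\<open>S t\<close> is linear and bounded on \<open>Y\<close>, so it is moved through
  Riemann sums, which stay in \<open>Y\<close>.\<close>

lemma S_integral:
 fixes f :: "real => 'b"
 assumes t: "t \<ge> 0" and f: "continuous_on {a..b} f" "\<And>s. s \<in> {a..b} ==> f s \<in> Y"
 shows "S t (integral {a..b} f) = integral {a..b} (\<lambda>s. S t (f s))"
proof -
 have i1: "f integrable_on {a..b}" using f(1) by (rule integrable_continuous_real)
 have "continuous_on {a..b} (\<lambda>s. S t (f s))" using f t by (intro S_continuous_comp continuous_on_const) auto
 hence i2: "(\<lambda>s. S t (f s)) integrable_on {a..b}" by (rule integrable_continuous_real)
 have IY: "integral {a..b} f \<in> Y" by (rule integral_in_closed_subspace[OF Y i1 f(2)])
 obtain M where M: "M \<ge> 1" "\<And>y. y \<in> Y ==> norm (S t y) \<le> M * norm y" using S_loc_bdd[of t] t by auto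
 have "norm (S t (integral {a..b} f) - integral {a..b} (\<lambda>s. S t (f s))) \<le> 0"
 proof (rule field_le_epsilon)
  fix e :: real assume e: "e > 0"
  have "e / (2 * M) > 0" "e / 2 > 0" using e M by auto
  from integrable_integral[OF i1, unfolded has_integral_real, rule_format, OF this(1)]
   integrable_integral[OF i2, unfolded has_integral_real, rule_format, OF this(2)]
  obtain \<gamma> \<delta> where g: "gauge \<gamma>" "\<And>p. p tagged_division_of {a..b} \<and> \<gamma> fine p ==> norm ((\<Sum>(x, K)\<in>p. measure lborel K *\<^sub>R f x) - integral {a..b} f) < e / (2 * M)"
   and d: "gauge \<delta>" "\<And>p. p tagged_division_of {a..b} \<and> \<delta> fine p ==> norm ((\<Sum>(x, K)\<in>p. measure lborel K *\<^sub>R S t (f x)) - integral {a..b} (\<lambda>s. S t (f s))) < e / 2"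
   by blast
  obtain p where p: "p tagged_division_of {a..b}" "\<gamma> fine p" "\<delta> fine p"
   using fine_division_exists_real[OF gauge_Int[OF g(1) d(1)]] by (metis fine_Int)
  let ?R = "\<Sum>(x, K)\<in>p. measure lborel K *\<^sub>R f x"
  have fY: "f x \<in> Y" if "(x, K) \<in> p" for x K using tag_in_interval[OF p(1) that] f(2) by simp
  have RY: "?R \<in> Y" using fY by (intro subspace_sum Y) (auto intro: subspace_scale[OF Y(1)])
  have "S t ?R = (\<Sum>q\<in>p. S t (case q of (x, K) => measure lborel K *\<^sub>R f x))"
   using tagged_division_of_finite[OF p(1)] fY by (intro S_sum t) (auto intro: subspace_scale[OF Y(1)])
  also have "\<dots> = (\<Sum>(x, K)\<in>p. measure lborel K *\<^sub>R S t (f x))"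
   using fY by (intro sum.cong) (auto simp: S_scale t)
  finally have SR: "S t ?R = (\<Sum>(x, K)\<in>p. measure lborel K *\<^sub>R S t (f x))" .
  have "norm (S t (integral {a..b} f) - S t ?R) \<le> M * norm (integral {a..b} f - ?R)"
   using M(2)[OF subspace_diff[OF Y(1) IY RY]] S_diff[OF t IY RY] by simp
  also have "\<dots> \<le> M * (e / (2 * M))" using g(2)[of p] p M by (intro mult_left_mono) (auto simp: norm_minus_commute)
  also have "\<dots> = e / 2" using M by simp
  finally have "norm (S t (integral {a..b} f) - S t ?R) \<le> e / 2" .
  moreover have "norm (S t ?R - integral {a..b} (\<lambda>s. S t (f s))) < e / 2" unfolding SR using d(2) p by blast
  ultimately show "norm (S t (integral {a..b} f) - integral {a..b} (\<lambda>s. S t (f s))) \<le> 0 + e"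
   using norm_triangle_ineq[of "S t (integral {a..b} f) - S t ?R" "S t ?R - integral {a..b} (\<lambda>s. S t (f s))"] by simp
 qed
 thus ?thesis by simp
qed

definition gen :: "('b \<times> 'b) set" where
 "gen = {(y, f). y \<in> Y \<and> f \<in> Y \<and> ((\<lambda>h. (1 / h) *\<^sub>R (S h y - y)) \<longlongrightarrow> f) (at_right 0)}"

lemma gen_invariant: assumes "(y, f) \<in> gen" "t \<ge> 0" shows "(S t y, S t f) \<in> gen"
proof -
 have y: "y \<in> Y" "f \<in> Y" and l: "((\<lambda>h. (1 / h) *\<^sub>R (S h y - y)) \<longlongrightarrow> f) (at_right 0)" using assms by (auto simp: gen_def)
 obtain M where M: "M \<ge> 1" "\<And>y. y \<in> Y ==> norm (S t y) \<le> M * norm y" using S_loc_bdd[of t] assms(2) by auto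
 have "((\<lambda>h. (1 / h) *\<^sub>R (S h (S t y) - S t y) - S t f) \<longlongrightarrow> 0) (at_right 0)"
 proof (rule Lim_null_comparison)
  show "((\<lambda>h. M * norm ((1 / h) *\<^sub>R (S h y - y) - f)) \<longlongrightarrow> 0) (at_right 0)"
   by (intro tendsto_mult_right_zero tendsto_norm_zero LIM_zero l)
  show "\<forall>\<^sub>F h in at_right 0. norm ((1 / h) *\<^sub>R (S h (S t y) - S t y) - S t f) \<le> M * norm ((1 / h) *\<^sub>R (S h y - y) - f)"
   using eventually_at_right_less[of 0]
  proof eventually_elim
   case (elim h)
   have q: "(1 / h) *\<^sub>R (S h y - y) \<in> Y" using elim y by (intro subspace_scale subspace_diff S_in Y) auto
   have "S h (S t y) = S t (S h y)" using S_plus[of h t y] S_plus[of t h y] elim assms(2) y by (simp add: add.commute)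
   hence "(1 / h) *\<^sub>R (S h (S t y) - S t y) - S t f = S t ((1 / h) *\<^sub>R (S h y - y) - f)"
    using elim y assms(2) q by (simp add: S_diff S_scale S_in subspace_diff[OF Y(1)])
   thus ?case using M(2)[of "(1 / h) *\<^sub>R (S h y - y) - f"] q y subspace_diff[OF Y(1)] by simp
  qed
 qed
 hence "((\<lambda>h. (1 / h) *\<^sub>R (S h (S t y) - S t y)) \<longlongrightarrow> S t f) (at_right 0)" by (rule LIM_zero_cancel)
 thus ?thesis using y assms(2) by (simp add: gen_def S_in)
qed

lemma average_tendsto:
 fixes F :: "real => 'b"
 assumes F: "continuous_on {0..} F" and x: "x \<ge> 0"
 shows "((\<lambda>r. (1 / r) *\<^sub>R integral {x..x + r} F) \<longlongrightarrow> F x) (at_right 0)"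
proof (rule tendstoI)
 fix e :: real assume e: "e > 0"
 hence "e / 2 > 0" by simp
 with F x obtain d where d: "d > 0" "\<And>s. s \<ge> 0 ==> dist s x < d ==> dist (F s) (F x) < e / 2"
  unfolding continuous_on_iff by (metis atLeast_iff)
 have "dist ((1 / r) *\<^sub>R integral {x..x + r} F) (F x) < e" if r: "0 < r" "r < d" for r
 proof -
  have Fc: "continuous_on {x..x + r} F" using x by (intro continuous_on_subset[OF F]) auto
  have "norm (integral {x..x + r} (\<lambda>s. F s - F x)) \<le> (e / 2) * (x + r - x)"
  proof (rule integral_bound)
   show "norm (F s - F x) \<le> e / 2" if "s \<in> {x..x + r}" for s
    using d(2)[of s] that r x by (simp add: dist_norm dist_real_def less_imp_le)
  qed (use r in \<open>auto intro!: continuous_intros Fc\<close>)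
  moreover have "integral {x..x + r} (\<lambda>s. F s - F x) = integral {x..x + r} F - r *\<^sub>R F x"
   using r by (subst Henstock_Kurzweil_Integration.integral_diff) (auto intro: integrable_continuous_real Fc)
  ultimately have n: "norm (integral {x..x + r} F - r *\<^sub>R F x) \<le> e / 2 * r" by simp
  have "(1 / r) *\<^sub>R integral {x..x + r} F - F x = (1 / r) *\<^sub>R (integral {x..x + r} F - r *\<^sub>R F x)"
   using r by (simp add: scaleR_diff_right)
  hence "dist ((1 / r) *\<^sub>R integral {x..x + r} F) (F x) = (1 / r) * norm (integral {x..x + r} F - r *\<^sub>R F x)"
   using r by (simp add: dist_norm)
  also have "\<dots> \<le> (1 / r) * (e / 2 * r)" using n r by (intro mult_left_mono) auto
  also have "\<dots> < e" using r e by simp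
  finally show ?thesis .
 qed
 thus "\<forall>\<^sub>F r in at_right 0. dist ((1 / r) *\<^sub>R integral {x..x + r} F) (F x) < e"
  unfolding eventually_at_right_field using d(1) by (intro exI[of _ d]) auto
qed

lemma integral_shift_real:
 fixes F :: "real => 'b"
 assumes "continuous_on {r..r + h} F"
 shows "integral {0..h} (\<lambda>s. F (s + r)) = integral {r..r + h} F"
proof -
 have "(F has_integral integral {r..r + h} F) (cbox r (r + h))"
  using integrable_integral[OF integrable_continuous_real[OF assms]] by simp
 from has_integral_affinity[OF this, of 1 r]
 have "((\<lambda>s. F (s + r)) has_integral integral {r..r + h} F) ((\<lambda>x. x - r) ` {r..r + h})" by simp
 also have "(\<lambda>x. x - r) ` {r..r + h} = {0..h}" by simp
 finally show ?thesis by (rule integral_unique)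
qed

text \<open>The averages of S s y over [0,h] lie in the domain: the difference quotient telescopes
  to two short averages, one starting at h and one at 0. As h tends to 0 the averages converge to
  y.\<close>

lemma gen_dense:
 assumes y: "y \<in> Y" and e: "e > 0"
 shows "\<exists>x f. (x, f) \<in> gen \<and> norm (x - y) < e"
proof -
 define F where "F s = S s y" for s
 have Fc: "continuous_on {0..} F" unfolding F_def[abs_def] using y by (rule S_continuous)
 have FY: "F s \<in> Y" if "s \<ge> 0" for s using that y by (simp add: F_def S_in)
 have Fc': "continuous_on {a..b} F" if "a \<ge> 0" for a b using that by (intro continuous_on_subset[OF Fc]) auto
 have Fi: "F integrable_on {a..b}" if "a \<ge> 0" for a b using Fc'[OF that] by (rule integrable_continuous_real)
 have "((\<lambda>r. (1 / r) *\<^sub>R integral {0..0 + r} F) \<longlongrightarrow> F 0) (at_right 0)" by (rule average_tendsto[OF Fc]) simp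
 from tendstoD[OF this e] have "\<forall>\<^sub>F h in at_right 0. dist ((1 / h) *\<^sub>R integral {0..h} F) y < e"
  by (simp add: F_def S_0[OF y])
 then obtain b where b: "b > 0" "\<And>h. 0 < h ==> h < b ==> dist ((1 / h) *\<^sub>R integral {0..h} F) y < e"
  unfolding eventually_at_right_field by auto
 define h where "h = b / 2"
 have h: "h > 0" "h < b" using b by (auto simp: h_def)
 define x where "x = (1 / h) *\<^sub>R integral {0..h} F"
 define f where "f = (1 / h) *\<^sub>R (F h - F 0)"
 have IY: "integral {0..h} F \<in> Y" by (rule integral_in_closed_subspace[OF Y Fi]) (auto intro: FY)
 hence xY: "x \<in> Y" unfolding x_def by (rule subspace_scale[OF Y(1)])
 have fY: "f \<in> Y" unfolding f_def using h by (intro subspace_scale subspace_diff Y FY) auto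
 have SI: "S r (integral {0..h} F) - integral {0..h} F = integral {h..h + r} F - integral {0..0 + r} F" if r: "r > 0" for r
 proof -
  have "S r (integral {0..h} F) = integral {0..h} (\<lambda>s. S r (F s))"
   using r by (intro S_integral Fc' FY) auto
  also have "\<dots> = integral {0..h} (\<lambda>s. F (s + r))"
   using r y by (intro Henstock_Kurzweil_Integration.integral_cong) (auto simp: F_def S_plus[symmetric] add.commute)
  also have "\<dots> = integral {r..r + h} F" using r by (intro integral_shift_real Fc') simp
  finally have a: "S r (integral {0..h} F) = integral {r..r + h} F" .
  have "integral {0..r} F + integral {r..r + h} F = integral {0..r + h} F"
   using r h by (intro Henstock_Kurzweil_Integration.integral_combine Fi) auto
  moreover have "integral {0..h} F + integral {h..h + r} F = integral {0..h + r} F"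
   using r h by (intro Henstock_Kurzweil_Integration.integral_combine Fi) auto
  ultimately show ?thesis unfolding a by (simp add: algebra_simps)
 qed
 have "((\<lambda>r. (1 / h) *\<^sub>R ((1 / r) *\<^sub>R integral {h..h + r} F - (1 / r) *\<^sub>R integral {0..0 + r} F)) \<longlongrightarrow> f) (at_right 0)"
  unfolding f_def using h by (intro tendsto_intros average_tendsto Fc) auto
 hence "((\<lambda>r. (1 / r) *\<^sub>R (S r x - x)) \<longlongrightarrow> f) (at_right 0)"
 proof (rule Lim_transform_eventually)
  show "\<forall>\<^sub>F r in at_right 0. (1 / h) *\<^sub>R ((1 / r) *\<^sub>R integral {h..h + r} F - (1 / r) *\<^sub>R integral {0..0 + r} F) = (1 / r) *\<^sub>R (S r x - x)"
   using eventually_at_right_less[of 0]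
  proof eventually_elim
   case (elim r)
   have "S r x - x = (1 / h) *\<^sub>R (integral {h..h + r} F - integral {0..0 + r} F)"
    unfolding SI[OF elim, symmetric] x_def using elim by (simp add: S_scale IY scaleR_diff_right)
   thus ?case by (simp add: scaleR_diff_right mult.commute)
  qed
 qed
 hence "(x, f) \<in> gen" using xY fY by (simp add: gen_def)
 moreover have "norm (x - y) < e" using b(2)[OF h] by (simp add: x_def dist_norm)
 ultimately show ?thesis by blast
qed

text \<open>
 The hypothesis on \<open>P\<close> is the dissipativity of the generator, in the form of a lower bound for
 its resolvent.
\<close>

lemma seminorm_decay:
 assumes PL: "\<And>x y. x \<in> Y ==> y \<in> Y ==> \<bar>P x - P y\<bar> \<le> C * norm (x - y)"
  and diss: "\<And>y f h. (y, f) \<in> gen ==> h > 0 ==> (1 + h * \<sigma>) * P y \<le> P (y - h *\<^sub>R f)"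
  and y: "y \<in> Y" and t: "t \<ge> 0"
 shows "P (S t y) \<le> exp (- \<sigma> * t) * P y"
proof -
 have Pc: "continuous_on Y P"
  unfolding continuous_on_iff
 proof (intro ballI allI impI)
  fix x and e :: real assume x: "x \<in> Y" and e: "e > 0"
  show "\<exists>d>0. \<forall>x'\<in>Y. dist x' x < d --> dist (P x') (P x) < e"
  proof (intro exI conjI ballI impI)
   show "e / (\<bar>C\<bar> + 1) > 0" using e by simp
   fix x' assume x': "x' \<in> Y" "dist x' x < e / (\<bar>C\<bar> + 1)"
   have "dist (P x') (P x) \<le> C * norm (x' - x)" using PL[OF x'(1) x] by (simp add: dist_real_def)
   also have "\<dots> \<le> (\<bar>C\<bar> + 1) * norm (x' - x)" by (intro mult_right_mono) auto
   also have "\<dots> < e" using x'(2) by (simp add: dist_norm field_simps)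
   finally show "dist (P x') (P x) < e" .
  qed
 qed
 have SPc: "continuous_on {0..} (\<lambda>t. P (S t x))" if "x \<in> Y" for x
  using that by (intro continuous_on_compose2[OF Pc S_continuous]) (auto intro: S_in)
 have main: "P (S t x) \<le> exp (- \<sigma> * t) * P x" if gx: "(x, g) \<in> gen" for x g
 proof -
  have xY: "x \<in> Y" using gx by (simp add: gen_def)
  define \<phi> where "\<phi> s = exp (\<sigma> * s) * P (S s x)" for s
  have "\<phi> t \<le> \<phi> 0"
  proof (rule dini_nonincreasing[OF t])
   show "continuous_on {0..t} \<phi>" unfolding \<phi>_def[abs_def]
    by (intro continuous_intros continuous_on_subset[OF SPc[OF xY]]) auto
   fix s assume s: "0 \<le> s" "s < t"
   define x' f' where "x' = S s x" "f' = S s g"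
   have x'g: "(x', f') \<in> gen" using gen_invariant[OF gx s(1)] by (simp add: x'_f'_def)
   hence x'Y: "x' \<in> Y" "f' \<in> Y" and lim: "((\<lambda>h. (1 / h) *\<^sub>R (S h x' - x')) \<longlongrightarrow> f') (at_right 0)"
    by (auto simp: gen_def)
   \<comment> \<open>The relative error of one step: the difference quotient against f', the motion
     of f' itself, and the error of linearising exp. All three tend to 0.\<close>
   define r where "r h = exp (\<sigma> * s) * (\<bar>C\<bar> * (norm ((1 / h) *\<^sub>R (S h x' - x') - f') + norm (S h f' - f'))
     + \<bar>(exp (\<sigma> * h) - 1) / h - \<sigma>\<bar> * \<bar>P (S h x')\<bar>)" for h
   have "((\<lambda>h. (exp (\<sigma> * h) - 1) / h) \<longlongrightarrow> \<sigma>) (at 0)"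
   proof -
    have "((\<lambda>h. exp (\<sigma> * h)) has_real_derivative \<sigma>) (at 0)" by (auto intro!: derivative_eq_intros)
    from DERIV_D[OF this] show ?thesis by simp
   qed
   hence l1: "((\<lambda>h. (exp (\<sigma> * h) - 1) / h) \<longlongrightarrow> \<sigma>) (at_right 0)"
    by (rule filterlim_mono) (auto simp: at_within_le_at)
   have l2: "((\<lambda>h. P (S h x')) \<longlongrightarrow> P x') (at_right 0)"
   proof -
    have "(P \<longlongrightarrow> P x') (at x' within Y)" using Pc x'Y by (simp add: continuous_on_def)
    hence "\<And>e. e > 0 ==> \<forall>\<^sub>F h in at_right 0. dist (P (S h x')) (P x') < e"
    proof -
     fix e :: real assume e: "e > 0"
     with Pc x'Y(1) obtain d where d: "d > 0" "\<And>w. w \<in> Y ==> dist w x' < d ==> dist (P w) (P x') < e"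
      unfolding continuous_on_iff by blast
     show "\<forall>\<^sub>F h in at_right 0. dist (P (S h x')) (P x') < e"
      using tendstoD[OF S_cont[OF x'Y(1)] d(1)] eventually_at_right_less[of 0]
      by eventually_elim (use d(2) S_in x'Y in auto)
    qed
    thus ?thesis by (rule tendstoI)
   qed
   have "(r \<longlongrightarrow> exp (\<sigma> * s) * (\<bar>C\<bar> * (norm (f' - f') + norm (f' - f')) + \<bar>\<sigma> - \<sigma>\<bar> * \<bar>P x'\<bar>)) (at_right 0)"
    unfolding r_def[abs_def] by (intro tendsto_intros lim S_cont x'Y l1 l2)
   hence r0: "(r \<longlongrightarrow> 0) (at_right 0)" by simp
   have "\<forall>\<^sub>F h in at_right 0. \<phi> (s + h) \<le> \<phi> s + h * r h"
    using eventually_at_right_less[of 0]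
   proof eventually_elim
    case (elim h)
    have Sx: "S (s + h) x = S h x'" using S_plus[of h s x] elim s xY by (simp add: x'_f'_def add.commute)
    have hY: "S h x' \<in> Y" "S h f' \<in> Y" using elim x'Y by (auto intro: S_in)
    have "(S h x', S h f') \<in> gen" using gen_invariant[OF x'g] elim by simp
    \<comment> \<open>A backward Euler step: the new point minus h times its generator value is x'
      up to o(h), so the resolvent bound at the new point controls P there by P x'.\<close>
    from diss[OF this elim] have "(1 + h * \<sigma>) * P (S h x') \<le> P (S h x' - h *\<^sub>R S h f')" .
    also have "\<dots> \<le> P x' + C * norm (S h x' - h *\<^sub>R S h f' - x')"
     using PL[of "S h x' - h *\<^sub>R S h f'" x'] hY x'Y subspace_diff[OF Y(1)] subspace_scale[OF Y(1)] by fastforce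
    also have "C * norm (S h x' - h *\<^sub>R S h f' - x') \<le> \<bar>C\<bar> * (h * (norm ((1 / h) *\<^sub>R (S h x' - x') - f') + norm (S h f' - f')))"
    proof -
     have "S h x' - h *\<^sub>R S h f' - x' = h *\<^sub>R (((1 / h) *\<^sub>R (S h x' - x') - f') - (S h f' - f'))"
      using elim by (simp add: algebra_simps)
     hence "norm (S h x' - h *\<^sub>R S h f' - x') = h * norm (((1 / h) *\<^sub>R (S h x' - x') - f') - (S h f' - f'))"
      using elim by (simp only: norm_scaleR abs_of_pos)
     also have "\<dots> \<le> h * (norm ((1 / h) *\<^sub>R (S h x' - x') - f') + norm (S h f' - f'))"
      using elim by (intro mult_left_mono norm_triangle_ineq4) simp
     finally have "norm (S h x' - h *\<^sub>R S h f' - x') \<le> h * (norm ((1 / h) *\<^sub>R (S h x' - x') - f') + norm (S h f' - f'))" .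
     hence "\<bar>C\<bar> * norm (S h x' - h *\<^sub>R S h f' - x') \<le> \<bar>C\<bar> * (h * (norm ((1 / h) *\<^sub>R (S h x' - x') - f') + norm (S h f' - f')))"
      by (rule mult_left_mono) simp
     moreover have "C * norm (S h x' - h *\<^sub>R S h f' - x') \<le> \<bar>C\<bar> * norm (S h x' - h *\<^sub>R S h f' - x')"
      by (intro mult_right_mono) auto
     ultimately show ?thesis by linarith
    qed
    finally have 1: "(1 + h * \<sigma>) * P (S h x') \<le> P x' + \<bar>C\<bar> * (h * (norm ((1 / h) *\<^sub>R (S h x' - x') - f') + norm (S h f' - f')))"
     by simp
    have "exp (\<sigma> * h) - 1 - h * \<sigma> = h * ((exp (\<sigma> * h) - 1) / h - \<sigma>)" using elim by (simp add: field_simps)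
    hence e: "exp (\<sigma> * h) = 1 + h * \<sigma> + h * ((exp (\<sigma> * h) - 1) / h - \<sigma>)" by linarith
    have "exp (\<sigma> * h) * P (S h x') = (1 + h * \<sigma>) * P (S h x') + h * (((exp (\<sigma> * h) - 1) / h - \<sigma>) * P (S h x'))"
     by (subst e) (simp only: distrib_right mult.assoc)
    also have "h * (((exp (\<sigma> * h) - 1) / h - \<sigma>) * P (S h x')) \<le> h * (\<bar>(exp (\<sigma> * h) - 1) / h - \<sigma>\<bar> * \<bar>P (S h x')\<bar>)"
     using elim by (intro mult_left_mono) (auto simp flip: abs_mult)
    finally have "exp (\<sigma> * h) * P (S h x') \<le> P x' + h * (\<bar>C\<bar> * (norm ((1 / h) *\<^sub>R (S h x' - x') - f') + norm (S h f' - f')) + \<bar>(exp (\<sigma> * h) - 1) / h - \<sigma>\<bar> * \<bar>P (S h x')\<bar>)"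
     using 1 by (simp add: distrib_left mult.left_commute)
    hence "exp (\<sigma> * s) * (exp (\<sigma> * h) * P (S h x')) \<le> exp (\<sigma> * s) * (P x' + h * (\<bar>C\<bar> * (norm ((1 / h) *\<^sub>R (S h x' - x') - f') + norm (S h f' - f')) + \<bar>(exp (\<sigma> * h) - 1) / h - \<sigma>\<bar> * \<bar>P (S h x')\<bar>))"
     by (rule mult_left_mono) simp
    moreover have "\<phi> (s + h) = exp (\<sigma> * s) * (exp (\<sigma> * h) * P (S h x'))"
     by (simp add: \<phi>_def Sx distrib_left exp_add)
    moreover have "\<phi> s = exp (\<sigma> * s) * P x'" by (simp add: \<phi>_def x'_f'_def)
    moreover have "h * r h = exp (\<sigma> * s) * (h * (\<bar>C\<bar> * (norm ((1 / h) *\<^sub>R (S h x' - x') - f') + norm (S h f' - f')) + \<bar>(exp (\<sigma> * h) - 1) / h - \<sigma>\<bar> * \<bar>P (S h x')\<bar>))"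
     unfolding r_def by (rule mult.left_commute)
    ultimately show ?case by (simp only: distrib_left)
   qed
   with r0 show "\<exists>r. (r \<longlongrightarrow> 0) (at_right 0) \<and> (\<forall>\<^sub>F h in at_right 0. \<phi> (s + h) \<le> \<phi> s + h * r h)" by blast
  qed
  hence "exp (\<sigma> * t) * P (S t x) \<le> P x" by (simp add: \<phi>_def S_0[OF xY])
  hence "exp (- \<sigma> * t) * (exp (\<sigma> * t) * P (S t x)) \<le> exp (- \<sigma> * t) * P x" by (rule mult_left_mono) simp
  thus ?thesis by (simp add: mult.assoc[symmetric] flip: exp_add)
 qed
 obtain M where M: "M \<ge> 1" "\<And>y. y \<in> Y ==> norm (S t y) \<le> M * norm y" using S_loc_bdd[of t] t by auto
 \<comment> \<open>A general y is approximated from the domain of the generator; P is Lipschitz and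
   S t is bounded on \<open>Y\<close>, so the estimate survives.\<close>
 show ?thesis
 proof (rule field_le_epsilon)
  fix e :: real assume e: "e > 0"
  define D where "D = \<bar>C\<bar> * M + exp (- \<sigma> * t) * \<bar>C\<bar> + 1"
  have D: "D > 0" using M by (simp add: D_def add_nonneg_pos)
  obtain x g where x: "(x, g) \<in> gen" "norm (x - y) < e / D" using gen_dense[OF y, of "e / D"] e D by auto
  have xY: "x \<in> Y" using x by (simp add: gen_def)
  have CC: "P a \<le> P b + \<bar>C\<bar> * norm (a - b)" if "a \<in> Y" "b \<in> Y" for a b
  proof -
   have "C * norm (a - b) \<le> \<bar>C\<bar> * norm (a - b)" by (intro mult_right_mono) auto
   thus ?thesis using PL[OF that] by linarith
  qed
  have "P (S t y) \<le> P (S t x) + \<bar>C\<bar> * norm (S t y - S t x)" using t y xY by (intro CC S_in)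
  also have "norm (S t y - S t x) \<le> M * norm (x - y)"
   using M(2)[of "y - x"] t y xY by (simp add: S_diff subspace_diff[OF Y(1)] norm_minus_commute)
  also have "P (S t x) \<le> exp (- \<sigma> * t) * P x" by (rule main[OF x(1)])
  also have "P x \<le> P y + \<bar>C\<bar> * norm (x - y)" by (rule CC[OF xY y])
  finally have "P (S t y) \<le> exp (- \<sigma> * t) * (P y + \<bar>C\<bar> * norm (x - y)) + \<bar>C\<bar> * (M * norm (x - y))"
   by (simp add: mult_left_mono)
  also have "\<dots> \<le> exp (- \<sigma> * t) * P y + D * norm (x - y)" by (simp add: D_def algebra_simps)
  also have "D * norm (x - y) \<le> e" using x(2) D by (simp add: field_simps)
  finally show "P (S t y) \<le> exp (- \<sigma> * t) * P y + e" by simp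
 qed
qed

end

section \<open>Small solutions of an abstract Duhamel equation\<close>

text \<open>\<open>p1\<close> and \<open>p2\<close> stand for the two components in the plain norm,
  \<open>q1\<close> and \<open>q2\<close> for the weighted ones, and K for 1/\<kappa>. Only for
  \<open>p1\<close> is no decay assumed. The linear rate is 2\<nu> while solutions are sought at
  rate \<nu>; the difference absorbs the convolution in time. Each bound on \<open>G\<close> is a
  sum of products of a \<open>p1\<close> norm with a quantity that decays, and is available only
  where \<open>p1\<close> is at most r0.\<close>

locale decaying_system = semigroup_on Y S
 for Y :: "'b::banach set" and S :: "real => 'b => 'b" +
 fixes p1 p2 q1 q2 :: "'b => 'c::banach" and K \<nu> L r0 :: real and G :: "'b => 'b"
 assumes blin: "bounded_linear p1" "bounded_linear p2" "bounded_linear q1" "bounded_linear q2"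
  and le_norm: "\<And>y. norm (p1 y) \<le> norm y" "\<And>y. norm (p2 y) \<le> norm y" "\<And>y. norm (q1 y) \<le> norm y" "\<And>y. norm (q2 y) \<le> norm y"
  and norm_le: "\<And>y. norm y \<le> norm (p1 y) + norm (p2 y) + norm (q1 y) + norm (q2 y)"
  and pos: "K > 0" "\<nu> > 0" "L \<ge> 0" "r0 > 0"
  and S_p2: "\<And>t y. t \<ge> 0 ==> y \<in> Y ==> norm (p2 (S t y)) \<le> exp (- (2 * \<nu>) * t) * norm (p2 y)"
  and S_p1: "\<And>t y. t \<ge> 0 ==> y \<in> Y ==> norm (p1 (S t y)) \<le> norm (p1 y) + K * norm (p2 y)"
  and S_q: "\<And>t y. t \<ge> 0 ==> y \<in> Y ==>
    norm (q1 (S t y)) + K * norm (q2 (S t y)) \<le> exp (- (2 * \<nu>) * t) * (norm (q1 y) + K * norm (q2 y))"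
  and G_in: "\<And>v. v \<in> Y ==> norm (p1 v) \<le> r0 ==> G v \<in> Y"
  and G_0: "G 0 = 0"
  and G_p1: "\<And>v w. v \<in> Y ==> w \<in> Y ==> norm (p1 v) \<le> r0 ==> norm (p1 w) \<le> r0 ==>
    norm (p1 (G v - G w)) \<le> L * (norm (p1 (v - w)) * norm (p2 v) + norm (p1 w) * norm (p2 (v - w)))"
  and G_p2: "\<And>v w. v \<in> Y ==> w \<in> Y ==> norm (p1 v) \<le> r0 ==> norm (p1 w) \<le> r0 ==>
    norm (p2 (G v - G w)) \<le> L * (norm (p1 (v - w)) * norm (p2 v) + norm (p1 w) * norm (p2 (v - w)))"
  and G_q: "\<And>v w. v \<in> Y ==> w \<in> Y ==> norm (p1 v) \<le> r0 ==> norm (p1 w) \<le> r0 ==>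
    norm (q1 (G v - G w)) + K * norm (q2 (G v - G w)) \<le>
    L * (norm (p1 (v - w)) * (norm (q1 v) + K * norm (q2 v)) + norm (p1 w) * (norm (q1 (v - w)) + K * norm (q2 (v - w))))"
begin

abbreviation decay_factor ("\<E>") where "\<E> t \<equiv> exp (- \<nu> * t)"

definition Q :: "'b => real" where "Q y = norm (q1 y) + K * norm (q2 y)"

definition duhamel :: "(real => 'b) => real => 'b" where
 "duhamel F t = integral {0..t} (\<lambda>s. S (t - s) (F s))"

definition decays :: "real => (real => 'b) => bool" where
 "decays m v \<longleftrightarrow> (\<forall>t\<ge>0. norm (p1 (v t)) \<le> m \<and> norm (p2 (v t)) \<le> m * \<E> t \<and> Q (v t) \<le> m * \<E> t)"

definition curve :: "(real => 'b) => bool" where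
 "curve v \<longleftrightarrow> continuous_on {0..} v \<and> (\<forall>t\<ge>0. v t \<in> Y)"

lemma lin_diff: "p1 (x - y) = p1 x - p1 y" "p2 (x - y) = p2 x - p2 y" "q1 (x - y) = q1 x - q1 y" "q2 (x - y) = q2 x - q2 y"
 using blin by (auto simp: linear_diff bounded_linear.linear)

lemma lin_add: "p1 (x + y) = p1 x + p1 y" "p2 (x + y) = p2 x + p2 y" "q1 (x + y) = q1 x + q1 y" "q2 (x + y) = q2 x + q2 y"
 using blin by (auto simp: linear_add bounded_linear.linear)

lemma lin_0: "p1 0 = 0" "p2 0 = 0" "q1 0 = 0" "q2 0 = 0"
 using blin by (auto simp: linear_0 bounded_linear.linear)

lemma Q_nonneg: "Q y \<ge> 0" using pos by (simp add: Q_def)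

lemma Q_add: "Q (x + y) \<le> Q x + Q y"
proof -
 have "K * norm (q2 x + q2 y) \<le> K * (norm (q2 x) + norm (q2 y))"
  using pos by (intro mult_left_mono norm_triangle_ineq) auto
 thus ?thesis unfolding Q_def lin_add using norm_triangle_ineq[of "q1 x" "q1 y"] by (simp add: distrib_left)
qed

lemma norm_le_Q: "norm y \<le> norm (p1 y) + norm (p2 y) + (1 + 1 / K) * Q y"
proof -
 have "norm (q1 y) \<le> Q y" using pos by (simp add: Q_def)
 moreover have "norm (q2 y) \<le> (1 / K) * Q y" using pos by (simp add: Q_def field_simps)
 ultimately show ?thesis using norm_le[of y] by (simp add: distrib_right)
qed

lemma duhamel_continuous_arg:
 assumes "curve F" "t \<ge> 0" shows "continuous_on {0..t} (\<lambda>s. S (t - s) (F s))"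
 using assms unfolding curve_def
 by (intro S_continuous_comp continuous_intros) (auto intro: continuous_on_subset)

lemma duhamel_integrable: "curve F ==> t \<ge> 0 ==> (\<lambda>s. S (t - s) (F s)) integrable_on {0..t}"
 by (intro integrable_continuous_real duhamel_continuous_arg)

lemma duhamel_curve: assumes F: "curve F" shows "curve (duhamel F)"
 unfolding curve_def
proof (intro conjI allI impI)
 show "duhamel F t \<in> Y" if "t \<ge> 0" for t
  unfolding duhamel_def using that F
  by (intro integral_in_closed_subspace Y duhamel_integrable S_in) (auto simp: curve_def)
 \<comment> \<open>Rescaling to [0,1] moves t from the range of integration into the integrand, so
   that continuity of a parameter integral applies.\<close>
 have eq: "duhamel F t = t *\<^sub>R integral {0..1} (\<lambda>s. S (t * (1 - s)) (F (t * s)))" if t: "t \<ge> 0" for t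
 proof (cases "t = 0")
  case True
  thus ?thesis by (simp add: duhamel_def)
 next
  case False
  hence tp: "t > 0" using t by simp
  have "((\<lambda>s. S (t - s) (F s)) has_integral duhamel F t) (cbox 0 t)"
   unfolding duhamel_def using integrable_integral[OF duhamel_integrable[OF F t]] by simp
  from has_integral_affinity[OF this, of t 0] tp
  have "((\<lambda>s. S (t - t * s) (F (t * s))) has_integral (1 / t) *\<^sub>R duhamel F t) ((\<lambda>x. x / t) ` {0..t})"
   by (simp add: divide_inverse mult.commute)
  also have "(\<lambda>x. x / t) ` {0..t} = {0..1}"
  proof (intro set_eqI iffI)
   show "x \<in> {0..1}" if "x \<in> (\<lambda>x. x / t) ` {0..t}" for x using that tp by auto
   show "x \<in> (\<lambda>x. x / t) ` {0..t}" if "x \<in> {0..1}" for x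
    using that tp by (intro image_eqI[of _ _ "t * x"]) (auto simp: mult_left_le)
  qed
  finally have "integral {0..1} (\<lambda>s. S (t - t * s) (F (t * s))) = (1 / t) *\<^sub>R duhamel F t" by (rule integral_unique)
  thus ?thesis using tp by (simp add: right_diff_distrib)
 qed
 have Fc: "continuous_on ({0..} \<times> cbox 0 (1::real)) (\<lambda>p. F (fst p * snd p))"
 proof (rule continuous_on_compose2[of "{0..}" F])
  show "continuous_on {0..} F" using F by (simp add: curve_def)
  show "continuous_on ({0..} \<times> cbox 0 (1::real)) (\<lambda>p. fst p * snd p)" by (intro continuous_intros)
 qed auto
 have "continuous_on ({0..} \<times> cbox 0 (1::real)) (\<lambda>p. S (fst p * (1 - snd p)) (F (fst p * snd p)))"
 proof (rule S_continuous_comp[OF _ Fc])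
  show "continuous_on ({0..} \<times> cbox 0 (1::real)) (\<lambda>p. fst p * (1 - snd p))" by (intro continuous_intros)
 qed (use F in \<open>auto simp: curve_def\<close>)
 hence "continuous_on ({0..} \<times> cbox 0 (1::real)) (\<lambda>(t, s). S (t * (1 - s)) (F (t * s)))"
  by (simp add: split_beta)
 hence "continuous_on {0..} (\<lambda>t. integral (cbox 0 1) (\<lambda>s. S (t * (1 - s)) (F (t * s))))"
  by (rule integral_continuous_on_param)
 hence "continuous_on {0..} (\<lambda>t. t *\<^sub>R integral (cbox 0 1) (\<lambda>s. S (t * (1 - s)) (F (t * s))))"
  by (intro continuous_on_scaleR continuous_on_id)
 thus "continuous_on {0..} (duhamel F)"
  by (rule continuous_on_eq) (auto simp: eq)
qed

lemma integral_linear_bound: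
 fixes t :: real and f :: "real => 'b"
 assumes f: "continuous_on {0..t} f" and p: "bounded_linear (p :: 'b => 'c)"
 shows "norm (p (integral {0..t} f)) \<le> integral {0..t} (\<lambda>s. norm (p (f s)))" "(\<lambda>s. norm (p (f s))) integrable_on {0..t}"
proof -
 have fi: "f integrable_on {0..t}" using f by (rule integrable_continuous_real)
 have pc: "continuous_on {0..t} (\<lambda>s. p (f s))" by (rule bounded_linear.continuous_on[OF p f])
 hence nc: "continuous_on {0..t} (\<lambda>s. norm (p (f s)))" by (rule continuous_on_norm)
 show i: "(\<lambda>s. norm (p (f s))) integrable_on {0..t}" by (rule integrable_continuous_real[OF nc])
 have "p (integral {0..t} f) = integral {0..t} (\<lambda>s. p (f s))"
  using integral_linear[OF fi p] by (simp add: o_def)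
 moreover have "norm (integral {0..t} (\<lambda>s. p (f s))) \<le> integral {0..t} (\<lambda>s. norm (p (f s)))"
  by (rule integral_norm_bound_integral[OF integrable_continuous_real[OF pc] i order_refl])
 ultimately show "norm (p (integral {0..t} f)) \<le> integral {0..t} (\<lambda>s. norm (p (f s)))" by simp
qed

lemma exp_integral: "t \<ge> 0 ==> ((\<lambda>s. \<E> s) has_integral (1 - \<E> t) / \<nu>) {0..t}"
proof -
 assume t: "t \<ge> 0"
 have "((\<lambda>s. \<E> s) has_integral ((- \<E> t / \<nu>) - (- \<E> 0 / \<nu>))) {0..t}"
  by (rule fundamental_theorem_of_calculus[OF t])
   (use pos in \<open>auto intro!: derivative_eq_intros simp flip: has_real_derivative_iff_has_vector_derivative\<close>)
 thus ?thesis by (simp add: diff_divide_distrib)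
qed

text \<open>Rate 2\<nu> against rate \<nu>: the convolution decays like exp(-\<nu>t) without the
  factor t that equal rates would produce.\<close>

lemma exp_conv_integral:
 assumes t: "t \<ge> 0"
 shows "((\<lambda>s. exp (- (2 * \<nu>) * (t - s)) * \<E> s) has_integral \<E> t * (1 - \<E> t) / \<nu>) {0..t}"
proof -
 have "((\<lambda>s. exp (- (2 * \<nu>) * t) * exp (\<nu> * s)) has_integral (exp (- (2 * \<nu>) * t) * exp (\<nu> * t) / \<nu> - exp (- (2 * \<nu>) * t) * exp (\<nu> * 0) / \<nu>)) {0..t}"
  by (rule fundamental_theorem_of_calculus[OF t])
   (use pos in \<open>auto intro!: derivative_eq_intros simp flip: has_real_derivative_iff_has_vector_derivative\<close>)
 moreover have "exp (- (2 * \<nu>) * t) * exp (\<nu> * s) = exp (- (2 * \<nu>) * (t - s)) * \<E> s" for s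
  by (simp add: algebra_simps flip: exp_add)
 moreover have "exp (- (2 * \<nu>) * t) * exp (\<nu> * t) / \<nu> - exp (- (2 * \<nu>) * t) * exp (\<nu> * 0) / \<nu> = \<E> t * (1 - \<E> t) / \<nu>"
 proof -
  have "exp (- (2 * \<nu>) * t) = \<E> t * \<E> t" by (simp flip: exp_add)
  moreover have "\<E> t * exp (\<nu> * t) = 1" by (simp flip: exp_add)
  ultimately show ?thesis by (simp add: algebra_simps diff_divide_distrib)
 qed
 ultimately show ?thesis by simp
qed

lemma duhamel_Q:
 assumes F: "curve F" and m: "m \<ge> 0" and b: "\<And>s. s \<ge> 0 ==> Q (F s) \<le> m * \<E> s" and t: "t \<ge> 0"
 shows "Q (duhamel F t) \<le> (m / \<nu>) * \<E> t"
proof -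
 let ?f = "\<lambda>s. S (t - s) (F s)"
 have fc: "continuous_on {0..t} ?f" by (rule duhamel_continuous_arg[OF F t])
 note i1 = integral_linear_bound[OF fc blin(3)] and i2 = integral_linear_bound[OF fc blin(4)]
 have i3: "(\<lambda>s. K * norm (q2 (?f s))) integrable_on {0..t}"
  using integrable_on_cmult_left[OF i2(2), of K] by simp
 have "Q (duhamel F t) \<le> integral {0..t} (\<lambda>s. norm (q1 (?f s))) + K * integral {0..t} (\<lambda>s. norm (q2 (?f s)))"
  unfolding Q_def duhamel_def using i1(1) i2(1) pos by (intro add_mono mult_left_mono) auto
 also have "\<dots> = integral {0..t} (\<lambda>s. norm (q1 (?f s)) + K * norm (q2 (?f s)))"
  using Henstock_Kurzweil_Integration.integral_add[OF i1(2) i3] by simp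
 also have "\<dots> \<le> integral {0..t} (\<lambda>s. m * (exp (- (2 * \<nu>) * (t - s)) * \<E> s))"
 proof (rule integral_le)
  show "(\<lambda>s. norm (q1 (?f s)) + K * norm (q2 (?f s))) integrable_on {0..t}"
   by (rule integrable_add[OF i1(2) i3])
  show "(\<lambda>s. m * (exp (- (2 * \<nu>) * (t - s)) * \<E> s)) integrable_on {0..t}"
   by (intro integrable_continuous_real continuous_intros)
  fix s assume s: "s \<in> {0..t}"
  have "norm (q1 (?f s)) + K * norm (q2 (?f s)) \<le> exp (- (2 * \<nu>) * (t - s)) * Q (F s)"
   unfolding Q_def using F s by (intro S_q) (auto simp: curve_def)
  also have "\<dots> \<le> exp (- (2 * \<nu>) * (t - s)) * (m * \<E> s)" using b s by (intro mult_left_mono) auto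
  finally show "norm (q1 (?f s)) + K * norm (q2 (?f s)) \<le> m * (exp (- (2 * \<nu>) * (t - s)) * \<E> s)"
   by (simp add: mult_ac)
 qed
 also have "\<dots> = m * (\<E> t * (1 - \<E> t) / \<nu>)"
  by (rule integral_unique[OF has_integral_mult_right[OF exp_conv_integral[OF t]]])
 also have "\<dots> \<le> m * (\<E> t * 1 / \<nu>)"
  using pos m by (intro mult_left_mono divide_right_mono) auto
 finally show ?thesis by (simp add: mult_ac)
qed

text \<open>\<open>p2\<close> and \<open>Q\<close> use the damping of the semigroup.
  \<open>p1\<close> relies instead on the forcing being integrable in time; the coupling in
  \<open>S_p1\<close> accounts for the factor 1 + K.\<close>

lemma duhamel_decays:
 assumes F: "curve F" and m: "m \<ge> 0"
  and b: "\<And>s. s \<ge> 0 ==> norm (p1 (F s)) \<le> m * \<E> s" "\<And>s. s \<ge> 0 ==> norm (p2 (F s)) \<le> m * \<E> s"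
   "\<And>s. s \<ge> 0 ==> Q (F s) \<le> m * \<E> s"
 shows "decays ((1 + K) / \<nu> * m) (duhamel F)"
 unfolding decays_def
proof (intro allI impI)
 fix t :: real assume t: "t \<ge> 0"
 let ?f = "\<lambda>s. S (t - s) (F s)"
 have fc: "continuous_on {0..t} ?f" by (rule duhamel_continuous_arg[OF F t])
 have FY: "F s \<in> Y" if "s \<ge> 0" for s using F that by (simp add: curve_def)
 note i1 = integral_linear_bound[OF fc blin(1)] and i2 = integral_linear_bound[OF fc blin(2)]
 have c: "m / \<nu> \<le> (1 + K) / \<nu> * m" using pos m by (simp add: field_simps)
 have "norm (p1 (duhamel F t)) \<le> integral {0..t} (\<lambda>s. norm (p1 (?f s)))" unfolding duhamel_def by (rule i1(1))
 also have "\<dots> \<le> integral {0..t} (\<lambda>s. ((1 + K) * m) * \<E> s)"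
 proof (rule integral_le)
  show "(\<lambda>s. ((1 + K) * m) * \<E> s) integrable_on {0..t}" by (intro integrable_continuous_real continuous_intros)
  fix s assume s: "s \<in> {0..t}"
  have "norm (p1 (?f s)) \<le> norm (p1 (F s)) + K * norm (p2 (F s))" using s FY by (intro S_p1) auto
  also have "\<dots> \<le> m * \<E> s + K * (m * \<E> s)" using b s pos by (intro add_mono mult_left_mono) auto
  finally show "norm (p1 (?f s)) \<le> ((1 + K) * m) * \<E> s" by (simp add: algebra_simps)
 qed (rule i1(2))
 also have "\<dots> = ((1 + K) * m) * ((1 - \<E> t) / \<nu>)"
  by (rule integral_unique[OF has_integral_mult_right[OF exp_integral[OF t]]])
 also have "\<dots> \<le> ((1 + K) * m) * (1 / \<nu>)" using pos m by (intro mult_left_mono divide_right_mono) auto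
 finally have 1: "norm (p1 (duhamel F t)) \<le> (1 + K) / \<nu> * m" by simp
 have "norm (p2 (duhamel F t)) \<le> integral {0..t} (\<lambda>s. norm (p2 (?f s)))" unfolding duhamel_def by (rule i2(1))
 also have "\<dots> \<le> integral {0..t} (\<lambda>s. m * (exp (- (2 * \<nu>) * (t - s)) * \<E> s))"
 proof (rule integral_le)
  show "(\<lambda>s. m * (exp (- (2 * \<nu>) * (t - s)) * \<E> s)) integrable_on {0..t}"
   by (intro integrable_continuous_real continuous_intros)
  fix s assume s: "s \<in> {0..t}"
  have "norm (p2 (?f s)) \<le> exp (- (2 * \<nu>) * (t - s)) * norm (p2 (F s))" using s FY by (intro S_p2) auto
  also have "\<dots> \<le> exp (- (2 * \<nu>) * (t - s)) * (m * \<E> s)" using b s by (intro mult_left_mono) auto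
  finally show "norm (p2 (?f s)) \<le> m * (exp (- (2 * \<nu>) * (t - s)) * \<E> s)" by (simp add: mult_ac)
 qed (rule i2(2))
 also have "\<dots> = m * (\<E> t * (1 - \<E> t) / \<nu>)"
  by (rule integral_unique[OF has_integral_mult_right[OF exp_conv_integral[OF t]]])
 also have "\<dots> \<le> m * (\<E> t * 1 / \<nu>)"
  using pos m by (intro mult_left_mono divide_right_mono) auto
 finally have "norm (p2 (duhamel F t)) \<le> (m / \<nu>) * \<E> t" by (simp add: mult_ac)
 moreover have "(m / \<nu>) * \<E> t \<le> ((1 + K) / \<nu> * m) * \<E> t" using c by (intro mult_right_mono) auto
 ultimately show "norm (p1 (duhamel F t)) \<le> (1 + K) / \<nu> * m \<and>
   norm (p2 (duhamel F t)) \<le> (1 + K) / \<nu> * m * \<E> t \<and> Q (duhamel F t) \<le> (1 + K) / \<nu> * m * \<E> t"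
  using 1 duhamel_Q[OF F m b(3) t] by linarith
qed

lemma decays_add: assumes "decays a v" "decays b w" shows "decays (a + b) (\<lambda>t. v t + w t)"
 unfolding decays_def
proof (intro allI impI)
 fix t :: real assume t: "t \<ge> 0"
 note 1 = assms(1)[unfolded decays_def, rule_format, OF t] and 2 = assms(2)[unfolded decays_def, rule_format, OF t]
 show "norm (p1 (v t + w t)) \<le> a + b \<and> norm (p2 (v t + w t)) \<le> (a + b) * \<E> t \<and> Q (v t + w t) \<le> (a + b) * \<E> t"
  using 1 2 norm_triangle_ineq[of "p1 (v t)" "p1 (w t)"] norm_triangle_ineq[of "p2 (v t)" "p2 (w t)"] Q_add[of "v t" "w t"]
  unfolding lin_add distrib_right by linarith
qed

lemma decays_mono: "decays a v ==> a \<le> b ==> decays b v"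
 unfolding decays_def by (meson exp_ge_zero mult_right_mono order_trans)

lemma decays_limit:
 assumes "\<And>n. decays (m n) (v n)" "m \<longlonglongrightarrow> M" "\<And>t. t \<ge> 0 ==> (\<lambda>n. v n t) \<longlonglongrightarrow> w t"
 shows "decays M w"
 unfolding decays_def
proof (intro allI impI)
 fix t :: real assume t: "t \<ge> 0"
 note b = assms(1)[unfolded decays_def, rule_format, OF t]
 have l: "(\<lambda>n. p (v n t)) \<longlonglongrightarrow> p (w t)" if "bounded_linear (p :: 'b => 'c)" for p
  by (rule bounded_linear.tendsto[OF that assms(3)[OF t]])
 have "norm (p1 (w t)) \<le> M"
  by (rule LIMSEQ_le[OF tendsto_norm[OF l[OF blin(1)]] assms(2)]) (use b in auto)
 moreover have "norm (p2 (w t)) \<le> M * \<E> t"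
  by (rule LIMSEQ_le[OF tendsto_norm[OF l[OF blin(2)]] tendsto_mult_right[OF assms(2)]]) (use b in auto)
 moreover have "Q (w t) \<le> M * \<E> t"
  unfolding Q_def
  by (rule LIMSEQ_le[OF tendsto_add[OF tendsto_norm[OF l[OF blin(3)]] tendsto_mult_left[OF tendsto_norm[OF l[OF blin(4)]]]] tendsto_mult_right[OF assms(2)]])
   (use b in \<open>auto simp: Q_def\<close>)
 ultimately show "norm (p1 (w t)) \<le> M \<and> norm (p2 (w t)) \<le> M * \<E> t \<and> Q (w t) \<le> M * \<E> t" by blast
qed

lemma decays_norm:
 assumes "decays m v" "m \<ge> 0" "t \<ge> 0" shows "norm (v t) \<le> (3 + 1 / K) * m"
proof -
 note b = assms(1)[unfolded decays_def, rule_format, OF assms(3)]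
 have e: "m * \<E> t \<le> m" using assms pos by (simp add: mult_left_le)
 have "(1 + 1 / K) * Q (v t) \<le> (1 + 1 / K) * m" using b e pos by (intro mult_left_mono) auto
 thus ?thesis using norm_le_Q[of "v t"] b e by (simp add: algebra_simps)
qed

lemma S_decays:
 assumes y: "y \<in> Y" and e: "norm (p1 y) \<le> e" "norm (p2 y) \<le> e" "norm (q1 y) \<le> e" "norm (q2 y) \<le> e"
 shows "decays ((1 + K) * e) (\<lambda>t. S t y)"
 unfolding decays_def
proof (intro allI impI)
 fix t :: real assume t: "t \<ge> 0"
 have e0: "e \<ge> 0" using e(1) norm_ge_zero order_trans by blast
 have Ke: "K * norm (p2 y) \<le> K * e" "K * norm (q2 y) \<le> K * e" using e pos by (auto intro: mult_left_mono)
 have ex: "exp (- (2 * \<nu>) * t) \<le> \<E> t" using pos t by simp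
 have "norm (p2 (S t y)) \<le> \<E> t * ((1 + K) * e)"
 proof (rule order_trans[OF S_p2[OF t y]], rule mult_mono[OF ex])
  show "norm (p2 y) \<le> (1 + K) * e" using e(2) e0 pos by (simp add: distrib_right add_increasing2)
 qed auto
 moreover have "Q (S t y) \<le> \<E> t * ((1 + K) * e)"
  unfolding Q_def
 proof (rule order_trans[OF S_q[OF t y]], rule mult_mono[OF ex])
  show "norm (q1 y) + K * norm (q2 y) \<le> (1 + K) * e" using e Ke by (simp add: distrib_right)
  show "0 \<le> norm (q1 y) + K * norm (q2 y)" using pos by simp
 qed auto
 moreover have "norm (p1 (S t y)) \<le> (1 + K) * e"
  using S_p1[OF t y] e Ke by (simp add: distrib_right)
 ultimately show "norm (p1 (S t y)) \<le> (1 + K) * e \<and> norm (p2 (S t y)) \<le> (1 + K) * e * \<E> t \<and> Q (S t y) \<le> (1 + K) * e * \<E> t"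
  by (simp add: mult.commute)
qed

lemma S_curve: "y \<in> Y ==> curve (\<lambda>t. S t y)"
 by (simp add: curve_def S_continuous S_in)

lemma curve_add: "curve v ==> curve w ==> curve (\<lambda>t. v t + w t)"
 unfolding curve_def by (auto intro!: continuous_intros subspace_add Y)

lemma curve_diff: "curve v ==> curve w ==> curve (\<lambda>t. v t - w t)"
 unfolding curve_def by (auto intro!: continuous_intros subspace_diff Y)

text \<open>The component bounds are collected into one for the full norm: 2 comes from
  \<open>p1\<close> and \<open>p2\<close>, 1 + 1/K from recovering the norm out of \<open>Q\<close>,
  and 1 + K from bounding \<open>Q\<close> by the norm. It serves continuity along curves and
  uniqueness, where no decay is available.\<close>

lemma G_lipschitz:
 assumes v: "v \<in> Y" "norm (p1 v) \<le> r0" "norm v \<le> B" and w: "w \<in> Y" "norm (p1 w) \<le> r0"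
 shows "norm (G v - G w) \<le> (2 + (1 + 1 / K) * (1 + K)) * L * (B + r0) * norm (v - w)"
proof -
 have B: "B \<ge> 0" using v(3) norm_ge_zero order_trans by blast
 let ?d = "norm (v - w)"
 have Qle: "Q y \<le> (1 + K) * norm y" for y
 proof -
  have "K * norm (q2 y) \<le> K * norm y" using le_norm(4) pos by (intro mult_left_mono) auto
  thus ?thesis unfolding Q_def using le_norm(3)[of y] by (simp add: distrib_right)
 qed
 have h: "norm (p1 (v - w)) * norm (p2 v) + norm (p1 w) * norm (p2 (v - w)) \<le> (B + r0) * ?d"
 proof -
  have "norm (p1 (v - w)) * norm (p2 v) \<le> ?d * B" using le_norm(2)[of v] v by (intro mult_mono le_norm) auto
  moreover have "norm (p1 w) * norm (p2 (v - w)) \<le> r0 * ?d" using w pos by (intro mult_mono le_norm) auto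
  ultimately show ?thesis by (simp add: algebra_simps)
 qed
 have "L * (norm (p1 (v - w)) * norm (p2 v) + norm (p1 w) * norm (p2 (v - w))) \<le> L * ((B + r0) * ?d)"
  using h pos by (intro mult_left_mono) auto
 hence 1: "norm (p1 (G v - G w)) \<le> L * ((B + r0) * ?d)" "norm (p2 (G v - G w)) \<le> L * ((B + r0) * ?d)"
  using G_p1[OF v(1) w(1) v(2) w(2)] G_p2[OF v(1) w(1) v(2) w(2)] by linarith+
 have "norm (p1 (v - w)) * Q v + norm (p1 w) * Q (v - w) \<le> (1 + K) * ((B + r0) * ?d)"
 proof -
  have "Q v \<le> (1 + K) * B" using Qle[of v] v(3) pos by (meson add_nonneg_nonneg less_imp_le mult_left_mono order_trans zero_le_one)
  hence "norm (p1 (v - w)) * Q v \<le> ?d * ((1 + K) * B)" using Q_nonneg by (intro mult_mono le_norm) auto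
  moreover have "norm (p1 w) * Q (v - w) \<le> r0 * ((1 + K) * ?d)" using w pos Q_nonneg Qle by (intro mult_mono) auto
  ultimately show ?thesis by (simp add: algebra_simps)
 qed
 hence "L * (norm (p1 (v - w)) * Q v + norm (p1 w) * Q (v - w)) \<le> L * ((1 + K) * ((B + r0) * ?d))"
  using pos by (intro mult_left_mono) auto
 hence 2: "Q (G v - G w) \<le> L * ((1 + K) * ((B + r0) * ?d))"
  using G_q[OF v(1) w(1) v(2) w(2)] by (simp add: Q_def)
 have "(1 + 1 / K) * Q (G v - G w) \<le> (1 + 1 / K) * (L * ((1 + K) * ((B + r0) * ?d)))"
  using 2 pos by (intro mult_left_mono) auto
 hence "norm (G v - G w) \<le> L * ((B + r0) * ?d) + L * ((B + r0) * ?d) + (1 + 1 / K) * (L * ((1 + K) * ((B + r0) * ?d)))"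
  using norm_le_Q[of "G v - G w"] 1 by linarith
 also have "\<dots> = (2 + (1 + 1 / K) * (1 + K)) * L * (B + r0) * ?d"
 proof -
  have "L * X + L * X + k * (L * ((1 + K) * X)) = (2 + k * (1 + K)) * L * X" for X k by (simp add: algebra_simps)
  thus ?thesis by (simp only: mult.assoc)
 qed
 finally show ?thesis .
qed

lemma G_curve:
 fixes v :: "real => 'b"
 assumes v: "curve v" and r: "\<And>t::real. t \<ge> 0 ==> norm (p1 (v t)) \<le> r0"
 shows "curve (\<lambda>t. G (v t))"
 unfolding curve_def
proof (intro conjI allI impI)
 show "G (v t) \<in> Y" if "t \<ge> 0" for t using v r that by (intro G_in) (auto simp: curve_def)
 show "continuous_on {0..} (\<lambda>t. G (v t))"
  unfolding continuous_on_iff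
 proof (intro ballI allI impI)
  fix t e :: real assume t: "t \<in> {0..}" and e: "e > 0"
  define D where "D = (2 + (1 + 1 / K) * (1 + K)) * L * (norm (v t) + r0)"
  have D: "D \<ge> 0" using pos by (simp add: D_def)
  have "e / (D + 1) > 0" using e D by simp
  with v t obtain d where d: "d > 0" "\<And>s. s \<ge> 0 ==> dist s t < d ==> dist (v s) (v t) < e / (D + 1)"
   unfolding curve_def continuous_on_iff by (metis atLeast_iff)
  have "dist (G (v s)) (G (v t)) < e" if "s \<ge> 0" "dist s t < d" for s
  proof -
   have "norm (G (v t) - G (v s)) \<le> D * norm (v t - v s)"
    unfolding D_def by (rule G_lipschitz) (use v r t that in \<open>auto simp: curve_def\<close>)
   also have "\<dots> \<le> D * (e / (D + 1))" using d(2)[OF that] D by (intro mult_left_mono) (auto simp: dist_norm norm_minus_commute)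
   also have "\<dots> < e" using e D by (simp add: field_simps)
   finally show ?thesis by (simp add: dist_norm norm_minus_commute)
  qed
  thus "\<exists>d>0. \<forall>s\<in>{0..}. dist s t < d --> dist (G (v s)) (G (v t)) < e" using d(1) by auto
 qed
qed

lemma duhamel_diff:
 assumes "curve F" "curve H" "t \<ge> 0"
 shows "duhamel F t - duhamel H t = duhamel (\<lambda>s. F s - H s) t"
proof -
 have "duhamel F t - duhamel H t = integral {0..t} (\<lambda>s. S (t - s) (F s) - S (t - s) (H s))"
  unfolding duhamel_def using assms by (intro Henstock_Kurzweil_Integration.integral_diff[symmetric] duhamel_integrable)
 also have "\<dots> = duhamel (\<lambda>s. F s - H s) t"
  unfolding duhamel_def using assms by (intro Henstock_Kurzweil_Integration.integral_cong) (auto simp: S_diff curve_def)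
 finally show ?thesis .
qed

definition \<Phi> :: "'b => (real => 'b) => real => 'b" where
 "\<Phi> y v t = S t y + duhamel (\<lambda>s. G (v s)) t"

text \<open>The linear parts cancel. In each product bounding the difference of the nonlinearities
  one factor is governed by m and the other by \<rho>, and one of them carries exp(-\<nu>s). So
  \<open>duhamel_decays\<close> applies with 2L\<rho>m, and \<open>small\<close> turns the result
  into m/2.\<close>

lemma \<Phi>_contraction:
 assumes v: "curve v" "decays \<rho> v" and w: "curve w" "decays \<rho> w" and \<rho>: "\<rho> \<le> r0" "0 \<le> \<rho>"
  and small: "(1 + K) / \<nu> * (2 * L * \<rho>) \<le> 1 / 2" and m: "decays m (\<lambda>t. v t - w t)" "m \<ge> 0"
 shows "decays (m / 2) (\<lambda>t. \<Phi> y v t - \<Phi> y w t)"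
proof -
 have rv: "norm (p1 (v t)) \<le> r0" "norm (p1 (w t)) \<le> r0" if "t \<ge> 0" for t
  using v(2) w(2) that \<rho> unfolding decays_def by (meson order_trans)+
 have Gc: "curve (\<lambda>t. G (v t))" "curve (\<lambda>t. G (w t))" using G_curve v(1) w(1) rv by blast+
 have "decays ((1 + K) / \<nu> * (2 * L * \<rho> * m)) (duhamel (\<lambda>s. G (v s) - G (w s)))"
 proof (rule duhamel_decays[OF curve_diff[OF Gc]])
  show "0 \<le> 2 * L * \<rho> * m" using pos \<rho> m by simp
  fix s :: real assume s: "s \<ge> 0"
  let ?e = "\<E> s"
  have vY: "v s \<in> Y" "w s \<in> Y" using v(1) w(1) s by (auto simp: curve_def)
  note bv = v(2)[unfolded decays_def, rule_format, OF s] and bw = w(2)[unfolded decays_def, rule_format, OF s]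
   and bm = m(1)[unfolded decays_def, rule_format, OF s]
  have "norm (p1 (v s - w s)) * norm (p2 (v s)) \<le> m * (\<rho> * ?e)" using bv bm m(2) by (intro mult_mono) auto
  moreover have "norm (p1 (w s)) * norm (p2 (v s - w s)) \<le> \<rho> * (m * ?e)" using bw bm \<rho> by (intro mult_mono) auto
  ultimately have "norm (p1 (v s - w s)) * norm (p2 (v s)) + norm (p1 (w s)) * norm (p2 (v s - w s)) \<le> 2 * \<rho> * m * ?e" by (simp add: mult_ac)
  from mult_left_mono[OF this pos(3)]
  have a: "L * (norm (p1 (v s - w s)) * norm (p2 (v s)) + norm (p1 (w s)) * norm (p2 (v s - w s))) \<le> 2 * L * \<rho> * m * ?e" by (simp add: mult_ac)
  show "norm (p1 (G (v s) - G (w s))) \<le> 2 * L * \<rho> * m * ?e" using G_p1[OF vY rv(1)[OF s] rv(2)[OF s]] a by linarith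
  show "norm (p2 (G (v s) - G (w s))) \<le> 2 * L * \<rho> * m * ?e" using G_p2[OF vY rv(1)[OF s] rv(2)[OF s]] a by linarith
  have "norm (p1 (v s - w s)) * Q (v s) \<le> m * (\<rho> * ?e)" using bv bm m(2) Q_nonneg by (intro mult_mono) auto
  moreover have "norm (p1 (w s)) * Q (v s - w s) \<le> \<rho> * (m * ?e)" using bw bm \<rho> Q_nonneg by (intro mult_mono) auto
  ultimately have "norm (p1 (v s - w s)) * Q (v s) + norm (p1 (w s)) * Q (v s - w s) \<le> 2 * \<rho> * m * ?e" by (simp add: mult_ac)
  from mult_left_mono[OF this pos(3)]
  have b: "L * (norm (p1 (v s - w s)) * Q (v s) + norm (p1 (w s)) * Q (v s - w s)) \<le> 2 * L * \<rho> * m * ?e" by (simp add: mult_ac)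
  show "Q (G (v s) - G (w s)) \<le> 2 * L * \<rho> * m * ?e"
   using G_q[OF vY rv(1)[OF s] rv(2)[OF s]] b unfolding Q_def by linarith
 qed
 hence d: "decays (m / 2) (duhamel (\<lambda>s. G (v s) - G (w s)))"
 proof (rule decays_mono)
  have "((1 + K) / \<nu> * (2 * L * \<rho>)) * m \<le> 1 / 2 * m" using small m by (intro mult_right_mono) auto
  thus "(1 + K) / \<nu> * (2 * L * \<rho> * m) \<le> m / 2" by (simp add: mult.assoc)
 qed
 have eq: "\<Phi> y v t - \<Phi> y w t = duhamel (\<lambda>s. G (v s) - G (w s)) t" if "t \<ge> 0" for t
  unfolding \<Phi>_def using duhamel_diff[OF Gc that] by simp
 show ?thesis using d eq unfolding decays_def by auto
qed

end

context decaying_system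
begin

lemma \<Phi>_curve:
 assumes "curve v" "y \<in> Y" "\<And>t. t \<ge> 0 ==> norm (p1 (v t)) \<le> r0"
 shows "curve (\<Phi> y v)"
proof -
 have "curve (\<lambda>t. S t y + duhamel (\<lambda>s. G (v s)) t)"
  by (rule curve_add[OF S_curve[OF assms(2)] duhamel_curve[OF G_curve[OF assms(1,3)]]])
 thus ?thesis by (simp add: \<Phi>_def[abs_def])
qed

text \<open>With w = 0 the bound on the weighted part of \<open>G\<close> is linear in
  \<open>Q\<close>, with the small coefficient L\<rho>. Hence a bound by the initial
  \<open>Q y\<close> alone is preserved by the iteration, which yields weighted decay in terms of
  weighted data.\<close>

lemma \<Phi>_Q:
 assumes v: "curve v" "decays \<rho> v" and y: "y \<in> Y" and \<rho>: "\<rho> \<le> r0" "0 \<le> \<rho>"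
  and small: "(1 + K) / \<nu> * (2 * L * \<rho>) \<le> 1 / 2"
  and b: "\<And>s. s \<ge> 0 ==> Q (v s) \<le> 2 * Q y * \<E> s" and t: "t \<ge> 0"
 shows "Q (\<Phi> y v t) \<le> 2 * Q y * \<E> t"
proof -
 have r: "norm (p1 (v t)) \<le> \<rho>" if "t \<ge> 0" for t using v(2) that unfolding decays_def by blast
 have Gc: "curve (\<lambda>t. G (v t))" using G_curve[OF v(1)] r \<rho> by (meson order_trans)
 have "Q (duhamel (\<lambda>s. G (v s)) t) \<le> (2 * L * \<rho> * Q y / \<nu>) * \<E> t"
 proof (rule duhamel_Q[OF Gc _ _ t])
  show "0 \<le> 2 * L * \<rho> * Q y" using pos \<rho> Q_nonneg by simp
  fix s :: real assume s: "s \<ge> 0"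
  have Y0: "0 \<in> Y" using Y by (simp add: subspace_0)
  have vY: "v s \<in> Y" using v(1) s by (simp add: curve_def)
  have "Q (G (v s)) \<le> L * (norm (p1 (v s)) * Q (v s))"
   using G_q[OF vY Y0] r[OF s] \<rho> pos unfolding Q_def by (simp add: lin_0 G_0)
  also have "\<dots> \<le> L * (\<rho> * (2 * Q y * \<E> s))"
   using pos \<rho> r[OF s] b[OF s] Q_nonneg by (intro mult_left_mono mult_mono) auto
  finally show "Q (G (v s)) \<le> 2 * L * \<rho> * Q y * \<E> s" by (simp add: mult_ac)
 qed
 also have "\<dots> \<le> Q y * \<E> t"
 proof (rule mult_right_mono)
  have "2 * L * \<rho> / \<nu> \<le> (1 + K) * (2 * L * \<rho> / \<nu>)" using mult_right_mono[of 1 "1 + K" "2 * L * \<rho> / \<nu>"] pos \<rho> by simp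
  also have "\<dots> \<le> 1" using small by simp
  finally have "(2 * L * \<rho> / \<nu>) * Q y \<le> 1 * Q y" by (rule mult_right_mono[OF _ Q_nonneg])
  thus "2 * L * \<rho> * Q y / \<nu> \<le> Q y" by simp
 qed simp
 finally have "Q (duhamel (\<lambda>s. G (v s)) t) \<le> Q y * \<E> t" .
 moreover have "Q (S t y) \<le> Q y * \<E> t"
 proof -
  have "Q (S t y) \<le> exp (- (2 * \<nu>) * t) * Q y" unfolding Q_def by (rule S_q[OF t y])
  also have "\<dots> \<le> \<E> t * Q y" using pos t Q_nonneg by (intro mult_right_mono) auto
  finally show ?thesis by (simp add: mult.commute)
 qed
 ultimately show ?thesis unfolding \<Phi>_def using Q_add[of "S t y" "duhamel (\<lambda>s. G (v s)) t"] by linarith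
qed

text \<open>Picard iteration from 0. The first increment is the linear evolution, of size m = (1+K)e
  by \<open>S_decays\<close>; later increments halve, so all iterates stay within \<rho> = 2m, the
  ball on which the contraction holds.\<close>

lemma global_solution:
 assumes y: "y \<in> Y" and e: "norm (p1 y) \<le> e" "norm (p2 y) \<le> e" "norm (q1 y) \<le> e" "norm (q2 y) \<le> e"
  and \<rho>: "\<rho> = 2 * (1 + K) * e" "\<rho> \<le> r0" and small: "(1 + K) / \<nu> * (2 * L * \<rho>) \<le> 1 / 2"
 obtains v where "curve v" "decays \<rho> v" "\<And>t. t \<ge> 0 ==> \<Phi> y v t = v t"
  "\<And>t. t \<ge> 0 ==> Q (v t) \<le> 2 * Q y * \<E> t"
proof -
 define V where "V n = (\<Phi> y ^^ n) (\<lambda>t. 0)" for n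
 have V0: "V 0 = (\<lambda>t. 0)" and VS: "V (Suc n) = \<Phi> y (V n)" for n by (simp_all add: V_def)
 have e0: "e \<ge> 0" using e(1) norm_ge_zero order_trans by blast
 define m where "m = (1 + K) * e"
 have m0: "m \<ge> 0" using e0 pos by (simp add: m_def)
 have \<rho>m: "\<rho> = 2 * m" by (simp add: \<rho> m_def)
 have \<rho>0: "\<rho> \<ge> 0" using m0 \<rho>m by simp
 \<comment> \<open>2m(1 - 2^-n) is the sum of the bounds for the first n increments. The bound on
   \<open>Q\<close> is carried along separately, since it refers to the weighted data only.\<close>
 have h: "curve (V n) \<and> decays (2 * m * (1 - 1 / 2 ^ n)) (V n) \<and> decays (m / 2 ^ n) (\<lambda>t. V (Suc n) t - V n t) \<and>
   (\<forall>t\<ge>0. Q (V n t) \<le> 2 * Q y * \<E> t)" for n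
 proof (induction n)
  case 0
  have z: "curve (\<lambda>t. 0)" using Y by (simp add: curve_def subspace_0)
  have "S s 0 = 0" if "s \<ge> 0" for s using S_diff[OF that y y] by simp
  hence "duhamel (\<lambda>s. G 0) t = 0" if "t \<ge> 0" for t
   using that integral_cong[of "{0..t}" "\<lambda>s. S (t - s) 0" "\<lambda>s. 0"] unfolding duhamel_def G_0 by simp
  hence "V (Suc 0) t - V 0 t = S t y" if "t \<ge> 0" for t using that by (simp add: V0 VS \<Phi>_def)
  moreover have "decays m (\<lambda>t. S t y)" unfolding m_def by (rule S_decays[OF y e])
  ultimately have "decays m (\<lambda>t. V (Suc 0) t - V 0 t)" unfolding decays_def by auto
  moreover have "Q 0 = 0" by (simp add: Q_def lin_0)
  ultimately show ?case using z Q_nonneg by (simp add: V0 decays_def lin_0)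
 next
  case (Suc n)
  hence c: "curve (V n)" and d: "decays (2 * m * (1 - 1 / 2 ^ n)) (V n)" and
   dd: "decays (m / 2 ^ n) (\<lambda>t. V (Suc n) t - V n t)" and q: "\<And>t. t \<ge> 0 ==> Q (V n t) \<le> 2 * Q y * \<E> t" by auto
  have le: "2 * m * (1 - 1 / 2 ^ j) \<le> \<rho>" for j :: nat
   using m0 by (simp add: \<rho>m algebra_simps)
  have d\<rho>: "decays \<rho> (V n)" by (rule decays_mono[OF d le])
  hence r: "norm (p1 (V n t)) \<le> r0" if "t \<ge> 0" for t using that \<rho> unfolding decays_def by (meson order_trans)
  have c': "curve (V (Suc n))" unfolding VS by (rule \<Phi>_curve[OF c y r])
  have d': "decays (2 * m * (1 - 1 / 2 ^ Suc n)) (V (Suc n))"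
  proof -
   have "decays (2 * m * (1 - 1 / 2 ^ n) + m / 2 ^ n) (\<lambda>t. V n t + (V (Suc n) t - V n t))" by (rule decays_add[OF d dd])
   moreover have "2 * m * (1 - 1 / 2 ^ n) + m / 2 ^ n = 2 * m * (1 - 1 / 2 ^ Suc n)" by (simp add: field_simps)
   ultimately show ?thesis by simp
  qed
  have "decays (m / 2 ^ n / 2) (\<lambda>t. \<Phi> y (V (Suc n)) t - \<Phi> y (V n) t)"
   by (rule \<Phi>_contraction[OF c' decays_mono[OF d' le] c d\<rho> \<rho>(2) \<rho>0 small dd]) (use m0 in simp)
  hence "decays (m / 2 ^ Suc n) (\<lambda>t. V (Suc (Suc n)) t - V (Suc n) t)" by (simp add: VS mult.commute)
  moreover have "Q (V (Suc n) t) \<le> 2 * Q y * \<E> t" if "t \<ge> 0" for t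
   unfolding VS by (rule \<Phi>_Q[OF c d\<rho> y \<rho>(2) \<rho>0 small q that])
  ultimately show ?case using c' d' by blast
 qed
 have d\<rho>: "decays \<rho> (V n)" for n
  by (rule decays_mono[of "2 * m * (1 - 1 / 2 ^ n)"]) (use h m0 in \<open>auto simp: \<rho>m algebra_simps\<close>)
 define v where "v t = (\<Sum>n. V (Suc n) t - V n t)" for t
 have "uniform_limit {0..} (\<lambda>n t. \<Sum>i<n. V (Suc i) t - V i t) (\<lambda>t. \<Sum>i. V (Suc i) t - V i t) sequentially"
 proof (rule Weierstrass_m_test)
  show "norm (V (Suc n) t - V n t) \<le> (3 + 1 / K) * m * (1 / 2) ^ n" if "t \<in> {0..}" for n t
   using decays_norm[of "m / 2 ^ n" "\<lambda>t. V (Suc n) t - V n t" t] h[of n] m0 that by (simp add: power_divide)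
  show "summable (\<lambda>n. (3 + 1 / K) * m * (1 / 2) ^ n)" by (intro summable_mult summable_geometric) simp
 qed
 moreover have "(\<Sum>i<n. V (Suc i) t - V i t) = V n t" for n t
  using sum_lessThan_telescope[of "\<lambda>i. V i t" n] by (simp add: V0)
 ultimately have ul: "uniform_limit {0..} V v sequentially" by (simp add: v_def[abs_def])
 have lim: "(\<lambda>n. V n t) \<longlonglongrightarrow> v t" if "t \<ge> 0" for t
  by (rule tendsto_uniform_limitI[OF ul]) (use that in simp)
 have vc: "curve v"
  unfolding curve_def
 proof (intro conjI allI impI)
  show "continuous_on {0..} v"
   by (rule uniform_limit_theorem[OF _ ul]) (use h in \<open>auto simp: curve_def\<close>)
  show "v t \<in> Y" if "t \<ge> 0" for t
   by (rule closed_sequentially[OF _ _ lim[OF that]]) (use h Y that in \<open>auto simp: curve_def\<close>)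
 qed
 have vd: "decays \<rho> v" by (rule decays_limit[OF d\<rho> tendsto_const lim])
 \<comment> \<open>Pointwise convergence does not suffice for applying the contraction to
   \<open>v\<close> and \<open>V n\<close>; their distance has to be measured in the sense of
   \<open>decays\<close>.\<close>
 have tail: "decays (2 * m / 2 ^ n) (\<lambda>t. v t - V n t)" for n
 proof (rule decays_limit[of "\<lambda>N. 2 * m / 2 ^ n" "\<lambda>N t. V (n + N) t - V n t"])
  show "(\<lambda>N. V (n + N) t - V n t) \<longlonglongrightarrow> v t - V n t" if "t \<ge> 0" for t
   using LIMSEQ_ignore_initial_segment[OF lim[OF that], of n] by (intro tendsto_diff tendsto_const) (simp add: add.commute)
  have "decays (2 * m / 2 ^ n * (1 - 1 / 2 ^ N)) (\<lambda>t. V (n + N) t - V n t)" for N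
  proof (induction N)
   case 0
   show ?case by (simp add: decays_def lin_0 Q_def)
  next
   case (Suc N)
   have "decays (2 * m / 2 ^ n * (1 - 1 / 2 ^ N) + m / 2 ^ (n + N)) (\<lambda>t. (V (n + N) t - V n t) + (V (Suc (n + N)) t - V (n + N) t))"
    by (rule decays_add[OF Suc]) (use h in blast)
   moreover have "2 * m / 2 ^ n * (1 - 1 / 2 ^ N) + m / 2 ^ (n + N) = 2 * m / 2 ^ n * (1 - 1 / 2 ^ Suc N)"
    by (simp add: field_simps power_add)
   ultimately show ?case by simp
  qed
  thus "decays (2 * m / 2 ^ n) (\<lambda>t. V (n + N) t - V n t)" for N
   by (rule decays_mono) (use m0 in \<open>simp add: field_simps\<close>)
 qed simp
 have fixed: "\<Phi> y v t = v t" if t: "t \<ge> 0" for t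
 proof -
  have "decays (2 * m / 2 ^ n / 2) (\<lambda>t. \<Phi> y v t - \<Phi> y (V n) t)" for n
   by (rule \<Phi>_contraction[OF vc vd _ d\<rho> \<rho>(2) \<rho>0 small tail]) (use h m0 in auto)
  hence "norm (\<Phi> y v t - V (Suc n) t) \<le> (3 + 1 / K) * (2 * m / 2 ^ n / 2)" for n
   using decays_norm[of "2 * m / 2 ^ n / 2" "\<lambda>t. \<Phi> y v t - \<Phi> y (V n) t" t] m0 t by (simp add: VS)
  hence b: "norm (\<Phi> y v t - V (Suc n) t) \<le> ((3 + 1 / K) * m) * (1 / 2) ^ n" for n
   by (simp add: power_divide)
  have z: "(\<lambda>n. ((3 + 1 / K) * m) * (1 / 2) ^ n) \<longlonglongrightarrow> 0"
   by (rule tendsto_mult_right_zero[OF LIMSEQ_power_zero]) simp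
  have "(\<lambda>n. \<Phi> y v t - V (Suc n) t) \<longlonglongrightarrow> 0"
   by (rule Lim_null_comparison[OF always_eventually z]) (use b in blast)
  moreover have "(\<lambda>n. \<Phi> y v t - V (Suc n) t) \<longlonglongrightarrow> \<Phi> y v t - v t"
   by (intro tendsto_diff tendsto_const LIMSEQ_Suc lim t)
  ultimately have "\<Phi> y v t - v t = 0" by (rule LIMSEQ_unique[symmetric])
  thus ?thesis by simp
 qed
 have "Q (v t) \<le> 2 * Q y * \<E> t" if t: "t \<ge> 0" for t
 proof (rule Lim_bounded)
  show "(\<lambda>n. Q (V n t)) \<longlonglongrightarrow> Q (v t)"
   unfolding Q_def by (intro tendsto_intros bounded_linear.tendsto[OF blin(3) lim[OF t]] bounded_linear.tendsto[OF blin(4) lim[OF t]])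
  show "\<forall>n\<ge>0. Q (V n t) \<le> 2 * Q y * \<E> t" using h t by auto
 qed
 with vc vd fixed that show thesis by blast
qed

text \<open>The competitor \<open>w\<close> is not known to be small, so its integrand k is
  prescribed only where \<open>p1\<close> of \<open>w\<close> is at most r0. Agreement is propagated
  from [0,a] to [0,a+d]: \<open>p1\<close> of \<open>v\<close> is at most r0/2, continuity keeps
  \<open>p1\<close> of \<open>w\<close> below r0 during time d, and a Lipschitz estimate with factor
  1/2 closes the step.\<close>

lemma solution_unique:
 fixes \<tau> :: real and v w :: "real => 'b"
 assumes y: "y \<in> Y" and v: "curve v" "\<And>t. t \<ge> 0 ==> norm (p1 (v t)) \<le> r0 / 2" "\<And>t. t \<ge> 0 ==> \<Phi> y v t = v t"
  and \<tau>: "\<tau> \<ge> 0" and w: "continuous_on {0..\<tau>} w" "\<And>t. t \<in> {0..\<tau>} ==> w t \<in> Y"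
  and eq: "\<And>t. t \<in> {0..\<tau>} ==> \<exists>k. (k has_integral (w t - S t y)) {0..t} \<and>
    (\<forall>s\<in>{0..t}. norm (p1 (w s)) \<le> r0 --> k s = S (t - s) (G (w s)))"
  and t: "t \<in> {0..\<tau>}"
 shows "w t = v t"
proof -
 have "bounded (w ` {0..\<tau>})" by (intro compact_imp_bounded compact_continuous_image w) simp
 then obtain B where B: "\<And>s. s \<in> {0..\<tau>} ==> norm (w s) \<le> B" unfolding bounded_iff by (metis imageI)
 have B0: "B \<ge> 0" using order_trans[OF norm_ge_zero B[of 0]] \<tau> by simp
 obtain M where M: "M \<ge> 1" "\<And>t y. t \<in> {0..\<tau>} ==> y \<in> Y ==> norm (S t y) \<le> M * norm y"
  using S_loc_bdd[of \<tau>] by blast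
 define R where "R = (2 + (1 + 1 / K) * (1 + K)) * L * (B + r0)"
 have R0: "R \<ge> 0" using pos B0 by (simp add: R_def)
 have "uniformly_continuous_on {0..\<tau>} w" by (intro compact_uniformly_continuous w) simp
 then obtain d0 where d0: "d0 > 0" "\<And>s t. s \<in> {0..\<tau>} ==> t \<in> {0..\<tau>} ==> dist s t < d0 ==> dist (w s) (w t) < r0 / 2"
  unfolding uniformly_continuous_on_def using pos by (metis half_gt_zero dist_commute)
 \<comment> \<open>d0/2 keeps the step below d0, so that w moves by less than r0/2; the second term
   gives d M R <= 1/2.\<close>
 define d where "d = min (d0 / 2) (1 / (2 * (M * R + 1)))"
 have MR: "M * R \<ge> 0" using M R0 by simp
 have d: "d > 0" "d < d0" "d * (M * R) \<le> 1 / 2"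
 proof -
  show "d > 0" "d < d0" using d0 MR by (auto simp: d_def min_def add_nonneg_pos)
  have "d * (M * R) \<le> 1 / (2 * (M * R + 1)) * (M * R)" using MR by (intro mult_right_mono) (auto simp: d_def)
  also have "\<dots> \<le> 1 / 2" using MR by (simp add: field_simps)
  finally show "d * (M * R) \<le> 1 / 2" .
 qed
 have w0: "w 0 = v 0"
 proof -
  obtain k where k: "(k has_integral (w 0 - S 0 y)) {0..0::real}"
  proof -
   have "(0::real) \<in> {0..\<tau>}" using \<tau> by simp
   from eq[OF this] show thesis using that by blast
  qed
  have "(k has_integral 0) {0..0::real}" using has_integral_refl(2)[of k "0::real"] by simp
  with k have "w 0 - S 0 y = 0" by (rule has_integral_unique)
  moreover have "v 0 = S 0 y" using v(3)[of 0] by (simp add: \<Phi>_def duhamel_def)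
  ultimately show ?thesis by simp
 qed
 have vG: "curve (\<lambda>t. G (v t))"
  by (rule G_curve[OF v(1)]) (use v(2) pos in \<open>fastforce\<close>)
 have extend: "w t = v t" if a: "0 \<le> a" "a \<le> \<tau>" and agree: "\<And>s. s \<in> {0..a} ==> w s = v s"
   and t: "t \<in> {0..min (a + d) \<tau>}" for a t
 proof -
  define b where "b = min (a + d) \<tau>"
  have b: "a \<le> b" "b \<le> \<tau>" "b \<le> a + d" using a d by (auto simp: b_def)
  have p1w: "norm (p1 (w s)) \<le> r0" if s: "s \<in> {0..b}" for s
  proof (cases "s \<le> a")
   case True
   thus ?thesis using agree[of s] v(2)[of s] s pos by auto
  next
   case False
   have "dist (w s) (w a) < r0 / 2" using s b a False d by (intro d0(2)) (auto simp: dist_real_def)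
   hence "norm (p1 (w s - w a)) \<le> r0 / 2" using le_norm(1)[of "w s - w a"] by (simp add: dist_norm)
   moreover have "norm (p1 (w a)) \<le> r0 / 2" using agree[of a] v(2)[of a] a by auto
   moreover have "norm (p1 (w s)) \<le> norm (p1 (w s - w a)) + norm (p1 (w a))"
    using norm_triangle_ineq[of "p1 (w s - w a)" "p1 (w a)"] by (simp add: lin_diff)
   ultimately show ?thesis by linarith
  qed
  have vc: "continuous_on {0..b} v" using v(1) unfolding curve_def by (auto intro: continuous_on_subset)
  have wc: "continuous_on {0..b} w" using w(1) by (rule continuous_on_subset) (use b in auto)
  have "continuous_on {0..b} (\<lambda>s. norm (w s - v s))" by (intro continuous_intros vc wc)
  \<comment> \<open>The maximal difference D satisfies D <= D/2: the difference of the integrands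
    vanishes before a, so only a time of length at most d contributes.\<close>
  then obtain t0 where t0: "t0 \<in> {0..b}" "\<And>s. s \<in> {0..b} ==> norm (w s - v s) \<le> norm (w t0 - v t0)"
   using continuous_attains_sup[of "{0..b}" "\<lambda>s. norm (w s - v s)"] a b by auto
  define D where "D = norm (w t0 - v t0)"
  have D0: "D \<ge> 0" by (simp add: D_def)
  have "D \<le> 0"
  proof (cases "t0 \<le> a")
   case True
   thus ?thesis using agree[of t0] t0 by (simp add: D_def)
  next
   case False
   have t0': "t0 \<in> {0..\<tau>}" "t0 \<ge> 0" using t0 b by auto
   obtain k where k: "(k has_integral (w t0 - S t0 y)) {0..t0}"
    "\<And>s. s \<in> {0..t0} ==> norm (p1 (w s)) \<le> r0 ==> k s = S (t0 - s) (G (w s))" using eq[OF t0'(1)] by blast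
   have "((\<lambda>s. S (t0 - s) (G (v s))) has_integral duhamel (\<lambda>s. G (v s)) t0) {0..t0}"
    unfolding duhamel_def by (rule integrable_integral[OF duhamel_integrable[OF vG t0'(2)]])
   moreover have "duhamel (\<lambda>s. G (v s)) t0 = v t0 - S t0 y" using v(3)[OF t0'(2)] by (simp add: \<Phi>_def algebra_simps)
   ultimately have hv: "((\<lambda>s. S (t0 - s) (G (v s))) has_integral (v t0 - S t0 y)) {0..t0}" by simp
   have dif: "((\<lambda>s. k s - S (t0 - s) (G (v s))) has_integral (w t0 - v t0)) {0..t0}"
    using has_integral_diff[OF k(1) hv] by simp
   have C: "((\<lambda>s. if s \<in> {a..t0} then M * R * D else 0) has_integral (t0 - a) * (M * R * D)) {0..t0}"
   proof -
    have "((\<lambda>s::real. M * R * D) has_integral (t0 - a) * (M * R * D)) {a..t0}"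
     using has_integral_const_real[of "M * R * D" a t0] False by simp
    moreover have "{a..t0} \<subseteq> {0..t0}" using a by auto
    ultimately show ?thesis by (simp only: has_integral_restrict)
   qed
   have "norm (integral {0..t0} (\<lambda>s. k s - S (t0 - s) (G (v s)))) \<le> integral {0..t0} (\<lambda>s. if s \<in> {a..t0} then M * R * D else 0)"
   proof (rule integral_norm_bound_integral[OF has_integral_integrable[OF dif] has_integral_integrable[OF C]])
    fix s assume s: "s \<in> {0..t0}"
    hence s': "s \<in> {0..b}" "s \<in> {0..\<tau>}" "t0 - s \<in> {0..\<tau>}" "s \<ge> 0" using t0 b by auto
    have ks: "k s = S (t0 - s) (G (w s))" by (rule k(2)[OF s p1w[OF s'(1)]])
    have vs: "v s \<in> Y" "norm (p1 (v s)) \<le> r0" using v(1) v(2)[OF s'(4)] s'(4) pos by (auto simp: curve_def)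
    show "norm (k s - S (t0 - s) (G (v s))) \<le> (if s \<in> {a..t0} then M * R * D else 0)"
    proof (cases "s \<in> {a..t0}")
     case False
     hence "w s = v s" using agree[of s] s by auto
     thus ?thesis using ks by (simp only: if_not_P[OF False]) simp
    next
     case True
     have GY: "G (w s) \<in> Y" "G (v s) \<in> Y" using G_in[OF w(2)[OF s'(2)] p1w[OF s'(1)]] G_in[OF vs] by auto
     have "k s - S (t0 - s) (G (v s)) = S (t0 - s) (G (w s) - G (v s))"
      unfolding ks using s GY by (intro S_diff[symmetric]) auto
     also have "norm \<dots> \<le> M * norm (G (w s) - G (v s))" using GY Y s' by (intro M(2)) (auto intro: subspace_diff)
     also have "\<dots> \<le> M * (R * norm (w s - v s))"
      unfolding R_def using M by (intro mult_left_mono G_lipschitz w(2) s' p1w B vs) auto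
     also have "\<dots> \<le> M * (R * D)" using M R0 t0(2)[OF s'(1)] unfolding D_def by (intro mult_left_mono) auto
     finally show ?thesis using True by (simp add: mult.assoc)
    qed
   qed
   hence "D \<le> (t0 - a) * (M * R * D)"
    unfolding D_def[symmetric] integral_unique[OF dif] integral_unique[OF C] .
   also have "\<dots> \<le> d * (M * R * D)" using t0 b MR D0 by (intro mult_right_mono) auto
   also have "\<dots> = (d * (M * R)) * D" by simp
   also have "\<dots> \<le> 1 / 2 * D" by (rule mult_right_mono[OF d(3) D0])
   finally show ?thesis using D0 by simp
  qed
  moreover have "norm (w t - v t) \<le> D" unfolding D_def using t0(2)[of t] t by (simp add: b_def)
  ultimately have "norm (w t - v t) \<le> 0" by linarith
  thus ?thesis by simp
 qed
 have "\<forall>s\<in>{0..min (real n * d) \<tau>}. w s = v s" for n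
 proof (induction n)
  case 0
  thus ?case using w0 \<tau> by auto
 next
  case (Suc n)
  define a where "a = min (real n * d) \<tau>"
  have a: "0 \<le> a" "a \<le> \<tau>" using d \<tau> by (auto simp: a_def)
  have "min (real (Suc n) * d) \<tau> \<le> min (a + d) \<tau>" using d \<tau> by (auto simp: a_def algebra_simps)
  thus ?case using extend[OF a] Suc by (auto simp: a_def)
 qed
 moreover obtain n where "real n * d > \<tau>" using reals_Archimedean3[OF d(1)] by blast
 ultimately show ?thesis using t by (metis min.absorb2 less_imp_le)
qed

end

section \<open>The system in a Banach space type\<close>

definition Hinner :: "nat => 'n::finite fn => 'n fn => real" where
 "Hinner k u w = (\<Sum>\<beta> | mdeg \<beta> \<le> k. LEB x. weak_deriv \<beta> u x * weak_deriv \<beta> w x)"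

lemma Hspace_weak_deriv_L2:
 assumes "u \<in> Hspace k" "mdeg \<beta> \<le> k" shows "weak_deriv \<beta> u \<in> L2_space"
 using assms by (metis Hspace_wder(1) multiindex_cases)

lemma Hinner_commute: "Hinner k u w = Hinner k w u"
 by (simp add: Hinner_def mult.commute)

lemma Hinner_self: "Hinner k u u = (Hnorm k u)\<^sup>2"
 unfolding Hinner_def Hnorm_def by (subst real_sqrt_pow2) (auto intro!: sum_nonneg simp: power2_eq_square)

lemma Hinner_bound:
 fixes u w :: "'n::finite fn"
 assumes u: "u \<in> Hspace k" and w: "w \<in> Hspace k"
 shows "\<bar>Hinner k u w\<bar> \<le> Hnorm k u * Hnorm k w"
proof -
 let ?A = "{\<beta> :: 'n => nat. mdeg \<beta> \<le> k}"
 have "\<bar>Hinner k u w\<bar> \<le> (\<Sum>\<beta>\<in>?A. \<bar>LEB x. weak_deriv \<beta> u x * weak_deriv \<beta> w x\<bar>)"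
  unfolding Hinner_def by (rule sum_abs)
 also have "\<dots> \<le> (\<Sum>\<beta>\<in>?A. \<bar>L2norm (weak_deriv \<beta> u)\<bar> * \<bar>L2norm (weak_deriv \<beta> w)\<bar>)"
 proof (rule sum_mono)
  fix \<beta> assume "\<beta> \<in> ?A"
  hence "weak_deriv \<beta> u \<in> L2_space" "weak_deriv \<beta> w \<in> L2_space" using u w by (auto intro: Hspace_weak_deriv_L2)
  from L2_Cauchy_Schwarz[OF this]
  show "\<bar>LEB x. weak_deriv \<beta> u x * weak_deriv \<beta> w x\<bar> \<le> \<bar>L2norm (weak_deriv \<beta> u)\<bar> * \<bar>L2norm (weak_deriv \<beta> w)\<bar>"
   by simp
 qed
 also have "\<dots> \<le> Hnorm k u * Hnorm k w" unfolding Hnorm_L2_set by (rule L2_set_mult_ineq)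
 finally show ?thesis .
qed

lemma Hinner_lincomb:
 assumes u: "u \<in> Hspace k" and v: "v \<in> Hspace k" and w: "w \<in> Hspace k"
 shows "Hinner k (\<lambda>x. a * u x + b * v x) w = a * Hinner k u w + b * Hinner k v w"
proof -
 have eq: "(LEB x. weak_deriv \<beta> (\<lambda>x. a * u x + b * v x) x * weak_deriv \<beta> w x) =
   a * (LEB x. weak_deriv \<beta> u x * weak_deriv \<beta> w x) + b * (LEB x. weak_deriv \<beta> v x * weak_deriv \<beta> w x)"
  if \<beta>: "mdeg \<beta> \<le> k" for \<beta>
 proof -
  obtain js where js: "\<beta> = count_list js" "length js \<le> k" using multiindex_cases[OF \<beta>] by blast
  note L = Hspace_weak_deriv_L2[OF u \<beta>] Hspace_weak_deriv_L2[OF v \<beta>] Hspace_weak_deriv_L2[OF w \<beta>]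
  have ae: "AE x in lebesgue. weak_deriv \<beta> (\<lambda>x. a * u x + b * v x) x = a * weak_deriv \<beta> u x + b * weak_deriv \<beta> v x"
   unfolding js(1) by (rule wder_lincomb[OF u v js(2)])
  have "(LEB x. weak_deriv \<beta> (\<lambda>x. a * u x + b * v x) x * weak_deriv \<beta> w x) =
    (LEB x. a * (weak_deriv \<beta> u x * weak_deriv \<beta> w x) + b * (weak_deriv \<beta> v x * weak_deriv \<beta> w x))"
  proof (rule integral_cong_lebesgue)
   show "AE x in lebesgue. weak_deriv \<beta> (\<lambda>x. a * u x + b * v x) x * weak_deriv \<beta> w x =
     a * (weak_deriv \<beta> u x * weak_deriv \<beta> w x) + b * (weak_deriv \<beta> v x * weak_deriv \<beta> w x)"
    using ae by eventually_elim (simp add: algebra_simps)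
  qed
  also have "\<dots> = a * (LEB x. weak_deriv \<beta> u x * weak_deriv \<beta> w x) + b * (LEB x. weak_deriv \<beta> v x * weak_deriv \<beta> w x)"
   using L2_mult_integrable[OF L(1,3)] L2_mult_integrable[OF L(2,3)] by simp
  finally show ?thesis .
 qed
 have "Hinner k (\<lambda>x. a * u x + b * v x) w = (\<Sum>\<beta> | mdeg \<beta> \<le> k.
   a * (LEB x. weak_deriv \<beta> u x * weak_deriv \<beta> w x) + b * (LEB x. weak_deriv \<beta> v x * weak_deriv \<beta> w x))"
  unfolding Hinner_def by (rule sum.cong) (auto simp: eq)
 thus ?thesis unfolding Hinner_def by (simp add: sum.distrib sum_distrib_left)
qed

instance bcontfun :: (metric_space, banach) banach ..

text \<open>
 \<open>H\<^sup>k\<close> is only a seminormed space of functions; identifying \<open>u\<close> with the functional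
 \<open>\<langle>u, \<cdot>\<rangle>\<close> on the unit ball realises the quotient isometrically inside a Banach space type.
\<close>

definition Hembed :: "nat => 'n::finite fn => 'n fn discrete \<Rightarrow>\<^sub>C real" where
 "Hembed k u = Bcontfun (\<lambda>d. if of_discrete d \<in> Hspace k \<and> Hnorm k (of_discrete d) \<le> 1 then Hinner k u (of_discrete d) else 0)"

lemma Hembed_apply:
 assumes u: "u \<in> Hspace k"
 shows "apply_bcontfun (Hembed k u) d =
  (if of_discrete d \<in> Hspace k \<and> Hnorm k (of_discrete d) \<le> 1 then Hinner k u (of_discrete d) else 0)"
proof -
 let ?f = "\<lambda>d. if of_discrete d \<in> Hspace k \<and> Hnorm k (of_discrete d) \<le> 1 then Hinner k u (of_discrete d) else 0"
 have "?f \<in> bcontfun"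
 proof (rule bcontfun_normI)
  \<comment> \<open>The argument ranges over functions with the discrete topology, so continuity is
    automatic and \<open>bcontfun\<close> is simply a space of bounded functions.\<close>
  show "continuous_on UNIV ?f" by (simp add: continuous_on_open_vimage open_discrete)
  show "norm (?f d) \<le> Hnorm k u" for d
   using Hinner_bound[OF u, of "of_discrete d"] mult_left_le[of "Hnorm k (of_discrete d)" "Hnorm k u"]
   by auto
 qed
 thus ?thesis unfolding Hembed_def by (simp add: Bcontfun_inverse)
qed

lemma norm_Hembed:
 assumes u: "u \<in> Hspace k" shows "norm (Hembed k u) = Hnorm k u"
proof (rule antisym)
 show "norm (Hembed k u) \<le> Hnorm k u"
 proof (rule norm_bound)
  show "norm (apply_bcontfun (Hembed k u) d) \<le> Hnorm k u" for d
   using Hinner_bound[OF u, of "of_discrete d"] mult_left_le[of "Hnorm k (of_discrete d)" "Hnorm k u"]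
   by (auto simp: Hembed_apply[OF u])
 qed
 show "Hnorm k u \<le> norm (Hembed k u)"
 proof (cases "Hnorm k u = 0")
  case False
  \<comment> \<open>The supremum is attained at u divided by its norm.\<close>
  define a where "a = 1 / Hnorm k u"
  define w where "w = (\<lambda>x. a * u x + 0 * u x)"
  have a: "a > 0" using False Hnorm_nonneg[of k u] by (simp add: a_def order_le_neq_trans)
  have w: "w \<in> Hspace k" unfolding w_def by (rule Hspace_lincomb[OF u u])
  have nw: "Hnorm k w = 1" using a False Hnorm_cmult[OF u, of a] by (simp add: w_def a_def)
  have "Hinner k u w = a * Hinner k u u" unfolding Hinner_commute[of k u w] unfolding w_def Hinner_lincomb[OF u u u] by simp
  also have "\<dots> = Hnorm k u" using False by (simp add: Hinner_self a_def power2_eq_square)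
  finally have "Hnorm k u = apply_bcontfun (Hembed k u) (discrete w)"
   using w nw by (simp add: Hembed_apply[OF u] discrete_inverse)
  also have "\<dots> \<le> norm (apply_bcontfun (Hembed k u) (discrete w))" by simp
  also have "\<dots> \<le> norm (Hembed k u)" by (rule norm_bounded)
  finally show ?thesis .
 qed simp
qed

lemma Hembed_lincomb:
 assumes u: "u \<in> Hspace k" and v: "v \<in> Hspace k"
 shows "Hembed k (\<lambda>x. a * u x + b * v x) = a *\<^sub>R Hembed k u + b *\<^sub>R Hembed k v"
proof (rule bcontfun_eqI)
 show "apply_bcontfun (Hembed k (\<lambda>x. a * u x + b * v x)) d = apply_bcontfun (a *\<^sub>R Hembed k u + b *\<^sub>R Hembed k v) d" for d
  by (simp add: Hembed_apply[OF Hspace_lincomb[OF u v]] Hembed_apply[OF u] Hembed_apply[OF v] Hinner_lincomb[OF u v])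
qed

text \<open>\<open>has_riemann_integral\<close> asks for a constant mesh r, whereas the gauge
  integral only yields some gauge. For continuous integrands the modulus of continuity provides the
  mesh.\<close>

lemma riemann_sum_error:
 fixes f :: "real => 'b::banach"
 assumes f: "continuous_on {a..b} f" and ab: "a \<le> b" and r: "\<And>s t. s \<in> {a..b} ==> t \<in> {a..b} ==> dist t s < r ==> dist (f t) (f s) \<le> e"
  and e: "e \<ge> 0" and p: "p tagged_division_of {a..b}" "(\<lambda>s. ball s r) fine p"
 shows "norm ((\<Sum>(s, K)\<in>p. measure lborel K *\<^sub>R f s) - integral {a..b} f) \<le> e * (b - a)"
proof -
 have p': "p tagged_division_of cbox a b" using p(1) by simp
 have fin: "finite p" by (rule tagged_division_of_finite[OF p(1)])
 have fi: "f integrable_on cbox a b" using integrable_continuous_real[OF f] by simp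
 have sum: "integral {a..b} f = (\<Sum>(s, K)\<in>p. integral K f)"
  using integral_combine_tagged_division_topdown[OF fi p'] by simp
 have "norm ((\<Sum>(s, K)\<in>p. measure lborel K *\<^sub>R f s) - integral {a..b} f) = norm (\<Sum>(s, K)\<in>p. measure lborel K *\<^sub>R f s - integral K f)"
  unfolding sum by (simp add: sum_subtractf split_beta)
 also have "\<dots> \<le> (\<Sum>(s, K)\<in>p. e * measure lborel K)"
 proof (rule sum_norm_le)
  fix q assume q: "q \<in> p"
  obtain s K where sK: "q = (s, K)" by (cases q)
  have sK': "(s, K) \<in> p" using q sK by simp
  obtain c d where K: "K = cbox c d" using tagged_division_ofD(4)[OF p(1) sK'] by blast
  have s: "s \<in> K" "K \<subseteq> {a..b}" using tagged_division_ofD(2,3)[OF p(1) sK'] by auto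
  have Kb: "K \<subseteq> ball s r" using p(2) sK' by (auto simp: fine_def)
  have fK: "f integrable_on cbox c d" using fi s(2) K by (intro integrable_on_subcbox[OF fi]) auto
  have "((\<lambda>x. f s - f x) has_integral (measure lborel (cbox c d) *\<^sub>R f s - integral (cbox c d) f)) (cbox c d)"
   by (intro has_integral_diff has_integral_const integrable_integral fK)
  hence "norm (measure lborel (cbox c d) *\<^sub>R f s - integral (cbox c d) f) \<le> e * measure lborel (cbox c d)"
  proof (rule has_integral_bound[OF e])
   fix x assume x: "x \<in> cbox c d"
   hence "dist x s < r" using Kb K by (auto simp: dist_commute)
   hence "dist (f x) (f s) \<le> e" using s x K by (intro r) auto
   thus "norm (f s - f x) \<le> e" by (simp add: dist_norm norm_minus_commute)
  qed
  thus "norm (case q of (s, K) => measure lborel K *\<^sub>R f s - integral K f) \<le> (case q of (s, K) => e * measure lborel K)"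
   by (simp add: sK K)
 qed
 also have "\<dots> = e * (\<Sum>(s, K)\<in>p. measure lborel K)" by (simp add: sum_distrib_left split_beta)
 also have "(\<Sum>(s, K)\<in>p. measure lborel K) = b - a"
  using additive_content_tagged_division[OF p'] ab by simp
 finally show ?thesis .
qed

text \<open>The four components follow the layout of \<open>J\<close>: plain first and second
  component, then weighted first and second component.\<close>

abbreviation nrm1 :: "('a::real_normed_vector \<times> 'b::real_normed_vector) \<times> ('c::real_normed_vector \<times> 'd::real_normed_vector) => real" where
 "nrm1 y \<equiv> norm (fst (fst y))"

abbreviation nrm2 :: "('a::real_normed_vector \<times> 'b::real_normed_vector) \<times> ('c::real_normed_vector \<times> 'd::real_normed_vector) => real" where
 "nrm2 y \<equiv> norm (snd (fst y))"

abbreviation nrm3 :: "('a::real_normed_vector \<times> 'b::real_normed_vector) \<times> ('c::real_normed_vector \<times> 'd::real_normed_vector) => real" where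
 "nrm3 y \<equiv> norm (fst (snd y))"

abbreviation nrm4 :: "('a::real_normed_vector \<times> 'b::real_normed_vector) \<times> ('c::real_normed_vector \<times> 'd::real_normed_vector) => real" where
 "nrm4 y \<equiv> norm (snd (snd y))"

section \<open>The product space and its copy in a Banach space type\<close>

locale sobolev_pair =
 fixes k :: nat and z :: "'n::finite" and \<alpha> :: real
begin

definition X :: "(real^'n => real \<times> real) set" where "X = sq_space (Espace k z \<alpha>)"

definition N :: "(real^'n => real \<times> real) => real" where "N = sq_norm (Enorm k z \<alpha>)"

abbreviation wt :: "'n fn => 'n fn" where "wt u \<equiv> \<lambda>x. weight z \<alpha> x * u x"

definition J :: "(real^'n => real \<times> real) => _" where
 "J v = ((Hembed k (\<lambda>x. fst (v x)), Hembed k (\<lambda>x. snd (v x))),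
     (Hembed k (wt (\<lambda>x. fst (v x))), Hembed k (wt (\<lambda>x. snd (v x)))))"

lemma X_iff: "v \<in> X \<longleftrightarrow> (\<lambda>x. fst (v x)) \<in> Hspace k \<and> (\<lambda>x. snd (v x)) \<in> Hspace k \<and>
  wt (\<lambda>x. fst (v x)) \<in> Hspace k \<and> wt (\<lambda>x. snd (v x)) \<in> Hspace k"
 by (auto simp: X_def sq_space_def Espace_def Wspace_def o_def)

lemma N_eq: "N v = max (max (Hnorm k (\<lambda>x. fst (v x))) (Hnorm k (wt (\<lambda>x. fst (v x)))))
  (max (Hnorm k (\<lambda>x. snd (v x))) (Hnorm k (wt (\<lambda>x. snd (v x)))))"
 by (simp add: N_def sq_norm_def Enorm_def Wnorm_def o_def)

lemma X_lincomb:
 assumes u: "u \<in> X" and v: "v \<in> X"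
 shows "(\<lambda>x. a *\<^sub>R u x + b *\<^sub>R v x) \<in> X"
  "J (\<lambda>x. a *\<^sub>R u x + b *\<^sub>R v x) = a *\<^sub>R J u + b *\<^sub>R J v"
proof -
 have w: "wt (\<lambda>x. a * p x + b * q x) = (\<lambda>x. a * wt p x + b * wt q x)" for p q by (auto simp: algebra_simps)
 show "(\<lambda>x. a *\<^sub>R u x + b *\<^sub>R v x) \<in> X"
  using u v unfolding X_iff fst_add snd_add fst_scaleR snd_scaleR real_scaleR_def w by (intro conjI Hspace_lincomb) auto
 show "J (\<lambda>x. a *\<^sub>R u x + b *\<^sub>R v x) = a *\<^sub>R J u + b *\<^sub>R J v"
  using u v unfolding J_def X_iff fst_add snd_add fst_scaleR snd_scaleR real_scaleR_def w by (simp add: Hembed_lincomb)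
qed

lemma X_add: "u \<in> X ==> v \<in> X ==> (\<lambda>x. u x + v x) \<in> X"
 and J_add: "u \<in> X ==> v \<in> X ==> J (\<lambda>x. u x + v x) = J u + J v"
 using X_lincomb[of u v 1 1] by simp_all

lemma X_diff: "u \<in> X ==> v \<in> X ==> (\<lambda>x. u x - v x) \<in> X"
 and J_diff: "u \<in> X ==> v \<in> X ==> J (\<lambda>x. u x - v x) = J u - J v"
 using X_lincomb[of u v 1 "-1"] by simp_all

lemma X_scale: "u \<in> X ==> (\<lambda>x. a *\<^sub>R u x) \<in> X"
 and J_scale: "u \<in> X ==> J (\<lambda>x. a *\<^sub>R u x) = a *\<^sub>R J u"
 using X_lincomb[of u u a 0] by simp_all

lemma X_zero: "(\<lambda>x. 0) \<in> X" by (simp add: X_iff Hspace_zero)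

lemma J_zero: "J (\<lambda>x. 0) = 0"
 using J_scale[OF X_zero, of 0] by simp

lemma J_sum:
 assumes "finite I" "\<And>i. i \<in> I ==> f i \<in> X"
 shows "(\<lambda>x. \<Sum>i\<in>I. a i *\<^sub>R f i x) \<in> X \<and> J (\<lambda>x. \<Sum>i\<in>I. a i *\<^sub>R f i x) = (\<Sum>i\<in>I. a i *\<^sub>R J (f i))"
 using assms
proof (induction I rule: finite_induct)
 case (insert i I)
 hence "(\<lambda>x. \<Sum>i\<in>I. a i *\<^sub>R f i x) \<in> X" "J (\<lambda>x. \<Sum>i\<in>I. a i *\<^sub>R f i x) = (\<Sum>i\<in>I. a i *\<^sub>R J (f i))" "f i \<in> X" by auto
 thus ?case using insert(1,2) by (simp add: X_add J_add X_scale J_scale)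
qed (simp add: X_zero J_zero)

lemma components_J:
 assumes "v \<in> X"
 shows "nrm1 (J v) = Hnorm k (\<lambda>x. fst (v x))" "nrm2 (J v) = Hnorm k (\<lambda>x. snd (v x))"
  "nrm3 (J v) = Hnorm k (wt (\<lambda>x. fst (v x)))" "nrm4 (J v) = Hnorm k (wt (\<lambda>x. snd (v x)))"
 using assms by (simp_all add: J_def X_iff norm_Hembed)

lemma component_le_norm:
 fixes y :: "('a::real_normed_vector \<times> 'b::real_normed_vector) \<times> ('c::real_normed_vector \<times> 'd::real_normed_vector)"
 shows "nrm1 y \<le> norm y" "nrm2 y \<le> norm y" "nrm3 y \<le> norm y" "nrm4 y \<le> norm y"
 using norm_fst_le[of "fst y" "snd y"] norm_snd_le[of "snd y" "fst y"]
  norm_fst_le[of "fst (fst y)" "snd (fst y)"] norm_snd_le[of "snd (fst y)" "fst (fst y)"]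
  norm_fst_le[of "fst (snd y)" "snd (snd y)"] norm_snd_le[of "snd (snd y)" "fst (snd y)"]
 by simp_all

lemma norm_le_components:
 fixes y :: "('a::real_normed_vector \<times> 'b::real_normed_vector) \<times> ('c::real_normed_vector \<times> 'd::real_normed_vector)"
 shows "norm y \<le> nrm1 y + nrm2 y + nrm3 y + nrm4 y"
 using norm_Pair_le[of "fst y" "snd y"] norm_Pair_le[of "fst (fst y)" "snd (fst y)"] norm_Pair_le[of "fst (snd y)" "snd (snd y)"]
 by simp

lemma N_le_J: "v \<in> X ==> N v \<le> norm (J v)"
 unfolding N_eq using component_le_norm[of "J v"] by (simp add: components_J)

lemma J_le_N: "v \<in> X ==> norm (J v) \<le> 4 * N v"
 unfolding N_eq using norm_le_components[of "J v"] by (simp add: components_J)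

lemma N_nonneg: "N v \<ge> 0" by (simp add: N_eq le_max_iff_disj)

text \<open>Equality modulo null functions, in which the semigroup laws and mild solutions are
  phrased, becomes equality in the Banach space type.\<close>

lemma N_diff_0: "u \<in> X ==> v \<in> X ==> N (\<lambda>x. u x - v x) = 0 \<longleftrightarrow> J u = J v"
 using N_le_J[OF X_diff, of u v] J_le_N[OF X_diff, of u v] N_nonneg[of "\<lambda>x. u x - v x"] by (auto simp: J_diff)

text \<open>The plain and the weighted limit are found independently; a common almost everywhere
  convergent subsequence shows that the second is the weight times the first.\<close>

lemma weighted_complete:
 assumes u: "\<And>n. u n \<in> Hspace k" "\<And>n. wt (u n) \<in> Hspace k"
  and cau: "\<And>e. e > 0 ==> \<exists>M. \<forall>m\<ge>M. \<forall>n\<ge>M. Hnorm k (\<lambda>x. u m x - u n x) < e"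
   "\<And>e. e > 0 ==> \<exists>M. \<forall>m\<ge>M. \<forall>n\<ge>M. Hnorm k (\<lambda>x. wt (u m) x - wt (u n) x) < e"
 shows "\<exists>w\<in>Hspace k. wt w \<in> Hspace k \<and> (\<lambda>n. Hnorm k (\<lambda>x. u n x - w x)) \<longlonglongrightarrow> 0 \<and>
  (\<lambda>n. Hnorm k (\<lambda>x. wt (u n) x - wt w x)) \<longlonglongrightarrow> 0"
proof -
 obtain w where w: "w \<in> Hspace k" "(\<lambda>n. Hnorm k (\<lambda>x. u n x - w x)) \<longlonglongrightarrow> 0"
  using Hspace_complete[OF u(1) cau(1)] by blast
 obtain W where W: "W \<in> Hspace k" "(\<lambda>n. Hnorm k (\<lambda>x. wt (u n) x - W x)) \<longlonglongrightarrow> 0"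
  using Hspace_complete[OF u(2) cau(2)] by blast
 have L2lim: "(\<lambda>n. L2norm (\<lambda>x. f n x - g x)) \<longlonglongrightarrow> 0"
  if "\<And>n. f n \<in> Hspace k" "g \<in> Hspace k" "(\<lambda>n. Hnorm k (\<lambda>x. f n x - g x)) \<longlonglongrightarrow> 0" for f g
  by (rule Lim_null_comparison[OF always_eventually that(3)])
   (use L2norm_le_Hnorm[OF Hspace_diff[OF that(1,2)]] in simp)
 obtain r where r: "strict_mono r" "AE x in lebesgue. (\<lambda>n. u (r n) x) \<longlonglongrightarrow> w x"
  using L2_AE_subseq[OF Hspace_L2[OF u(1)] Hspace_L2[OF w(1)] L2lim[OF u(1) w]] by blast
 have lim2: "(\<lambda>n. L2norm (\<lambda>x. wt (u (r n)) x - W x)) \<longlonglongrightarrow> 0"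
  using LIMSEQ_subseq_LIMSEQ[OF L2lim[OF u(2) W] r(1)] by (simp add: o_def)
 obtain q where q: "strict_mono q" "AE x in lebesgue. (\<lambda>n. wt (u (r (q n))) x) \<longlonglongrightarrow> W x"
  using L2_AE_subseq[of "\<lambda>n. wt (u (r n))" W, OF Hspace_L2[OF u(2)] Hspace_L2[OF W(1)] lim2] by blast
 have ae: "AE x in lebesgue. W x = wt w x"
  using r(2) q(2)
 proof eventually_elim
  case (elim x)
  have "(\<lambda>n. u (r (q n)) x) \<longlonglongrightarrow> w x" using LIMSEQ_subseq_LIMSEQ[OF elim(1) q(1)] by (simp add: o_def)
  hence "(\<lambda>n. wt (u (r (q n))) x) \<longlonglongrightarrow> wt w x" by (intro tendsto_mult tendsto_const)
  thus ?case using LIMSEQ_unique[OF elim(2)] by simp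
 qed
 have "wt w \<in> Hspace k" by (rule Hspace_cong_AE[OF W(1) ae])
 moreover have "Hnorm k (\<lambda>x. wt (u n) x - wt w x) = Hnorm k (\<lambda>x. wt (u n) x - W x)" for n
  by (rule Hnorm_cong_AE[OF Hspace_diff[OF u(2) W(1)]]) (use ae in \<open>auto elim: eventually_mono\<close>)
 ultimately show ?thesis using w W(2) by auto
qed

lemma subspace_JX: "subspace (J ` X)"
proof (rule subspaceI)
 show "0 \<in> J ` X" using J_zero X_zero by (metis imageI)
 show "x + y \<in> J ` X" if "x \<in> J ` X" "y \<in> J ` X" for x y
  using that J_add X_add by (auto simp flip: J_add)
 show "a *\<^sub>R x \<in> J ` X" if "x \<in> J ` X" for x a
  using that X_scale by (auto simp flip: J_scale)
qed

text \<open>Closedness of the image is completeness of the function space: a convergent sequence of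
  images comes from a Cauchy sequence for \<open>N\<close>.\<close>

lemma closed_JX: "closed (J ` X)"
 unfolding closed_sequential_limits
proof (intro allI impI, elim conjE)
 fix f l assume f: "\<forall>n. f n \<in> J ` X" and l: "f \<longlonglongrightarrow> l"
 from f have "\<forall>n. \<exists>v. v \<in> X \<and> f n = J v" by blast
 from choice[OF this] obtain v where "\<forall>n. v n \<in> X \<and> f n = J (v n)" by (elim exE)
 hence v: "\<And>n. v n \<in> X" "\<And>n. f n = J (v n)" by simp_all
 have cau: "\<exists>M. \<forall>m\<ge>M. \<forall>n\<ge>M. N (\<lambda>x. v m x - v n x) < e" if "e > 0" for e
 proof -
  from LIMSEQ_imp_Cauchy[OF l] that obtain M where M: "\<And>m n. m \<ge> M ==> n \<ge> M ==> dist (f m) (f n) < e"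
   unfolding Cauchy_def by blast
  have "N (\<lambda>x. v m x - v n x) < e" if "m \<ge> M" "n \<ge> M" for m n
   using N_le_J[OF X_diff[OF v(1) v(1)], of m n] M[OF that] by (simp add: J_diff v dist_norm)
  thus ?thesis by blast
 qed
 have comp: "Hnorm k (\<lambda>x. fst (v m x) - fst (v n x)) \<le> N (\<lambda>x. v m x - v n x)"
  "Hnorm k (\<lambda>x. wt (\<lambda>x. fst (v m x)) x - wt (\<lambda>x. fst (v n x)) x) \<le> N (\<lambda>x. v m x - v n x)"
  "Hnorm k (\<lambda>x. snd (v m x) - snd (v n x)) \<le> N (\<lambda>x. v m x - v n x)"
  "Hnorm k (\<lambda>x. wt (\<lambda>x. snd (v m x)) x - wt (\<lambda>x. snd (v n x)) x) \<le> N (\<lambda>x. v m x - v n x)" for m n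
  by (auto simp: N_eq right_diff_distrib)
 have vX: "(\<lambda>x. fst (v n x)) \<in> Hspace k" "(\<lambda>x. snd (v n x)) \<in> Hspace k"
  "wt (\<lambda>x. fst (v n x)) \<in> Hspace k" "wt (\<lambda>x. snd (v n x)) \<in> Hspace k" for n
  using v(1)[of n] by (auto simp: X_iff)
 have "\<exists>w\<in>Hspace k. wt w \<in> Hspace k \<and> (\<lambda>n. Hnorm k (\<lambda>x. fst (v n x) - w x)) \<longlonglongrightarrow> 0 \<and>
   (\<lambda>n. Hnorm k (\<lambda>x. wt (\<lambda>x. fst (v n x)) x - wt w x)) \<longlonglongrightarrow> 0"
  by (rule weighted_complete[of "\<lambda>n x. fst (v n x)"]) (use vX cau comp in \<open>meson order_le_less_trans\<close>)+
 then obtain w1 where w1: "w1 \<in> Hspace k" "wt w1 \<in> Hspace k" "(\<lambda>n. Hnorm k (\<lambda>x. fst (v n x) - w1 x)) \<longlonglongrightarrow> 0"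
   "(\<lambda>n. Hnorm k (\<lambda>x. wt (\<lambda>x. fst (v n x)) x - wt w1 x)) \<longlonglongrightarrow> 0" by blast
 have "\<exists>w\<in>Hspace k. wt w \<in> Hspace k \<and> (\<lambda>n. Hnorm k (\<lambda>x. snd (v n x) - w x)) \<longlonglongrightarrow> 0 \<and>
   (\<lambda>n. Hnorm k (\<lambda>x. wt (\<lambda>x. snd (v n x)) x - wt w x)) \<longlonglongrightarrow> 0"
  by (rule weighted_complete[of "\<lambda>n x. snd (v n x)"]) (use vX cau comp in \<open>meson order_le_less_trans\<close>)+
 then obtain w2 where w2: "w2 \<in> Hspace k" "wt w2 \<in> Hspace k" "(\<lambda>n. Hnorm k (\<lambda>x. snd (v n x) - w2 x)) \<longlonglongrightarrow> 0"
   "(\<lambda>n. Hnorm k (\<lambda>x. wt (\<lambda>x. snd (v n x)) x - wt w2 x)) \<longlonglongrightarrow> 0" by blast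
 define w where "w x = (w1 x, w2 x)" for x
 have w: "w \<in> X" using w1 w2 by (simp add: X_iff w_def)
 define R where "R n = Hnorm k (\<lambda>x. fst (v n x) - w1 x) + Hnorm k (\<lambda>x. wt (\<lambda>x. fst (v n x)) x - wt w1 x) +
   Hnorm k (\<lambda>x. snd (v n x) - w2 x) + Hnorm k (\<lambda>x. wt (\<lambda>x. snd (v n x)) x - wt w2 x)" for n
 have NR: "N (\<lambda>x. v n x - w x) \<le> R n" for n
 proof -
  have m: "max (max a b) (max c d) \<le> a + b + c + d" if "a \<ge> 0" "b \<ge> 0" "c \<ge> 0" "d \<ge> 0" for a b c d :: real
   using that by linarith
  show ?thesis unfolding N_eq w_def R_def fst_diff snd_diff fst_conv snd_conv right_diff_distrib
   by (rule m[OF Hnorm_nonneg Hnorm_nonneg Hnorm_nonneg Hnorm_nonneg])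
 qed
 have b: "norm (f n - J w) \<le> 4 * R n" for n
  using J_le_N[OF X_diff[OF v(1) w], of n] NR[of n] unfolding J_diff[OF v(1) w] v(2) by linarith
 have "R \<longlonglongrightarrow> 0 + 0 + 0 + 0"
  unfolding R_def[abs_def] by (intro tendsto_add w1 w2)
 hence z: "(\<lambda>n. 4 * R n) \<longlonglongrightarrow> 0" by (intro tendsto_mult_right_zero) simp
 have "(\<lambda>n. f n - J w) \<longlonglongrightarrow> 0"
  by (rule Lim_null_comparison[OF always_eventually z]) (use b in blast)
 hence "f \<longlonglongrightarrow> J w" by (simp add: LIM_zero_iff)
 hence "l = J w" using l LIMSEQ_unique by blast
 thus "l \<in> J ` X" using w by simp
qed

lemma J_riemann_sum:
 fixes p :: "(real \<times> real set) set"
 assumes p: "p tagged_division_of {a..b}" and F: "\<forall>s\<in>{a..b}. F s \<in> X"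
 shows "(\<lambda>x. \<Sum>(s, K)\<in>p. measure lborel K *\<^sub>R F s x) \<in> X"
  "J (\<lambda>x. \<Sum>(s, K)\<in>p. measure lborel K *\<^sub>R F s x) = (\<Sum>(s, K)\<in>p. measure lborel K *\<^sub>R J (F s))"
proof -
 have "F (fst q) \<in> X" if "q \<in> p" for q
  using tagged_division_ofD(2,3)[OF p, of "fst q" "snd q"] that F by auto
 from J_sum[of p "\<lambda>q. F (fst q)" "\<lambda>q. measure lborel (snd q)", OF tagged_division_of_finite[OF p] this]
 show "(\<lambda>x. \<Sum>(s, K)\<in>p. measure lborel K *\<^sub>R F s x) \<in> X"
  "J (\<lambda>x. \<Sum>(s, K)\<in>p. measure lborel K *\<^sub>R F s x) = (\<Sum>(s, K)\<in>p. measure lborel K *\<^sub>R J (F s))"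
  by (simp_all add: split_beta)
qed

text \<open>The direction for an arbitrary mild solution: its Riemann integral is a gauge integral
  with a constant gauge. The e/4 in the proof compensates the factor 4 in
  \<open>J_le_N\<close>.\<close>

lemma riemann_imp_integral:
 assumes h: "has_riemann_integral X N F I 0 t" and t: "t \<ge> 0"
 shows "((\<lambda>s. J (F s)) has_integral J I) {0..t}"
 unfolding has_integral_real
proof (intro allI impI)
 fix e :: real assume e: "e > 0"
 have FX: "F s \<in> X" if "s \<in> {0..t}" for s using h that by (simp add: has_riemann_integral_def)
 have IX: "I \<in> X" using h by (simp add: has_riemann_integral_def)
 obtain r where r: "r > 0" "\<And>p. p tagged_division_of {0..t} ==> (\<lambda>s. ball s r) fine p ==>
   N (\<lambda>x. (\<Sum>(s, K)\<in>p. measure lborel K *\<^sub>R F s x) - I x) < e / 4"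
  using h e unfolding has_riemann_integral_def by (meson divide_pos_pos zero_less_numeral)
 have "norm ((\<Sum>(s, K)\<in>p. measure lborel K *\<^sub>R J (F s)) - J I) < e"
  if p: "p tagged_division_of {0..t}" "(\<lambda>s. ball s r) fine p" for p
 proof -
  have "\<forall>s\<in>{0..t}. F s \<in> X" using FX by blast
  note S = J_riemann_sum[OF p(1) this]
  have "norm (J (\<lambda>x. (\<Sum>(s, K)\<in>p. measure lborel K *\<^sub>R F s x) - I x)) \<le>
    4 * N (\<lambda>x. (\<Sum>(s, K)\<in>p. measure lborel K *\<^sub>R F s x) - I x)"
   by (rule J_le_N[OF X_diff[OF S(1) IX]])
  thus ?thesis using r(2)[OF p] unfolding J_diff[OF S(1) IX] S(2) by linarith
 qed
 thus "\<exists>\<gamma>. gauge \<gamma> \<and> (\<forall>d. d tagged_division_of {0..t} \<and> \<gamma> fine d -->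
   norm ((\<Sum>(s, K)\<in>d. measure lborel K *\<^sub>R J (F s)) - J I) < e)"
  using r(1) by (intro exI[of _ "\<lambda>s. ball s r"]) auto
qed

text \<open>The converse direction, for the constructed solution, whose integrand is
  continuous.\<close>

lemma riemann_of_continuous:
 assumes F: "\<And>s. s \<in> {0..t} ==> F s \<in> X" and c: "continuous_on {0..t} (\<lambda>s. J (F s))" and I: "I \<in> X"
  and JI: "J I = integral {0..t} (\<lambda>s. J (F s))" and t: "t \<ge> 0"
 shows "has_riemann_integral X N F I 0 t"
 unfolding has_riemann_integral_def
proof (intro conjI ballI allI impI)
 fix e :: real assume e: "e > 0"
 define d where "d = e / (2 * (t + 1))"
 have d: "d > 0" using e t by (simp add: d_def)
 have "uniformly_continuous_on {0..t} (\<lambda>s. J (F s))" by (rule compact_uniformly_continuous[OF c]) simp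
 then obtain r where r: "r > 0" "\<And>s s'. s \<in> {0..t} ==> s' \<in> {0..t} ==> dist s' s < r ==> dist (J (F s')) (J (F s)) < d"
  using d unfolding uniformly_continuous_on_def by blast
 have "N (\<lambda>x. (\<Sum>(s, K)\<in>p. measure lborel K *\<^sub>R F s x) - I x) < e"
  if p: "p tagged_division_of {0..t}" "(\<lambda>s. ball s r) fine p" for p
 proof -
  have "\<forall>s\<in>{0..t}. F s \<in> X" using F by blast
  note S = J_riemann_sum[OF p(1) this]
  have "N (\<lambda>x. (\<Sum>(s, K)\<in>p. measure lborel K *\<^sub>R F s x) - I x) \<le>
    norm ((\<Sum>(s, K)\<in>p. measure lborel K *\<^sub>R J (F s)) - integral {0..t} (\<lambda>s. J (F s)))"
   using N_le_J[OF X_diff[OF S(1) I]] unfolding J_diff[OF S(1) I] S(2) JI .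
  also have "\<dots> \<le> d * (t - 0)"
   by (rule riemann_sum_error[OF c t _ _ p]) (use r(2) d in \<open>auto intro: less_imp_le\<close>)
  also have "\<dots> < e" using e t by (simp add: d_def field_simps add_nonneg_pos)
  finally show ?thesis .
 qed
 thus "\<exists>r>0. \<forall>p. p tagged_division_of {0..t} \<and> (\<lambda>s. ball s r) fine p -->
   N (\<lambda>x. (\<Sum>(s, K)\<in>p. measure lborel K *\<^sub>R F s x) - I x) < e"
  using r(1) by blast
qed (use F I in auto)

end

text \<open>f(a)p - f(b)q = (f(a) - f(b))p + f(b)(p - q), with the Lipschitz bound of the power
  series for the factors in f. Keeping p and q separate from a and b allows p and q to carry the
  weight while a and b do not.\<close>

lemma arrhenius_product_estimate:
 assumes k: "2 * real k \<ge> real CARD('n) + 1" and \<kappa>: "\<kappa> > 0"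
 obtains L r where "L \<ge> 0" "r > 0"
  "\<And>a b p q :: 'n::finite fn. a \<in> Hspace k ==> b \<in> Hspace k ==> p \<in> Hspace k ==> q \<in> Hspace k ==>
   Hnorm k a \<le> r ==> Hnorm k b \<le> r ==>
   (\<lambda>x. (arrhenius (a x + 1 / \<kappa>) - arrhenius (1 / \<kappa>)) * p x - (arrhenius (b x + 1 / \<kappa>) - arrhenius (1 / \<kappa>)) * q x) \<in> Hspace k \<and>
   Hnorm k (\<lambda>x. (arrhenius (a x + 1 / \<kappa>) - arrhenius (1 / \<kappa>)) * p x - (arrhenius (b x + 1 / \<kappa>) - arrhenius (1 / \<kappa>)) * q x)
    \<le> L * (Hnorm k (\<lambda>x. a x - b x) * Hnorm k p + Hnorm k b * Hnorm k (\<lambda>x. p x - q x))"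
proof -
 obtain K where K: "K \<ge> 1"
  and alg: "\<And>a b. a \<in> Hspace k ==> b \<in> Hspace k ==> (\<lambda>x::real^'n. a x * b x) \<in> Hspace k"
  "\<And>a b :: 'n fn. a \<in> Hspace k ==> b \<in> Hspace k ==> Hnorm k (\<lambda>x. a x * b x) \<le> K * Hnorm k a * Hnorm k b"
  and sup: "\<And>u. u \<in> Hspace k ==> AE x::real^'n in lebesgue. \<bar>u x\<bar> \<le> K * Hnorm k u"
  using Hspace_constant[OF k] by blast
 define f where "f x = arrhenius (x + 1 / \<kappa>) - arrhenius (1 / \<kappa>)" for x
 obtain cf where cf: "summable (\<lambda>n. \<bar>cf n\<bar> * real (Suc n) * (1 / (2 * \<kappa>)) ^ n)"
  "\<And>x. \<bar>x\<bar> \<le> 1 / (2 * \<kappa>) ==> (\<lambda>n. cf n * x ^ Suc n) sums f x"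
  using arrhenius_series[OF \<kappa>] unfolding f_def by blast
 have r0: "1 / (2 * \<kappa>) > 0" using \<kappa> by simp
 define R where "R = 1 / (2 * \<kappa>) / K"
 define M where "M = (\<Sum>n. \<bar>cf n\<bar> * real (Suc n) * (1 / (2 * \<kappa>)) ^ n)"
 have R: "R > 0" using K \<kappa> by (simp add: R_def)
 have M: "M \<ge> 0" unfolding M_def using \<kappa> by (intro suminf_nonneg cf(1)) auto
 have lip: "(\<lambda>x. f (a x) - f (b x)) \<in> Hspace k" "Hnorm k (\<lambda>x. f (a x) - f (b x)) \<le> M * Hnorm k (\<lambda>x. a x - b x)"
  if "a \<in> Hspace k" "Hnorm k a \<le> R" "b \<in> Hspace k" "Hnorm k b \<le> R" for a b :: "'n fn"
  using Hspace_series[OF K alg sup r0 cf that[unfolded R_def]] unfolding M_def by blast+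
 have f0: "f 0 = 0" by (simp add: f_def)
 have "(\<lambda>x. f (a x) * p x - f (b x) * q x) \<in> Hspace k \<and>
   Hnorm k (\<lambda>x. f (a x) * p x - f (b x) * q x) \<le> (K * M) * (Hnorm k (\<lambda>x. a x - b x) * Hnorm k p + Hnorm k b * Hnorm k (\<lambda>x. p x - q x))"
  if a: "a \<in> Hspace k" and b: "b \<in> Hspace k" and p: "p \<in> Hspace k" and q: "q \<in> Hspace k"
   and n: "Hnorm k a \<le> R" "Hnorm k b \<le> R" for a b p q :: "'n fn"
 proof -
  have z: "Hnorm k (\<lambda>x::real^'n. 0) = 0" using Hnorm_cmult[OF Hspace_zero, of k 0] by simp
  have zz: "Hnorm k (\<lambda>x::real^'n. 0) \<le> R" using z R by simp
  note 1 = lip[OF a n(1) b n(2)]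
  have 2: "(\<lambda>x. f (b x)) \<in> Hspace k" "Hnorm k (\<lambda>x. f (b x)) \<le> M * Hnorm k b"
   using lip[OF b n(2) Hspace_zero zz] by (simp_all add: f0)
  note pq = Hspace_diff[OF p q]
  have eq: "(\<lambda>x. f (a x) * p x - f (b x) * q x) = (\<lambda>x. (f (a x) - f (b x)) * p x + f (b x) * (p x - q x))"
   by (auto simp: algebra_simps)
  have "Hnorm k (\<lambda>x. (f (a x) - f (b x)) * p x + f (b x) * (p x - q x)) \<le>
    Hnorm k (\<lambda>x. (f (a x) - f (b x)) * p x) + Hnorm k (\<lambda>x. f (b x) * (p x - q x))"
   by (intro Hnorm_triangle alg 1 2 p pq)
  also have "\<dots> \<le> K * Hnorm k (\<lambda>x. f (a x) - f (b x)) * Hnorm k p + K * Hnorm k (\<lambda>x. f (b x)) * Hnorm k (\<lambda>x. p x - q x)"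
   by (intro add_mono alg 1 2 p pq)
  also have "\<dots> \<le> K * (M * Hnorm k (\<lambda>x. a x - b x)) * Hnorm k p + K * (M * Hnorm k b) * Hnorm k (\<lambda>x. p x - q x)"
   using K by (intro add_mono mult_right_mono mult_left_mono 1 2) auto
  also have "\<dots> = (K * M) * (Hnorm k (\<lambda>x. a x - b x) * Hnorm k p + Hnorm k b * Hnorm k (\<lambda>x. p x - q x))"
   by (simp add: algebra_simps)
  finally show ?thesis unfolding eq by (intro conjI Hspace_add alg 1 2 p pq)
 qed
 note est = this
 show thesis
 proof (rule that[of "K * M" R])
  show "0 \<le> K * M" "R > 0" using K M R by simp_all
 qed (rule est[unfolded f_def])
qed

section \<open>The semigroup of the linear part\<close>

locale combustion = sobolev_pair k z \<alpha>
 for k :: nat and z :: "'n::finite" and \<alpha> :: real +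
 fixes c \<kappa> \<epsilon> :: real and T :: "real => (real^'n => real \<times> real) => real^'n => real \<times> real"
 assumes k2: "2 * real k \<ge> real CARD('n) + 1"
  and par: "c > 0" "\<kappa> > 0" "0 \<le> \<epsilon>" "\<epsilon> < 1" "0 < \<alpha>" "\<alpha> < c / 2"
  and lin: "is_linear_semigroup k z \<alpha> c \<epsilon> \<kappa> T"
begin

definition rep where "rep = inv_into X J"

definition S :: "real => _" where "S t y = J (T t (rep y))"

lemma rep: "y \<in> J ` X ==> rep y \<in> X" "y \<in> J ` X ==> J (rep y) = y"
 unfolding rep_def by (erule inv_into_into, erule f_inv_into_f)

lemma C0: "C0_semigroup X N T" "generator_graph X N T = linear_part_graph k z \<alpha> c \<epsilon> \<kappa>"
 using lin by (simp_all add: is_linear_semigroup_def X_def N_def)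

lemmas C0_unfolded = C0(1)[unfolded C0_semigroup_def]

lemma T_X: "t \<ge> 0 ==> u \<in> X ==> T t u \<in> X"
 by (rule C0_unfolded[THEN conjunct1, rule_format])

lemma T_linear: "t \<ge> 0 ==> u \<in> X ==> w \<in> X ==>
  N (\<lambda>x. T t (\<lambda>y. a *\<^sub>R u y + b *\<^sub>R w y) x - (a *\<^sub>R T t u x + b *\<^sub>R T t w x)) = 0"
 by (rule C0_unfolded[THEN conjunct2, THEN conjunct1, rule_format])

lemma T_bounded: "t \<ge> 0 ==> \<exists>M. \<forall>u\<in>X. N (T t u) \<le> M * N u"
 by (rule C0_unfolded[THEN conjunct2, THEN conjunct2, THEN conjunct1, rule_format])

lemma T_0: "u \<in> X ==> N (\<lambda>x. T 0 u x - u x) = 0"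
 by (rule C0_unfolded[THEN conjunct2, THEN conjunct2, THEN conjunct2, THEN conjunct1, rule_format])

lemma T_plus: "s \<ge> 0 ==> t \<ge> 0 ==> u \<in> X ==> N (\<lambda>x. T (s + t) u x - T s (T t u) x) = 0"
 by (rule C0_unfolded[THEN conjunct2, THEN conjunct2, THEN conjunct2, THEN conjunct2, THEN conjunct1, rule_format])

lemma T_cont: "u \<in> X ==> ((\<lambda>t. N (\<lambda>x. T t u x - u x)) \<longlongrightarrow> 0) (at_right 0)"
 by (rule C0_unfolded[THEN conjunct2, THEN conjunct2, THEN conjunct2, THEN conjunct2, THEN conjunct2, rule_format])

lemma T_lincomb:
 assumes t: "t \<ge> 0" and u: "u \<in> X" and w: "w \<in> X"
 shows "J (T t (\<lambda>x. a *\<^sub>R u x + b *\<^sub>R w x)) = a *\<^sub>R J (T t u) + b *\<^sub>R J (T t w)"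
proof -
 have "N (\<lambda>x. T t (\<lambda>y. a *\<^sub>R u y + b *\<^sub>R w y) x - (a *\<^sub>R T t u x + b *\<^sub>R T t w x)) = 0"
  by (rule T_linear[OF t u w])
 from this[unfolded N_diff_0[OF T_X[OF t X_lincomb(1)[OF u w]] X_lincomb(1)[OF T_X[OF t u] T_X[OF t w]]]]
 show ?thesis by (simp add: X_lincomb(2)[OF T_X[OF t u] T_X[OF t w]])
qed

text \<open>\<open>S\<close> evaluates \<open>T\<close> at a chosen representative. Two
  representatives differ by some d with N d = 0; boundedness gives N (T t d) = 0, and linearity
  modulo null functions shows that the choice does not matter.\<close>

lemma S_J:
 assumes t: "t \<ge> 0" and u: "u \<in> X" shows "S t (J u) = J (T t u)"
proof -
 define w where "w = rep (J u)"
 have w: "w \<in> X" "J w = J u" using rep[of "J u"] u by (auto simp: w_def)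
 define d where "d = (\<lambda>x. 1 *\<^sub>R w x + (- 1) *\<^sub>R u x)"
 have d: "d \<in> X" "J d = 0" unfolding d_def using X_lincomb[OF w(1) u, of 1 "-1"] w(2) by simp_all
 obtain M where M: "\<And>u. u \<in> X ==> N (T t u) \<le> M * N u" using T_bounded[OF t] by blast
 have "N d = 0" using N_le_J[OF d(1)] N_nonneg[of d] d(2) by simp
 hence "N (T t d) \<le> 0" using M[OF d(1)] by simp
 hence "norm (J (T t d)) \<le> 0" using J_le_N[OF T_X[OF t d(1)]] by linarith
 moreover have "J (T t d) = J (T t w) - J (T t u)" unfolding d_def using T_lincomb[OF t w(1) u, of 1 "-1"] by simp
 ultimately show ?thesis by (simp add: S_def w_def)
qed

sublocale sg: semigroup_on "J ` X" S
proof
 show "subspace (J ` X)" by (rule subspace_JX)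
 show "closed (J ` X)" by (rule closed_JX)
 show "S t y \<in> J ` X" if "t \<ge> 0" "y \<in> J ` X" for t y
  using that by (auto simp: S_J intro: T_X)
 show "S t (x + y) = S t x + S t y" if t: "t \<ge> 0" and xy: "x \<in> J ` X" "y \<in> J ` X" for t x y
 proof -
  obtain u w where u: "u \<in> X" "x = J u" and w: "w \<in> X" "y = J w" using xy by blast
  have "x + y = J (\<lambda>x. 1 *\<^sub>R u x + 1 *\<^sub>R w x)" using X_lincomb(2)[OF u(1) w(1), of 1 1] u w by simp
  thus ?thesis using S_J[OF t X_lincomb(1)[OF u(1) w(1), of 1 1]] T_lincomb[OF t u(1) w(1), of 1 1] u w
   by (simp add: S_J[OF t])
 qed
 show "S t (a *\<^sub>R x) = a *\<^sub>R S t x" if t: "t \<ge> 0" and xX: "x \<in> J ` X" for t x a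
 proof -
  obtain u where u: "u \<in> X" "x = J u" using xX by blast
  have "a *\<^sub>R x = J (\<lambda>x. a *\<^sub>R u x + 0 *\<^sub>R u x)" using X_lincomb(2)[OF u(1) u(1), of a 0] u by simp
  thus ?thesis using S_J[OF t X_lincomb(1)[OF u(1) u(1), of a 0]] T_lincomb[OF t u(1) u(1), of a 0] u
   by (simp add: S_J[OF t])
 qed
 show "\<exists>M. \<forall>y\<in>J ` X. norm (S t y) \<le> M * norm y" if t: "t \<ge> 0" for t
 proof -
  obtain M where M: "\<And>u. u \<in> X ==> N (T t u) \<le> M * N u" using T_bounded[OF t] by blast
  have "norm (S t (J u)) \<le> (4 * \<bar>M\<bar>) * norm (J u)" if u: "u \<in> X" for u
  proof -
   have "norm (S t (J u)) \<le> 4 * N (T t u)" unfolding S_J[OF t u] by (rule J_le_N[OF T_X[OF t u]])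
   also have "\<dots> \<le> 4 * (\<bar>M\<bar> * N u)" using M[OF u] mult_right_mono[OF abs_ge_self N_nonneg, of M u] by linarith
   also have "\<dots> \<le> 4 * (\<bar>M\<bar> * norm (J u))" using N_le_J[OF u] by (intro mult_left_mono) auto
   finally show ?thesis by simp
  qed
  thus ?thesis by blast
 qed
 show "S 0 y = y" if yX: "y \<in> J ` X" for y
 proof -
  obtain u where u: "u \<in> X" "y = J u" using yX by blast
  have "N (\<lambda>x. T 0 u x - u x) = 0" by (rule T_0[OF u(1)])
  thus ?thesis using N_diff_0[OF T_X[of 0 u] u(1)] u by (simp add: S_J)
 qed
 show "S (s + t) y = S s (S t y)" if s: "s \<ge> 0" and t: "t \<ge> 0" and yX: "y \<in> J ` X" for s t y
 proof -
  obtain u where u: "u \<in> X" "y = J u" using yX by blast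
  have "N (\<lambda>x. T (s + t) u x - T s (T t u) x) = 0" by (rule T_plus[OF s t u(1)])
  thus ?thesis using N_diff_0[OF T_X[of "s + t" u] T_X[OF s T_X[OF t u(1)]]] u s t by (simp add: S_J T_X)
 qed
 show "((\<lambda>t. S t y) \<longlongrightarrow> y) (at_right 0)" if yX: "y \<in> J ` X" for y
 proof -
  obtain u where u: "u \<in> X" "y = J u" using yX by blast
  have "((\<lambda>t. N (\<lambda>x. T t u x - u x)) \<longlongrightarrow> 0) (at_right 0)" by (rule T_cont[OF u(1)])
  from tendsto_mult_right_zero[OF this] have z: "((\<lambda>t. 4 * N (\<lambda>x. T t u x - u x)) \<longlongrightarrow> 0) (at_right 0)" .
  have "\<forall>\<^sub>F t in at_right 0. norm (S t y - y) \<le> 4 * N (\<lambda>x. T t u x - u x)"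
   using eventually_at_right_less[of "0::real"]
  proof eventually_elim
   case (elim t)
   hence t: "t \<ge> 0" by simp
   show ?case using J_le_N[OF X_diff[OF T_X[OF t u(1)] u(1)]] J_diff[OF T_X[OF t u(1)] u(1)] S_J[OF t u(1)] u(2) by simp
  qed
  from Lim_null_comparison[OF this z] show ?thesis by (simp add: LIM_zero_iff)
 qed
qed

text \<open>Convergence in the Banach space norm implies convergence in \<open>N\<close>, so an
  element of the generator of \<open>S\<close> comes from the generator of \<open>T\<close>, for
  which \<open>is_linear_semigroup\<close> supplies the differential equations.\<close>

lemma gen_cases:
 assumes "(y, f) \<in> sg.gen"
 obtains u g where "u \<in> X" "g \<in> X" "y = J u" "f = J g"
  "weak_drift_diffusion z 1 c (\<lambda>x. fst (u x)) (\<lambda>x. fst (g x) - exp (- \<kappa>) * snd (u x))"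
  "weak_drift_diffusion z \<epsilon> c (\<lambda>x. snd (u x)) (\<lambda>x. snd (g x) + \<kappa> * exp (- \<kappa>) * snd (u x))"
proof -
 from assms obtain u g where u: "u \<in> X" "y = J u" and g: "g \<in> X" "f = J g"
  and lim: "((\<lambda>h. (1 / h) *\<^sub>R (S h y - y)) \<longlongrightarrow> f) (at_right 0)"
  unfolding sg.gen_def by blast
 have z: "((\<lambda>h. norm ((1 / h) *\<^sub>R (S h y - y) - f)) \<longlongrightarrow> 0) (at_right 0)"
  using lim by (simp add: tendsto_norm_zero_iff LIM_zero_iff)
 have "\<forall>\<^sub>F h in at_right 0. norm (N (\<lambda>x. (1 / h) *\<^sub>R (T h u x - u x) - g x)) \<le> norm ((1 / h) *\<^sub>R (S h y - y) - f)"
  using eventually_at_right_less[of "0::real"]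
 proof eventually_elim
  case (elim h)
  hence h: "h \<ge> 0" by simp
  note d = X_diff[OF T_X[OF h u(1)] u(1)]
  have "N (\<lambda>x. (1 / h) *\<^sub>R (T h u x - u x) - g x) \<le> norm (J (\<lambda>x. (1 / h) *\<^sub>R (T h u x - u x) - g x))"
   by (rule N_le_J[OF X_diff[OF X_scale[OF d] g(1)]])
  also have "J (\<lambda>x. (1 / h) *\<^sub>R (T h u x - u x) - g x) = (1 / h) *\<^sub>R (S h y - y) - f"
   unfolding J_diff[OF X_scale[OF d] g(1)] J_scale[OF d] J_diff[OF T_X[OF h u(1)] u(1)] u(2) g(2) S_J[OF h u(1)] ..
  finally show ?case using N_nonneg by simp
 qed
 from Lim_null_comparison[OF this z] have "(u, g) \<in> generator_graph X N T"
  using u g by (simp add: generator_graph_def)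
 thus thesis using that u g unfolding C0(2) linear_part_graph_def by (simp add: o_def)
qed

end

section \<open>Dissipativity of the linear part\<close>

abbreviation wmul :: "'n::finite => real => 'n fn => 'n fn" where
 "wmul z \<beta> u \<equiv> \<lambda>x. weight z \<beta> x * u x"

text \<open>The coupling adds h exp(-\<kappa>) times the norm of the second component to the first
  estimate. Multiplied by 1/\<kappa>, the extra damping \<kappa> exp(-\<kappa>) of the second
  equation contributes exactly this amount on the other side, so the two cancel in the sum. As
  \<epsilon> < 1, the second diffusion does not push the rate below c\<beta> - \<beta>^2. The uses
  are \<beta> = 0 and \<beta> = \<alpha>.\<close>

lemma Hnorm_drift_pair:
 fixes u1 u2 g1 g2 :: "'n::finite fn"
 assumes eq1: "weak_drift_diffusion z 1 c u1 (\<lambda>x. g1 x - exp (- \<kappa>) * u2 x)"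
  and eq2: "weak_drift_diffusion z \<epsilon> c u2 (\<lambda>x. g2 x + \<kappa> * exp (- \<kappa>) * u2 x)"
  and u: "(wmul z \<beta> u1) \<in> Hspace k" "(wmul z \<beta> u2) \<in> Hspace k"
  and g: "(wmul z \<beta> g1) \<in> Hspace k" "(wmul z \<beta> g2) \<in> Hspace k"
  and \<kappa>: "\<kappa> > 0" and \<epsilon>: "0 \<le> \<epsilon>" "\<epsilon> < 1" and \<beta>: "c * \<beta> - \<beta>\<^sup>2 \<ge> 0" and h: "h > 0"
 shows "(1 + h * (c * \<beta> - \<beta>\<^sup>2 + \<kappa> * exp (- \<kappa>))) * Hnorm k (wmul z \<beta> u2)
   \<le> Hnorm k (\<lambda>x. wmul z \<beta> u2 x - h * (wmul z \<beta> g2 x))"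
  and "(1 + h * (c * \<beta> - \<beta>\<^sup>2)) * (Hnorm k (wmul z \<beta> u1) + 1 / \<kappa> * Hnorm k (wmul z \<beta> u2))
   \<le> Hnorm k (\<lambda>x. wmul z \<beta> u1 x - h * (wmul z \<beta> g1 x)) +
    1 / \<kappa> * Hnorm k (\<lambda>x. wmul z \<beta> u2 x - h * (wmul z \<beta> g2 x))"
proof -
 define s where "s = c * \<beta> - \<beta>\<^sup>2"
 define e where "e = exp (- \<kappa>)"
 define H1 H2 H1' H2' where "H1 = Hnorm k (wmul z \<beta> u1)" and "H2 = Hnorm k (wmul z \<beta> u2)"
  and "H1' = Hnorm k (\<lambda>x. wmul z \<beta> u1 x - h * (wmul z \<beta> g1 x))"
  and "H2' = Hnorm k (\<lambda>x. wmul z \<beta> u2 x - h * (wmul z \<beta> g2 x))"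
 have e: "e > 0" by (simp add: e_def)
 have s: "s \<ge> 0" using \<beta> by (simp add: s_def)
 have H2: "H2 \<ge> 0" by (simp add: H2_def)
 have le: "s \<le> c * \<beta> - \<epsilon> * \<beta>\<^sup>2" using \<epsilon> mult_right_mono[of \<epsilon> 1 "\<beta>\<^sup>2"] by (simp add: s_def)
 have "\<kappa> * e > 0" using \<kappa> e by simp
 hence "0 \<le> h * (c * \<beta> - \<epsilon> * \<beta>\<^sup>2 + \<kappa> * e)" using h le s by (intro mult_nonneg_nonneg) auto
 hence "(1 + h * (c * \<beta> - \<epsilon> * \<beta>\<^sup>2 + \<kappa> * e)) * H2 \<le> H2'"
  unfolding H2_def H2'_def e_def by (intro drift_resolvent[OF eq2 u(2) g(2) \<epsilon>(1)]) (use h in auto)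
 moreover have "(1 + h * (s + \<kappa> * e)) * H2 \<le> (1 + h * (c * \<beta> - \<epsilon> * \<beta>\<^sup>2 + \<kappa> * e)) * H2"
  using le h H2 by (intro mult_right_mono add_left_mono mult_left_mono) auto
 ultimately have A: "(1 + h * (s + \<kappa> * e)) * H2 \<le> H2'" by linarith
 thus "(1 + h * (c * \<beta> - \<beta>\<^sup>2 + \<kappa> * exp (- \<kappa>))) * Hnorm k (wmul z \<beta> u2)
   \<le> Hnorm k (\<lambda>x. wmul z \<beta> u2 x - h * (wmul z \<beta> g2 x))" by (simp add: s_def e_def H2_def H2'_def)
 have eq1': "weak_drift_diffusion z 1 c u1 (\<lambda>x. (g1 x - e * u2 x) + 0 * u1 x)" using eq1 by (simp add: e_def)
 have w: "(\<lambda>x. weight z \<beta> x * (g1 x - e * u2 x)) = (\<lambda>x. 1 * (wmul z \<beta> g1 x) + (- e) * (wmul z \<beta> u2 x))"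
  by (auto simp: algebra_simps)
 have wH: "(\<lambda>x. weight z \<beta> x * (g1 x - e * u2 x)) \<in> Hspace k" unfolding w by (intro Hspace_lincomb u g)
 have "(1 + h * (c * \<beta> - 1 * \<beta>\<^sup>2 + 0)) * H1 \<le> Hnorm k (\<lambda>x. wmul z \<beta> u1 x - h * (weight z \<beta> x * (g1 x - e * u2 x)))"
  unfolding H1_def by (rule drift_resolvent[OF eq1' u(1) wH]) (use h s in \<open>auto simp: s_def intro: add_pos_nonneg\<close>)
 also have "(\<lambda>x. wmul z \<beta> u1 x - h * (weight z \<beta> x * (g1 x - e * u2 x))) =
   (\<lambda>x. (wmul z \<beta> u1 x - h * (wmul z \<beta> g1 x)) + (h * e) * (wmul z \<beta> u2 x))"
  by (auto simp: algebra_simps)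
 also have "Hnorm k \<dots> \<le> H1' + Hnorm k (\<lambda>x. (h * e) * (wmul z \<beta> u2 x))"
  unfolding H1'_def by (intro Hnorm_triangle Hspace_diff Hspace_cmult u g)
 also have "\<dots> = H1' + h * e * H2" using h e unfolding H2_def by (subst Hnorm_cmult[OF u(2)]) simp
 finally have B: "(1 + h * s) * H1 \<le> H1' + h * e * H2" by (simp add: s_def)
 have "1 / \<kappa> * ((1 + h * (s + \<kappa> * e)) * H2) \<le> 1 / \<kappa> * H2'" using A \<kappa> by (intro mult_left_mono) auto
 moreover have "1 / \<kappa> * ((1 + h * (s + \<kappa> * e)) * H2) = (1 + h * s) * (1 / \<kappa> * H2) + h * e * H2"
  using \<kappa> by (simp add: field_simps)
 ultimately have "(1 + h * s) * (H1 + 1 / \<kappa> * H2) \<le> H1' + 1 / \<kappa> * H2'" using B by (simp add: distrib_left)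
 thus "(1 + h * (c * \<beta> - \<beta>\<^sup>2)) * (Hnorm k (wmul z \<beta> u1) + 1 / \<kappa> * Hnorm k (wmul z \<beta> u2))
   \<le> Hnorm k (\<lambda>x. wmul z \<beta> u1 x - h * (wmul z \<beta> g1 x)) +
    1 / \<kappa> * Hnorm k (\<lambda>x. wmul z \<beta> u2 x - h * (wmul z \<beta> g2 x))"
  by (simp add: s_def H1_def H2_def H1'_def H2'_def)
qed

context combustion
begin

definition \<sigma> where "\<sigma> = c * \<alpha> - \<alpha>\<^sup>2"

definition \<mu> where "\<mu> = \<kappa> * exp (- \<kappa>)"

lemma rates_pos: "\<sigma> > 0" "\<mu> > 0"
proof -
 have "\<alpha> * (c - \<alpha>) > 0" using par by (intro mult_pos_pos) auto
 thus "\<sigma> > 0" by (simp add: \<sigma>_def algebra_simps power2_eq_square)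
 show "\<mu> > 0" using par by (simp add: \<mu>_def)
qed

lemma components_diff:
 assumes u: "u \<in> X" and g: "g \<in> X"
 shows "nrm1 (J u - h *\<^sub>R J g) = Hnorm k (\<lambda>x. fst (u x) - h * fst (g x))"
  "nrm2 (J u - h *\<^sub>R J g) = Hnorm k (\<lambda>x. snd (u x) - h * snd (g x))"
  "nrm3 (J u - h *\<^sub>R J g) = Hnorm k (\<lambda>x. wt (\<lambda>x. fst (u x)) x - h * wt (\<lambda>x. fst (g x)) x)"
  "nrm4 (J u - h *\<^sub>R J g) = Hnorm k (\<lambda>x. wt (\<lambda>x. snd (u x)) x - h * wt (\<lambda>x. snd (g x)) x)"
proof -
 define d where "d = (\<lambda>x. 1 *\<^sub>R u x + (- h) *\<^sub>R g x)"
 have d: "d \<in> X" "J d = J u - h *\<^sub>R J g" unfolding d_def using X_lincomb[OF u g, of 1 "- h"] by simp_all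
 have f: "fst (d x) = fst (u x) - h * fst (g x)" "snd (d x) = snd (u x) - h * snd (g x)" for x by (simp_all add: d_def)
 have w: "wt (\<lambda>x. p x - h * q x) = (\<lambda>x. wt p x - h * wt q x)" for p q by (auto simp: algebra_simps)
 note cJ = components_J[OF d(1), unfolded f w d(2)]
 show "nrm1 (J u - h *\<^sub>R J g) = Hnorm k (\<lambda>x. fst (u x) - h * fst (g x))" by (rule cJ)
 show "nrm2 (J u - h *\<^sub>R J g) = Hnorm k (\<lambda>x. snd (u x) - h * snd (g x))" by (rule cJ)
 show "nrm3 (J u - h *\<^sub>R J g) = Hnorm k (\<lambda>x. wt (\<lambda>x. fst (u x)) x - h * wt (\<lambda>x. fst (g x)) x)" by (rule cJ)
 show "nrm4 (J u - h *\<^sub>R J g) = Hnorm k (\<lambda>x. wt (\<lambda>x. snd (u x)) x - h * wt (\<lambda>x. snd (g x)) x)" by (rule cJ)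
qed

lemma components_minus:
 assumes u: "u \<in> X" and g: "g \<in> X"
 shows "nrm1 (J u - J g) = Hnorm k (\<lambda>x. fst (u x) - fst (g x))"
  "nrm2 (J u - J g) = Hnorm k (\<lambda>x. snd (u x) - snd (g x))"
  "nrm3 (J u - J g) = Hnorm k (\<lambda>x. wt (\<lambda>x. fst (u x)) x - wt (\<lambda>x. fst (g x)) x)"
  "nrm4 (J u - J g) = Hnorm k (\<lambda>x. wt (\<lambda>x. snd (u x)) x - wt (\<lambda>x. snd (g x)) x)"
 using components_diff[OF u g, of 1] by (simp_all only: scaleR_one mult_1)

lemma dissipation:
 assumes yf: "(y, f) \<in> sg.gen" and h: "h > 0"
 shows "(1 + h * \<mu>) * nrm2 y \<le> nrm2 (y - h *\<^sub>R f)"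
  "(1 + h * 0) * (nrm1 y + 1 / \<kappa> * nrm2 y)
   \<le> nrm1 (y - h *\<^sub>R f) + 1 / \<kappa> * nrm2 (y - h *\<^sub>R f)"
  "(1 + h * \<sigma>) * (nrm3 y + 1 / \<kappa> * nrm4 y)
   \<le> nrm3 (y - h *\<^sub>R f) + 1 / \<kappa> * nrm4 (y - h *\<^sub>R f)"
proof -
 obtain u g where u: "u \<in> X" and g: "g \<in> X" and y: "y = J u" and f: "f = J g"
  and eq1: "weak_drift_diffusion z 1 c (\<lambda>x. fst (u x)) (\<lambda>x. fst (g x) - exp (- \<kappa>) * snd (u x))"
  and eq2: "weak_drift_diffusion z \<epsilon> c (\<lambda>x. snd (u x)) (\<lambda>x. snd (g x) + \<kappa> * exp (- \<kappa>) * snd (u x))"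
  by (rule gen_cases[OF yf])
 have w0: "weight z 0 x * p = p" for x :: "real^'n" and p by (simp add: weight_def)
 note uX = u[unfolded X_iff] and gX = g[unfolded X_iff]
 note pair0 = Hnorm_drift_pair[OF eq1 eq2, where \<beta> = 0 and k = k and h = h, unfolded w0]
 note pairw = Hnorm_drift_pair[OF eq1 eq2, where \<beta> = \<alpha> and k = k and h = h]
 note comp = components_J[OF u] components_diff[OF u g, of h]
 show "(1 + h * \<mu>) * nrm2 y \<le> nrm2 (y - h *\<^sub>R f)"
  unfolding y f comp \<mu>_def using pair0(1) uX gX par h by simp
 show "(1 + h * 0) * (nrm1 y + 1 / \<kappa> * nrm2 y)
   \<le> nrm1 (y - h *\<^sub>R f) + 1 / \<kappa> * nrm2 (y - h *\<^sub>R f)"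
  unfolding y f comp using pair0(2) uX gX par h by simp
 show "(1 + h * \<sigma>) * (nrm3 y + 1 / \<kappa> * nrm4 y)
   \<le> nrm3 (y - h *\<^sub>R f) + 1 / \<kappa> * nrm4 (y - h *\<^sub>R f)"
  unfolding y f comp \<sigma>_def
  by (rule pairw(2)) (use uX gX par h rates_pos(1) in \<open>auto simp: \<sigma>_def\<close>)
qed

lemma seminorm_lipschitz:
 fixes p q :: "'a::real_normed_vector => 'b::real_normed_vector"
 assumes "linear p" "linear q" and le: "\<And>x. norm (p x) \<le> norm x" "\<And>x. norm (q x) \<le> norm x" and a: "a \<ge> 0"
 shows "\<bar>(norm (p x) + a * norm (q x)) - (norm (p y) + a * norm (q y))\<bar> \<le> (1 + a) * norm (x - y)"
proof -
 have 1: "\<bar>norm (p x) - norm (p y)\<bar> \<le> norm (x - y)"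
  using norm_triangle_ineq3[of "p x" "p y"] le(1)[of "x - y"] by (simp add: linear_diff[OF assms(1)])
 have 2: "\<bar>norm (q x) - norm (q y)\<bar> \<le> norm (x - y)"
  using norm_triangle_ineq3[of "q x" "q y"] le(2)[of "x - y"] by (simp add: linear_diff[OF assms(2)])
 have "\<bar>(norm (p x) + a * norm (q x)) - (norm (p y) + a * norm (q y))\<bar> = \<bar>(norm (p x) - norm (p y)) + a * (norm (q x) - norm (q y))\<bar>"
  by (simp add: algebra_simps)
 also have "\<dots> \<le> \<bar>norm (p x) - norm (p y)\<bar> + \<bar>a * (norm (q x) - norm (q y))\<bar>" by (rule abs_triangle_ineq)
 also have "\<dots> = \<bar>norm (p x) - norm (p y)\<bar> + a * \<bar>norm (q x) - norm (q y)\<bar>" using a by (simp add: abs_mult)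
 also have "\<dots> \<le> norm (x - y) + a * norm (x - y)" by (intro add_mono mult_left_mono 1 2 a)
 finally show ?thesis by (simp add: distrib_right)
qed

lemma bounded_linear_components:
 "bounded_linear (\<lambda>y::('a::real_normed_vector \<times> 'b::real_normed_vector) \<times> ('c::real_normed_vector \<times> 'd::real_normed_vector). fst (fst y))"
 "bounded_linear (\<lambda>y::('a \<times> 'b) \<times> ('c \<times> 'd). snd (fst y))"
 "bounded_linear (\<lambda>y::('a \<times> 'b) \<times> ('c \<times> 'd). fst (snd y))"
 "bounded_linear (\<lambda>y::('a \<times> 'b) \<times> ('c \<times> 'd). snd (snd y))"
 by (rule bounded_linear_compose[OF bounded_linear_fst bounded_linear_fst] bounded_linear_compose[OF bounded_linear_snd bounded_linear_fst]
  bounded_linear_compose[OF bounded_linear_fst bounded_linear_snd] bounded_linear_compose[OF bounded_linear_snd bounded_linear_snd])+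

lemmas linear_components = bounded_linear_components[THEN bounded_linear.linear]

text \<open>The second bound has rate 0: in the plain norm the sum with factor 1/\<kappa> is merely
  nonincreasing, and its second term is dropped on the left.\<close>

lemma S_decay:
 assumes t: "t \<ge> 0" and y: "y \<in> J ` X"
 shows "nrm2 (S t y) \<le> exp (- \<mu> * t) * nrm2 y"
  "nrm1 (S t y) \<le> nrm1 y + 1 / \<kappa> * nrm2 y"
  "nrm3 (S t y) + 1 / \<kappa> * nrm4 (S t y)
   \<le> exp (- \<sigma> * t) * (nrm3 y + 1 / \<kappa> * nrm4 y)"
proof -
 have k0: "1 / \<kappa> \<ge> 0" using par by simp
 note lip1 = seminorm_lipschitz[OF linear_components(2,2) component_le_norm(2,2) order_refl, simplified]
 note lip2 = seminorm_lipschitz[OF linear_components(1,2) component_le_norm(1,2) k0]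
 note lip3 = seminorm_lipschitz[OF linear_components(3,4) component_le_norm(3,4) k0]
 show "nrm2 (S t y) \<le> exp (- \<mu> * t) * nrm2 y"
  by (rule sg.seminorm_decay[where P = "\<lambda>y. nrm2 y" and C = 1, OF _ dissipation(1) y t], unfold mult_1, rule lip1)
 have "nrm1 (S t y) + 1 / \<kappa> * nrm2 (S t y) \<le>
   exp (- 0 * t) * (nrm1 y + 1 / \<kappa> * nrm2 y)"
  by (rule sg.seminorm_decay[where P = "\<lambda>y. nrm1 y + 1 / \<kappa> * nrm2 y", OF lip2 dissipation(2) y t])
 moreover have "1 / \<kappa> * nrm2 (S t y) \<ge> 0" using par by simp
 ultimately show "nrm1 (S t y) \<le> nrm1 y + 1 / \<kappa> * nrm2 y" by simp
 show "nrm3 (S t y) + 1 / \<kappa> * nrm4 (S t y)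
   \<le> exp (- \<sigma> * t) * (nrm3 y + 1 / \<kappa> * nrm4 y)"
  by (rule sg.seminorm_decay[where P = "\<lambda>y. nrm3 y + 1 / \<kappa> * nrm4 y", OF lip3 dissipation(3) y t])
qed

definition G where "G y = J (nonlin \<kappa> (rep y))"

text \<open>\<open>B2\<close> and \<open>B4\<close> are the bilinear bounds for differences of the
  nonlinearity in the plain and the weighted norm. In both, the factor from the first component is
  unweighted.\<close>

definition B2 where "B2 v w = nrm1 (v - w) * nrm2 v + nrm1 w * nrm2 (v - w)"

definition B4 where "B4 v w = nrm1 (v - w) * nrm4 v + nrm1 w * nrm4 (v - w)"

definition nonlin_bounds where
 "nonlin_bounds L u w \<longleftrightarrow>
  nrm1 (J (nonlin \<kappa> u) - J (nonlin \<kappa> w)) \<le> L * B2 (J u) (J w) \<and>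
  nrm2 (J (nonlin \<kappa> u) - J (nonlin \<kappa> w)) \<le> \<kappa> * (L * B2 (J u) (J w)) \<and>
  nrm3 (J (nonlin \<kappa> u) - J (nonlin \<kappa> w)) \<le> L * B4 (J u) (J w) \<and>
  nrm4 (J (nonlin \<kappa> u) - J (nonlin \<kappa> w)) \<le> \<kappa> * (L * B4 (J u) (J w))"

text \<open>By \<open>wf\<close> the weight is shifted entirely onto the second component, so the
  weighted estimates are \<open>arrhenius_product_estimate\<close> with weighted p and q. Smallness
  of the plain first component keeps the power series convergent.\<close>

lemma nonlin_estimate:
 obtains L r where "L \<ge> 0" "r > 0"
  "\<And>u. u \<in> X ==> nrm1 (J u) \<le> r ==> nonlin \<kappa> u \<in> X"
  "\<And>u w. u \<in> X ==> w \<in> X ==> nrm1 (J u) \<le> r ==> nrm1 (J w) \<le> r ==> nonlin_bounds L u w"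
proof -
 define f where "f x = arrhenius (x + 1 / \<kappa>) - arrhenius (1 / \<kappa>)" for x
 obtain L r where L: "L \<ge> 0" "r > 0"
  and est: "\<And>a b p q :: 'n fn. a \<in> Hspace k ==> b \<in> Hspace k ==> p \<in> Hspace k ==> q \<in> Hspace k ==>
   Hnorm k a \<le> r ==> Hnorm k b \<le> r ==>
   (\<lambda>x. f (a x) * p x - f (b x) * q x) \<in> Hspace k \<and>
   Hnorm k (\<lambda>x. f (a x) * p x - f (b x) * q x) \<le> L * (Hnorm k (\<lambda>x. a x - b x) * Hnorm k p + Hnorm k b * Hnorm k (\<lambda>x. p x - q x))"
  using arrhenius_product_estimate[OF k2 par(2)] unfolding f_def by blast
 have fn: "fst (nonlin \<kappa> u x) = f (fst (u x)) * snd (u x)" "snd (nonlin \<kappa> u x) = - \<kappa> * (f (fst (u x)) * snd (u x))"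
  for u :: "real^'n => real \<times> real" and x by (simp_all add: nonlin_def f_def)
 have wf: "weight z \<alpha> x * (a * b) = a * (weight z \<alpha> x * b)" for x :: "real^'n" and a b by simp
 have f0: "f 0 = 0" by (simp add: f_def)
 have "Hnorm k (\<lambda>x::real^'n. 0) = 0" using Hnorm_cmult[OF Hspace_zero, of k 0] by simp
 hence z: "Hnorm k (\<lambda>x::real^'n. 0) \<le> r" using L by simp
 have NX: "nonlin \<kappa> u \<in> X" if u: "u \<in> X" "nrm1 (J u) \<le> r" for u
 proof -
  note uX = u(1)[unfolded X_iff]
  have n: "Hnorm k (\<lambda>x. fst (u x)) \<le> r" using u components_J by simp
  have "(\<lambda>x. f (fst (u x)) * p x) \<in> Hspace k" if "p \<in> Hspace k" for p
   using est[of "\<lambda>x. fst (u x)" "\<lambda>x. 0" p "\<lambda>x. 0"] that n z uX by (simp add: Hspace_zero)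
  thus ?thesis using uX unfolding X_iff fn wf by (intro conjI Hspace_cmult) auto
 qed
 show thesis
 proof (rule that[OF L NX])
  fix u w
  assume u: "u \<in> X" "nrm1 (J u) \<le> r" and w: "w \<in> X" "nrm1 (J w) \<le> r"
  note uX = u(1)[unfolded X_iff] and wX = w(1)[unfolded X_iff]
  have n: "Hnorm k (\<lambda>x. fst (u x)) \<le> r" "Hnorm k (\<lambda>x. fst (w x)) \<le> r" using u w components_J by simp_all
  note cd = components_minus[OF u(1) w(1)]
  note nd = components_minus[OF NX[OF u] NX[OF w], unfolded fn wf]
  have 1: "(\<lambda>x. f (fst (u x)) * snd (u x) - f (fst (w x)) * snd (w x)) \<in> Hspace k \<and>
    Hnorm k (\<lambda>x. f (fst (u x)) * snd (u x) - f (fst (w x)) * snd (w x)) \<le>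
    L * B2 (J u) (J w)"
   unfolding B2_def cd components_J[OF u(1)] components_J[OF w(1)] using uX wX n by (intro est) auto
  have 2: "(\<lambda>x. f (fst (u x)) * (weight z \<alpha> x * snd (u x)) - f (fst (w x)) * (weight z \<alpha> x * snd (w x))) \<in> Hspace k \<and>
    Hnorm k (\<lambda>x. f (fst (u x)) * (weight z \<alpha> x * snd (u x)) - f (fst (w x)) * (weight z \<alpha> x * snd (w x))) \<le>
    L * B4 (J u) (J w)"
   unfolding B4_def cd components_J[OF u(1)] components_J[OF w(1)] using uX wX n by (intro est) auto
  have m: "(\<lambda>x. - \<kappa> * a x - - \<kappa> * b x) = (\<lambda>x. (- \<kappa>) * (a x - b x))" for a b :: "'n fn" by (auto simp: algebra_simps)
  have mk: "Hnorm k (\<lambda>x. - \<kappa> * a x - - \<kappa> * b x) \<le> \<kappa> * M" if "(\<lambda>x. a x - b x) \<in> Hspace k \<and> Hnorm k (\<lambda>x. a x - b x) \<le> M" for a b :: "'n fn" and M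
   unfolding m Hnorm_cmult[OF conjunct1[OF that]] using that par by (simp add: mult_left_mono)
  show "nonlin_bounds L u w"
   unfolding nonlin_bounds_def nd using conjunct2[OF 1] mk[OF 1] conjunct2[OF 2] mk[OF 2] by (intro conjI)
 qed
qed

end

locale combustion_estimate = combustion k z \<alpha> c \<kappa> \<epsilon> T
 for k :: nat and z :: "'n::finite" and \<alpha> c \<kappa> \<epsilon> :: real and T +
 fixes L r :: real
 assumes L: "L \<ge> 0" and r: "r > 0"
  and nonlin_X: "\<And>u. u \<in> X ==> nrm1 (J u) \<le> r ==> nonlin \<kappa> u \<in> X"
  and nonlin_lipschitz: "\<And>u w. u \<in> X ==> w \<in> X ==> nrm1 (J u) \<le> r ==> nrm1 (J w) \<le> r ==>
   nonlin_bounds L u w"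
begin

text \<open>Independence of the representative: between two representatives of the same element all
  four Lipschitz bounds are 0.\<close>

lemma G_J:
 assumes u: "u \<in> X" "nrm1 (J u) \<le> r" shows "G (J u) = J (nonlin \<kappa> u)"
proof -
 define w where "w = rep (J u)"
 have w: "w \<in> X" "J w = J u" using rep[of "J u"] u by (simp_all add: w_def)
 hence wr: "nrm1 (J w) \<le> r" using u(2) by simp
 note b = nonlin_lipschitz[OF w(1) u(1) wr u(2), unfolded nonlin_bounds_def B2_def B4_def w(2) diff_self fst_zero snd_zero norm_zero mult_zero_left mult_zero_right add_0]
 let ?d = "J (nonlin \<kappa> w) - J (nonlin \<kappa> u)"
 have "norm ?d \<le> nrm1 ?d + nrm2 ?d + nrm3 ?d + nrm4 ?d"
  by (rule norm_le_components)
 also have "\<dots> \<le> 0" using b by linarith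
 finally show ?thesis by (simp add: G_def w_def)
qed

sublocale ds: decaying_system "J ` X" S "\<lambda>y. fst (fst y)" "\<lambda>y. snd (fst y)" "\<lambda>y. fst (snd y)" "\<lambda>y. snd (snd y)"
 "1 / \<kappa>" "min \<sigma> \<mu> / 2" "L * (1 + 2 * \<kappa>)" r G
proof (rule decaying_system.intro[OF sg.semigroup_on_axioms], rule decaying_system_axioms.intro)
 show "1 / \<kappa> > 0" "r > 0" using par r by simp_all
 show "min \<sigma> \<mu> / 2 > 0" using rates_pos by simp
 show "L * (1 + 2 * \<kappa>) \<ge> 0" using L par by (intro mult_nonneg_nonneg) auto
 have e: "exp (- \<mu> * t) \<le> exp (- (2 * (min \<sigma> \<mu> / 2)) * t)" "exp (- \<sigma> * t) \<le> exp (- (2 * (min \<sigma> \<mu> / 2)) * t)" if "t \<ge> 0" for t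
  using that by (auto intro: mult_right_mono)
 show "nrm2 (S t y) \<le> exp (- (2 * (min \<sigma> \<mu> / 2)) * t) * nrm2 y" if "t \<ge> 0" "y \<in> J ` X" for t y
  by (rule order_trans[OF S_decay(1)[OF that] mult_right_mono[OF e(1)[OF that(1)] norm_ge_zero]])
 show "nrm1 (S t y) \<le> nrm1 y + 1 / \<kappa> * nrm2 y" if "t \<ge> 0" "y \<in> J ` X" for t y
  by (rule S_decay(2)[OF that])
 show "nrm3 (S t y) + 1 / \<kappa> * nrm4 (S t y)
   \<le> exp (- (2 * (min \<sigma> \<mu> / 2)) * t) * (nrm3 y + 1 / \<kappa> * nrm4 y)" if "t \<ge> 0" "y \<in> J ` X" for t y
  by (rule order_trans[OF S_decay(3)[OF that] mult_right_mono[OF e(2)[OF that(1)]]]) (use par in simp)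
 show "G v \<in> J ` X" if "v \<in> J ` X" "nrm1 v \<le> r" for v
  using that by (auto simp: G_J intro: nonlin_X)
 show "G 0 = 0"
 proof -
  have "G (J (\<lambda>x. 0)) = J (nonlin \<kappa> (\<lambda>x. 0))" by (rule G_J[OF X_zero]) (use r in \<open>simp add: J_zero\<close>)
  moreover have "nonlin \<kappa> (\<lambda>x::real^'n. 0) = (\<lambda>x. 0)" by (rule ext) (simp add: nonlin_def zero_prod_def)
  ultimately show ?thesis by (simp add: J_zero)
 qed
 \<comment> \<open>One constant serves three purposes: L for \<open>p1\<close>, \<kappa>L for
   \<open>p2\<close>, and 2L\<kappa> for the weighted sum, where the two components contribute LD
   each and D <= \<kappa>D'.\<close>
 have L': "L \<le> L * (1 + 2 * \<kappa>)" "\<kappa> * L \<le> L * (1 + 2 * \<kappa>)" "2 * L * \<kappa> \<le> L * (1 + 2 * \<kappa>)"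
  using L par by (simp_all add: algebra_simps)
 fix v w assume "v \<in> J ` X" "w \<in> J ` X" and b: "nrm1 v \<le> r" "nrm1 w \<le> r"
 then obtain u u' where u: "u \<in> X" "v = J u" and u': "u' \<in> X" "w = J u'" by blast
 have Gv: "G v = J (nonlin \<kappa> u)" "G w = J (nonlin \<kappa> u')" using G_J u u' b by auto
 note est = nonlin_lipschitz[OF u(1) u'(1) b[unfolded u(2) u'(2)], unfolded nonlin_bounds_def, folded Gv u(2) u'(2)]
 define B where "B = B2 v w"
 have B: "B \<ge> 0" by (simp add: B_def B2_def)
 have "nrm1 (G v - G w) \<le> L * B" "nrm2 (G v - G w) \<le> \<kappa> * L * B"
  using est unfolding B_def by (simp_all only: mult.assoc)
 moreover note mult_right_mono[OF L'(1) B] mult_right_mono[OF L'(2) B]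
 ultimately have 1: "nrm1 (G v - G w) \<le> L * (1 + 2 * \<kappa>) * B" "nrm2 (G v - G w) \<le> L * (1 + 2 * \<kappa>) * B"
  by linarith+
 show "nrm1 (G v - G w) \<le> L * (1 + 2 * \<kappa>) *
   (nrm1 (v - w) * nrm2 v + nrm1 w * nrm2 (v - w))"
  using 1(1) by (simp only: B_def B2_def)
 show "nrm2 (G v - G w) \<le> L * (1 + 2 * \<kappa>) *
   (nrm1 (v - w) * nrm2 v + nrm1 w * nrm2 (v - w))"
  using 1(2) by (simp only: B_def B2_def)
 define D where "D = B4 v w"
 define D' where "D' = nrm1 (v - w) * (nrm3 v + 1 / \<kappa> * nrm4 v) +
   nrm1 w * (nrm3 (v - w) + 1 / \<kappa> * nrm4 (v - w))"
 have q: "norm b \<le> \<kappa> * (norm a + 1 / \<kappa> * norm b)" for a b using par by (simp add: distrib_left)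
 have "D \<le> nrm1 (v - w) * (\<kappa> * (nrm3 v + 1 / \<kappa> * nrm4 v)) +
   nrm1 w * (\<kappa> * (nrm3 (v - w) + 1 / \<kappa> * nrm4 (v - w)))"
  unfolding D_def B4_def by (intro add_mono mult_left_mono q norm_ge_zero)
 also have "\<dots> = \<kappa> * D'" by (simp only: D'_def distrib_left mult_ac)
 finally have DD: "D \<le> \<kappa> * D'" .
 have D': "D' \<ge> 0" using par by (simp add: D'_def)
 have "nrm3 (G v - G w) \<le> L * D" "nrm4 (G v - G w) \<le> \<kappa> * (L * D)"
  using est unfolding D_def by simp_all
 moreover from this(2) have "1 / \<kappa> * nrm4 (G v - G w) \<le> L * D" using par by (simp add: field_simps)
 ultimately have "nrm3 (G v - G w) + 1 / \<kappa> * nrm4 (G v - G w) \<le> 2 * L * D" by simp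
 also have "\<dots> \<le> 2 * L * (\<kappa> * D')" using DD L by (intro mult_left_mono) auto
 also have "\<dots> \<le> L * (1 + 2 * \<kappa>) * D'" using mult_right_mono[OF L'(3) D'] by (simp add: mult.assoc)
 finally show "nrm3 (G v - G w) + 1 / \<kappa> * nrm4 (G v - G w) \<le> L * (1 + 2 * \<kappa>) *
   (nrm1 (v - w) * (nrm3 v + 1 / \<kappa> * nrm4 v) +
   nrm1 w * (nrm3 (v - w) + 1 / \<kappa> * nrm4 (v - w)))"
  unfolding D'_def .
qed (rule bounded_linear_components component_le_norm norm_le_components)+

section \<open>Abstract solutions and mild solutions\<close>

lemma mild_solution_of_fixed_point:
 assumes v0: "v0 \<in> X" and v: "ds.curve v" "\<And>t. t \<ge> 0 ==> nrm1 (v t) \<le> r"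
  and fp: "\<And>t. t \<ge> 0 ==> ds.\<Phi> (J v0) v t = v t"
 shows "mild_solution X N T \<kappa> v0 \<infinity> (\<lambda>t. rep (v t))"
proof -
 have vX: "v t \<in> J ` X" if "t \<ge> 0" for t using v(1) that by (simp add: ds.curve_def)
 have Gc: "ds.curve (\<lambda>t. G (v t))" by (rule ds.G_curve[OF v])
 have lim: "((\<lambda>s. N (\<lambda>x. rep (v s) x - rep (v t) x)) \<longlongrightarrow> 0) (at t within {0..})" if t: "t \<ge> 0" for t
 proof -
  have "(v \<longlongrightarrow> v t) (at t within {0..})" using v(1) t by (auto simp: ds.curve_def continuous_on_def)
  hence z: "((\<lambda>s. norm (v s - v t)) \<longlongrightarrow> 0) (at t within {0..})"
   by (simp add: tendsto_norm_zero_iff LIM_zero_iff)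
  have "\<forall>\<^sub>F s in at t within {0..}. norm (N (\<lambda>x. rep (v s) x - rep (v t) x)) \<le> norm (v s - v t)"
   unfolding eventually_at_filter
  proof (intro always_eventually allI impI)
   fix s :: real assume "s \<in> {0..}"
   hence s: "s \<ge> 0" by simp
   show "norm (N (\<lambda>x. rep (v s) x - rep (v t) x)) \<le> norm (v s - v t)"
    using N_le_J[OF X_diff[OF rep(1)[OF vX[OF s]] rep(1)[OF vX[OF t]]]] N_nonneg
    by (simp add: J_diff rep vX s t)
  qed
  from Lim_null_comparison[OF this z] show ?thesis .
 qed
 have int: "\<exists>I. has_riemann_integral X N (\<lambda>s. T (t - s) (nonlin \<kappa> (rep (v s)))) I 0 t \<and>
   N (\<lambda>x. rep (v t) x - (T t v0 x + I x)) = 0" if t: "t \<ge> 0" for t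
 proof -
  have nX: "nonlin \<kappa> (rep (v s)) \<in> X" if "s \<ge> 0" for s
   by (rule nonlin_X) (use rep vX v(2) that in auto)
  have TX: "T (t - s) (nonlin \<kappa> (rep (v s))) \<in> X" if "s \<in> {0..t}" for s
   using T_X nX that by simp
  have eq: "J (T (t - s) (nonlin \<kappa> (rep (v s)))) = S (t - s) (G (v s))" if "s \<in> {0..t}" for s
   using S_J[of "t - s" "nonlin \<kappa> (rep (v s))"] nX that by (simp add: G_def)
  have c: "continuous_on {0..t} (\<lambda>s. J (T (t - s) (nonlin \<kappa> (rep (v s)))))"
   using ds.duhamel_continuous_arg[OF Gc t] by (rule continuous_on_eq) (simp add: eq)
  have "ds.duhamel (\<lambda>s. G (v s)) t \<in> J ` X" using ds.duhamel_curve[OF Gc] t by (simp add: ds.curve_def)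
  then obtain I where I: "I \<in> X" "ds.duhamel (\<lambda>s. G (v s)) t = J I" by blast
  have JI: "J I = integral {0..t} (\<lambda>s. J (T (t - s) (nonlin \<kappa> (rep (v s)))))"
   unfolding I(2)[symmetric] ds.duhamel_def by (rule integral_cong) (simp add: eq)
  have "has_riemann_integral X N (\<lambda>s. T (t - s) (nonlin \<kappa> (rep (v s)))) I 0 t"
   by (rule riemann_of_continuous[OF TX c I(1) JI t])
  moreover have "J (rep (v t)) = J (\<lambda>x. T t v0 x + I x)"
   using fp[OF t] unfolding ds.\<Phi>_def I(2) S_J[OF t v0] J_add[OF T_X[OF t v0] I(1)] rep(2)[OF vX[OF t]] by simp
  hence "N (\<lambda>x. rep (v t) x - (T t v0 x + I x)) = 0"
   using N_diff_0[OF rep(1)[OF vX[OF t]] X_add[OF T_X[OF t v0] I(1)]] by simp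
  ultimately show ?thesis by blast
 qed
 have set: "{s. 0 \<le> s \<and> ereal s < \<infinity>} = {0..}" by auto
 show ?thesis
  unfolding mild_solution_def set using lim int rep(1)[OF vX] by simp
qed

text \<open>On [0,t] the image of an arbitrary mild solution is continuous and satisfies an integral
  equation of the kind treated by \<open>ds.solution_unique\<close>. Its integrand is rewritten
  through \<open>G\<close> only where the first component is at most r, because \<open>G_J\<close>
  is available only there.\<close>

lemma mild_solution_unique:
 assumes v0: "v0 \<in> X" and v: "ds.curve v" "\<And>t. t \<ge> 0 ==> nrm1 (v t) \<le> r / 2"
  and fp: "\<And>t. t \<ge> 0 ==> ds.\<Phi> (J v0) v t = v t"
  and w: "mild_solution X N T \<kappa> v0 \<tau> w" and t: "t \<ge> 0" "ereal t < \<tau>"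
 shows "w t \<in> X" "J (w t) = v t"
proof -
 have W: "w s \<in> X" "((\<lambda>s'. N (\<lambda>x. w s' x - w s x)) \<longlongrightarrow> 0) (at s within {s. 0 \<le> s \<and> ereal s < \<tau>})"
  "\<exists>I. has_riemann_integral X N (\<lambda>s'. T (s - s') (nonlin \<kappa> (w s'))) I 0 s \<and> N (\<lambda>x. w s x - (T s v0 x + I x)) = 0"
  if "s \<in> {0..t}" for s
 proof -
  have "s \<ge> 0" "ereal s < \<tau>" using that t order_le_less_trans[of "ereal s" "ereal t" \<tau>] by auto
  thus "w s \<in> X" "((\<lambda>s'. N (\<lambda>x. w s' x - w s x)) \<longlongrightarrow> 0) (at s within {s. 0 \<le> s \<and> ereal s < \<tau>})"
   "\<exists>I. has_riemann_integral X N (\<lambda>s'. T (s - s') (nonlin \<kappa> (w s'))) I 0 s \<and> N (\<lambda>x. w s x - (T s v0 x + I x)) = 0"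
   using w unfolding mild_solution_def by simp_all
 qed
 show "w t \<in> X" using W(1) t by simp
 have sub: "{0..t} \<subseteq> {s. 0 \<le> s \<and> ereal s < \<tau>}"
  using t order_le_less_trans[of _ "ereal t" \<tau>] by auto
 have wc: "continuous_on {0..t} (\<lambda>s. J (w s))"
  unfolding continuous_on_def
 proof
  fix s assume s: "s \<in> {0..t}"
  have z: "((\<lambda>s'. 4 * N (\<lambda>x. w s' x - w s x)) \<longlongrightarrow> 0) (at s within {0..t})"
   by (rule tendsto_mult_right_zero[OF tendsto_within_subset[OF W(2)[OF s] sub]])
  have "\<forall>\<^sub>F s' in at s within {0..t}. norm (J (w s') - J (w s)) \<le> 4 * N (\<lambda>x. w s' x - w s x)"
   unfolding eventually_at_filter
  proof (intro always_eventually allI impI)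
   fix s' assume s': "s' \<in> {0..t}"
   show "norm (J (w s') - J (w s)) \<le> 4 * N (\<lambda>x. w s' x - w s x)"
    using J_le_N[OF X_diff[OF W(1)[OF s'] W(1)[OF s]]] unfolding J_diff[OF W(1)[OF s'] W(1)[OF s]] .
  qed
  from Lim_null_comparison[OF this z] show "((\<lambda>s. J (w s)) \<longlongrightarrow> J (w s)) (at s within {0..t})"
   by (simp add: LIM_zero_iff)
 qed
 show "J (w t) = v t"
 proof (rule ds.solution_unique[OF _ v fp t(1) wc])
  show "J v0 \<in> J ` X" using v0 by simp
  show "J (w s) \<in> J ` X" if "s \<in> {0..t}" for s using W(1)[OF that] by simp
  show "t \<in> {0..t}" using t by simp
  fix s assume s: "s \<in> {0..t}"
  hence s0: "s \<ge> 0" by simp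
  obtain I where I: "has_riemann_integral X N (\<lambda>s'. T (s - s') (nonlin \<kappa> (w s'))) I 0 s" "N (\<lambda>x. w s x - (T s v0 x + I x)) = 0"
   using W(3)[OF s] by blast
  have IX: "I \<in> X" using I(1) by (simp add: has_riemann_integral_def)
  have "J (w s) = J (T s v0) + J I"
   using I(2)[unfolded N_diff_0[OF W(1)[OF s] X_add[OF T_X[OF s0 v0] IX]] J_add[OF T_X[OF s0 v0] IX]] .
  hence "J I = J (w s) - S s (J v0)" by (simp add: S_J[OF s0 v0])
  hence "((\<lambda>s'. J (T (s - s') (nonlin \<kappa> (w s')))) has_integral (J (w s) - S s (J v0))) {0..s}"
   using riemann_imp_integral[OF I(1) s0] by simp
  moreover have "J (T (s - s') (nonlin \<kappa> (w s'))) = S (s - s') (G (J (w s')))"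
   if "s' \<in> {0..s}" "nrm1 (J (w s')) \<le> r" for s'
  proof -
   have w': "w s' \<in> X" using W(1)[of s'] that s by simp
   show ?thesis unfolding G_J[OF w' that(2)] using that(1) by (intro S_J[symmetric] nonlin_X w' that) simp
  qed
  ultimately show "\<exists>k. (k has_integral (J (w s) - S s (J v0))) {0..s} \<and>
    (\<forall>s'\<in>{0..s}. nrm1 (J (w s')) \<le> r --> k s' = S (s - s') (G (J (w s'))))"
   by (intro exI[of _ "\<lambda>s'. J (T (s - s') (nonlin \<kappa> (w s')))"]) blast
 qed
qed

end

context combustion_estimate
begin

section \<open>Global existence and decay\<close>

definition stable where
 "stable C \<nu> \<delta> v0 \<longleftrightarrow>
   (\<exists>tmax v. maximal_mild_solution X N T \<kappa> v0 tmax v) \<and>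
    (\<forall>tmax v. maximal_mild_solution X N T \<kappa> v0 tmax v -->
     (\<forall>t>0. ereal t < tmax \<and> v t \<in> X \<and>
        N (v t) \<le> \<delta> \<and>
        sq_norm (Wnorm k z \<alpha>) (v t) \<le> C * exp (- \<nu> * t) * sq_norm (Wnorm k z \<alpha>) v0 \<and>
        Hnorm k (fst \<circ> v t) \<le> C * N v0 \<and>
        Hnorm k (snd \<circ> v t) \<le> C * exp (- \<nu> * t) * N v0))"

lemma stability:
 "\<exists>C>0. \<exists>\<nu>>0. \<exists>\<delta>0>0. \<forall>\<delta>. 0 < \<delta> \<and> \<delta> < \<delta>0 -->
  (\<exists>\<eta>. 0 < \<eta> \<and> \<eta> < \<delta> \<and>
   (\<forall>v0 \<in> X. N v0 \<le> \<eta> -->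
    stable C \<nu> \<delta> v0))"
proof -
 define \<nu> where "\<nu> = min \<sigma> \<mu> / 2"
 define a where "a = 1 / \<kappa>"
 define L' where "L' = L * (1 + 2 * \<kappa>)"
 \<comment> \<open>2(1 + a) is the ratio of \<rho> to the size of the data; 1 + \<kappa> recovers
   both weighted components from \<open>Q\<close>, in which the second is divided by
   \<kappa>.\<close>
 define C where "C = 2 * (1 + a) * (1 + \<kappa>)"
 \<comment> \<open>r/2 is the radius that uniqueness asks for; the second term makes the contraction
   factor at most 1/2, with L' + 1 keeping the denominator positive.\<close>
 define \<delta>0 where "\<delta>0 = min (r / 2) (\<nu> / (4 * (1 + a) * (L' + 1)))"
 have pos: "\<nu> > 0" "a > 0" "L' \<ge> 0" "\<kappa> > 0" using rates_pos par L by (simp_all add: \<nu>_def a_def L'_def)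
 have C: "C > 0" "2 * (1 + a) \<le> C" using pos mult_left_mono[of 1 "1 + \<kappa>" "2 * (1 + a)"] by (simp_all add: C_def)
 have \<delta>0: "\<delta>0 > 0" using r pos by (simp add: \<delta>0_def)
 \<comment> \<open>The threshold \<delta>/(C + 1) lies below \<delta> and ensures that C times the
   size of the data is at most \<delta>, hence also that \<rho> is at most
   \<open>\<delta>0\<close>.\<close>
 have concl: "stable C \<nu> \<delta> v0"
  if \<delta>: "0 < \<delta>" "\<delta> < \<delta>0" and v0: "v0 \<in> X" "N v0 \<le> \<delta> / (C + 1)" for \<delta> v0
 proof -
  define e where "e = N v0"
  define \<rho> where "\<rho> = 2 * (1 + a) * e"
  have e0: "e \<ge> 0" using N_nonneg by (simp add: e_def)
  have \<rho>0: "\<rho> \<ge> 0" using e0 pos by (simp add: \<rho>_def)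
  have Ce: "C * e \<le> \<delta>"
  proof -
   have "C * e \<le> C * (\<delta> / (C + 1))" using v0(2) C by (intro mult_left_mono) (auto simp: e_def)
   also have "\<dots> \<le> \<delta>" using C \<delta> by (simp add: field_simps)
   finally show ?thesis .
  qed
  have \<rho>C: "\<rho> \<le> C * e" unfolding \<rho>_def by (rule mult_right_mono[OF C(2) e0])
  have \<rho>\<delta>: "\<rho> \<le> \<delta>0" using \<rho>C Ce \<delta> by linarith
  have \<rho>r: "\<rho> \<le> r / 2" "\<rho> \<le> r" using \<rho>\<delta> r by (auto simp: \<delta>0_def)
  have small: "(1 + a) / \<nu> * (2 * L' * \<rho>) \<le> 1 / 2"
  proof -
   have "L' * \<rho> \<le> (L' + 1) * (\<nu> / (4 * (1 + a) * (L' + 1)))"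
    using pos \<rho>0 \<rho>\<delta> by (intro mult_mono) (auto simp: \<delta>0_def)
   also have "\<dots> = \<nu> / (4 * (1 + a))" using pos by simp
   finally have "(1 + a) / \<nu> * (2 * (L' * \<rho>)) \<le> (1 + a) / \<nu> * (2 * (\<nu> / (4 * (1 + a))))"
    using pos by (intro mult_left_mono) auto
   also have "\<dots> = 1 / 2"
   proof -
    have "q / \<nu> * (2 * (\<nu> / (4 * q))) = 1 / 2" if "q > 0" for q using that pos by (simp add: field_simps)
    thus ?thesis using pos by simp
   qed
   finally show ?thesis by (simp only: mult.assoc)
  qed
  have y: "J v0 \<in> J ` X" using v0 by simp
  have ye: "nrm1 (J v0) \<le> e" "nrm2 (J v0) \<le> e" "nrm3 (J v0) \<le> e" "nrm4 (J v0) \<le> e"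
   unfolding components_J[OF v0(1)] e_def N_eq by simp_all
  obtain V where V: "ds.curve V" "ds.decays \<rho> V" "\<And>t. t \<ge> 0 ==> ds.\<Phi> (J v0) V t = V t"
   "\<And>t. t \<ge> 0 ==> ds.Q (V t) \<le> 2 * ds.Q (J v0) * exp (- (min \<sigma> \<mu> / 2) * t)"
   using ds.global_solution[OF y ye \<rho>_def[unfolded a_def] \<rho>r(2) small[unfolded a_def \<nu>_def L'_def]] by blast
  have d: "nrm1 (V t) \<le> \<rho>" "nrm2 (V t) \<le> \<rho> * exp (- \<nu> * t)" "ds.Q (V t) \<le> \<rho> * exp (- \<nu> * t)"
   if "t \<ge> 0" for t using V(2) that unfolding ds.decays_def \<nu>_def by blast+
  have Vr: "nrm1 (V t) \<le> r" "nrm1 (V t) \<le> r / 2" if "t \<ge> 0" for t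
   using d(1)[OF that] \<rho>r by linarith+
  have mild: "mild_solution X N T \<kappa> v0 \<infinity> (\<lambda>t. rep (V t))"
   by (rule mild_solution_of_fixed_point[OF v0(1) V(1) Vr(1) V(3)])
  have uniq: "w t \<in> X" "J (w t) = V t" if "mild_solution X N T \<kappa> v0 \<tau> w" "t \<ge> 0" "ereal t < \<tau>" for \<tau> w t
  proof -
   show "w t \<in> X" by (rule mild_solution_unique(1)[OF v0(1) V(1) _ _ that]) ((rule Vr(2) V(3), assumption)+)
   show "J (w t) = V t" by (rule mild_solution_unique(2)[OF v0(1) V(1) _ _ that]) ((rule Vr(2) V(3), assumption)+)
  qed
  have VX: "V t \<in> J ` X" if "t \<ge> 0" for t using V(1) that by (simp add: ds.curve_def)
  have "maximal_mild_solution X N T \<kappa> v0 \<infinity> (\<lambda>t. rep (V t))"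
   unfolding maximal_mild_solution_def
  proof (intro conjI mild allI impI)
   fix \<tau> w t assume w: "mild_solution X N T \<kappa> v0 \<tau> w" and t: "t \<ge> 0" "ereal t < \<tau>"
   have "J (w t) = J (rep (V t))" using uniq(2)[OF w t] rep(2)[OF VX[OF t(1)]] by simp
   thus "N (\<lambda>x. w t x - rep (V t) x) = 0"
    using N_diff_0[OF uniq(1)[OF w t] rep(1)[OF VX[OF t(1)]]] by simp
  qed simp
  moreover have "ereal t < tmax \<and> v t \<in> X \<and> N (v t) \<le> \<delta> \<and>
    sq_norm (Wnorm k z \<alpha>) (v t) \<le> C * exp (- \<nu> * t) * sq_norm (Wnorm k z \<alpha>) v0 \<and>
    Hnorm k (fst \<circ> v t) \<le> C * N v0 \<and> Hnorm k (snd \<circ> v t) \<le> C * exp (- \<nu> * t) * N v0"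
   if v: "maximal_mild_solution X N T \<kappa> v0 tmax v" and t: "t > 0" for tmax v t
  proof -
   have t0: "t \<ge> 0" using t by simp
   \<comment> \<open>A maximal solution extends every mild solution with the same data, in
     particular the global one just built.\<close>
   have "\<infinity> \<le> tmax" using v mild unfolding maximal_mild_solution_def by blast
   hence tm: "ereal t < tmax" by simp
   have vm: "mild_solution X N T \<kappa> v0 tmax v" using v by (simp add: maximal_mild_solution_def)
   have vX: "v t \<in> X" and JV: "J (v t) = V t" using uniq[OF vm t0 tm] by auto
   define E where "E = exp (- \<nu> * t)"
   have E: "0 < E" "E \<le> 1" using pos t by (simp_all add: E_def)
   note b = d[OF t0, folded E_def JV]
   have Q: "ds.Q (J u) = nrm3 (J u) + a * nrm4 (J u)" for u by (simp add: ds.Q_def a_def)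
   have qle: "nrm3 (J u) \<le> (1 + \<kappa>) * ds.Q (J u)" "nrm4 (J u) \<le> (1 + \<kappa>) * ds.Q (J u)" for u
   proof -
    have "nrm3 (J u) \<le> ds.Q (J u)" using pos by (simp add: Q)
    also have "\<dots> \<le> (1 + \<kappa>) * ds.Q (J u)" using pos ds.Q_nonneg mult_right_mono[of 1 "1 + \<kappa>" "ds.Q (J u)"] by simp
    finally show "nrm3 (J u) \<le> (1 + \<kappa>) * ds.Q (J u)" .
    have "nrm4 (J u) = \<kappa> * (a * nrm4 (J u))" using pos by (simp add: a_def)
    also have "\<dots> \<le> (1 + \<kappa>) * ds.Q (J u)" using pos by (intro mult_mono) (auto simp: Q)
    finally show "nrm4 (J u) \<le> (1 + \<kappa>) * ds.Q (J u)" .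
   qed
   have \<rho>E: "\<rho> * E \<le> \<rho>" using \<rho>0 E by (simp add: mult_left_le)
   have Qe: "(1 + \<kappa>) * ds.Q (J (v t)) \<le> C * e"
   proof -
    have "(1 + \<kappa>) * ds.Q (J (v t)) \<le> (1 + \<kappa>) * \<rho>" using b(3) \<rho>E pos by (intro mult_left_mono) auto
    also have "\<dots> = C * e" by (simp add: C_def \<rho>_def)
    finally show ?thesis .
   qed
   have sqW: "sq_norm (Wnorm k z \<alpha>) u = max (nrm3 (J u)) (nrm4 (J u))" if "u \<in> X" for u
    using components_J(3,4)[OF that] by (simp add: sq_norm_def Wnorm_def o_def)
   have H: "Hnorm k (fst \<circ> u) = nrm1 (J u)" "Hnorm k (snd \<circ> u) = nrm2 (J u)" if "u \<in> X" for u
    using components_J(1,2)[OF that] by (simp_all add: o_def)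
   have Nv: "N (v t) \<le> \<delta>"
   proof -
    have "N (v t) \<le> C * e"
     unfolding N_eq components_J[OF vX, symmetric]
     using b(1,2) \<rho>E \<rho>C order_trans[OF qle(1) Qe] order_trans[OF qle(2) Qe] by auto
    thus ?thesis using Ce by linarith
   qed
   have W: "sq_norm (Wnorm k z \<alpha>) (v t) \<le> C * E * sq_norm (Wnorm k z \<alpha>) v0"
   proof -
    define s where "s = sq_norm (Wnorm k z \<alpha>) v0"
    have s: "nrm3 (J v0) \<le> s" "nrm4 (J v0) \<le> s" unfolding s_def sqW[OF v0(1)] by auto
    have "ds.Q (J v0) \<le> (1 + a) * s" unfolding Q using add_mono[OF s(1) mult_left_mono[OF s(2) less_imp_le[OF pos(2)]]] by (simp add: distrib_right)
    hence "2 * ds.Q (J v0) * E \<le> 2 * ((1 + a) * s) * E" using E by (intro mult_right_mono mult_left_mono) auto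
    hence "ds.Q (J (v t)) \<le> 2 * ((1 + a) * s) * E" using V(4)[OF t0] unfolding JV E_def \<nu>_def by linarith
    hence "(1 + \<kappa>) * ds.Q (J (v t)) \<le> (1 + \<kappa>) * (2 * ((1 + a) * s) * E)" using pos by (intro mult_left_mono) auto
    also have "\<dots> = C * E * s" by (simp add: C_def)
    finally have "(1 + \<kappa>) * ds.Q (J (v t)) \<le> C * E * s" .
    thus ?thesis unfolding sqW[OF vX] s_def[symmetric] using qle[of "v t"] by auto
   qed
   have "Hnorm k (fst \<circ> v t) \<le> C * N v0" unfolding H(1)[OF vX] e_def[symmetric] using b(1) \<rho>C by linarith
   moreover have "Hnorm k (snd \<circ> v t) \<le> C * E * N v0"
   proof -
    have "\<rho> * E \<le> C * e * E" using E by (intro mult_right_mono[OF \<rho>C]) simp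
    also have "\<dots> = C * E * e" by simp
    finally show ?thesis using b(2) unfolding H(2)[OF vX] e_def[symmetric] by linarith
   qed
   ultimately show ?thesis using tm vX Nv W unfolding E_def by blast
  qed
  ultimately show ?thesis unfolding stable_def by blast
 qed
 show ?thesis
 proof (rule exI[of _ C], rule conjI[OF C(1)], rule exI[of _ \<nu>], rule conjI[OF pos(1)],
   rule exI[of _ \<delta>0], rule conjI[OF \<delta>0], rule allI, rule impI)
  fix \<delta> :: real assume \<delta>: "0 < \<delta> \<and> \<delta> < \<delta>0"
  have \<eta>: "0 < \<delta> / (C + 1)" "\<delta> / (C + 1) < \<delta>" using \<delta> C by (simp_all add: field_simps)
  show "\<exists>\<eta>. 0 < \<eta> \<and> \<eta> < \<delta> \<and>
   (\<forall>v0 \<in> X. N v0 \<le> \<eta> -->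
    stable C \<nu> \<delta> v0)"
   by (rule exI[of _ "\<delta> / (C + 1)"], rule conjI[OF \<eta>(1) conjI[OF \<eta>(2)]], rule ballI, rule impI, rule concl)
    (use \<delta> in simp_all)
 qed
qed

end

theorem theorem2p17:
  fixes k :: nat and z :: "'n::finite" and c \<kappa> \<epsilon> \<alpha> :: real
    and T :: "real \<Rightarrow> (real^'n \<Rightarrow> real \<times> real) \<Rightarrow> real^'n \<Rightarrow> real \<times> real"
  assumes "CARD('n) \<ge> 2"
    and "real k \<ge> (real CARD('n) + 1) / 2"
    and "c > 0" and "\<kappa> > 0"
    and "0 \<le> \<epsilon>" and "\<epsilon> < 1"
    and "0 < \<alpha>" and "\<alpha> < c / 2"
    and "is_linear_semigroup k z \<alpha> c \<epsilon> \<kappa> T"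
  shows "\<exists>C>0. \<exists>\<nu>>0. \<exists>\<delta>0>0. \<forall>\<delta>. 0 < \<delta> \<and> \<delta> < \<delta>0 \<longrightarrow>
    (\<exists>\<eta>. 0 < \<eta> \<and> \<eta> < \<delta> \<and>
      (\<forall>v0 \<in> sq_space (Espace k z \<alpha>). sq_norm (Enorm k z \<alpha>) v0 \<le> \<eta> \<longrightarrow>
        (\<exists>tmax v. maximal_mild_solution (sq_space (Espace k z \<alpha>)) (sq_norm (Enorm k z \<alpha>))
                    T \<kappa> v0 tmax v) \<and>
        (\<forall>tmax v. maximal_mild_solution (sq_space (Espace k z \<alpha>)) (sq_norm (Enorm k z \<alpha>))
                    T \<kappa> v0 tmax v \<longrightarrow>
          (\<forall>t>0. ereal t < tmax \<and> v t \<in> sq_space (Espace k z \<alpha>) \<and>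
                 sq_norm (Enorm k z \<alpha>) (v t) \<le> \<delta> \<and>
                 sq_norm (Wnorm k z \<alpha>) (v t) \<le> C * exp (- \<nu> * t) * sq_norm (Wnorm k z \<alpha>) v0 \<and>
                 Hnorm k (fst \<circ> v t) \<le> C * sq_norm (Enorm k z \<alpha>) v0 \<and>
                 Hnorm k (snd \<circ> v t) \<le> C * exp (- \<nu> * t) * sq_norm (Enorm k z \<alpha>) v0))))"
proof -
  interpret combustion k z \<alpha> c \<kappa> \<epsilon> T
    by unfold_locales (use assms in auto)
  obtain L r where "combustion_estimate k z \<alpha> c \<kappa> \<epsilon> T L r"
    by (rule nonlin_estimate, rule that, rule combustion_estimate.intro[OF combustion_axioms],
        rule combustion_estimate_axioms.intro) blast+
  then interpret combustion_estimate k z \<alpha> c \<kappa> \<epsilon> T L r .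
  show ?thesis using stability unfolding stable_def X_def N_def .
qed

end
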